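(* Let $K$ be a number field, $N\ge 2$, $F$ a symmetric bilinear form on $K^N$, and $Z\subseteq K^N$ a subspace of dimension $L$, $1\le L\le N$, such that the bilinear space $(Z,F)$ is regular. Let $\sigma\in\mathcal{O}(Z,F)$. Then either $\sigma$ is the identity, or there exist an integer $1\le l\le 2L-1$ and reflections $\tau_1,\dots,\tau_l\in\mathcal{O}(Z,F)$ such that $\sigma=\tau_1\circ\cdots\circ\tau_l$ and for each $1\le i\le l$, $$H(\tau_i)\le\left\{\left(2N^2|\mathcal{D}_K|^{\frac{1}{2d}}\right)^{\frac{L^2}{2}}H(F)^{\frac{L}{3}}H(Z)^{\frac{L}{2}}H(\sigma)\right\}^{5^{L-1}}.$$
   Context: $K$ is a number field of degree $d$ over $\mathbb{Q}$ with discriminant $\mathcal{D}_K$ and set of places $M(K)$. For $v\in M(K)$, $d_v=[K_v:\mathbb{Q}_v]$, $\|\cdot\|_v$ is the absolute value on $K_v$ extending the usual absolute value on $\mathbb{R}$ or $\mathbb{C}$ (if $v\mid\infty$) or the usual $p$-adic one (if $v\mid p$), and $|a|_v=\|a\|_v^{d_v/d}$. For $x\in K^n$: $H_v(x)=\max_i|x_i|_v$ if $v\nmid\infty$, $H_v(x)=(\sum_i\|x_i\|_v^2)^{d_v/2d}$ if $v\mid\infty$, and $H(x)=\prod_v H_v(x)$. The height of a matrix is the height of its vector of entries. A symmetric bilinear form $F(X,Y)=\sum f_{ij}X_iY_j$ ($f_{ij}=f_{ji}\in K$) is identified with its matrix, $F(x)=F(x,x)$, and $H(F)=H((f_{ij}))$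 as a vector in $K^{N^2}$. For a subspace $U\subseteq K^N$ of dimension $J\ge1$ with basis $x_1,\dots,x_J$, $H(U)$ is the height of the vector in $K^{\binom{N}{J}}$ of all $J\times J$ minors of the $N\times J$ matrix $(x_1\ \cdots\ x_J)$. $(Z,F)$ is regular if $\{x\in Z:F(x,z)=0\ \forall z\in Z\}=\{0\}$; then $K^N=Z\perp Z^{\perp_{K^N}}$ with $Z^{\perp_{K^N}}=\{x\in K^N:F(x,z)=0\ \forall z\in Z\}$. $\mathcal{O}(Z,F)$ is the group of $K$-linear isometries of $(Z,F)$. For $\sigma\in\mathcal{O}(Z,F)$, an extension is $\hat\sigma\in\mathcal{O}(K^N,F)$ equal to $\sigma$ on $Z$ and to some $\sigma'\in\mathcal{O}(Z^{\perp_{K^N}},F)$ on $Z^{\perp_{K^N}}$; $H(\sigma)$ is the minimum over such extensions of the height of the $N\times N$ matrix of $\hat\sigma$ (viewed as a vector in $K^{N^2}$). For $x\in Z$ with $F(x)\neq0$, the reflection $\tau_x\in\mathcal{O}(Z,F)$ is $\tau_x(y)=y-\frac{2F(x,y)}{F(x)}x$; a reflection is an isometry of this form. *)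

theory Defs
  imports
    "HOL-Analysis.Analysis"
    "HOL-Algebra.QuotRing"
    "HOL-Algebra.Embedded_Algebras"
    "HOL-Computational_Algebra.Computational_Algebra"
    "Jordan_Normal_Form.Determinant"
begin

no_notation Matrix.vec_index (infixl \<open>$\<close> 100)

section \<open>Number fields\<close>

abbreviation scale_rat :: "rat \<Rightarrow> 'k::field_char_0 \<Rightarrow> 'k"
  where "scale_rat q x \<equiv> of_rat q * x"

abbreviation scale_int :: "int \<Rightarrow> 'k::field_char_0 \<Rightarrow> 'k"
  where "scale_int m x \<equiv> of_int m * x"

class number_field = field_char_0 +
  assumes finite_over_rat: "\<exists>B. finite B \<and> (\<forall>x. \<exists>c. x = (\<Sum>b\<in>B. of_rat (c b) * b))"

definition degree_K :: "'k::number_field itself \<Rightarrow> nat"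
  where "degree_K _ = vector_space.dim scale_rat (UNIV :: 'k set)"

text \<open>The trace of multiplication by \<open>x\<close>, an endomorphism of the rational vector space \<open>'k\<close>;
  it does not depend on the basis chosen.\<close>

definition field_trace :: "'k::number_field \<Rightarrow> rat"
  where "field_trace x =
    (let B = (SOME B. \<not> module.dependent scale_rat B \<and> module.span scale_rat B = UNIV)
     in \<Sum>b\<in>B. module.representation scale_rat B (x * b) b)"

definition integral_basis :: "'k::number_field list \<Rightarrow> bool"
  where "integral_basis bs \<longleftrightarrow>
    distinct bs \<and> \<not> module.dependent scale_int (set bs) \<and>
    module.span scale_int (set bs) = {x. algebraic_int x}"

text \<open>The discriminant does not depend on the integral basis chosen.\<close>

definition discriminant :: "'k::number_field itself \<Rightarrow> rat"
  where "discriminant _ =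
    (let bs = (SOME bs :: 'k list. integral_basis bs); n = length bs
     in Determinant.det (Matrix.mat n n (\<lambda>(i, j). field_trace (bs ! i * bs ! j))))"


section \<open>Places\<close>

definition absolute_value :: "('k::field \<Rightarrow> real) \<Rightarrow> bool"
  where "absolute_value w \<longleftrightarrow>
    (\<forall>x. 0 \<le> w x) \<and> (\<forall>x. w x = 0 \<longleftrightarrow> x = 0) \<and>
    (\<forall>x y. w (x * y) = w x * w y) \<and> (\<forall>x y. w (x + y) \<le> w x + w y)"

definition padic_abs :: "nat \<Rightarrow> rat \<Rightarrow> real"
  where "padic_abs p q =
    (if q = 0 then 0
     else real p powi (int (multiplicity (int p) (snd (quotient_of q)))
                       - int (multiplicity (int p) (fst (quotient_of q)))))"

definition archimedean :: "('k::number_field \<Rightarrow> real) \<Rightarrow> bool"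
  where "archimedean w \<longleftrightarrow> (\<forall>q. w (of_rat q) = \<bar>of_rat q\<bar>)"

text \<open>A place \<open>v\<close> is represented by its normalised absolute value, the function written
  \<open>\<parallel>\<cdot>\<parallel>\<^sub>v\<close> in the literature, restricted to \<open>'k\<close>: the one that extends the usual absolute value or
  the usual \<open>p\<close>-adic absolute value of the rationals. By Ostrowski's theorem every equivalence
  class of nontrivial absolute values contains exactly one such function.\<close>

definition places :: "('k::number_field \<Rightarrow> real) set"
  where "places = {w. absolute_value w \<and>
    (archimedean w \<or> (\<exists>p. prime p \<and> (\<forall>q. w (of_rat q) = padic_abs p q)))}"

text \<open>The completion at a place is the ring of Cauchy sequences modulo the ideal of null sequences.\<close>

definition cauchy_ring :: "('k::number_field \<Rightarrow> real) \<Rightarrow> (nat \<Rightarrow> 'k) ring"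
  where "cauchy_ring w =
    \<lparr>carrier = {s. \<forall>e>0. \<exists>n0. \<forall>m\<ge>n0. \<forall>n\<ge>n0. w (s m - s n) < e},
     mult = (\<lambda>s t n. s n * t n), one = (\<lambda>_. 1),
     zero = (\<lambda>_. 0), add = (\<lambda>s t n. s n + t n)\<rparr>"

definition null_ideal :: "('k::number_field \<Rightarrow> real) \<Rightarrow> (nat \<Rightarrow> 'k) set"
  where "null_ideal w = {s. (\<lambda>n. w (s n)) \<longlonglongrightarrow> 0}"

definition completion :: "('k::number_field \<Rightarrow> real) \<Rightarrow> (nat \<Rightarrow> 'k) set ring"
  where "completion w = cauchy_ring w Quot null_ideal w"

text \<open>The completion of the rationals, as the subfield of \<open>completion w\<close> formed by the classes of
  rational Cauchy sequences.\<close>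

definition rat_completion :: "('k::number_field \<Rightarrow> real) \<Rightarrow> (nat \<Rightarrow> 'k) set set"
  where "rat_completion w =
    {null_ideal w +>\<^bsub>cauchy_ring w\<^esub> s | s. s \<in> carrier (cauchy_ring w) \<and> range s \<subseteq> \<rat>}"

definition local_degree :: "('k::number_field \<Rightarrow> real) \<Rightarrow> nat"
  where "local_degree w =
    ring.dim (completion w) (rat_completion w) (carrier (completion w))"


section \<open>Heights\<close>

text \<open>Vectors over \<open>'k\<close> are families \<open>x\<close> indexed by a nonempty finite set \<open>I\<close>.\<close>

definition local_height ::
    "('k::number_field \<Rightarrow> real) \<Rightarrow> 'i set \<Rightarrow> ('i \<Rightarrow> 'k) \<Rightarrow> real"
  where "local_height w I x =
    (if archimedean w
     then (\<Sum>i\<in>I. (w (x i))\<^sup>2) powr (real (local_degree w) / (2 * real (degree_K TYPE('k))))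
     else Max ((\<lambda>i. w (x i) powr (real (local_degree w) / real (degree_K TYPE('k)))) ` I))"

text \<open>If \<open>x\<close> is not zero on \<open>I\<close>, only finitely many local heights differ from \<open>1\<close>, so the infinite
  product over all places is the finite product below. The zero vector, for which this formula is
  not meaningful, never occurs.\<close>

definition height :: "'i set \<Rightarrow> ('i \<Rightarrow> 'k::number_field) \<Rightarrow> real"
  where "height I x = (\<Prod>w | w \<in> places \<and> local_height w I x \<noteq> 1. local_height w I x)"

definition matrix_height :: "'k::number_field ^ 'n ^ 'm \<Rightarrow> real"
  where "matrix_height A = height UNIV (\<lambda>(i, j). A $ i $ j)"

definition subspace_basis :: "('k::field ^ 'n) set \<Rightarrow> ('k ^ 'n) list \<Rightarrow> bool"
  where "subspace_basis U xs \<longleftrightarrow>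
    distinct xs \<and> vec.independent (set xs) \<and> vec.span (set xs) = U"

text \<open>The minor on the rows in \<open>I\<close> of the matrix with columns \<open>xs\<close>. The linear order on the row
  indices serves only to fix the order of these rows, hence the sign of the minor.\<close>

definition minor :: "('k::field ^ 'n::{finite,linorder}) list \<Rightarrow> 'n set \<Rightarrow> 'k"
  where "minor xs I = Determinant.det
    (Matrix.mat (length xs) (length xs) (\<lambda>(i, j). (xs ! j) $ (sorted_list_of_set I ! i)))"

text \<open>By the product formula the height does not depend on the basis chosen.\<close>

definition subspace_height :: "('k::number_field ^ 'n::{finite,linorder}) set \<Rightarrow> real"
  where "subspace_height U =
    (let xs = (SOME xs. subspace_basis U xs) in height {I. card I = length xs} (minor xs))"


section \<open>Bilinear spaces and isometries\<close>

definition bilin :: "'k::field ^ 'n ^ 'n \<Rightarrow> 'k ^ 'n \<Rightarrow> 'k ^ 'n \<Rightarrow> 'k"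
  where "bilin F x y = (\<Sum>i\<in>UNIV. \<Sum>j\<in>UNIV. F $ i $ j * x $ i * y $ j)"

definition regular :: "'k::field ^ 'n ^ 'n \<Rightarrow> ('k ^ 'n) set \<Rightarrow> bool"
  where "regular F Z \<longleftrightarrow> {x \<in> Z. \<forall>z\<in>Z. bilin F x z = 0} = {0}"

definition orth_complement :: "'k::field ^ 'n ^ 'n \<Rightarrow> ('k ^ 'n) set \<Rightarrow> ('k ^ 'n) set"
  where "orth_complement F Z = {x. \<forall>z\<in>Z. bilin F x z = 0}"

text \<open>The group of isometries of \<open>(Z, F)\<close>. Its elements are maps from \<open>Z\<close> to \<open>Z\<close>; they are
  represented by total functions, whose values outside \<open>Z\<close> are irrelevant.\<close>

definition isometries ::
    "'k::field ^ 'n ^ 'n \<Rightarrow> ('k ^ 'n) set \<Rightarrow> ('k ^ 'n \<Rightarrow> 'k ^ 'n) set"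
  where "isometries F Z = {\<sigma>. bij_betw \<sigma> Z Z \<and>
    (\<forall>x\<in>Z. \<forall>y\<in>Z. \<sigma> (x + y) = \<sigma> x + \<sigma> y) \<and> (\<forall>c. \<forall>x\<in>Z. \<sigma> (c *s x) = c *s \<sigma> x) \<and>
    (\<forall>x\<in>Z. \<forall>y\<in>Z. bilin F (\<sigma> x) (\<sigma> y) = bilin F x y)}"

definition reflections ::
    "'k::field ^ 'n ^ 'n \<Rightarrow> ('k ^ 'n) set \<Rightarrow> ('k ^ 'n \<Rightarrow> 'k ^ 'n) set"
  where "reflections F Z = {\<tau> \<in> isometries F Z. \<exists>x\<in>Z. bilin F x x \<noteq> 0 \<and>
    (\<forall>y\<in>Z. \<tau> y = y - (2 * bilin F x y / bilin F x x) *s x)}"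

definition extensions ::
    "'k::field ^ 'n ^ 'n \<Rightarrow> ('k ^ 'n) set \<Rightarrow> ('k ^ 'n \<Rightarrow> 'k ^ 'n) \<Rightarrow> ('k ^ 'n \<Rightarrow> 'k ^ 'n) set"
  where "extensions F Z \<sigma> = {\<rho> \<in> isometries F UNIV. (\<forall>z\<in>Z. \<rho> z = \<sigma> z) \<and>
    (\<exists>\<sigma>'\<in>isometries F (orth_complement F Z). \<forall>y\<in>orth_complement F Z. \<rho> y = \<sigma>' y)}"

text \<open>The minimum exists by Northcott's theorem.\<close>

definition isometry_height ::
    "'k::number_field ^ 'n ^ 'n \<Rightarrow> ('k ^ 'n) set \<Rightarrow> ('k ^ 'n \<Rightarrow> 'k ^ 'n) \<Rightarrow> real"
  where "isometry_height F Z \<sigma> = (LEAST h. h \<in> (\<lambda>\<rho>. matrix_height (matrix \<rho>)) ` extensions F Z \<sigma>)"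

end

theory Submission
  imports
    Defs
    "Jordan_Normal_Form.Char_Poly"
begin

text \<open>
  The decomposition is the one in the proof of the Cartan-Dieudonne theorem, carried out with control of
  the heights. The vectors of minors of a basis of \<open>Z\<close> span \<open>Z\<close>, so one of them or of their pairwise
  sums is an anisotropic \<open>x\<close> of height at most \<open>2 N H(Z)\<close>. For an extension \<open>\<rho>\<close> of \<open>\<sigma>\<close> of minimal
  height, \<open>\<rho> x - x\<close> or \<open>\<rho> x + x\<close> is anisotropic, and composing \<open>\<rho>\<close> with one or two reflections makes it fix
  \<open>x\<close>; it then acts on the hyperplane of \<open>Z\<close> orthogonal to \<open>x\<close>, whose height is bounded by Laplace
  expansion. Induction on \<open>L\<close> gives at most \<open>2 L - 1\<close> reflections, and each step multiplies the exponents
  by at most 5.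

  Heights are compared place by place, which rests on the product formula and on
  \<open>\<Sum> d\<^sub>v = d\<close> over the places above a rational place. Both are derived
  without constructing field extensions: absolute values are extended as minimal power-multiplicative
  norms, and weak approximation counts dimensions. That the minimal height of an extension is attained is
  Northcott's theorem, and the discriminant, a nonzero integer, is at least 1 in absolute value.
\<close>

text \<open>The induction runs on an isometry of the whole space that maps \<open>Z\<close> into
  itself, not on an isometry of \<open>Z\<close>. Such a map has a matrix, composition with a
  reflection of the whole space multiplies heights, and the restriction to the hyperplane comes with
  its extension. Minimality over extensions matters only at the two ends: it supplies
  \<open>\<rho>\<close>, and it lets the height of each reflection of \<open>Z\<close> be bounded by
  that of the reflection of the whole space.

  Logarithms make the bounds additive. With \<open>k\<close>, \<open>f\<close>, \<open>z\<close>,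
  \<open>r\<close> for the constant \<open>2 N^2\<close>, the form, the subspace and the isometry, a
  step replaces \<open>z\<close> by at most \<open>2 k + f + 2 z\<close> and \<open>r\<close> by at
  most \<open>6 k + 2 f + 4 z + 3 r\<close>. The base 5 exceeds every ratio of coefficients that
  arises; the largest is 9/2, at the passage from a line to a plane. On a line the bound
  \<open>3 k + f + 2 z\<close> is above the one claimed, but there the reflection agrees with
  \<open>\<sigma>\<close> and has its height.

  The rationals are not complete, so norms on the field cannot be compared by compactness. The trace
  form replaces it: coordinates are traces, and traces are bounded by the spectral radius.\<close>

no_notation Matrix.vec_index (infixl \<open>$\<close> 100)

section \<open>Rational coordinates and the trace\<close>

interpretation Qv: vector_space "scale_rat :: rat \<Rightarrow> 'k::field_char_0 \<Rightarrow> 'k"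
  by unfold_locales (auto simp: algebra_simps of_rat_add of_rat_mult)

text \<open>The same choice as inside \<open>field_trace\<close>, so that coordinates and traces
  refer to one basis.\<close>

definition qbasis_set :: "'k::number_field set" where
  "qbasis_set = (SOME B. \<not> module.dependent scale_rat B \<and> module.span scale_rat B = UNIV)"

lemma qbasis_set_basis: "Qv.independent (qbasis_set :: 'k::number_field set)" "Qv.span (qbasis_set :: 'k set) = UNIV"
proof -
  obtain B :: "'k set" where "Qv.independent B" "UNIV \<subseteq> Qv.span B"
    using Qv.basis_exists[of UNIV] by metis
  hence "\<exists>B::'k set. Qv.independent B \<and> Qv.span B = UNIV" by auto
  from someI_ex[OF this] show "Qv.independent (qbasis_set :: 'k::number_field set)" "Qv.span (qbasis_set :: 'k set) = UNIV"
    unfolding qbasis_set_def by auto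
qed

lemma finite_qbasis_set: "finite (qbasis_set :: 'k::number_field set)"
proof -
  obtain B :: "'k set" where B: "finite B" "\<forall>x. \<exists>c. x = (\<Sum>b\<in>B. of_rat (c b) * b)"
    using finite_over_rat by blast
  have "x \<in> Qv.span B" for x
  proof -
    obtain c where "x = (\<Sum>b\<in>B. of_rat (c b) * b)" using B by blast
    thus ?thesis by (auto intro: Qv.span_sum Qv.span_scale Qv.span_base)
  qed
  thus ?thesis using Qv.independent_span_bound[OF B(1) qbasis_set_basis(1)] by blast
qed

interpretation Qf: finite_dimensional_vector_space "scale_rat :: rat \<Rightarrow> 'k::number_field \<Rightarrow> 'k" qbasis_set
  by unfold_locales (use finite_qbasis_set qbasis_set_basis in auto)

text \<open>The codomain is the space of rationals over themselves. It provides the extension of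
  linear functionals that \<open>approx_basis_span\<close> applies.\<close>

interpretation Qp: finite_dimensional_vector_space_pair_1 "scale_rat :: rat \<Rightarrow> 'k::number_field \<Rightarrow> 'k" qbasis_set
    "(*) :: rat \<Rightarrow> rat \<Rightarrow> rat"
  by unfold_locales (auto simp: algebra_simps)

lemma degree_card: "degree_K TYPE('k::number_field) = card (qbasis_set :: 'k set)"
  unfolding degree_K_def using Qf.dimension_def Qf.dim_UNIV by simp

definition qbasis_list :: "'k::number_field list" where
  "qbasis_list = (SOME bl. distinct bl \<and> set bl = qbasis_set)"

definition qbasis :: "nat \<Rightarrow> 'k::number_field" where "qbasis i = qbasis_list ! i"

definition coord :: "'k::number_field \<Rightarrow> nat \<Rightarrow> rat" where
  "coord x i = Qv.representation qbasis_set x (qbasis i)"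

lemma qbasis_list: "distinct (qbasis_list :: 'k::number_field list)" "set (qbasis_list :: 'k list) = qbasis_set"
  using someI_ex[OF finite_distinct_list[OF finite_qbasis_set], folded qbasis_list_def]
  by (smt (verit, ccfv_threshold) finite_distinct_list finite_qbasis_set qbasis_list_def someI_ex)+

lemma qbasis_bij: "bij_betw (qbasis :: nat \<Rightarrow> 'k::number_field) {..<degree_K TYPE('k)} qbasis_set"
  unfolding degree_card qbasis_def[abs_def]
  by (rule bij_betw_nth[OF qbasis_list(1)]) (simp_all add: qbasis_list(2) distinct_card[OF qbasis_list(1), symmetric, unfolded qbasis_list(2)])

lemma sum_qbasis_set: "(\<Sum>b\<in>(qbasis_set::'k::number_field set). f b) = (\<Sum>i<degree_K TYPE('k). f (qbasis i))"
  using sum.reindex_bij_betw[OF qbasis_bij, of f] by simp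

lemma coord_expand: "x = (\<Sum>i<degree_K TYPE('k). of_rat (coord x i) * (qbasis i :: 'k::number_field))"
proof -
  have "(\<Sum>b\<in>qbasis_set. of_rat (Qv.representation qbasis_set x b) * b) = x"
    by (rule Qv.sum_representation_eq) (use qbasis_set_basis finite_qbasis_set in auto)
  thus ?thesis by (simp add: sum_qbasis_set coord_def)
qed

lemma coord_add: "coord (x + y) i = coord x i + coord y i"
  using Qv.representation_add[OF qbasis_set_basis(1), of y x] by (simp add: coord_def qbasis_set_basis(2))

lemma coord_scale: "coord (of_rat q * x) i = q * coord x i"
  using Qv.representation_scale[OF qbasis_set_basis(1), of x q] by (simp add: coord_def qbasis_set_basis(2))

lemma coord_zero [simp]: "coord 0 i = 0"
  using coord_scale[of 0 0 i] by simp

lemma coord_sum: "coord (\<Sum>j\<in>A. f j) i = (\<Sum>j\<in>A. coord (f j) i)"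
  by (induction A rule: infinite_finite_induct) (auto simp: coord_add)

lemma coord_qbasis: "i < degree_K TYPE('k) \<Longrightarrow> j < degree_K TYPE('k) \<Longrightarrow>
   coord (qbasis i :: 'k::number_field) j = (if i = j then 1 else 0)"
proof -
  assume ij: "i < degree_K TYPE('k)" "j < degree_K TYPE('k)"
  have "(qbasis i :: 'k) \<in> qbasis_set" using qbasis_bij[where 'k='k] ij by (auto simp: bij_betw_def)
  moreover have "(qbasis i :: 'k) = qbasis j \<longleftrightarrow> i = j"
    using inj_on_eq_iff[OF bij_betw_imp_inj_on[OF qbasis_bij[where 'k='k]], of i j] ij by simp
  ultimately show ?thesis
    using Qv.representation_basis[OF qbasis_set_basis(1), of "qbasis i :: 'k"] by (auto simp: coord_def)
qed

lemma coord_eq: "j < degree_K TYPE('k) \<Longrightarrow>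
   coord (\<Sum>i<degree_K TYPE('k). of_rat (q i) * (qbasis i :: 'k::number_field)) j = q j"
proof -
  assume j: "j < degree_K TYPE('k)"
  have "coord (\<Sum>i<degree_K TYPE('k). of_rat (q i) * (qbasis i :: 'k)) j =
     (\<Sum>i<degree_K TYPE('k). if i = j then q i else 0)"
    unfolding coord_sum by (rule sum.cong) (use j in \<open>simp_all add: coord_scale coord_qbasis\<close>)
  thus ?thesis using j by simp
qed

lemma degree_pos: "degree_K TYPE('k::number_field) > 0"
proof (rule ccontr)
  assume "\<not> ?thesis"
  then have "(1::'k) = 0" using coord_expand[of "1::'k"] by simp
  thus False by simp
qed

lemma trace_coord: "field_trace (x::'k::number_field) = (\<Sum>i<degree_K TYPE('k). coord (x * qbasis i) i)"
  unfolding field_trace_def Let_def qbasis_set_def[symmetric] sum_qbasis_set coord_def ..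

lemma trace_add: "field_trace (x + y) = field_trace x + field_trace y"
  by (simp add: trace_coord ring_distribs coord_add sum.distrib)

lemma trace_scale: "field_trace (of_rat q * x) = q * field_trace x"
  by (simp add: trace_coord mult.assoc coord_scale sum_distrib_left)

lemma trace_zero [simp]: "field_trace 0 = 0"
  using trace_scale[of 0 0] by simp

lemma trace_diff: "field_trace (x - y) = field_trace x - field_trace y"
  using trace_add[of x "-y"] trace_scale[of "-1" y] by simp

lemma trace_sum: "field_trace (\<Sum>j\<in>A. f j) = (\<Sum>j\<in>A. field_trace (f j))"
  by (induction A rule: infinite_finite_induct) (auto simp: trace_add)

lemma trace_one: "field_trace (1::'k::number_field) = of_nat (degree_K TYPE('k))"
  by (simp add: trace_coord coord_qbasis)

text \<open>The product \<open>x * inverse x = 1\<close> has trace \<open>degree_K\<close>, which is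
  nonzero.\<close>

lemma trace_nondegenerate:
  assumes "\<And>y. field_trace (x * y) = 0" shows "x = (0::'k::number_field)"
proof (rule ccontr)
  assume "x \<noteq> 0"
  then show False using assms[of "inverse x"] degree_pos[where 'k='k] by (simp add: trace_one)
qed

lemma trace_nondegenerate_qbasis:
  assumes "\<And>i. i < degree_K TYPE('k) \<Longrightarrow> field_trace (x * qbasis i) = 0" shows "x = (0::'k::number_field)"
proof (rule trace_nondegenerate)
  fix y
  have "x * y = (\<Sum>i<degree_K TYPE('k). of_rat (coord y i) * (x * qbasis i))"
    by (subst (1) coord_expand[of y]) (simp add: sum_distrib_left algebra_simps)
  thus "field_trace (x * y) = 0" using assms by (simp add: trace_sum trace_scale)
qed

text \<open>By nondegeneracy the map \<open>\<Phi>\<close>, which records the traces against the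
  basis, is injective, hence surjective by equality of dimensions; a preimage of
  \<open>qbasis i\<close> is the \<open>i\<close>-th dual element. Bounds for traces thereby become
  bounds for coordinates.\<close>

lemma dual_basis: "\<exists>dl :: nat \<Rightarrow> 'k::number_field. \<forall>i<degree_K TYPE('k). \<forall>x. coord x i = field_trace (x * dl i)"
proof -
  define \<Phi> :: "'k \<Rightarrow> 'k" where "\<Phi> y = (\<Sum>j<degree_K TYPE('k). of_rat (field_trace (y * qbasis j)) * qbasis j)" for y
  have lin: "Vector_Spaces.linear scale_rat scale_rat \<Phi>"
  proof -
    have "\<Phi> (x + y) = \<Phi> x + \<Phi> y" for x y
      by (simp add: \<Phi>_def distrib_right of_rat_add sum.distrib trace_add)
    moreover have "\<Phi> (of_rat q * x) = of_rat q * \<Phi> x" for q x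
      unfolding \<Phi>_def sum_distrib_left
      by (rule sum.cong) (simp_all only: mult.assoc trace_scale of_rat_mult)
    ultimately show ?thesis
      by (simp add: Vector_Spaces.linear_iff Qv.vector_space_axioms)
  qed
  have "inj \<Phi>"
  proof (rule injI)
    fix x y assume "\<Phi> x = \<Phi> y"
    hence "coord (\<Phi> x) j = coord (\<Phi> y) j" for j by simp
    hence "field_trace ((x - y) * qbasis j) = 0" if "j < degree_K TYPE('k)" for j
    proof -
      have "field_trace (x * qbasis j) = field_trace (y * qbasis j)"
        using \<open>coord (\<Phi> x) j = coord (\<Phi> y) j\<close>
        unfolding \<Phi>_def coord_eq[OF that, of "\<lambda>j. field_trace (_ * qbasis j)"] .
      thus ?thesis by (simp add: left_diff_distrib trace_diff)
    qed
    thus "x = y" using trace_nondegenerate_qbasis[of "x - y"] by simp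
  qed
  hence "surj \<Phi>" using Qf.linear_inj_imp_surj[OF lin] by blast
  have "\<exists>y::'k. \<forall>x. coord x i = field_trace (x * y)" if i: "i < degree_K TYPE('k)" for i
  proof -
    obtain y where y: "\<Phi> y = qbasis i" using \<open>surj \<Phi>\<close> by (metis surjD)
    have tr: "field_trace (y * qbasis j) = (if i = j then 1 else 0)" if "j < degree_K TYPE('k)" for j
    proof -
      have "coord (\<Phi> y) j = field_trace (y * qbasis j)" using that unfolding \<Phi>_def by (simp add: coord_eq)
      thus ?thesis unfolding y using coord_qbasis[OF i that] by simp
    qed
    have "coord x i = field_trace (x * y)" for x
    proof -
      have "field_trace (x * y) = (\<Sum>j<degree_K TYPE('k). coord x j * field_trace (y * qbasis j))"
        by (subst (1) coord_expand[of x]) (simp add: sum_distrib_right mult.assoc trace_sum trace_scale mult.commute[of "qbasis _" y])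
      also have "\<dots> = (\<Sum>j<degree_K TYPE('k). if i = j then coord x j else 0)"
        by (rule sum.cong) (simp_all add: tr)
      also have "\<dots> = coord x i" using i by simp
      finally show ?thesis by simp
    qed
    thus ?thesis by blast
  qed
  thus ?thesis by metis
qed

section \<open>Extensions of absolute values of the rationals\<close>

lemma
  assumes "absolute_value w"
  shows av_nonneg: "0 \<le> w x"
    and av_zero_iff: "w x = 0 \<longleftrightarrow> x = 0"
    and av_mult: "w (x * y) = w x * w y"
    and av_triangle: "w (x + y) \<le> w x + w y"
  using assms unfolding absolute_value_def by blast+

lemma av_zero: "absolute_value w \<Longrightarrow> w 0 = 0"
  by (simp add: av_zero_iff)

lemma av_pos: "absolute_value w \<Longrightarrow> x \<noteq> 0 \<Longrightarrow> w x > 0"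
  using av_nonneg[of w x] av_zero_iff[of w x] by simp

lemma av_one: assumes "absolute_value w" shows "w 1 = 1"
  using av_mult[OF assms, of 1 1] av_zero_iff[OF assms, of 1] by simp

lemma av_power: assumes "absolute_value w" shows "w (x ^ n) = w x ^ n"
  by (induction n) (simp_all add: assms av_one av_mult)

lemma av_uminus: assumes "absolute_value w" shows "w (- x) = w x"
proof -
  have "w (- 1) ^ 2 = 1" using av_mult[OF assms, of "-1" "-1"] av_one[OF assms] by (simp add: power2_eq_square)
  hence "w (- 1) = 1" using av_nonneg[OF assms, of "-1"] by (simp add: power2_eq_1_iff)
  thus ?thesis using av_mult[OF assms, of "-1" x] by simp
qed

lemma av_diff: assumes "absolute_value w" shows "w (x - y) \<le> w x + w y"
  using av_triangle[OF assms, of x "-y"] av_uminus[OF assms, of y] by simp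

lemma av_diff_ge: assumes "absolute_value w" shows "w x - w y \<le> w (x - y)"
  using av_triangle[OF assms, of "x - y" y] by simp

lemma av_add_ge: assumes "absolute_value w" shows "w x - w y \<le> w (x + y)"
  using av_diff[OF assms, of "x + y" y] by simp

lemma av_diff_commute: assumes "absolute_value w" shows "w (x - y) = w (y - x)"
  using av_uminus[OF assms, of "x - y"] by simp

lemma av_inverse: assumes "absolute_value w" shows "w (inverse x) = inverse (w x)"
proof (cases "x = 0")
  case False
  hence "w x * w (inverse x) = 1" using av_mult[OF assms, of x "inverse x"] av_one[OF assms] by simp
  thus ?thesis by (metis inverse_unique)
qed (simp add: av_zero assms)

lemma av_divide: assumes "absolute_value w" shows "w (x / y) = w x / w y"
  using av_mult[OF assms, of x "inverse y"] av_inverse[OF assms, of y] by (simp add: divide_inverse)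

lemma av_sum: assumes "absolute_value w" shows "w (\<Sum>i\<in>A. f i) \<le> (\<Sum>i\<in>A. w (f i))"
proof (induction A rule: infinite_finite_induct)
  case (insert x F)
  thus ?case using av_triangle[OF assms, of "f x" "\<Sum>i\<in>F. f i"] by simp
qed (simp_all add: av_zero assms)

lemma av_of_nat: assumes "absolute_value w" shows "w (of_nat n) \<le> real n"
proof (induction n)
  case (Suc n)
  thus ?case using av_triangle[OF assms, of "1" "of_nat n"] av_one[OF assms] by simp
qed (simp add: av_zero assms)

text \<open>Infima are controlled only through numbers strictly above them; letting the excess tend
  to 0 recovers the product of the infima.\<close>

lemma mult_le_limit:
  fixes r s t :: real
  assumes "\<And>a b. r < a \<Longrightarrow> s < b \<Longrightarrow> t \<le> a * b"
  shows "t \<le> r * s"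
proof -
  have "((\<lambda>e. (r + e) * (s + e)) \<longlongrightarrow> (r + 0) * (s + 0)) (at_right 0)" by (intro tendsto_intros)
  moreover have "\<forall>\<^sub>F e in at_right 0. t \<le> (r + e) * (s + e)"
    unfolding eventually_at_right_field by (rule exI[of _ 1]) (auto intro!: assms)
  ultimately show ?thesis using tendsto_lowerbound[of _ _ "at_right (0::real)" t] by simp
qed

text \<open>Otherwise \<open>(r / a) ^ n\<close> would exceed \<open>A / c\<close>. Applied to the
  powers of an element, this removes the unspecified constants from multiplicative
  inequalities.\<close>

lemma power_growth_le:
  fixes a r c A :: real
  assumes "\<And>n. c * r ^ n \<le> A * a ^ n" "c > 0" "a > 0"
  shows "r \<le> a"
proof (rule ccontr)
  assume "\<not> ?thesis"
  hence "1 < r / a" using assms by simp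
  then obtain n where "A / c < (r / a) ^ n" using real_arch_pow by blast
  hence "A * a ^ n < c * r ^ n" using assms by (simp add: power_divide field_simps)
  thus False using assms(1)[of n] by simp
qed

text \<open>The usual and the p-adic absolute values are treated together. Nontriviality is
  expressed by a value above 1, whose powers serve to rescale in
  \<open>separate_aux\<close>.\<close>

locale rat_abs =
  fixes v :: "rat \<Rightarrow> real"
  assumes av: "absolute_value v" and nontriv: "\<exists>q. v q > 1"
begin

section \<open>The coordinate norm and the spectral radius\<close>

definition coord_norm :: "'k::number_field \<Rightarrow> real" where
  "coord_norm x = (\<Sum>i<degree_K TYPE('k). v (coord x i))"

definition exts :: "('k::number_field \<Rightarrow> real) set" where
  "exts = {w. absolute_value w \<and> (\<forall>q. w (of_rat q) = v q)}"

lemma coord_norm_nonneg: "0 \<le> coord_norm x"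
  unfolding coord_norm_def by (intro sum_nonneg av_nonneg[OF av])

lemma coord_norm_ge_coord: "i < degree_K TYPE('k) \<Longrightarrow> v (coord x i) \<le> coord_norm (x::'k::number_field)"
  unfolding coord_norm_def by (rule member_le_sum) (auto intro: av_nonneg[OF av])

lemma coord_norm_zero_iff: "coord_norm x = 0 \<longleftrightarrow> x = (0::'k::number_field)"
proof
  assume "coord_norm x = 0"
  hence "coord x i = 0" if "i < degree_K TYPE('k)" for i
    using coord_norm_ge_coord[OF that, of x] av_nonneg[OF av, of "coord x i"] by (simp add: av_zero_iff[OF av, symmetric])
  thus "x = 0" using coord_expand[of x] by simp
qed (simp add: coord_norm_def av_zero[OF av])

lemma coord_norm_zero [simp]: "coord_norm 0 = 0" by (simp add: coord_norm_zero_iff)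

lemma coord_norm_pos: "x \<noteq> 0 \<Longrightarrow> coord_norm x > 0"
  using coord_norm_nonneg[of x] coord_norm_zero_iff[of x] by simp

lemma coord_norm_add: "coord_norm (x + y) \<le> coord_norm x + coord_norm y"
  unfolding coord_norm_def sum.distrib[symmetric] coord_add by (intro sum_mono av_triangle[OF av])

lemma coord_norm_scale: "coord_norm (of_rat q * x) = v q * coord_norm x"
  unfolding coord_norm_def sum_distrib_left coord_scale av_mult[OF av] ..

lemma coord_norm_sum: "coord_norm (\<Sum>i\<in>A. f i) \<le> (\<Sum>i\<in>A. coord_norm (f i))"
proof (induction A rule: infinite_finite_induct)
  case (insert x F)
  thus ?case using coord_norm_add[of "f x" "\<Sum>i\<in>F. f i"] by simp
qed simp_all

text \<open>The constant is the sum of the norms of the products \<open>qbasis i * qbasis j\<close>;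
  the added 1 makes it positive.\<close>

lemma coord_norm_mult: "\<exists>C>0. \<forall>x y :: 'k::number_field. coord_norm (x * y) \<le> C * coord_norm x * coord_norm y"
proof (intro exI conjI allI)
  let ?C = "(\<Sum>i<degree_K TYPE('k). \<Sum>j<degree_K TYPE('k). coord_norm (qbasis i * qbasis j :: 'k)) + 1"
  let ?I = "{..<degree_K TYPE('k)}"
  show "0 < ?C" using sum_nonneg[of ?I "\<lambda>i. \<Sum>j\<in>?I. coord_norm (qbasis i * qbasis j :: 'k)"]
    by (auto intro!: sum_nonneg coord_norm_nonneg add_nonneg_pos)
  fix x y :: 'k
  have "x * y = (\<Sum>i\<in>?I. \<Sum>j\<in>?I. of_rat (coord x i * coord y j) * (qbasis i * qbasis j))"
    by (subst (1) coord_expand[of x], subst (1) coord_expand[of y])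
      (simp add: sum_product of_rat_mult algebra_simps)
  hence "coord_norm (x * y) \<le> (\<Sum>i\<in>?I. coord_norm (\<Sum>j\<in>?I. of_rat (coord x i * coord y j) * (qbasis i * qbasis j :: 'k)))"
    by (simp add: coord_norm_sum)
  also have "\<dots> \<le> (\<Sum>i\<in>?I. \<Sum>j\<in>?I. coord_norm (of_rat (coord x i * coord y j) * (qbasis i * qbasis j :: 'k)))"
    by (intro sum_mono coord_norm_sum)
  also have "\<dots> \<le> (\<Sum>i\<in>?I. \<Sum>j\<in>?I. coord_norm x * coord_norm y * coord_norm (qbasis i * qbasis j :: 'k))"
    unfolding coord_norm_scale av_mult[OF av]
    by (intro sum_mono mult_right_mono mult_mono coord_norm_ge_coord coord_norm_nonneg av_nonneg[OF av]) auto
  also have "\<dots> \<le> coord_norm x * coord_norm y * ?C"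
    by (simp add: sum_distrib_left[symmetric] distrib_left coord_norm_nonneg)
  finally show "coord_norm (x * y) \<le> ?C * coord_norm x * coord_norm y" by (simp add: mult_ac)
qed

text \<open>The spectral seminorm: it is power-multiplicative, and extensions of \<open>v\<close> are found below it by
  Zorn's lemma.\<close>
definition spec_rad :: "'k::number_field \<Rightarrow> real" where
  "spec_rad x = Inf {a. a > 0 \<and> (\<exists>A. \<forall>n. coord_norm (x ^ n) \<le> A * a ^ n)}"

lemma spec_rad_nonempty: "{a. a > 0 \<and> (\<exists>A. \<forall>n. coord_norm (x ^ n) \<le> A * a ^ n)} \<noteq> {}"
proof -
  obtain C where C: "C > 0" "\<And>x y :: 'a. coord_norm (x * y) \<le> C * coord_norm x * coord_norm y" using coord_norm_mult by blast
  define a where "a = C * coord_norm x + 1"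
  have a: "a > 0" unfolding a_def using C coord_norm_nonneg[of x] by (simp add: add_nonneg_pos)
  have "coord_norm (x ^ n) \<le> coord_norm (1::'a) * a ^ n" for n
  proof (induction n)
    case (Suc n)
    have "coord_norm (x ^ Suc n) \<le> C * coord_norm x * coord_norm (x ^ n)" using C(2)[of x "x ^ n"] by simp
    also have "\<dots> \<le> a * coord_norm (x ^ n)" unfolding a_def by (simp add: coord_norm_nonneg distrib_right)
    also have "\<dots> \<le> a * (coord_norm (1::'a) * a ^ n)" using Suc a by (intro mult_left_mono) auto
    finally show ?case by (simp add: mult_ac)
  qed simp
  thus ?thesis using a by blast
qed

lemma spec_rad_bdd: "bdd_below {a. a > 0 \<and> (\<exists>A. \<forall>n. coord_norm (x ^ n) \<le> A * a ^ n)}"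
  by (rule bdd_belowI[of _ 0]) auto

lemma spec_rad_nonneg: "spec_rad x \<ge> 0"
  unfolding spec_rad_def by (rule cInf_greatest[OF spec_rad_nonempty]) auto

lemma spec_rad_le: "a > 0 \<Longrightarrow> (\<And>n. coord_norm (x ^ n) \<le> A * a ^ n) \<Longrightarrow> spec_rad x \<le> a"
  unfolding spec_rad_def by (rule cInf_lower[OF _ spec_rad_bdd]) auto

lemma spec_rad_less:
  assumes "spec_rad x < a"
  obtains A where "A \<ge> 0" "\<And>n. coord_norm (x ^ n) \<le> A * a ^ n"
proof -
  obtain b A where b: "b < a" "b > 0" "\<And>n. coord_norm (x ^ n) \<le> A * b ^ n"
    using cInf_lessD[OF spec_rad_nonempty assms[unfolded spec_rad_def]] by blast
  have A: "A \<ge> 0" using b(3)[of 0] coord_norm_nonneg[of "x^0"] by simp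
  have "coord_norm (x ^ n) \<le> A * a ^ n" for n
    by (rule order_trans[OF b(3)]) (use A b in \<open>auto intro!: mult_left_mono power_mono\<close>)
  thus ?thesis using that A by blast
qed

lemma spec_rad_mult: "spec_rad (x * y) \<le> spec_rad x * spec_rad y"
proof (rule mult_le_limit)
  fix a b assume ab: "spec_rad x < a" "spec_rad y < b"
  obtain A where A: "A \<ge> 0" "\<And>n. coord_norm (x ^ n) \<le> A * a ^ n" using spec_rad_less[OF ab(1)] by blast
  obtain B where B: "B \<ge> 0" "\<And>n. coord_norm (y ^ n) \<le> B * b ^ n" using spec_rad_less[OF ab(2)] by blast
  obtain C where C: "C > 0" "\<And>x y :: 'a. coord_norm (x * y) \<le> C * coord_norm x * coord_norm y" using coord_norm_mult by blast
  have pos: "a > 0" "b > 0" using ab spec_rad_nonneg[of x] spec_rad_nonneg[of y] by linarith+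
  show "spec_rad (x * y) \<le> a * b"
  proof (rule spec_rad_le)
    fix n
    have "coord_norm ((x * y) ^ n) \<le> C * coord_norm (x ^ n) * coord_norm (y ^ n)" using C by (simp add: power_mult_distrib)
    also have "\<dots> \<le> C * (A * a ^ n) * (B * b ^ n)"
      using A B C pos by (intro mult_mono) (auto simp: coord_norm_nonneg)
    finally show "coord_norm ((x * y) ^ n) \<le> (C * A * B) * (a * b) ^ n" by (simp add: mult_ac power_mult_distrib)
  qed (use pos in auto)
qed

text \<open>In the binomial expansion of \<open>(x + y) ^ n\<close> every coefficient has absolute
  value at most its size, so the bounds for the summands recombine to a constant times
  \<open>(a + b) ^ n\<close>.\<close>

lemma spec_rad_add: "spec_rad (x + y) \<le> spec_rad x + spec_rad y"
proof (rule field_le_epsilon)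
  fix e :: real assume e: "e > 0"
  define a b where "a = spec_rad x + e / 2" and "b = spec_rad y + e / 2"
  have ab: "spec_rad x < a" "spec_rad y < b" using e by (auto simp: a_def b_def)
  obtain A where A: "A \<ge> 0" "\<And>n. coord_norm (x ^ n) \<le> A * a ^ n" using spec_rad_less[OF ab(1)] by blast
  obtain B where B: "B \<ge> 0" "\<And>n. coord_norm (y ^ n) \<le> B * b ^ n" using spec_rad_less[OF ab(2)] by blast
  obtain C where C: "C > 0" "\<And>x y :: 'a. coord_norm (x * y) \<le> C * coord_norm x * coord_norm y" using coord_norm_mult by blast
  have pos: "a > 0" "b > 0" using ab spec_rad_nonneg[of x] spec_rad_nonneg[of y] by linarith+
  have "spec_rad (x + y) \<le> a + b"
  proof (rule spec_rad_le)
    fix n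
    have "coord_norm ((x + y) ^ n) = coord_norm (\<Sum>k\<le>n. of_rat (of_nat (n choose k)) * (x ^ k * y ^ (n - k)))"
      by (simp add: binomial_ring mult.assoc)
    also have "\<dots> \<le> (\<Sum>k\<le>n. coord_norm (of_rat (of_nat (n choose k)) * (x ^ k * y ^ (n - k))))" by (rule coord_norm_sum)
    also have "\<dots> \<le> (\<Sum>k\<le>n. (C * A * B) * (of_nat (n choose k) * a ^ k * b ^ (n - k)))"
    proof (rule sum_mono)
      fix k
      have "coord_norm (of_rat (of_nat (n choose k)) * (x ^ k * y ^ (n - k))) \<le> real (n choose k) * coord_norm (x ^ k * y ^ (n - k))"
        unfolding coord_norm_scale by (intro mult_right_mono av_of_nat[OF av] coord_norm_nonneg)
      also have "\<dots> \<le> real (n choose k) * (C * coord_norm (x ^ k) * coord_norm (y ^ (n - k)))"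
        by (intro mult_left_mono C) auto
      also have "\<dots> \<le> real (n choose k) * (C * (A * a ^ k) * (B * b ^ (n - k)))"
        using A B C pos by (intro mult_left_mono mult_mono) (auto simp: coord_norm_nonneg)
      finally show "coord_norm (of_rat (of_nat (n choose k)) * (x ^ k * y ^ (n - k)))
          \<le> (C * A * B) * (of_nat (n choose k) * a ^ k * b ^ (n - k))" by (simp add: mult_ac)
    qed
    also have "\<dots> = (C * A * B) * (a + b) ^ n"
      by (simp only: binomial_ring sum_distrib_left)
    finally show "coord_norm ((x + y) ^ n) \<le> (C * A * B) * (a + b) ^ n" .
  qed (use pos in auto)
  thus "spec_rad (x + y) \<le> spec_rad x + spec_rad y + e" by (simp add: a_def b_def)
qed

lemma spec_rad_rat: "spec_rad (of_rat q :: 'k::number_field) = v q"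
proof -
  have p: "coord_norm ((of_rat q :: 'k) ^ n) = coord_norm (1::'k) * v q ^ n" for n
    using coord_norm_scale[of "q ^ n" "1::'k"] by (simp add: of_rat_power av_power[OF av] mult.commute)
  have "spec_rad (of_rat q :: 'k) \<le> v q"
  proof (rule field_le_epsilon, rule spec_rad_le)
    fix e :: real assume that: "e > 0"
    show "0 < v q + e" using that av_nonneg[OF av, of q] by linarith
    show "coord_norm ((of_rat q :: 'k) ^ n) \<le> coord_norm (1::'k) * (v q + e) ^ n" for n
      unfolding p using that by (intro mult_left_mono power_mono coord_norm_nonneg) (auto intro: av_nonneg[OF av])
  qed
  moreover have "v q \<le> spec_rad (of_rat q :: 'k)"
    unfolding spec_rad_def
  proof (rule cInf_greatest[OF spec_rad_nonempty], clarify)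
    fix a A assume "a > 0" "\<forall>n. coord_norm ((of_rat q :: 'k) ^ n) \<le> A * a ^ n"
    thus "v q \<le> a" by (intro power_growth_le[of "coord_norm (1::'k)" "v q" A a]) (simp_all only: p coord_norm_pos zero_neq_one[symmetric] simp_thms not_False_eq_True)
  qed
  ultimately show ?thesis by (rule antisym)
qed

section \<open>Power-multiplicative norms and their minimal elements\<close>

definition alg_norm :: "('k::number_field \<Rightarrow> real) \<Rightarrow> bool" where
  "alg_norm \<mu> \<longleftrightarrow> (\<forall>x. 0 \<le> \<mu> x) \<and> (\<forall>x y. \<mu> (x + y) \<le> \<mu> x + \<mu> y) \<and> (\<forall>x y. \<mu> (x * y) \<le> \<mu> x * \<mu> y)
     \<and> (\<forall>q. \<mu> (of_rat q) = v q) \<and> (\<forall>x n. \<mu> (x ^ n) = \<mu> x ^ n)"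

lemma alg_norm_one: "alg_norm \<mu> \<Longrightarrow> \<mu> 1 = 1"
  using av_one[OF av] unfolding alg_norm_def by (metis of_rat_1)

text \<open>In a field, submultiplicativity at \<open>x * inverse x = 1\<close> rules out the value
  0.\<close>

lemma alg_norm_pos: assumes "alg_norm \<mu>" "x \<noteq> 0" shows "\<mu> x > 0"
proof -
  have "1 \<le> \<mu> x * \<mu> (inverse x)"
    using assms alg_norm_one[OF assms(1)] unfolding alg_norm_def by (metis right_inverse)
  hence "\<mu> x \<noteq> 0" by auto
  thus ?thesis using assms unfolding alg_norm_def by (simp add: order_less_le)
qed

text \<open>Submultiplicativity is applied to the scalar \<open>q\<close> and to its inverse;
  together they give equality.\<close>

lemma alg_norm_scale: assumes "alg_norm \<mu>" shows "\<mu> (of_rat q * x) = v q * \<mu> x"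
proof (cases "q = 0")
  case True
  have "\<mu> 0 = 0" using assms av_zero[OF av] unfolding alg_norm_def by (metis of_rat_0)
  thus ?thesis using True av_zero[OF av] by simp
next
  case False
  have "\<mu> (of_rat q * x) \<le> v q * \<mu> x" using assms unfolding alg_norm_def by metis
  moreover have "\<mu> (of_rat (inverse q) * (of_rat q * x)) \<le> inverse (v q) * \<mu> (of_rat q * x)"
    using assms av_inverse[OF av] unfolding alg_norm_def by metis
  moreover have "of_rat (inverse q) * (of_rat q * x) = x" using False by (simp add: of_rat_inverse)
  ultimately have "\<mu> x \<le> inverse (v q) * \<mu> (of_rat q * x)" by metis
  hence "v q * \<mu> x \<le> \<mu> (of_rat q * x)" using av_pos[OF av False] by (simp add: field_simps)
  thus ?thesis using \<open>\<mu> (of_rat q * x) \<le> v q * \<mu> x\<close> by simp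
qed

text \<open>For the lower bound an exponent is divided by \<open>m\<close> with remainder: growth of
  the powers of \<open>x ^ m\<close> controls all powers of \<open>x\<close>, and the finitely many
  remainders contribute only the constant \<open>D\<close>.\<close>

lemma spec_rad_power: "spec_rad (x ^ m) = spec_rad x ^ m"
proof (cases "m = 0")
  case True
  have "spec_rad (1::'a) = 1" using spec_rad_rat[of 1, where 'k='a] av_one[OF av] by simp
  thus ?thesis using True by simp
next
  case m: False
  have "spec_rad (x ^ k) \<le> spec_rad x ^ k" for k
  proof (induction k)
    case 0 thus ?case using spec_rad_rat[of 1, where 'k='a] av_one[OF av] by simp
  next
    case (Suc k)
    have "spec_rad (x ^ Suc k) \<le> spec_rad x * spec_rad (x ^ k)" using spec_rad_mult[of x "x ^ k"] by simp
    also have "\<dots> \<le> spec_rad x * spec_rad x ^ k" by (intro mult_left_mono Suc spec_rad_nonneg)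
    finally show ?case by simp
  qed
  moreover have "spec_rad x ^ m \<le> spec_rad (x ^ m)"
  proof (rule dense_ge)
    fix a assume a: "spec_rad (x ^ m) < a"
    define b where "b = root m a"
    have apos: "a > 0" using a spec_rad_nonneg[of "x ^ m"] by linarith
    have bpos: "b > 0" and bm: "b ^ m = a" using apos m by (auto simp: b_def)
    obtain A where A: "A \<ge> 0" "\<And>n. coord_norm ((x ^ m) ^ n) \<le> A * a ^ n" using spec_rad_less[OF a] by blast
    obtain C where C: "C > 0" "\<And>x y :: 'a. coord_norm (x * y) \<le> C * coord_norm x * coord_norm y" using coord_norm_mult by blast
    define D where "D = (\<Sum>r<m. coord_norm (x ^ r) / b ^ r)"
    have "spec_rad x \<le> b"
    proof (rule spec_rad_le[OF bpos])
      fix n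
      define k r where "k = n div m" and "r = n mod m"
      have r: "r < m" and n: "n = m * k + r" using m by (auto simp: k_def r_def)
      have "coord_norm (x ^ n) \<le> C * coord_norm ((x ^ m) ^ k) * coord_norm (x ^ r)" using C(2) by (simp add: n power_add power_mult)
      also have "\<dots> \<le> C * (A * a ^ k) * (D * b ^ r)"
      proof (intro mult_mono)
        have "coord_norm (x ^ r) / b ^ r \<le> D" unfolding D_def using r bpos
          by (intro member_le_sum) (auto intro!: divide_nonneg_pos coord_norm_nonneg)
        thus "coord_norm (x ^ r) \<le> D * b ^ r" using bpos by (simp add: field_simps)
      qed (use A C apos bpos in \<open>auto simp: coord_norm_nonneg\<close>)
      finally show "coord_norm (x ^ n) \<le> (C * A * D) * b ^ n"
        unfolding n power_add power_mult bm by (simp only: mult_ac)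
    qed
    thus "spec_rad x ^ m \<le> a" unfolding bm[symmetric] by (intro power_mono spec_rad_nonneg)
  qed
  ultimately show ?thesis by (simp add: antisym)
qed

lemma alg_norm_spec_rad: "alg_norm spec_rad"
  unfolding alg_norm_def by (simp add: spec_rad_nonneg spec_rad_add spec_rad_mult spec_rad_rat spec_rad_power)

text \<open>Twisting \<open>\<mu>\<close> by \<open>a\<close> keeps it power-multiplicative, does not increase it and makes multiplication
  by \<open>a\<close> a similarity. Hence a minimal \<open>\<mu>\<close> is multiplicative, that is, an absolute value.\<close>
definition twist :: "('k::number_field \<Rightarrow> real) \<Rightarrow> 'k \<Rightarrow> 'k \<Rightarrow> real" where
  "twist \<mu> a x = (INF n. \<mu> (a ^ n * x) / \<mu> a ^ n)"

context
  fixes \<mu> :: "'k::number_field \<Rightarrow> real" and a :: 'k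
  assumes \<mu>: "alg_norm \<mu>" and a: "a \<noteq> 0"
begin

lemma alg_norm_props: "0 \<le> \<mu> x" "\<mu> (x + y) \<le> \<mu> x + \<mu> y" "\<mu> (x * y) \<le> \<mu> x * \<mu> y" "\<mu> (of_rat q) = v q" "\<mu> (x ^ n) = \<mu> x ^ n"
  using \<mu> unfolding alg_norm_def by auto

lemma twist_bdd: "bdd_below (range (\<lambda>n. \<mu> (a ^ n * x) / \<mu> a ^ n))"
  by (rule bdd_belowI[of _ 0]) (auto intro!: divide_nonneg_nonneg alg_norm_props zero_le_power)

lemma twist_lim: "(\<lambda>n. \<mu> (a ^ n * x) / \<mu> a ^ n) \<longlonglongrightarrow> twist \<mu> a x"
  unfolding twist_def
proof (rule LIMSEQ_decseq_INF[OF twist_bdd])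
  show "decseq (\<lambda>n. \<mu> (a ^ n * x) / \<mu> a ^ n)"
  proof (rule decseq_SucI)
    fix n
    have "\<mu> (a ^ Suc n * x) \<le> \<mu> a * \<mu> (a ^ n * x)" using alg_norm_props(3)[of a "a ^ n * x"] by (simp add: mult.assoc)
    thus "\<mu> (a ^ Suc n * x) / \<mu> a ^ Suc n \<le> \<mu> (a ^ n * x) / \<mu> a ^ n"
      using alg_norm_pos[OF \<mu> a] by (simp add: field_simps)
  qed
qed

lemma twist_lim_sub: "m > 0 \<Longrightarrow> (\<lambda>n. \<mu> (a ^ (m * n) * x) / \<mu> a ^ (m * n)) \<longlonglongrightarrow> twist \<mu> a x"
  using LIMSEQ_subseq_LIMSEQ[OF twist_lim, of "\<lambda>n. m * n"] by (simp add: strict_mono_def o_def)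

lemma twist_le: "twist \<mu> a x \<le> \<mu> x"
  unfolding twist_def using cINF_lower[OF twist_bdd, of 0 x] by simp

lemma twist_nonneg: "0 \<le> twist \<mu> a x"
  by (rule LIMSEQ_le_const[OF twist_lim], intro exI[of _ 0] allI impI divide_nonneg_nonneg zero_le_power alg_norm_props)

text \<open>The quotient of index \<open>2 * n\<close> for the product is compared with the
  quotients of index \<open>n\<close> for the factors, so that the powers of \<open>a\<close> are
  shared evenly.\<close>

lemma twist_mult: "twist \<mu> a (x * y) \<le> twist \<mu> a x * twist \<mu> a y"
proof (rule LIMSEQ_le[OF twist_lim_sub[of 2] tendsto_mult[OF twist_lim twist_lim]])
  show "\<exists>N. \<forall>n\<ge>N. \<mu> (a ^ (2 * n) * (x * y)) / \<mu> a ^ (2 * n)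
          \<le> \<mu> (a ^ n * x) / \<mu> a ^ n * (\<mu> (a ^ n * y) / \<mu> a ^ n)"
  proof (intro exI allI impI)
    fix n
    have "\<mu> (a ^ (2 * n) * (x * y)) \<le> \<mu> (a ^ n * x) * \<mu> (a ^ n * y)"
      using alg_norm_props(3)[of "a ^ n * x" "a ^ n * y"] unfolding mult_2 power_add by (simp only: mult_ac)
    thus "\<mu> (a ^ (2 * n) * (x * y)) / \<mu> a ^ (2 * n) \<le> \<mu> (a ^ n * x) / \<mu> a ^ n * (\<mu> (a ^ n * y) / \<mu> a ^ n)"
      using alg_norm_pos[OF \<mu> a] by (simp add: mult_2 power_add divide_simps)
  qed
qed simp

lemma twist_add: "twist \<mu> a (x + y) \<le> twist \<mu> a x + twist \<mu> a y"
proof (rule LIMSEQ_le[OF twist_lim tendsto_add[OF twist_lim twist_lim]], intro exI allI impI)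
  fix n
  have "\<mu> (a ^ n * (x + y)) \<le> \<mu> (a ^ n * x) + \<mu> (a ^ n * y)"
    using alg_norm_props(2)[of "a ^ n * x" "a ^ n * y"] by (simp add: distrib_left)
  thus "\<mu> (a ^ n * (x + y)) / \<mu> a ^ n \<le> \<mu> (a ^ n * x) / \<mu> a ^ n + \<mu> (a ^ n * y) / \<mu> a ^ n"
    using alg_norm_pos[OF \<mu> a] by (simp add: divide_simps)
qed

lemma twist_rat: "twist \<mu> a (of_rat q) = v q"
proof -
  have "\<mu> (a ^ n * of_rat q) / \<mu> a ^ n = v q" for n
    using alg_norm_scale[OF \<mu>, of q "a ^ n"] alg_norm_pos[OF \<mu> a] by (simp add: mult.commute alg_norm_props)
  thus ?thesis using twist_lim[of "of_rat q"] by (simp add: LIMSEQ_const_iff)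
qed

text \<open>Along the indices \<open>m * n\<close> the quotient for \<open>x ^ m\<close> is exactly
  the \<open>m\<close>-th power of the quotient for \<open>x\<close>, because \<open>\<mu>\<close>
  is power-multiplicative.\<close>

lemma twist_power: "twist \<mu> a (x ^ m) = twist \<mu> a x ^ m"
proof (cases "m = 0")
  case True
  thus ?thesis using twist_rat[of 1] av_one[OF av] by simp
next
  case False
  have "\<mu> (a ^ (m * n) * x ^ m) / \<mu> a ^ (m * n) = (\<mu> (a ^ n * x) / \<mu> a ^ n) ^ m" for n
    using alg_norm_props(5)[of "a ^ n * x" m] by (simp add: power_mult_distrib power_divide power_mult mult.commute flip: power_mult)
  thus ?thesis using twist_lim_sub[of m "x ^ m"] tendsto_power[OF twist_lim, of x m] False
    by (simp add: LIMSEQ_unique)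
qed

lemma twist_self: "twist \<mu> a (a * x) = \<mu> a * twist \<mu> a x"
proof -
  have "\<mu> (a ^ n * (a * x)) / \<mu> a ^ n = \<mu> a * (\<mu> (a ^ Suc n * x) / \<mu> a ^ Suc n)" for n
    using alg_norm_pos[OF \<mu> a] by (simp add: mult_ac)
  thus ?thesis
    using twist_lim[of "a * x"] tendsto_mult[OF tendsto_const LIMSEQ_Suc[OF twist_lim[of x]], of "\<mu> a"]
    by (simp add: LIMSEQ_unique)
qed

lemma alg_norm_twist: "alg_norm (twist \<mu> a)"
  unfolding alg_norm_def by (simp add: twist_nonneg twist_add twist_mult twist_rat twist_power)

end

lemma alg_norm_minimal:
  assumes "alg_norm (\<mu>0 :: 'k::number_field \<Rightarrow> real)"
  obtains \<mu> where "alg_norm \<mu>" "\<mu> \<le> \<mu>0" "\<And>\<nu>. alg_norm \<nu> \<Longrightarrow> \<nu> \<le> \<mu> \<Longrightarrow> \<nu> = \<mu>"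
proof -
  let ?A = "{\<mu>. alg_norm \<mu> \<and> \<mu> \<le> \<mu>0}" and ?P = "\<lambda>\<mu> \<nu> :: 'k \<Rightarrow> real. \<nu> \<le> \<mu>"
  have "\<exists>m\<in>?A. \<forall>a\<in>?A. ?P m a \<longrightarrow> a = m"
  proof (rule predicate_Zorn)
    show "partial_order_on ?A (relation_of ?P ?A)"
      unfolding partial_order_on_def preorder_on_def refl_on_def relation_of_def trans_def antisym_def by auto
    fix C assume C: "C \<in> Chains (relation_of ?P ?A)"
    show "\<exists>u\<in>?A. \<forall>a\<in>C. ?P a u"
    proof (cases "C = {}")
      case True thus ?thesis using assms by auto
    next
      case False
      have CA: "C \<subseteq> ?A" using C by (auto simp: Chains_def relation_of_def)
      have tot: "\<mu> \<le> \<nu> \<or> \<nu> \<le> \<mu>" if "\<mu> \<in> C" "\<nu> \<in> C" for \<mu> \<nu>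
        using C that by (auto simp: Chains_def relation_of_def)
      have an: "alg_norm \<mu>" if "\<mu> \<in> C" for \<mu> using that CA by auto
      have nn: "0 \<le> \<mu> x" if "\<mu> \<in> C" for \<mu> x using an[OF that] by (simp add: alg_norm_def)
      define u where "u x = (INF \<mu>\<in>C. \<mu> x)" for x
      have bdd: "bdd_below ((\<lambda>\<mu>. \<mu> x) ` C)" for x by (rule bdd_belowI[of _ 0]) (use nn in auto)
      have ul: "u x \<le> \<mu> x" if "\<mu> \<in> C" for \<mu> x unfolding u_def by (rule cINF_lower[OF bdd that])
      have u0: "0 \<le> u x" for x unfolding u_def by (rule cINF_greatest[OF False nn])
      \<comment> \<open>Because \<open>C\<close> is a chain, a single member is close to the infimum
        at two points at once. This is what carries subadditivity and submultiplicativity over to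
        the pointwise infimum \<open>u\<close>.\<close>
      have common: "\<exists>\<mu>\<in>C. \<mu> x < p \<and> \<mu> y < q" if xy: "u x < p" "u y < q" for x y p q
      proof -
        obtain \<mu> \<nu> where m: "\<mu> \<in> C" "\<nu> \<in> C" "\<mu> x < p" "\<nu> y < q"
          using xy cINF_less_iff[OF False bdd] unfolding u_def by metis
        show ?thesis using tot[OF m(1,2)] m by (metis le_fun_def order_le_less_trans)
      qed
      have "u (x * y) \<le> u x * u y" for x y
      proof (rule mult_le_limit)
        fix p q assume "u x < p" "u y < q"
        then obtain \<mu> where m: "\<mu> \<in> C" "\<mu> x < p" "\<mu> y < q" using common by blast
        have "u (x * y) \<le> \<mu> x * \<mu> y" using ul[OF m(1), of "x * y"] an[OF m(1)] unfolding alg_norm_def by (meson order_trans)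
        also have "\<dots> \<le> p * q" using m nn[OF m(1)] by (intro mult_mono) (auto intro: order_trans less_imp_le)
        finally show "u (x * y) \<le> p * q" .
      qed
      note um = this
      have "u (x + y) \<le> u x + u y" for x y
      proof (rule field_le_epsilon)
        fix e :: real assume "e > 0"
        then obtain \<mu> where m: "\<mu> \<in> C" "\<mu> x < u x + e/2" "\<mu> y < u y + e/2"
          using common[of x "u x + e/2" y "u y + e/2"] by auto
        have "u (x + y) \<le> \<mu> x + \<mu> y" using ul[OF m(1), of "x + y"] an[OF m(1)] unfolding alg_norm_def by (meson order_trans)
        thus "u (x + y) \<le> u x + u y + e" using m by linarith
      qed
      moreover have ur: "u (of_rat q) = v q" for q
      proof -
        have "(\<lambda>\<mu>. \<mu> (of_rat q)) ` C = {v q}" using an False by (auto simp: alg_norm_def image_iff)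
        thus ?thesis unfolding u_def by simp
      qed
      moreover have "u (x ^ n) = u x ^ n" for x n
      proof (rule antisym)
        show "u (x ^ n) \<le> u x ^ n"
        proof (induction n)
          case 0 thus ?case using ur[of 1] av_one[OF av] by simp
        next
          case (Suc n)
          have "u (x ^ Suc n) \<le> u x * u (x ^ n)" using um[of x "x ^ n"] by simp
          also have "\<dots> \<le> u x * u x ^ n" by (intro mult_left_mono Suc u0)
          finally show ?case by simp
        qed
        show "u x ^ n \<le> u (x ^ n)" unfolding u_def[of "x ^ n"]
        proof (rule cINF_greatest[OF False])
          fix \<mu> assume m: "\<mu> \<in> C"
          have "u x ^ n \<le> \<mu> x ^ n" by (intro power_mono ul[OF m] u0)
          thus "u x ^ n \<le> \<mu> (x ^ n)" using an[OF m] by (simp add: alg_norm_def)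
        qed
      qed
      ultimately have "alg_norm u" unfolding alg_norm_def using um u0 by auto
      moreover have "u \<le> \<mu>0"
      proof -
        obtain \<mu> where "\<mu> \<in> C" using False by blast
        hence "u \<le> \<mu>" "\<mu> \<le> \<mu>0" using ul CA by (auto simp: le_fun_def)
        thus ?thesis by (rule order_trans)
      qed
      ultimately show ?thesis using ul by (intro bexI[of _ u]) (auto simp: le_fun_def)
    qed
  qed
  then obtain m where m: "alg_norm m" "m \<le> \<mu>0" "\<And>a. alg_norm a \<Longrightarrow> a \<le> \<mu>0 \<Longrightarrow> a \<le> m \<Longrightarrow> a = m" by blast
  show ?thesis by (rule that[OF m(1,2)]) (use m(2,3) order_trans in blast)
qed

text \<open>The minimal norm is sought below the twist of the spectral radius by \<open>x\<close>.
  The twist takes the value \<open>1 / spec_rad x\<close> at \<open>inverse x\<close>, so a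
  multiplicative \<open>w\<close> below it is at least \<open>spec_rad x\<close> at
  \<open>x\<close>.\<close>

lemma exists_ext_ge:
  assumes "x \<noteq> (0 :: 'k::number_field)"
  shows "\<exists>w\<in>exts. spec_rad x \<le> w x"
proof -
  obtain w where w: "alg_norm w" "w \<le> twist spec_rad x" and wmin: "\<And>\<nu>. alg_norm \<nu> \<Longrightarrow> \<nu> \<le> w \<Longrightarrow> \<nu> = w"
    using alg_norm_minimal[OF alg_norm_twist[OF alg_norm_spec_rad assms]] by blast
  have mult: "w (a * y) = w a * w y" for a y
  proof (cases "a = 0")
    case True
    thus ?thesis using w(1) av_zero[OF av] unfolding alg_norm_def by (metis mult_zero_left of_rat_0)
  next
    case False
    \<comment> \<open>The twist of a minimal norm cannot be smaller, so multiplication by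
      \<open>a\<close> already multiplies \<open>w\<close> by \<open>w a\<close>.\<close>
    have "twist w a = w" by (rule wmin[OF alg_norm_twist[OF w(1) False]]) (use twist_le[OF w(1) False] in \<open>auto simp: le_fun_def\<close>)
    thus ?thesis using twist_self[OF w(1) False, of y] by simp
  qed
  have "w 0 = 0" using w(1) av_zero[OF av] unfolding alg_norm_def by (metis of_rat_0)
  hence "absolute_value w" unfolding absolute_value_def
    using w(1) mult alg_norm_pos[OF w(1)] by (metis alg_norm_def less_irrefl)
  hence "w \<in> exts" using w(1) by (simp add: exts_def alg_norm_def)
  moreover have "spec_rad x \<le> w x"
  proof -
    have s: "spec_rad x > 0" using alg_norm_pos[OF alg_norm_spec_rad assms] .
    have "1 = spec_rad x * twist spec_rad x (inverse x)"
      using twist_self[OF alg_norm_spec_rad assms, of "inverse x"] assms alg_norm_one[OF alg_norm_twist[OF alg_norm_spec_rad assms]] by simp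
    moreover have "w (inverse x) \<le> twist spec_rad x (inverse x)" using w(2) by (simp add: le_fun_def)
    ultimately have "spec_rad x * w (inverse x) \<le> 1" using s by (metis mult_left_mono less_imp_le)
    moreover have "w x * w (inverse x) = 1" using mult[of x "inverse x"] assms alg_norm_one[OF w(1)] by simp
    moreover have "w (inverse x) > 0" using alg_norm_pos[OF w(1)] assms by simp
    ultimately show ?thesis by (metis mult_le_cancel_right_pos)
  qed
  ultimately show ?thesis by blast
qed

end

section \<open>Determinants, norm and trace\<close>

text \<open>Each term of the Leibniz expansion is bounded by the product of the row bounds. The
  factor \<open>fact n\<close> is harmless, since the bound serves only to show boundedness or
  vanishing, or up to a constant.\<close>

lemma (in rat_abs) det_bound:
  assumes "A \<in> carrier_mat n n"
    and "\<And>i j. i < n \<Longrightarrow> j < n \<Longrightarrow> v (A $$ (i, j)) \<le> k i"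
  shows "v (Determinant.det A) \<le> fact n * (\<Prod>i<n. k i)"
proof -
  have "v (Determinant.det A) \<le> (\<Sum>p | p permutes {0..<n}. v (signof p * (\<Prod>i = 0..<n. A $$ (i, p i))))"
    using assms(1) unfolding Determinant.det_def by (simp add: av_sum[OF av])
  also have "\<dots> \<le> (\<Sum>p | p permutes {0..<n}. \<Prod>i<n. k i)"
  proof (rule sum_mono)
    fix p assume "p \<in> {p. p permutes {0..<n}}"
    hence p: "p permutes {0..<n}" by simp
    have "v (signof p) = 1" using av_one[OF av] av_uminus[OF av, of 1] by (auto simp: sign_def)
    moreover have "v (\<Prod>i\<in>I. A $$ (i, p i)) = (\<Prod>i\<in>I. v (A $$ (i, p i)))" for I
      by (induction I rule: infinite_finite_induct) (simp_all add: av_one[OF av] av_mult[OF av])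
    moreover have "(\<Prod>i = 0..<n. v (A $$ (i, p i))) \<le> (\<Prod>i = 0..<n. k i)"
      using permutes_in_image[OF p] by (intro prod_mono) (auto intro!: assms(2) av_nonneg[OF av])
    ultimately show "v (signof p * (\<Prod>i = 0..<n. A $$ (i, p i))) \<le> (\<Prod>i<n. k i)"
      by (simp add: av_mult[OF av] lessThan_atLeast0)
  qed
  also have "\<dots> = fact n * (\<Prod>i<n. k i)" by (simp add: card_permutations)
  finally show ?thesis .
qed

section \<open>Coordinate matrices, the trace and the norm\<close>

definition coord_mat :: "(nat \<Rightarrow> 'k::number_field) \<Rightarrow> rat mat" where
  "coord_mat e = mat (degree_K TYPE('k)) (degree_K TYPE('k)) (\<lambda>(i, j). coord (e i) j)"

lemma coord_mat_carrier [simp]: "coord_mat (e :: nat \<Rightarrow> 'k::number_field) \<in> carrier_mat (degree_K TYPE('k)) (degree_K TYPE('k))"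
  by (simp add: coord_mat_def)

lemma coord_mat_dim [simp]:
  "dim_row (coord_mat (e :: nat \<Rightarrow> 'k::number_field)) = degree_K TYPE('k)"
  "dim_col (coord_mat (e :: nat \<Rightarrow> 'k::number_field)) = degree_K TYPE('k)"
  by (simp_all add: coord_mat_def)

lemma coord_mat_index [simp]: "i < degree_K TYPE('k) \<Longrightarrow> j < degree_K TYPE('k) \<Longrightarrow>
   coord_mat (e :: nat \<Rightarrow> 'k::number_field) $$ (i, j) = coord (e i) j"
  by (simp add: coord_mat_def)

lemma coord_mat_qbasis: "coord_mat (qbasis :: nat \<Rightarrow> 'k::number_field) = 1\<^sub>m (degree_K TYPE('k))"
  by (rule eq_matI) (auto simp: coord_mat_def coord_qbasis)

lemma coord_mult_qbasis: "coord (y * x) j = (\<Sum>k<degree_K TYPE('k). coord x k * coord (y * (qbasis k :: 'k::number_field)) j)"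
proof -
  have "y * x = (\<Sum>k<degree_K TYPE('k). of_rat (coord x k) * (y * qbasis k))"
    by (subst (1) coord_expand[of x]) (simp add: sum_distrib_left mult_ac)
  thus ?thesis by (simp add: coord_sum coord_scale)
qed

text \<open>The cofactors along row \<open>i\<close> do not involve that row, so the determinant
  depends linearly on the element put there.\<close>

lemma det_coord_mat_update:
  fixes e :: "nat \<Rightarrow> 'k::number_field"
  defines "n \<equiv> degree_K TYPE('k)"
  assumes i: "i < n"
  shows "Determinant.det (coord_mat (e(i := u))) = (\<Sum>j<n. coord u j * cofactor (coord_mat e) i j)"
proof -
  have "Determinant.det (coord_mat (e(i := u))) = (\<Sum>j<n. coord_mat (e(i := u)) $$ (i, j) * cofactor (coord_mat (e(i := u))) i j)"
    by (rule laplace_expansion_row) (use i n_def in auto)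
  also have "\<dots> = (\<Sum>j<n. coord u j * cofactor (coord_mat e) i j)"
  proof (rule sum.cong[OF refl])
    fix j assume j: "j \<in> {..<n}"
    have "mat_delete (coord_mat (e(i := u))) i j = mat_delete (coord_mat e) i j"
      by (rule eq_matI) (auto simp: mat_delete_def coord_mat_def)
    thus "coord_mat (e(i := u)) $$ (i, j) * cofactor (coord_mat (e(i := u))) i j = coord u j * cofactor (coord_mat e) i j"
      using i j by (simp add: cofactor_def n_def)
  qed
  finally show ?thesis .
qed

text \<open>The trace as the derivation induced on the determinant form; independent of the basis \<open>e\<close>.\<close>
lemma trace_det:
  fixes e :: "nat \<Rightarrow> 'k::number_field"
  defines "n \<equiv> degree_K TYPE('k)"
  shows "(\<Sum>i<n. Determinant.det (coord_mat (e(i := y * e i)))) = field_trace y * Determinant.det (coord_mat e)"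
proof -
  let ?P = "coord_mat e" and ?c = "cofactor (coord_mat e)"
  have P: "?P \<in> carrier_mat n n" unfolding n_def by simp
  have "Determinant.det (coord_mat (e(i := y * e i))) = (\<Sum>j<n. coord (y * e i) j * ?c i j)" if "i < n" for i
    using det_coord_mat_update[of i e "y * e i"] that by (simp add: n_def)
  hence "(\<Sum>i<n. Determinant.det (coord_mat (e(i := y * e i))))
     = (\<Sum>i<n. \<Sum>j<n. (\<Sum>k<n. coord (e i) k * coord (y * qbasis k) j) * ?c i j)"
    by (simp add: coord_mult_qbasis[of y "e _"] n_def)
  also have "\<dots> = (\<Sum>k<n. \<Sum>j<n. coord (y * qbasis k) j * (\<Sum>i<n. ?c i j * coord (e i) k))"
  proof -
    have "(\<Sum>i<n. \<Sum>j<n. (\<Sum>k<n. coord (e i) k * coord (y * qbasis k) j) * ?c i j)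
      = (\<Sum>i<n. \<Sum>j<n. \<Sum>k<n. coord (y * qbasis k) j * (?c i j * coord (e i) k))"
      by (simp only: sum_distrib_right) (simp only: mult_ac)
    also have "\<dots> = (\<Sum>i<n. \<Sum>k<n. \<Sum>j<n. coord (y * qbasis k) j * (?c i j * coord (e i) k))"
      by (intro sum.cong refl sum.swap)
    also have "\<dots> = (\<Sum>k<n. \<Sum>i<n. \<Sum>j<n. coord (y * qbasis k) j * (?c i j * coord (e i) k))"
      by (rule sum.swap)
    also have "\<dots> = (\<Sum>k<n. \<Sum>j<n. \<Sum>i<n. coord (y * qbasis k) j * (?c i j * coord (e i) k))"
      by (intro sum.cong refl sum.swap)
    finally show ?thesis by (simp add: sum_distrib_left)
  qed
  also have "\<dots> = (\<Sum>k<n. \<Sum>j<n. if j = k then coord (y * qbasis k) j * Determinant.det ?P else 0)"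
  proof (intro sum.cong refl)
    fix k j assume kj: "k \<in> {..<n}" "j \<in> {..<n}"
    \<comment> \<open>The inner sum is an entry of the adjugate times the matrix, hence of a scalar
      matrix; only the diagonal coordinates survive, and their sum is the trace.\<close>
    have "(adj_mat ?P * ?P) $$ (j, k) = (\<Sum>i<n. ?c i j * coord (e i) k)"
      using kj P adj_mat(1)[OF P]
      by (auto simp: scalar_prod_def adj_mat_def n_def lessThan_atLeast0 intro!: sum.cong)
    moreover have "(adj_mat ?P * ?P) $$ (j, k) = (if j = k then Determinant.det ?P else 0)"
      using kj unfolding adj_mat(3)[OF P] by simp
    ultimately have "(\<Sum>i<n. ?c i j * coord (e i) k) = (if j = k then Determinant.det ?P else 0)" by metis
    thus "coord (y * qbasis k) j * (\<Sum>i<n. ?c i j * coord (e i) k) = (if j = k then coord (y * qbasis k) j * Determinant.det ?P else 0)"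
      by simp
  qed
  also have "\<dots> = field_trace y * Determinant.det ?P"
    by (simp add: trace_coord n_def sum_distrib_right)
  finally show ?thesis .
qed

definition field_norm :: "'k::number_field \<Rightarrow> rat" where
  "field_norm a = Determinant.det (coord_mat (\<lambda>i. a * (qbasis i :: 'k)))"

lemma coord_mat_mult:
  fixes e f :: "nat \<Rightarrow> 'k::number_field"
  assumes "\<And>i. i < degree_K TYPE('k) \<Longrightarrow> e i = (\<Sum>k<degree_K TYPE('k). of_rat (Q i k) * f k)"
  shows "coord_mat e = mat (degree_K TYPE('k)) (degree_K TYPE('k)) (\<lambda>(i, j). Q i j) * coord_mat f"
  by (rule eq_matI)
    (auto simp: coord_mat_def assms coord_sum coord_scale scalar_prod_def lessThan_atLeast0 intro!: sum.cong)

lemma field_norm_mult: "field_norm (a * b) = field_norm a * field_norm (b :: 'k::number_field)"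
proof -
  have "coord_mat (\<lambda>i. a * b * qbasis i) = coord_mat (\<lambda>i. b * qbasis i) * coord_mat (\<lambda>i. a * (qbasis i :: 'k))"
    unfolding coord_mat_def[of "\<lambda>i. b * qbasis i"]
  proof (rule coord_mat_mult)
    fix i
    show "a * b * qbasis i = (\<Sum>k<degree_K TYPE('k). of_rat (coord (b * qbasis i) k) * (a * (qbasis k :: 'k)))"
    proof -
      have "a * b * qbasis i = a * (\<Sum>k<degree_K TYPE('k). of_rat (coord (b * qbasis i) k) * qbasis k)"
        using coord_expand[of "b * qbasis i"] by (metis mult.assoc)
      thus ?thesis by (simp only: sum_distrib_left mult.left_commute)
    qed
  qed
  thus ?thesis by (simp add: field_norm_def det_mult[where n="degree_K TYPE('k)"])
qed

lemma field_norm_one: "field_norm (1 :: 'k::number_field) = 1"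
  by (simp add: field_norm_def coord_mat_qbasis)

lemma field_norm_nonzero: "a \<noteq> 0 \<Longrightarrow> field_norm (a :: 'k::number_field) \<noteq> 0"
  using field_norm_mult[of a "inverse a"] field_norm_one[where 'k='k] by auto

lemma field_norm_power: "field_norm (a ^ n) = field_norm a ^ n"
  by (induction n) (simp_all add: field_norm_one field_norm_mult)

context rat_abs
begin

text \<open>The elements \<open>e i\<close> nearly maximise the ratio of their determinant to the product of their norms,
  for a norm \<open>\<mu>\<close> with \<open>\<mu> (y * x) \<le> a * \<mu> x\<close>; so multiplying a single one of them by \<open>y\<close> multiplies
  the determinant by little more than \<open>a\<close>.\<close>
lemma trace_decomposition:
  assumes ya: "spec_rad y < a" and eps: "\<epsilon> > 0"
  shows "\<exists>c. field_trace (y :: 'k::number_field) = (\<Sum>i<degree_K TYPE('k). c i) \<and>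
    (\<forall>i<degree_K TYPE('k). v (c i) \<le> (1 + \<epsilon>) * a)"
proof -
  let ?n = "degree_K TYPE('k)" and ?D = "\<lambda>e :: nat \<Rightarrow> 'k. Determinant.det (coord_mat e)"
  have a0: "a > 0" using ya spec_rad_nonneg[of y] by linarith
  obtain A where A: "A \<ge> 0" "\<And>n. coord_norm (y ^ n) \<le> A * a ^ n" using spec_rad_less[OF ya] by blast
  obtain C where C: "C > 0" "\<And>x y :: 'k. coord_norm (x * y) \<le> C * coord_norm x * coord_norm y" using coord_norm_mult by blast
  \<comment> \<open>A norm, equivalent to \<open>coord_norm\<close>, for which multiplication by
    \<open>y\<close> has norm at most \<open>a\<close>. The supremum is finite because
    \<open>a\<close> exceeds the spectral radius.\<close>
  define \<mu> where "\<mu> x = (SUP n. coord_norm (y ^ n * x) / a ^ n)" for x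
  have bnd: "coord_norm (y ^ n * x) / a ^ n \<le> C * A * coord_norm x" for n x
  proof -
    have "coord_norm (y ^ n * x) \<le> C * coord_norm (y ^ n) * coord_norm x" by (rule C)
    also have "\<dots> \<le> C * (A * a ^ n) * coord_norm x" using C A by (intro mult_right_mono mult_left_mono) (auto simp: coord_norm_nonneg)
    finally show ?thesis using a0 by (simp add: field_simps)
  qed
  have bdd: "bdd_above (range (\<lambda>n. coord_norm (y ^ n * x) / a ^ n))" for x
    by (rule bdd_aboveI[of _ "C * A * coord_norm x"]) (use bnd in auto)
  have \<mu>coord_norm: "coord_norm x \<le> \<mu> x" for x
    unfolding \<mu>_def using cSUP_upper[OF _ bdd, of 0 x] by simp
  have \<mu>pos: "\<mu> x > 0" if "x \<noteq> 0" for x using \<mu>coord_norm[of x] coord_norm_pos[OF that] by linarith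
  have \<mu>y: "\<mu> (y * x) \<le> a * \<mu> x" for x
    unfolding \<mu>_def[of "y * x"]
  proof (rule cSUP_least)
    fix n
    have "coord_norm (y ^ Suc n * x) / a ^ Suc n \<le> \<mu> x" unfolding \<mu>_def by (rule cSUP_upper[OF _ bdd]) simp
    thus "coord_norm (y ^ n * (y * x)) / a ^ n \<le> a * \<mu> x" using a0 by (simp add: field_simps)
  qed simp
  define R where "R e = v (?D e) / (\<Prod>i<?n. \<mu> (e i))" for e
  let ?E = "{e :: nat \<Rightarrow> 'k. \<forall>i<?n. e i \<noteq> 0}"
  have Rb: "R e \<le> fact ?n" if "e \<in> ?E" for e
  proof -
    have pos: "(\<Prod>i<?n. \<mu> (e i)) > 0" using that by (intro prod_pos) (auto intro: \<mu>pos)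
    have "v (?D e) \<le> fact ?n * (\<Prod>i<?n. \<mu> (e i))"
      by (rule det_bound[OF coord_mat_carrier]) (auto intro: order_trans[OF coord_norm_ge_coord \<mu>coord_norm])
    thus ?thesis unfolding R_def using pos by (simp add: field_simps)
  qed
  have bR: "bdd_above (R ` ?E)" by (rule bdd_aboveI[of _ "fact ?n"]) (use Rb in auto)
  have "(qbasis i :: 'k) \<noteq> 0" if "i < ?n" for i using coord_qbasis[OF that that] by auto
  hence kbE: "qbasis \<in> ?E" by simp
  \<comment> \<open>The supremum need not be attained; an \<open>e\<close> within the factor
    \<open>1 + \<epsilon>\<close> of it is enough and explains this factor in the bound.\<close>
  define S where "S = (SUP e\<in>?E. R e)"
  have "R qbasis > 0" unfolding R_def coord_mat_qbasis using kbE
    by (auto intro!: divide_pos_pos prod_pos \<mu>pos simp: av_one[OF av])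
  moreover have "R qbasis \<le> S" unfolding S_def by (rule cSUP_upper[OF kbE bR])
  ultimately have S0: "S > 0" by linarith
  hence lt: "S / (1 + \<epsilon>) < S" using eps by (simp add: field_simps)
  have ne: "?E \<noteq> {}" using kbE by blast
  have "\<exists>e\<in>?E. S / (1 + \<epsilon>) < R e"
    by (rule iffD1[OF less_cSUP_iff[OF ne bR, of "S / (1 + \<epsilon>)", folded S_def] lt])
  then obtain e where e: "e \<in> ?E" "S / (1 + \<epsilon>) < R e" ..
  have "0 < S / (1 + \<epsilon>)" using S0 eps by simp
  hence Re: "R e > 0" using e(2) by linarith
  have De: "?D e \<noteq> 0" using Re unfolding R_def by (auto simp: av_zero[OF av])
  define c where "c i = ?D (e(i := y * e i)) / ?D e" for i
  have "field_trace y = (\<Sum>i<?n. c i)"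
    unfolding c_def using trace_det[of e y] De by (simp add: sum_divide_distrib[symmetric])
  moreover have "v (c i) \<le> (1 + \<epsilon>) * a" if i: "i < ?n" for i
  \<comment> \<open>Putting 0 in place of \<open>e i\<close> leaves the set \<open>?E\<close> over
    which \<open>S\<close> is the supremum; in this case the determinant vanishes instead.\<close>
  proof (cases "y = 0")
    case True
    have "coord ((e(i := 0)) i) j = 0" for j by simp
    hence "v (?D (e(i := 0))) \<le> fact ?n * (\<Prod>j<?n. if j = i then 0 else coord_norm (e j))"
      by (intro det_bound[OF coord_mat_carrier]) (auto simp: av_zero[OF av] coord_norm_ge_coord)
    also have "\<dots> = 0" using i by (auto intro!: prod_zero)
    finally have "?D (e(i := 0)) = 0" using av_nonneg[OF av] av_zero_iff[OF av] by (metis order_antisym)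
    thus ?thesis unfolding c_def True using a0 eps by (simp add: av_zero[OF av])
  next
    case False
    define e' where "e' = e(i := y * e i)"
    have e': "e' \<in> ?E" using e(1) False by (simp add: e'_def)
    have "R e' \<le> S" unfolding S_def by (rule cSUP_upper[OF e' bR])
    also have "S \<le> (1 + \<epsilon>) * R e" using e(2) eps by (simp add: field_simps)
    finally have 1: "R e' \<le> (1 + \<epsilon>) * R e" .
    let ?Q = "\<Prod>j\<in>{..<?n} - {i}. \<mu> (e j)"
    have Qpos: "?Q > 0" using e(1) by (intro prod_pos) (auto intro: \<mu>pos)
    have "(\<Prod>j<?n. \<mu> (e j)) = \<mu> (e i) * ?Q" using i by (simp add: prod.remove)
    moreover have "(\<Prod>j<?n. \<mu> (e' j)) = \<mu> (y * e i) * ?Q" using i by (simp add: prod.remove[of _ i] e'_def)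
    moreover have "\<mu> (e i) > 0" "\<mu> (y * e i) > 0" using e(1) i False by (auto intro!: \<mu>pos)
    ultimately have "v (?D e') / \<mu> (y * e i) \<le> (1 + \<epsilon>) * (v (?D e) / \<mu> (e i))"
    proof -
      assume Q: "(\<Prod>j<?n. \<mu> (e j)) = \<mu> (e i) * ?Q" "(\<Prod>j<?n. \<mu> (e' j)) = \<mu> (y * e i) * ?Q"
      have "R e' * ?Q \<le> (1 + \<epsilon>) * R e * ?Q" using 1 Qpos by (intro mult_right_mono) auto
      moreover have "p / (m * q) * q = p / m" if "q > 0" for p m q :: real using that by simp
      from this[OF Qpos] have "R e' * ?Q = v (?D e') / \<mu> (y * e i)" "R e * ?Q = v (?D e) / \<mu> (e i)"
        unfolding R_def Q by blast+
      ultimately show ?thesis by (simp only: mult.assoc)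
    qed
    hence "v (?D e') \<le> (1 + \<epsilon>) * (v (?D e) / \<mu> (e i)) * \<mu> (y * e i)"
      using \<open>\<mu> (y * e i) > 0\<close> by (simp add: field_simps)
    also have "\<dots> \<le> (1 + \<epsilon>) * (v (?D e) / \<mu> (e i)) * (a * \<mu> (e i))"
      using eps \<open>\<mu> (e i) > 0\<close> by (intro mult_left_mono \<mu>y) (auto intro!: mult_nonneg_nonneg divide_nonneg_pos av_nonneg[OF av])
    also have "\<dots> = (1 + \<epsilon>) * a * v (?D e)" using \<open>\<mu> (e i) > 0\<close> by simp
    finally show ?thesis unfolding c_def e'_def[symmetric] av_divide[OF av]
      using av_pos[OF av De] by (simp add: field_simps)
  qed
  ultimately show ?thesis by blast
qed

lemma le_of_all_eps:
  fixes t r K :: real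
  assumes "\<And>e a. e > 0 \<Longrightarrow> r < a \<Longrightarrow> t \<le> K * ((1 + e) * a)" "K \<ge> 0"
  shows "t \<le> K * r"
proof -
  have "((\<lambda>e. K * ((1 + e) * (r + e))) \<longlongrightarrow> K * ((1 + 0) * (r + 0))) (at_right 0)" by (intro tendsto_intros)
  moreover have "\<forall>\<^sub>F e in at_right 0. t \<le> K * ((1 + e) * (r + e))"
    unfolding eventually_at_right_field by (rule exI[of _ 1]) (auto intro!: assms)
  ultimately show ?thesis using tendsto_lowerbound[of _ _ "at_right (0::real)" t] by simp
qed

lemma trace_bound: "v (field_trace y) \<le> real (degree_K TYPE('k)) * spec_rad (y :: 'k::number_field)"
proof (rule le_of_all_eps)
  fix e a :: real assume ea: "e > 0" "spec_rad y < a"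
  obtain c where c: "field_trace y = (\<Sum>i<degree_K TYPE('k). c i)"
    "\<forall>i<degree_K TYPE('k). v (c i) \<le> (1 + e) * a" using trace_decomposition[OF ea(2,1)] by blast
  have "v (field_trace y) \<le> (\<Sum>i<degree_K TYPE('k). v (c i))" unfolding c by (rule av_sum[OF av])
  also have "\<dots> \<le> (\<Sum>i<degree_K TYPE('k). (1 + e) * a)" using c by (intro sum_mono) auto
  finally show "v (field_trace y) \<le> real (degree_K TYPE('k)) * ((1 + e) * a)" by simp
qed simp

text \<open>A maximum over the summands replaces their sum, and the factor \<open>degree_K\<close>
  disappears. Integrality of traces depends on this sharper form.\<close>

lemma trace_bound_ultrametric:
  assumes ultra: "\<And>x y. v (x + y) \<le> max (v x) (v y)"
  shows "v (field_trace y) \<le> spec_rad (y :: 'k::number_field)"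
proof -
  have "v (field_trace y) \<le> 1 * spec_rad y"
  proof (rule le_of_all_eps)
    fix e a :: real assume ea: "e > 0" "spec_rad y < a"
    obtain c where c: "field_trace y = (\<Sum>i<degree_K TYPE('k). c i)"
      "\<forall>i<degree_K TYPE('k). v (c i) \<le> (1 + e) * a" using trace_decomposition[OF ea(2,1)] by blast
    have a0: "a > 0" using ea spec_rad_nonneg[of y] by linarith
    have "v (\<Sum>i\<in>I. c i) \<le> (1 + e) * a" if "I \<subseteq> {..<degree_K TYPE('k)}" for I
      using finite_subset[OF that finite_lessThan] that
    proof (induction I rule: finite_induct)
      case (insert i I)
      thus ?case using ultra[of "c i" "sum c I"] c(2) by (auto simp: max_def split: if_splits)
    qed (use a0 ea in \<open>simp add: av_zero[OF av]\<close>)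
    thus "v (field_trace y) \<le> 1 * ((1 + e) * a)" unfolding c by simp
  qed simp
  thus ?thesis by simp
qed

text \<open>A coordinate is a trace against a dual basis element, and the trace is bounded by the
  spectral radius. So the spectral radius is equivalent to the coordinate norm.\<close>

lemma coord_norm_le_spec_rad: "\<exists>C>0. \<forall>x :: 'k::number_field. coord_norm x \<le> C * spec_rad x"
proof -
  obtain dl :: "nat \<Rightarrow> 'k" where dl: "\<And>i x. i < degree_K TYPE('k) \<Longrightarrow> coord x i = field_trace (x * dl i)"
    using dual_basis by blast
  let ?n = "degree_K TYPE('k)"
  define C where "C = (\<Sum>i<?n. real ?n * spec_rad (dl i)) + 1"
  have "C > 0" unfolding C_def by (intro add_nonneg_pos sum_nonneg mult_nonneg_nonneg spec_rad_nonneg) auto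
  moreover have "coord_norm x \<le> C * spec_rad x" for x :: 'k
  proof -
    have "coord_norm x \<le> (\<Sum>i<?n. real ?n * spec_rad (dl i) * spec_rad x)" unfolding coord_norm_def
    proof (rule sum_mono)
      fix i assume "i \<in> {..<?n}"
      hence "v (coord x i) \<le> real ?n * spec_rad (x * dl i)" using dl[of i x] trace_bound by simp
      also have "\<dots> \<le> real ?n * (spec_rad x * spec_rad (dl i))" by (intro mult_left_mono spec_rad_mult) auto
      finally show "v (coord x i) \<le> real ?n * spec_rad (dl i) * spec_rad x" by (simp add: mult_ac)
    qed
    also have "\<dots> \<le> C * spec_rad x" unfolding C_def by (simp add: sum_distrib_right[symmetric] distrib_right spec_rad_nonneg)
    finally show ?thesis .
  qed
  ultimately show ?thesis by blast
qed

end

section \<open>Weak approximation and local degrees\<close>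

lemma sum_of_rat_delta:
  assumes "finite I" "i \<in> I"
  shows "(\<Sum>k\<in>I. of_rat (if k = i then 1 else 0) * e k) = (e i :: 'k::field_char_0)"
proof -
  have "(\<Sum>k\<in>I. of_rat (if k = i then 1 else 0) * e k) = (\<Sum>k\<in>I. if k = i then e k else 0)"
    by (rule sum.cong) auto
  thus ?thesis using assms by simp
qed

lemma free_family:
  fixes e :: "'i \<Rightarrow> 'k::number_field"
  assumes "finite I" and free: "\<And>q. (\<Sum>i\<in>I. of_rat (q i) * e i) = 0 \<Longrightarrow> \<forall>i\<in>I. q i = 0"
  shows "inj_on e I" "Qv.independent (e ` I)" "card I \<le> degree_K TYPE('k)"
proof -
  show inj: "inj_on e I"
  proof (rule inj_onI, rule ccontr)
    fix i j assume ij: "i \<in> I" "j \<in> I" "e i = e j" "i \<noteq> j"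
    have "(\<Sum>k\<in>I. of_rat ((if k = i then 1 else 0) - (if k = j then 1 else 0)) * e k) = 0"
      using ij sum_of_rat_delta[OF assms(1), of i e] sum_of_rat_delta[OF assms(1), of j e]
      by (simp only: of_rat_diff left_diff_distrib sum_subtractf) simp
    from free[OF this] show False using ij by auto
  qed
  show indep: "Qv.independent (e ` I)"
  proof
    assume "Qv.dependent (e ` I)"
    then obtain u x where u: "x \<in> e ` I" "u x \<noteq> 0" "(\<Sum>x\<in>e ` I. of_rat (u x) * x) = 0"
      using Qv.dependent_finite[of "e ` I"] assms(1) by auto
    hence "(\<Sum>i\<in>I. of_rat (u (e i)) * e i) = 0" by (simp add: sum.reindex[OF inj])
    from free[OF this] u show False by auto
  qed
  have "card (e ` I) \<le> Qv.dim (UNIV :: 'k set)" by (rule Qf.independent_card_le_dim) (use indep in auto)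
  thus "card I \<le> degree_K TYPE('k)" by (simp add: card_image[OF inj] degree_K_def)
qed

lemma av_powi: assumes "absolute_value w" shows "w (x powi k) = w x powi k"
  by (simp add: power_int_def av_power[OF assms] av_inverse[OF assms] power_inverse)

text \<open>The elements \<open>a ^ n / (1 + a ^ n)\<close> become approximate idempotents: they
  tend to 0 where \<open>a\<close> is small and, by the next lemma, to 1 where \<open>a\<close> is
  large.\<close>

lemma av_seq_lt_1:
  assumes w: "absolute_value w" and a: "w a < 1"
  shows "(\<lambda>n. w (a ^ n / (1 + a ^ n))) \<longlonglongrightarrow> 0"
proof (rule tendsto_sandwich[OF _ _ tendsto_const])
  have l: "(\<lambda>n. w a ^ n) \<longlonglongrightarrow> 0" using av_nonneg[OF w, of a] a by (intro LIMSEQ_power_zero) simp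
  show "(\<lambda>n. w a ^ n / (1 - w a ^ n)) \<longlonglongrightarrow> 0" using tendsto_divide[OF l tendsto_diff[OF tendsto_const[of 1] l]] by simp
  show "\<forall>\<^sub>F n in sequentially. w (a ^ n / (1 + a ^ n)) \<le> w a ^ n / (1 - w a ^ n)"
  proof (intro eventually_sequentiallyI[of 1])
    fix n :: nat assume n: "1 \<le> n"
    have "w a ^ n < 1" using n a av_nonneg[OF w, of a] by (simp add: power_less_one_iff)
    moreover have "1 - w a ^ n \<le> w (1 + a ^ n)" using av_add_ge[OF w, of 1 "a ^ n"] by (simp add: av_one[OF w] av_power[OF w])
    ultimately show "w (a ^ n / (1 + a ^ n)) \<le> w a ^ n / (1 - w a ^ n)"
      unfolding av_divide[OF w] av_power[OF w] by (intro divide_left_mono) (auto simp: av_nonneg[OF w])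
  qed
qed (auto intro!: always_eventually av_nonneg[OF w])

lemma av_seq_gt_1:
  assumes w: "absolute_value w" and a: "w a > 1"
  shows "(\<lambda>n. w (a ^ n / (1 + a ^ n) - 1)) \<longlonglongrightarrow> 0"
proof (rule tendsto_sandwich[OF _ _ tendsto_const])
  have l: "(\<lambda>n. inverse (w a ^ n)) \<longlonglongrightarrow> 0" by (rule LIMSEQ_inverse_realpow_zero[OF a])
  show "(\<lambda>n. inverse (w a ^ n) / (1 - inverse (w a ^ n))) \<longlonglongrightarrow> 0"
    using tendsto_divide[OF l tendsto_diff[OF tendsto_const[of 1] l]] by simp
  show "\<forall>\<^sub>F n in sequentially. w (a ^ n / (1 + a ^ n) - 1) \<le> inverse (w a ^ n) / (1 - inverse (w a ^ n))"
  proof (intro eventually_sequentiallyI[of 1])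
    fix n :: nat assume n: "1 \<le> n"
    have p: "w a ^ n > 1" using n a by (simp add: one_less_power)
    have g: "-1 + w a ^ n \<le> w (1 + a ^ n)" using av_add_ge[OF w, of "a ^ n" 1] by (simp add: av_one[OF w] av_power[OF w] add.commute)
    hence "w (1 + a ^ n) > 0" using p by linarith
    hence nz: "1 + a ^ n \<noteq> 0" using av_zero[OF w] by auto
    hence "a ^ n / (1 + a ^ n) - 1 = - inverse (1 + a ^ n)" by (simp add: field_simps)
    hence "w (a ^ n / (1 + a ^ n) - 1) = inverse (w (1 + a ^ n))" by (simp add: av_uminus[OF w] av_inverse[OF w])
    hence "w (a ^ n / (1 + a ^ n) - 1) \<le> inverse (-1 + w a ^ n)" using g p by (simp add: le_imp_inverse_le)
    moreover have "inverse (-1 + X) = inverse X / (1 - inverse X)" if "X > 1" for X :: real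
      using that by (simp add: field_simps)
    from this[OF p] have "inverse (-1 + w a ^ n) = inverse (w a ^ n) / (1 - inverse (w a ^ n))" .
    ultimately show "w (a ^ n / (1 + a ^ n) - 1) \<le> inverse (w a ^ n) / (1 - inverse (w a ^ n))" by simp
  qed
qed (auto intro!: always_eventually av_nonneg[OF w])

context rat_abs
begin

section \<open>Independence over the completed rationals\<close>

lemma exts_av: "w \<in> exts \<Longrightarrow> absolute_value w" and exts_rat: "w \<in> exts \<Longrightarrow> w (of_rat q) = v q"
  by (auto simp: exts_def)

lemma exts_scale: "w \<in> exts \<Longrightarrow> w (of_rat q * x) = v q * w x"
  by (simp add: av_mult[OF exts_av] exts_rat)

text \<open>The constant \<open>c\<close>, uniform in the coefficients, makes this independence over
  the completion of the rationals and not only over the rationals.\<close>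

definition w_indep :: "('k::number_field \<Rightarrow> real) \<Rightarrow> 'i set \<Rightarrow> ('i \<Rightarrow> 'k) \<Rightarrow> bool" where
  "w_indep w I e \<longleftrightarrow> (\<exists>c>0. \<forall>q. c * (\<Sum>i\<in>I. v (q i)) \<le> w (\<Sum>i\<in>I. of_rat (q i) * e i))"

lemma sum_v_zero: "finite I \<Longrightarrow> (\<Sum>i\<in>I. v (q i)) \<le> 0 \<Longrightarrow> \<forall>i\<in>I. q i = 0"
  using sum_nonneg_eq_0_iff[of I "\<lambda>i. v (q i)"] sum_nonneg[of I "\<lambda>i. v (q i)"] av_nonneg[OF av] av_zero_iff[OF av] by force

lemma w_indep_free:
  assumes "finite I" "w 0 = 0" "w_indep w I e" "(\<Sum>i\<in>I. of_rat (q i) * e i) = 0"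
  shows "\<forall>i\<in>I. q i = 0"
proof -
  obtain c where "c > 0" "\<And>q. c * (\<Sum>i\<in>I. v (q i)) \<le> w (\<Sum>i\<in>I. of_rat (q i) * e i)"
    using assms(3) unfolding w_indep_def by blast
  hence "c * (\<Sum>i\<in>I. v (q i)) \<le> 0" using assms by metis
  hence "(\<Sum>i\<in>I. v (q i)) \<le> 0" using \<open>c > 0\<close> by (simp add: mult_le_0_iff)
  thus ?thesis using sum_v_zero[OF assms(1)] by blast
qed

lemma w_indep_card:
  assumes "finite I" "w 0 = 0" "w_indep w I (e :: 'i \<Rightarrow> 'k::number_field)"
  shows "card I \<le> degree_K TYPE('k)"
  using free_family(3)[OF assms(1)] w_indep_free[OF assms] by blast

text \<open>The largest number of elements independent over the closure of the rationals in the completion.\<close>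
definition local_dim :: "('k::number_field \<Rightarrow> real) \<Rightarrow> nat" where
  "local_dim w = (GREATEST m. \<exists>e. w_indep w {..<m} e)"

lemma
  assumes "w \<in> exts"
  shows local_dim_w_indep: "\<exists>e. w_indep w {..<local_dim w} e"
    and local_dim_max: "w_indep w {..<m} e \<Longrightarrow> m \<le> local_dim w"
proof -
  have b: "y \<le> degree_K TYPE('a)" if "\<exists>e. w_indep w {..<y} e" for y
    using that w_indep_card[of "{..<_}" w] av_zero[OF exts_av[OF assms]] by fastforce
  have "\<exists>e. w_indep w {..<0::nat} e" unfolding w_indep_def by (intro exI[of _ "\<lambda>_. 0"] exI[of _ 1]) (simp add: av_zero[OF exts_av[OF assms]])
  from GreatestI_nat[of "\<lambda>m. \<exists>e. w_indep w {..<m} e", OF this b] show "\<exists>e. w_indep w {..<local_dim w} e" unfolding local_dim_def .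
  show "w_indep w {..<m} e \<Longrightarrow> m \<le> local_dim w"
    unfolding local_dim_def using Greatest_le_nat[of "\<lambda>m. \<exists>e. w_indep w {..<m} e", OF _ b] by blast
qed

lemma local_dim_pos: assumes "w \<in> exts" shows "Suc 0 \<le> local_dim w"
proof (rule local_dim_max[OF assms])
  show "w_indep w {..<Suc 0} (\<lambda>_. 1)" unfolding w_indep_def
    by (intro exI[of _ 1]) (simp add: exts_rat[OF assms])
qed

text \<open>If adjoining \<open>x\<close> destroys independence, there are combinations that are
  arbitrarily small relative to their coefficients. Independence of \<open>e\<close> prevents the
  coefficient of \<open>x\<close> from being negligible, and division by it approximates
  \<open>x\<close>.\<close>

lemma w_indep_dense:
  assumes w: "w \<in> exts" and ind: "w_indep w {..<m} e" and dep: "\<not> w_indep w {..<Suc m} (e(m := x))" and eps: "\<epsilon> > 0"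
  shows "\<exists>q. w (x - (\<Sum>i<m. of_rat (q i) * e i)) < \<epsilon>"
proof -
  note wav = exts_av[OF w]
  obtain c0 where c0: "c0 > 0" "\<And>q. c0 * (\<Sum>i<m. v (q i)) \<le> w (\<Sum>i<m. of_rat (q i) * e i)"
    using ind unfolding w_indep_def by blast
  \<comment> \<open>\<open>K\<close> bounds the sum of all coefficients relative to that of
    \<open>x\<close>. In \<open>c\<close> below, \<open>c0 / 2\<close> gives this bound and
    \<open>\<epsilon> / K\<close> gives the final error.\<close>
  define K where "K = (c0 + w x) * 2 / c0 + 1"
  have K: "K > 0" unfolding K_def using c0 av_nonneg[OF wav, of x] by (intro add_nonneg_pos divide_nonneg_pos) auto
  define c where "c = min (c0 / 2) (\<epsilon> / K)"
  have c: "c > 0" "c \<le> c0 / 2" "c * K \<le> \<epsilon>" unfolding c_def using c0 K eps by (auto simp: min_def field_simps)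
  then obtain q where q: "w (\<Sum>i<Suc m. of_rat (q i) * (e(m := x)) i) < c * (\<Sum>i<Suc m. v (q i))"
    using dep unfolding w_indep_def by (auto simp: not_le)
  define u S r where "u = (\<Sum>i<m. of_rat (q i) * e i)" and "S = (\<Sum>i<m. v (q i))" and "r = v (q m)"
  have 1: "w (of_rat (q m) * x + u) < c * (S + r)" using q by (simp add: u_def S_def r_def add.commute)
  have S0: "S \<ge> 0" "r \<ge> 0" unfolding S_def r_def by (auto intro!: sum_nonneg av_nonneg[OF av])
  have "c0 * S \<le> w u" unfolding S_def u_def by (rule c0)
  also have "\<dots> \<le> w (of_rat (q m) * x + u) + r * w x"
    using av_diff[OF wav, of "of_rat (q m) * x + u" "of_rat (q m) * x"] by (simp add: exts_scale[OF w] r_def)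
  also have "\<dots> < c * (S + r) + r * w x" using 1 by simp
  also have "\<dots> \<le> c0 / 2 * (S + r) + r * w x" using c S0 by (intro add_right_mono mult_right_mono) auto
  finally have "c0 * S < c0 / 2 * (S + r) + r * w x" .
  moreover have "c0 * S = c0 / 2 * S + c0 / 2 * S" "c0 / 2 * (S + r) = c0 / 2 * S + r * (c0 / 2)"
    "r * (c0 / 2 + w x) = r * (c0 / 2) + r * w x" by (simp_all add: distrib_left)
  ultimately have 2: "c0 / 2 * S < r * (c0 / 2 + w x)" by linarith
  have "0 \<le> c0 / 2 * S" using c0 S0 by simp
  hence r: "r > 0" using 2 S0 by (cases "r = 0") auto
  hence qm: "q m \<noteq> 0" unfolding r_def using av_zero[OF av] by auto
  have "c0 / 2 * S \<le> r * (c0 + w x)"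
  proof -
    have "r * (c0 / 2 + w x) \<le> r * (c0 + w x)" using c0 r by (intro mult_left_mono) auto
    thus ?thesis using 2 by linarith
  qed
  hence "S / r \<le> (c0 + w x) * 2 / c0" using r c0 by (simp add: field_simps)
  hence SK: "(S + r) / r \<le> K" unfolding K_def using r by (simp add: add_divide_distrib)
  have "x - (\<Sum>i<m. of_rat (- q i / q m) * e i) = (of_rat (q m) * x + u) / of_rat (q m)"
    using qm by (simp add: u_def add_divide_distrib sum_divide_distrib of_rat_divide of_rat_minus sum_negf)
  hence "w (x - (\<Sum>i<m. of_rat (- q i / q m) * e i)) = w (of_rat (q m) * x + u) / r"
    by (simp add: av_divide[OF wav] exts_rat[OF w] r_def)
  also have "\<dots> < c * ((S + r) / r)" using 1 r by (simp add: divide_strict_right_mono)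
  also have "\<dots> \<le> c * K" using SK c by (intro mult_left_mono) auto
  also have "\<dots> \<le> \<epsilon>" by (rule c)
  finally show ?thesis by (rule exI[of _ "\<lambda>i. - q i / q m"])
qed

lemma local_dim_basis:
  assumes w: "w \<in> (exts :: ('k::number_field \<Rightarrow> real) set)"
  obtains e c where "c > 0" "\<And>q. c * (\<Sum>i<local_dim w. v (q i)) \<le> w (\<Sum>i<local_dim w. of_rat (q i) * e i)"
    "\<And>x \<epsilon>. \<epsilon> > 0 \<Longrightarrow> \<exists>q. w (x - (\<Sum>i<local_dim w. of_rat (q i) * e i)) < \<epsilon>"
proof -
  obtain e where e: "w_indep w {..<local_dim w} e" using local_dim_w_indep[OF w] by blast
  have "\<not> w_indep w {..<Suc (local_dim w)} f" for f using local_dim_max[OF w, of "Suc (local_dim w)" f] by auto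
  from w_indep_dense[OF w e this] that e show ?thesis unfolding w_indep_def by blast
qed

text \<open>A power of \<open>x\<close> makes the two values differ by more than the factor
  \<open>v q0\<close>. Then a power of \<open>q0\<close> has its value strictly above the smaller
  and strictly below the larger one, and dividing by it moves the two to opposite sides of
  1.\<close>

lemma separate_aux:
  assumes w: "w \<in> exts" "w' \<in> exts" and x: "w' x < w x"
  shows "\<exists>a. 1 < w a \<and> w' a < 1"
proof -
  note wa = exts_av[OF w(1)] and wa' = exts_av[OF w(2)]
  have "x \<noteq> 0" using x av_zero[OF wa] av_zero[OF wa'] by auto
  hence pos: "w' x > 0" by (rule av_pos[OF wa'])
  obtain q0 where q0: "v q0 > 1" using nontriv by blast
  define b where "b = v q0"
  have b: "b > 1" using q0 by (simp add: b_def)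
  have "1 < w x / w' x" using x pos by simp
  then obtain n where n: "b < (w x / w' x) ^ n" using real_arch_pow by blast
  define A B where "A = w' x ^ n" and "B = w x ^ n"
  have A: "A > 0" using pos by (simp add: A_def)
  have AB: "b * A < B" using n pos by (simp add: A_def B_def power_divide field_simps)
  define k where "k = \<lfloor>log b A\<rfloor> + 1"
  define q where "q = q0 powi k"
  have vq: "v q = b powr real_of_int k"
    unfolding q_def av_powi[OF av] b_def[symmetric] using b by (simp add: powr_real_of_int' )
  have "A = b powr (log b A)" using A b by simp
  also have "\<dots> < b powr real_of_int k" unfolding k_def using b by (intro powr_less_mono) linarith+
  finally have 1: "A < v q" using vq by simp
  have "b powr real_of_int k \<le> b powr (log b A + 1)" unfolding k_def using b by (intro powr_mono) (auto simp: of_int_floor_le)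
  also have "\<dots> = b * A" using A b by (simp add: powr_add)
  finally have 2: "v q < B" using vq AB by simp
  have vq0: "v q > 0" using 1 A by linarith
  have "w (x ^ n / of_rat q) = B / v q" "w' (x ^ n / of_rat q) = A / v q"
    by (simp_all add: av_divide[OF wa] av_divide[OF wa'] av_power[OF wa] av_power[OF wa'] exts_rat[OF w(1)] exts_rat[OF w(2)] A_def B_def)
  thus ?thesis using 1 2 vq0 by (intro exI[of _ "x ^ n / of_rat q"]) simp
qed

lemma separate:
  assumes w: "w \<in> exts" "w' \<in> exts" and ne: "w \<noteq> w'"
  shows "\<exists>a. 1 < w a \<and> w' a < 1"
proof -
  obtain x where x: "w x \<noteq> w' x" using ne by blast
  show ?thesis
  proof (cases "w' x < w x")
    case True thus ?thesis by (rule separate_aux[OF w])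
  next
    case False
    hence "w x < w' x" using x by simp
    moreover have "x \<noteq> 0" using x av_zero[OF exts_av[OF w(1)]] av_zero[OF exts_av[OF w(2)]] by auto
    ultimately have "w' (inverse x) < w (inverse x)"
      using av_pos[OF exts_av[OF w(1)], of x] by (simp add: av_inverse[OF exts_av[OF w(1)]] av_inverse[OF exts_av[OF w(2)]])
    thus ?thesis by (rule separate_aux[OF w])
  qed
qed

text \<open>Let \<open>a\<close> separate \<open>w\<close> from \<open>J\<close>, and
  \<open>b\<close> separate it from the new \<open>w2\<close>. If \<open>a\<close> is not small at
  \<open>w2\<close>, then for large \<open>n\<close> the element \<open>a ^ n * b\<close> works when
  \<open>w2 a = 1\<close>, and \<open>b * a ^ n / (1 + a ^ n)\<close> works when
  \<open>w2 a > 1\<close>.\<close>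

lemma separate_finite:
  assumes "finite J" "J \<subseteq> exts" "w \<in> exts" "w \<notin> J"
  shows "\<exists>a. 1 < w a \<and> (\<forall>w'\<in>J. w' a < 1)"
  using assms
proof (induction J rule: finite_induct)
  case empty
  thus ?case using nontriv exts_rat[OF \<open>w \<in> exts\<close>] by (metis empty_iff)
next
  case (insert w2 J)
  obtain a where a: "1 < w a" "\<forall>w'\<in>J. w' a < 1" using insert by auto
  obtain b where b: "1 < w b" "w2 b < 1" using separate[of w w2] insert by auto
  note wa = exts_av[OF \<open>w \<in> exts\<close>]
  have w2: "w2 \<in> exts" and w2a: "absolute_value w2" using insert exts_av by auto
  consider "w2 a < 1" | "w2 a = 1" | "w2 a > 1" by linarith
  thus ?case
  proof cases
    case 1 thus ?thesis using a by auto
  next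
    case 2
    have "\<forall>\<^sub>F n in sequentially. \<forall>w'\<in>J. w' (a ^ n * b) < 1"
    proof (rule eventually_ball_finite[OF insert.hyps(1)], rule ballI)
      fix w' assume w': "w' \<in> J"
      hence wa': "absolute_value w'" using insert exts_av by auto
      have "(\<lambda>n. w' a ^ n * w' b) \<longlonglongrightarrow> 0 * w' b"
        using a w' av_nonneg[OF wa', of a] by (intro tendsto_mult tendsto_const LIMSEQ_power_zero) auto
      hence "(\<lambda>n. w' (a ^ n * b)) \<longlonglongrightarrow> 0" by (simp add: av_mult[OF wa'] av_power[OF wa'])
      thus "\<forall>\<^sub>F n in sequentially. w' (a ^ n * b) < 1" by (rule order_tendstoD) simp
    qed
    then obtain n where n: "\<forall>w'\<in>J. w' (a ^ n * b) < 1" by (auto simp: eventually_sequentially)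
    have "1 * 1 < w a ^ n * w b" using a b by (intro mult_le_less_imp_less) (auto simp: one_le_power)
    moreover have "w2 (a ^ n * b) < 1" using 2 b by (simp add: av_mult[OF w2a] av_power[OF w2a])
    ultimately show ?thesis using n by (intro exI[of _ "a ^ n * b"]) (auto simp: av_mult[OF wa] av_power[OF wa])
  next
    case 3
    define t where "t n = a ^ n / (1 + a ^ n)" for n
    have lim1: "(\<lambda>n. u (t n * b)) \<longlonglongrightarrow> u b" if u: "absolute_value u" "u a > 1" for u
    proof (rule LIM_zero_cancel, rule tendsto_rabs_zero_cancel, rule tendsto_sandwich[OF _ _ tendsto_const])
      show "(\<lambda>n. u (t n - 1) * u b) \<longlonglongrightarrow> 0"
        using tendsto_mult[OF av_seq_gt_1[OF u] tendsto_const[of "u b"]] by (simp add: t_def)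
      show "\<forall>\<^sub>F n in sequentially. \<bar>u (t n * b) - u b\<bar> \<le> u (t n - 1) * u b"
      proof (intro always_eventually allI)
        fix n
        have "t n * b - b = (t n - 1) * b" by (simp add: algebra_simps)
        thus "\<bar>u (t n * b) - u b\<bar> \<le> u (t n - 1) * u b"
          using av_diff_ge[OF u(1), of "t n * b" b] av_diff_ge[OF u(1), of b "t n * b"] av_diff_commute[OF u(1), of b "t n * b"]
          by (simp add: av_mult[OF u(1), of "t n - 1" b])
      qed
    qed auto
    have "\<forall>\<^sub>F n in sequentially. w (t n * b) > 1" by (rule order_tendstoD(1)[OF lim1[OF wa a(1)] b(1)])
    moreover have "\<forall>\<^sub>F n in sequentially. w2 (t n * b) < 1" by (rule order_tendstoD(2)[OF lim1[OF w2a 3] b(2)])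
    moreover have "\<forall>\<^sub>F n in sequentially. \<forall>w'\<in>J. w' (t n * b) < 1"
    proof (rule eventually_ball_finite[OF insert.hyps(1)], rule ballI)
      fix w' assume w': "w' \<in> J"
      hence wa': "absolute_value w'" using insert exts_av by auto
      have "(\<lambda>n. w' (t n) * w' b) \<longlonglongrightarrow> 0 * w' b"
        using av_seq_lt_1[OF wa'] a w' unfolding t_def by (intro tendsto_mult tendsto_const) auto
      hence "(\<lambda>n. w' (t n * b)) \<longlonglongrightarrow> 0" by (simp add: av_mult[OF wa'])
      thus "\<forall>\<^sub>F n in sequentially. w' (t n * b) < 1" by (rule order_tendstoD) simp
    qed
    ultimately have "\<forall>\<^sub>F n in sequentially. w (t n * b) > 1 \<and> w2 (t n * b) < 1 \<and> (\<forall>w'\<in>J. w' (t n * b) < 1)"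
      by eventually_elim auto
    then obtain n where "w (t n * b) > 1 \<and> w2 (t n * b) < 1 \<and> (\<forall>w'\<in>J. w' (t n * b) < 1)"
      by (auto simp: eventually_sequentially)
    thus ?thesis by auto
  qed
qed

lemma approx_idempotent:
  assumes J: "finite J" "J \<subseteq> exts" and w: "w \<in> exts" "w \<notin> J" and eps: "\<epsilon> > 0"
  shows "\<exists>z. w (z - 1) < \<epsilon> \<and> (\<forall>w'\<in>J. w' z < \<epsilon>)"
proof -
  obtain a where a: "1 < w a" "\<forall>w'\<in>J. w' a < 1" using separate_finite[OF J w] by blast
  define t where "t n = a ^ n / (1 + a ^ n)" for n
  have "\<forall>\<^sub>F n in sequentially. w (t n - 1) < \<epsilon>"
    unfolding t_def by (rule order_tendstoD(2)[OF av_seq_gt_1[OF exts_av[OF w(1)] a(1)] eps])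
  moreover have "\<forall>\<^sub>F n in sequentially. \<forall>w'\<in>J. w' (t n) < \<epsilon>"
    unfolding t_def using J a eps
    by (intro eventually_ball_finite ballI order_tendstoD(2)[OF av_seq_lt_1] exts_av) auto
  ultimately have "\<forall>\<^sub>F n in sequentially. w (t n - 1) < \<epsilon> \<and> (\<forall>w'\<in>J. w' (t n) < \<epsilon>)"
    by eventually_elim auto
  thus ?thesis by (auto simp: eventually_sequentially)
qed

text \<open>Bases of the completions at the places in \<open>J\<close> are approximated simultaneously by elements of
  the field; \<open>\<delta>\<close> bounds the error.\<close>
definition approx_basis ::
  "('k::number_field \<Rightarrow> real) set \<Rightarrow> (('k \<Rightarrow> real) \<Rightarrow> nat \<Rightarrow> 'k) \<Rightarrow> real \<Rightarrow> (('k \<Rightarrow> real) \<times> nat \<Rightarrow> 'k) \<Rightarrow> bool" where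
  "approx_basis J e \<delta> E \<longleftrightarrow> (\<forall>w\<in>J. \<forall>i<local_dim w. \<forall>w'\<in>J. w' (E (w, i) - (if w' = w then e w i else 0)) \<le> \<delta>)"

text \<open>Local bases are multiplied by approximate idempotents. The order of quantifiers matters:
  \<open>c\<close>, \<open>B\<close> and \<open>e\<close> are fixed before \<open>\<delta>\<close>,
  so \<open>field_norm_le_const\<close> may choose \<open>\<delta>\<close> in terms of an element
  without spoiling its constant.\<close>

lemma exists_approx_basis:
  fixes J :: "('k::number_field \<Rightarrow> real) set"
  assumes J: "finite J" "J \<subseteq> exts"
  obtains c B e where "c > 0" "B \<ge> 0"
    "\<And>w q. w \<in> J \<Longrightarrow> c * (\<Sum>i<local_dim w. v (q i)) \<le> w (\<Sum>i<local_dim w. of_rat (q i) * e w i)"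
    "\<And>w x \<epsilon>. w \<in> J \<Longrightarrow> \<epsilon> > 0 \<Longrightarrow> \<exists>q. w (x - (\<Sum>i<local_dim w. of_rat (q i) * e w i)) < \<epsilon>"
    "\<And>w w' i. w \<in> J \<Longrightarrow> w' \<in> J \<Longrightarrow> i < local_dim w \<Longrightarrow> w' (e w i) \<le> B"
    "\<And>\<delta>. \<delta> > 0 \<Longrightarrow> \<exists>E. approx_basis J e \<delta> E"
proof -
  have "\<forall>w\<in>J. \<exists>ec. snd ec > 0 \<and> (\<forall>q. snd ec * (\<Sum>i<local_dim w. v (q i)) \<le> w (\<Sum>i<local_dim w. of_rat (q i) * fst ec i)) \<and>
    (\<forall>x \<epsilon>. \<epsilon> > 0 \<longrightarrow> (\<exists>q. w (x - (\<Sum>i<local_dim w. of_rat (q i) * fst ec i)) < \<epsilon>))"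
  proof
    fix w assume "w \<in> J"
    hence "w \<in> exts" using J by auto
    obtain f c where fc: "c > 0"
      "\<And>q. c * (\<Sum>i<local_dim w. v (q i)) \<le> w (\<Sum>i<local_dim w. of_rat (q i) * f i)"
      "\<And>x \<epsilon>. \<epsilon> > 0 \<Longrightarrow> \<exists>q. w (x - (\<Sum>i<local_dim w. of_rat (q i) * f i)) < \<epsilon>"
      by (rule local_dim_basis[OF \<open>w \<in> exts\<close>]) blast
    show "\<exists>ec. snd ec > 0 \<and> (\<forall>q. snd ec * (\<Sum>i<local_dim w. v (q i)) \<le> w (\<Sum>i<local_dim w. of_rat (q i) * fst ec i)) \<and>
    (\<forall>x \<epsilon>. \<epsilon> > 0 \<longrightarrow> (\<exists>q. w (x - (\<Sum>i<local_dim w. of_rat (q i) * fst ec i)) < \<epsilon>))"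
      by (rule exI[of _ "(f, c)"], unfold fst_conv snd_conv, intro conjI allI impI fc)
  qed
  from bchoice[OF this] obtain ec where ec: "\<forall>w\<in>J. snd (ec w) > 0 \<and> (\<forall>q. snd (ec w) * (\<Sum>i<local_dim w. v (q i)) \<le> w (\<Sum>i<local_dim w. of_rat (q i) * fst (ec w) i)) \<and>
    (\<forall>x \<epsilon>. \<epsilon> > 0 \<longrightarrow> (\<exists>q. w (x - (\<Sum>i<local_dim w. of_rat (q i) * fst (ec w) i)) < \<epsilon>))" ..
  define e where "e w = fst (ec w)" for w
  define c where "c = Min (insert 1 ((\<lambda>w. snd (ec w)) ` J))"
  have c0: "c > 0" unfolding c_def using J ec by (subst Min_gr_iff) auto
  have cle: "c \<le> snd (ec w)" if "w \<in> J" for w unfolding c_def using J that by (intro Min_le) auto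
  have ind: "c * (\<Sum>i<local_dim w. v (q i)) \<le> w (\<Sum>i<local_dim w. of_rat (q i) * e w i)" if "w \<in> J" for w q
  proof -
    have "c * (\<Sum>i<local_dim w. v (q i)) \<le> snd (ec w) * (\<Sum>i<local_dim w. v (q i))"
      by (intro mult_right_mono cle that sum_nonneg av_nonneg[OF av])
    also have "\<dots> \<le> w (\<Sum>i<local_dim w. of_rat (q i) * e w i)" using ec that by (simp add: e_def)
    finally show ?thesis .
  qed
  have nn: "0 \<le> w x" if "w \<in> J" for w x using that J exts_av av_nonneg by blast
  define B where "B = (\<Sum>w\<in>J. \<Sum>w'\<in>J. \<Sum>i<local_dim w. w' (e w i))"
  have B0: "B \<ge> 0" unfolding B_def by (intro sum_nonneg nn)
  have Ble: "w' (e w i) \<le> B" if "w \<in> J" "w' \<in> J" "i < local_dim w" for w w' i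
  proof -
    have "w' (e w i) \<le> (\<Sum>i<local_dim w. w' (e w i))" using that by (intro member_le_sum nn) auto
    also have "\<dots> \<le> (\<Sum>w'\<in>J. \<Sum>i<local_dim w. w' (e w i))" using that J by (intro member_le_sum[of w'] sum_nonneg nn) auto
    also have "\<dots> \<le> B" unfolding B_def using that J by (intro member_le_sum[of w] sum_nonneg nn) auto
    finally show ?thesis .
  qed
  have "\<exists>E. approx_basis J e \<delta> E" if \<delta>: "\<delta> > 0" for \<delta>
  proof -
    define \<epsilon> where "\<epsilon> = \<delta> / (B + 1)"
    have \<epsilon>: "\<epsilon> > 0" "\<epsilon> * B \<le> \<delta>" using \<delta> B0 by (auto simp: \<epsilon>_def field_simps)
    have "\<forall>w\<in>J. \<exists>z. w (z - 1) < \<epsilon> \<and> (\<forall>w'\<in>J - {w}. w' z < \<epsilon>)"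
      using J \<epsilon> by (intro ballI approx_idempotent) auto
    from bchoice[OF this] obtain z where z: "\<forall>w\<in>J. w (z w - 1) < \<epsilon> \<and> (\<forall>w'\<in>J - {w}. w' (z w) < \<epsilon>)" ..
    have "approx_basis J e \<delta> (\<lambda>(w, i). z w * e w i)"
      unfolding approx_basis_def
    proof (intro ballI allI impI)
      fix w i w' assume h: "w \<in> J" "i < local_dim w" "w' \<in> J"
      hence wa: "absolute_value w'" using J exts_av by auto
      have "w' (z w - (if w' = w then 1 else 0)) \<le> \<epsilon>" using z h by (auto intro: less_imp_le)
      hence "w' (z w - (if w' = w then 1 else 0)) * w' (e w i) \<le> \<epsilon> * B"
        using \<epsilon> h by (intro mult_mono Ble) (auto intro: nn)
      moreover have "(case (w, i) of (w, i) \<Rightarrow> z w * e w i) - (if w' = w then e w i else 0) = (z w - (if w' = w then 1 else 0)) * e w i"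
        by (simp add: algebra_simps)
      ultimately show "w' ((case (w, i) of (w, i) \<Rightarrow> z w * e w i) - (if w' = w then e w i else 0)) \<le> \<delta>"
        using \<epsilon> by (simp add: av_mult[OF wa])
    qed
    thus ?thesis by blast
  qed
  show ?thesis
  proof (rule that[OF c0 B0, of e])
    show "\<exists>q. w (x - (\<Sum>i<local_dim w. of_rat (q i) * e w i)) < \<epsilon>" if "w \<in> J" "\<epsilon> > 0" for w x \<epsilon>
      using ec that unfolding e_def by simp
  qed (fact ind Ble \<open>\<And>\<delta>. \<delta> > 0 \<Longrightarrow> \<exists>E. approx_basis J e \<delta> E\<close>)+
qed

lemma approx_basis_sum:
  fixes J :: "('k::number_field \<Rightarrow> real) set"
  assumes J: "finite J" "J \<subseteq> exts" and E: "approx_basis J e \<delta> E" and w: "w \<in> J"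
  defines "I \<equiv> Sigma J (\<lambda>w. {..<local_dim w})"
  shows "w ((\<Sum>p\<in>I. of_rat (q p) * E p) - (\<Sum>i<local_dim w. of_rat (q (w, i)) * e w i)) \<le> \<delta> * (\<Sum>p\<in>I. v (q p))"
proof -
  have we: "w \<in> exts" using w J by auto
  let ?f = "\<lambda>p. if w = fst p then e w (snd p) else 0"
  have "(\<Sum>p\<in>I. of_rat (q p) * ?f p) = (\<Sum>w'\<in>J. \<Sum>i<local_dim w'. of_rat (q (w', i)) * ?f (w', i))"
    unfolding I_def using J by (subst sum.Sigma) (auto simp: case_prod_beta cong: if_cong)
  also have "\<dots> = (\<Sum>w'\<in>J. if w = w' then (\<Sum>i<local_dim w. of_rat (q (w, i)) * e w i) else 0)"
    by (intro sum.cong refl) auto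
  also have "\<dots> = (\<Sum>i<local_dim w. of_rat (q (w, i)) * e w i)" using J w by simp
  finally have "(\<Sum>p\<in>I. of_rat (q p) * E p) - (\<Sum>i<local_dim w. of_rat (q (w, i)) * e w i)
     = (\<Sum>p\<in>I. of_rat (q p) * (E p - ?f p))"
    by (simp only: right_diff_distrib sum_subtractf)
  hence "w ((\<Sum>p\<in>I. of_rat (q p) * E p) - (\<Sum>i<local_dim w. of_rat (q (w, i)) * e w i))
     \<le> (\<Sum>p\<in>I. v (q p) * w (E p - ?f p))"
    using av_sum[OF exts_av[OF we], of "\<lambda>p. of_rat (q p) * (E p - ?f p)" I] by (simp only: exts_scale[OF we])
  also have "\<dots> \<le> (\<Sum>p\<in>I. v (q p) * \<delta>)"
  proof (intro sum_mono mult_left_mono av_nonneg[OF av])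
    fix p assume "p \<in> I"
    then obtain a b where p: "p = (a, b)" "a \<in> J" "b < local_dim a" unfolding I_def by auto
    hence "w (E (a, b) - (if w = a then e a b else 0)) \<le> \<delta>" using E w unfolding approx_basis_def by blast
    thus "w (E p - ?f p) \<le> \<delta>" using p by (cases "w = a") auto
  qed
  finally show ?thesis by (simp add: sum_distrib_left mult.commute)
qed

lemma sum_Sigma_local_dim:
  "finite J \<Longrightarrow> (\<Sum>p\<in>Sigma J (\<lambda>w. {..<local_dim w}). f p) = (\<Sum>w\<in>J. \<Sum>i<local_dim w. f (w, i))"
  by (subst sum.Sigma) (auto simp: case_prod_beta)

lemma approx_basis_lower:
  fixes J :: "('k::number_field \<Rightarrow> real) set"
  assumes J: "finite J" "J \<subseteq> exts" and E: "approx_basis J e \<delta> E"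
    and c: "\<And>w q. w \<in> J \<Longrightarrow> c * (\<Sum>i<local_dim w. v (q i)) \<le> w (\<Sum>i<local_dim w. of_rat (q i) * e w i)"
  defines "I \<equiv> Sigma J (\<lambda>w. {..<local_dim w})"
  assumes w: "w \<in> J"
  shows "c * (\<Sum>i<local_dim w. v (q (w, i))) \<le> w (\<Sum>p\<in>I. of_rat (q p) * E p) + \<delta> * (\<Sum>p\<in>I. v (q p))"
proof -
  have wa: "absolute_value w" using w J exts_av by auto
  let ?a = "\<Sum>p\<in>I. of_rat (q p) * E p" and ?b = "\<Sum>i<local_dim w. of_rat (q (w, i)) * e w i"
  have "c * (\<Sum>i<local_dim w. v (q (w, i))) \<le> w ?b" using c[OF w, of "\<lambda>i. q (w, i)"] .
  also have "w ?b \<le> w ?a + w (?a - ?b)" using av_diff[OF wa, of ?a "?a - ?b"] by simp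
  also have "w (?a - ?b) \<le> \<delta> * (\<Sum>p\<in>I. v (q p))"
    unfolding I_def by (rule approx_basis_sum[OF J E w])
  finally show ?thesis by simp
qed

lemma approx_basis_total:
  fixes J :: "('k::number_field \<Rightarrow> real) set"
  assumes J: "finite J" "J \<subseteq> exts" and E: "approx_basis J e \<delta> E"
    and c: "\<And>w q. w \<in> J \<Longrightarrow> c * (\<Sum>i<local_dim w. v (q i)) \<le> w (\<Sum>i<local_dim w. of_rat (q i) * e w i)"
  defines "I \<equiv> Sigma J (\<lambda>w. {..<local_dim w})"
  shows "(c - real (card J) * \<delta>) * (\<Sum>p\<in>I. v (q p)) \<le> (\<Sum>w\<in>J. w (\<Sum>p\<in>I. of_rat (q p) * E p))"
proof -
  have "c * (\<Sum>p\<in>I. v (q p)) = (\<Sum>w\<in>J. c * (\<Sum>i<local_dim w. v (q (w, i))))"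
    unfolding I_def by (simp add: sum_Sigma_local_dim[OF J(1)] sum_distrib_left)
  also have "\<dots> \<le> (\<Sum>w\<in>J. w (\<Sum>p\<in>I. of_rat (q p) * E p) + \<delta> * (\<Sum>p\<in>I. v (q p)))"
    unfolding I_def by (intro sum_mono approx_basis_lower[OF J E c]) auto
  finally show ?thesis by (simp add: sum.distrib algebra_simps)
qed

lemma approx_basis_free:
  fixes J :: "('k::number_field \<Rightarrow> real) set"
  assumes J: "finite J" "J \<subseteq> exts" and E: "approx_basis J e \<delta> E"
    and c: "\<And>w q. w \<in> J \<Longrightarrow> c * (\<Sum>i<local_dim w. v (q i)) \<le> w (\<Sum>i<local_dim w. of_rat (q i) * e w i)"
    and \<delta>: "real (card J) * \<delta> < c"
    and z: "(\<Sum>p\<in>Sigma J (\<lambda>w. {..<local_dim w}). of_rat (q p) * E p) = 0"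
  shows "\<forall>p\<in>Sigma J (\<lambda>w. {..<local_dim w}). q p = 0"
proof -
  have "w 0 = 0" if "w \<in> J" for w using that J exts_av av_zero by blast
  hence "(\<Sum>w\<in>J. w 0) = 0" by (intro sum.neutral) auto
  hence "(c - real (card J) * \<delta>) * (\<Sum>p\<in>Sigma J (\<lambda>w. {..<local_dim w}). v (q p)) \<le> 0"
    using approx_basis_total[OF J E c, of q] z by simp
  hence "(\<Sum>p\<in>Sigma J (\<lambda>w. {..<local_dim w}). v (q p)) \<le> 0" using \<delta> by (simp add: mult_le_0_iff)
  thus ?thesis using J by (intro sum_v_zero) auto
qed

lemma exists_delta: "c > 0 \<Longrightarrow> \<exists>\<delta>>0. real n * \<delta> < (c::real)"
  by (rule exI[of _ "c / (real n + 1)"]) (auto simp: field_simps)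

text \<open>An approximate basis with small error is free over the rationals and has one member for
  each local basis element. With \<open>local_dim_pos\<close> this also bounds the number of
  extensions.\<close>

lemma sum_local_dim_le:
  fixes J :: "('k::number_field \<Rightarrow> real) set"
  assumes J: "finite J" "J \<subseteq> exts"
  shows "(\<Sum>w\<in>J. local_dim w) \<le> degree_K TYPE('k)"
proof -
  obtain c B e where c: "c > 0"
    "\<And>w q. w \<in> J \<Longrightarrow> c * (\<Sum>i<local_dim w. v (q i)) \<le> w (\<Sum>i<local_dim w. of_rat (q i) * e w i)"
    and E: "\<And>\<delta>. \<delta> > 0 \<Longrightarrow> \<exists>E. approx_basis J e \<delta> E"
    by (rule exists_approx_basis[OF J]) blast
  obtain \<delta> where \<delta>: "\<delta> > 0" "real (card J) * \<delta> < c" using exists_delta[OF c(1)] by blast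
  obtain E where E: "approx_basis J e \<delta> E" using E[OF \<delta>(1)] by blast
  have "card (Sigma J (\<lambda>w. {..<local_dim w})) \<le> degree_K TYPE('k)"
    by (rule free_family(3)[OF _ approx_basis_free[OF J E c(2) \<delta>(2)]]) (use J in auto)
  thus ?thesis using J by simp
qed

lemma finite_exts: "finite (exts :: ('k::number_field \<Rightarrow> real) set)"
proof (rule ccontr)
  assume "infinite (exts :: ('k \<Rightarrow> real) set)"
  then obtain J :: "('k \<Rightarrow> real) set" where J: "J \<subseteq> exts" "finite J" "card J = Suc (degree_K TYPE('k))"
    using infinite_arbitrarily_large by blast
  have "card J = (\<Sum>w\<in>J. 1)" by simp
  also have "\<dots> \<le> (\<Sum>w\<in>J. local_dim w)" using J local_dim_pos by (intro sum_mono) auto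
  also have "\<dots> \<le> degree_K TYPE('k)" by (rule sum_local_dim_le[OF J(2,1)])
  finally show False using J by simp
qed

section \<open>The sum of the extensions as a norm, local degrees and the norm of an element\<close>

definition sum_norm :: "'k::number_field \<Rightarrow> real" where
  "sum_norm x = (\<Sum>w\<in>exts. w x)"

lemma exts_le_sum_norm: "w \<in> exts \<Longrightarrow> w x \<le> sum_norm x"
  unfolding sum_norm_def by (rule member_le_sum) (auto simp: finite_exts intro: av_nonneg exts_av)

lemma sum_norm_nonneg: "0 \<le> sum_norm x"
  unfolding sum_norm_def by (intro sum_nonneg av_nonneg exts_av)

text \<open>For each \<open>x\<close> a single extension already reaches the spectral radius, so all
  extensions together control the coordinates.\<close>

lemma spec_rad_le_sum_norm: "spec_rad x \<le> sum_norm x"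
proof (cases "x = 0")
  case True
  have "spec_rad (0::'a) = 0" using spec_rad_rat[of 0, where 'k='a] by (simp add: av_zero[OF av])
  thus ?thesis using sum_norm_nonneg True by simp
next
  case False
  then obtain w where "w \<in> exts" "spec_rad x \<le> w x" using exists_ext_ge by blast
  thus ?thesis using exts_le_sum_norm[of w x] by linarith
qed

lemma coord_norm_le_sum_norm: "\<exists>C>0. \<forall>x :: 'k::number_field. coord_norm x \<le> C * sum_norm x"
proof -
  obtain C where C: "C > 0" "\<forall>x :: 'k. coord_norm x \<le> C * spec_rad x" using coord_norm_le_spec_rad by blast
  hence "coord_norm x \<le> C * sum_norm x" for x :: 'k using spec_rad_le_sum_norm[of x] by (meson mult_left_mono order_trans less_imp_le)
  thus ?thesis using C by blast
qed

text \<open>An approximate basis spans: the \<open>sum_norm\<close>-distance of any element to the span can be halved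
  repeatedly, and a rational functional vanishing on the span is continuous for \<open>sum_norm\<close>.\<close>
lemma approx_basis_span:
  fixes E :: "('k::number_field \<Rightarrow> real) \<times> nat \<Rightarrow> 'k"
  assumes J: "J = (exts :: ('k \<Rightarrow> real) set)" and E: "approx_basis J e \<delta> E"
    and c: "\<And>w q. w \<in> J \<Longrightarrow> c * (\<Sum>i<local_dim w. v (q i)) \<le> w (\<Sum>i<local_dim w. of_rat (q i) * e w i)"
    and dense: "\<And>w x \<epsilon>. w \<in> J \<Longrightarrow> \<epsilon> > 0 \<Longrightarrow> \<exists>q. w (x - (\<Sum>i<local_dim w. of_rat (q i) * e w i)) < \<epsilon>"
    and c0: "c > 0" and \<delta>: "\<delta> > 0" "4 * real (card J) * \<delta> \<le> c"
  defines "I \<equiv> Sigma J (\<lambda>w. {..<local_dim w})"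
  shows "Qv.span (E ` I) = UNIV"
proof (rule ccontr)
  assume ns: "Qv.span (E ` I) \<noteq> UNIV"
  have J': "finite J" "J \<subseteq> exts" using J finite_exts by auto
  define m where "m = real (card J)"
  have m0: "m \<ge> 0" by (simp add: m_def)
  have half: "\<exists>y\<in>Qv.span (E ` I). sum_norm (x - y) \<le> sum_norm x / 2" if x: "sum_norm x > 0" for x
  proof -
    \<comment> \<open>The local errors then add up to at most an eighth of
      \<open>sum_norm x\<close>. The error of the approximate basis adds little more than a quarter,
      and the total stays below one half.\<close>
    define \<eta> where "\<eta> = sum_norm x / (8 * (m + 1))"
    have \<eta>: "\<eta> > 0" "8 * (m * \<eta>) \<le> sum_norm x" unfolding \<eta>_def using x m0 by (auto simp: field_simps)
    have "\<forall>w\<in>J. \<exists>q. w (x - (\<Sum>i<local_dim w. of_rat (q i) * e w i)) < \<eta>" using dense \<eta> by blast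
    from bchoice[OF this] obtain q' where q': "\<forall>w\<in>J. w (x - (\<Sum>i<local_dim w. of_rat (q' w i) * e w i)) < \<eta>" ..
    define q where "q p = q' (fst p) (snd p)" for p
    define y where "y = (\<Sum>p\<in>I. of_rat (q p) * E p)"
    have "y \<in> Qv.span (E ` I)" unfolding y_def by (intro Qv.span_sum Qv.span_scale Qv.span_base imageI)
    moreover have "sum_norm (x - y) \<le> sum_norm x / 2"
    proof -
      have 1: "c * (\<Sum>i<local_dim w. v (q (w, i))) \<le> w x + \<eta>" if w: "w \<in> J" for w
      proof -
        have wa: "absolute_value w" using w J' exts_av by auto
        let ?b = "\<Sum>i<local_dim w. of_rat (q' w i) * e w i"
        have "c * (\<Sum>i<local_dim w. v (q (w, i))) \<le> w ?b" using c[OF w, of "q' w"] by (simp add: q_def)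
        also have "\<dots> \<le> w x + w (x - ?b)" using av_diff[OF wa, of x "x - ?b"] by simp
        also have "w (x - ?b) < \<eta>" using q' w by blast
        finally show ?thesis by simp
      qed
      have "c * (\<Sum>p\<in>I. v (q p)) = (\<Sum>w\<in>J. c * (\<Sum>i<local_dim w. v (q (w, i))))"
        unfolding I_def by (simp add: sum_Sigma_local_dim[OF J'(1)] sum_distrib_left)
      also have "\<dots> \<le> (\<Sum>w\<in>J. w x + \<eta>)" by (intro sum_mono 1)
      also have "\<dots> = sum_norm x + m * \<eta>" by (simp add: sum.distrib sum_norm_def J m_def)
      finally have S: "c * (\<Sum>p\<in>I. v (q p)) \<le> sum_norm x + m * \<eta>" .
      have Sn: "(\<Sum>p\<in>I. v (q p)) \<ge> 0" by (intro sum_nonneg av_nonneg[OF av])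
      have 2: "w (x - y) \<le> \<eta> + \<delta> * (\<Sum>p\<in>I. v (q p))" if w: "w \<in> J" for w
      proof -
        have wa: "absolute_value w" using w J' exts_av by auto
        let ?b = "\<Sum>i<local_dim w. of_rat (q' w i) * e w i"
        have "w (x - y) \<le> w (x - ?b) + w (y - ?b)" using av_diff[OF wa, of "x - ?b" "y - ?b"] by simp
        moreover have "w (y - ?b) \<le> \<delta> * (\<Sum>p\<in>I. v (q p))"
          using approx_basis_sum[OF J' E w, of q] unfolding I_def y_def by (simp add: q_def)
        moreover have "w (x - ?b) < \<eta>" using q' w by blast
        ultimately show ?thesis by linarith
      qed
      have "sum_norm (x - y) = (\<Sum>w\<in>J. w (x - y))" by (simp add: sum_norm_def J)
      also have "\<dots> \<le> (\<Sum>w\<in>J. \<eta> + \<delta> * (\<Sum>p\<in>I. v (q p)))" by (intro sum_mono 2)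
      also have "\<dots> = m * \<eta> + (m * \<delta>) * (\<Sum>p\<in>I. v (q p))" by (simp add: m_def algebra_simps)
      also have "\<dots> \<le> m * \<eta> + (c / 4) * (\<Sum>p\<in>I. v (q p))"
        using \<delta> Sn by (intro add_left_mono mult_right_mono) (auto simp: m_def)
      also have "\<dots> \<le> sum_norm x / 2" using S \<eta> x by linarith
      finally show ?thesis .
    qed
    ultimately show ?thesis by blast
  qed
  have approx: "\<exists>y\<in>Qv.span (E ` I). sum_norm (x - y) \<le> (1 / 2) ^ n * sum_norm x" for n x
  proof (induction n)
    case 0 thus ?case using Qv.span_zero by (intro bexI[of _ 0]) auto
  next
    case (Suc n)
    then obtain y where y: "y \<in> Qv.span (E ` I)" "sum_norm (x - y) \<le> (1 / 2) ^ n * sum_norm x" by blast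
    show ?case
    proof (cases "sum_norm (x - y) > 0")
      case True
      obtain y' where y': "y' \<in> Qv.span (E ` I)" "sum_norm (x - y - y') \<le> sum_norm (x - y) / 2" using half[OF True] by blast
      show ?thesis
        by (rule bexI[of _ "y + y'"]) (use y y' in \<open>auto simp: diff_diff_eq intro: Qv.span_add\<close>)
    next
      case False
      hence "sum_norm (x - y) \<le> (1 / 2) ^ Suc n * sum_norm x" using sum_norm_nonneg[of x] by (meson linorder_not_le order_trans not_less mult_nonneg_nonneg zero_le_power zero_le_divide_1_iff zero_le_numeral)
      thus ?thesis using y by blast
    qed
  qed
  obtain x0 where x0: "x0 \<notin> Qv.span (E ` I)" using ns by blast
  obtain B where B0: "B \<subseteq> E ` I" "Qv.independent B" "E ` I \<subseteq> Qv.span B"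
    using Qv.maximal_independent_subset[of "E ` I"] by blast
  have BS: "Qv.span B = Qv.span (E ` I)"
    using Qv.span_mono[OF B0(1)] Qv.span_minimal[OF B0(3) Qv.subspace_span] by (rule subset_antisym)
  note B = B0 BS
  have ind: "Qv.independent (insert x0 B)" using B x0 by (simp add: Qv.independent_insert)
  \<comment> \<open>A rational functional equal to 1 at \<open>x0\<close> and to 0 on the span; its
    continuity contradicts the approximation of \<open>x0\<close> from the span.\<close>
  obtain g where g: "Vector_Spaces.linear scale_rat (*) g" "\<forall>x\<in>insert x0 B. g x = (if x = x0 then 1 else (0::rat))"
    using Qp.linear_independent_extend[OF ind, of "\<lambda>x. if x = x0 then 1 else 0"] by blast
  interpret g: Vector_Spaces.linear "scale_rat :: rat \<Rightarrow> 'k \<Rightarrow> 'k" "(*) :: rat \<Rightarrow> rat \<Rightarrow> rat" g by (rule g(1))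
  have gB: "g x = 0" if "x \<in> Qv.span (E ` I)" for x
  proof -
    have "x0 \<notin> B" using x0 B Qv.span_base by metis
    hence "\<forall>x\<in>B. g x = 0" using g(2) by auto
    have "Qv.subspace {x. g x = 0}" by (rule Qv.subspaceI) (simp_all add: g.zero g.add g.scale)
    from Qv.span_minimal[OF _ this, of B] show ?thesis
      using \<open>\<forall>x\<in>B. g x = 0\<close> that unfolding B(4)[symmetric] by blast
  qed
  obtain C where C: "C > 0" "\<forall>x :: 'k. coord_norm x \<le> C * sum_norm x" using coord_norm_le_sum_norm by blast
  define G where "G = (\<Sum>i<degree_K TYPE('k). v (g (qbasis i)))"
  have gle: "v (g x) \<le> G * C * sum_norm x" for x
  proof -
    have "g x = (\<Sum>i<degree_K TYPE('k). coord x i * g (qbasis i))"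
      by (subst (1) coord_expand[of x]) (simp add: g.sum g.scale)
    hence "v (g x) \<le> (\<Sum>i<degree_K TYPE('k). v (coord x i) * v (g (qbasis i)))"
      using av_sum[OF av, of "\<lambda>i. coord x i * g (qbasis i)"] by (simp add: av_mult[OF av])
    also have "\<dots> \<le> (\<Sum>i<degree_K TYPE('k). coord_norm x * v (g (qbasis i)))"
      by (intro sum_mono mult_right_mono coord_norm_ge_coord av_nonneg[OF av]) auto
    also have "\<dots> = G * coord_norm x" by (simp add: G_def sum_distrib_left mult.commute)
    also have "\<dots> \<le> G * (C * sum_norm x)" using C unfolding G_def by (intro mult_left_mono sum_nonneg av_nonneg[OF av]) auto
    finally show ?thesis by (simp add: mult_ac)
  qed
  have G0: "G \<ge> 0" unfolding G_def by (intro sum_nonneg av_nonneg[OF av])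
  have "1 \<le> G * C * ((1 / 2) ^ n * sum_norm x0)" for n
  proof -
    obtain y where y: "y \<in> Qv.span (E ` I)" "sum_norm (x0 - y) \<le> (1 / 2) ^ n * sum_norm x0" using approx by blast
    have "1 = v (g x0)" using g(2) av_one[OF av] by simp
    also have "\<dots> = v (g (x0 - y))" using gB[OF y(1)] by (simp add: g.diff)
    also have "\<dots> \<le> G * C * sum_norm (x0 - y)" by (rule gle)
    also have "\<dots> \<le> G * C * ((1 / 2) ^ n * sum_norm x0)" using y G0 C by (intro mult_left_mono) auto
    finally show ?thesis .
  qed
  hence "2 ^ n \<le> G * C * sum_norm x0" for n by (simp add: power_divide field_simps)
  thus False using real_arch_pow[of 2 "G * C * sum_norm x0"] by (auto simp: not_less[symmetric])
qed

text \<open>Freeness of an approximate basis gives one inequality. Spanning gives the other, and for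
  it all extensions have to be taken at once.\<close>

lemma sum_local_dim: "(\<Sum>w\<in>(exts :: ('k::number_field \<Rightarrow> real) set). local_dim w) = degree_K TYPE('k)"
proof (rule antisym)
  let ?J = "exts :: ('k \<Rightarrow> real) set"
  have J: "finite ?J" "?J \<subseteq> exts" by (auto simp: finite_exts)
  show "(\<Sum>w\<in>?J. local_dim w) \<le> degree_K TYPE('k)" by (rule sum_local_dim_le[OF J])
  obtain c B e where c: "c > 0"
    "\<And>w q. w \<in> ?J \<Longrightarrow> c * (\<Sum>i<local_dim w. v (q i)) \<le> w (\<Sum>i<local_dim w. of_rat (q i) * e w i)"
    and dense: "\<And>w x \<epsilon>. w \<in> ?J \<Longrightarrow> \<epsilon> > 0 \<Longrightarrow> \<exists>q. w (x - (\<Sum>i<local_dim w. of_rat (q i) * e w i)) < \<epsilon>"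
    and E: "\<And>\<delta>. \<delta> > 0 \<Longrightarrow> \<exists>E. approx_basis ?J e \<delta> E"
    by (rule exists_approx_basis[OF J]) blast
  obtain \<delta> where \<delta>: "\<delta> > 0" "real (4 * card ?J) * \<delta> < c" using exists_delta[OF c(1)] by blast
  obtain E where E: "approx_basis ?J e \<delta> E" using E[OF \<delta>(1)] by blast
  let ?I = "Sigma ?J (\<lambda>w. {..<local_dim w})"
  have "Qv.span (E ` ?I) = UNIV"
    by (rule approx_basis_span[OF refl E c(2) dense c(1) \<delta>(1)]) (use \<delta> in auto)
  hence "degree_K TYPE('k) \<le> card (E ` ?I)"
    unfolding degree_K_def using J by (intro Qv.dim_le_card) auto
  also have "\<dots> \<le> card ?I" using J by (intro card_image_le) auto
  also have "\<dots> = (\<Sum>w\<in>?J. local_dim w)" using J by simp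
  finally show "degree_K TYPE('k) \<le> (\<Sum>w\<in>?J. local_dim w)" .
qed

text \<open>Expanding the multiples of the \<open>qbasis i\<close> by \<open>a\<close> in an approximate basis whose error is small in terms of
  \<open>a\<close> bounds the norm up to a constant that does not depend on \<open>a\<close>.\<close>
lemma field_norm_le_const:
  "\<exists>C>0. \<forall>a::'k::number_field. a \<noteq> 0 \<longrightarrow> v (field_norm a) \<le> C * (\<Prod>w\<in>exts. w a ^ local_dim w)"
proof -
  let ?J = "exts :: ('k \<Rightarrow> real) set" and ?n = "degree_K TYPE('k)"
  let ?I = "Sigma ?J (\<lambda>w. {..<local_dim w})"
  have J: "finite ?J" "?J \<subseteq> exts" by (auto simp: finite_exts)
  have cardI: "card ?I = ?n" using J sum_local_dim[where 'k='k] by simp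
  obtain c B e where c: "c > 0" and B: "B \<ge> 0" and clow:
    "\<And>w q. w \<in> ?J \<Longrightarrow> c * (\<Sum>i<local_dim w. v (q i)) \<le> w (\<Sum>i<local_dim w. of_rat (q i) * e w i)"
    and dense: "\<And>w x \<epsilon>. w \<in> ?J \<Longrightarrow> \<epsilon> > 0 \<Longrightarrow> \<exists>q. w (x - (\<Sum>i<local_dim w. of_rat (q i) * e w i)) < \<epsilon>"
    and Bup: "\<And>w w' i. w \<in> ?J \<Longrightarrow> w' \<in> ?J \<Longrightarrow> i < local_dim w \<Longrightarrow> w' (e w i) \<le> B"
    and Ex: "\<And>\<delta>. \<delta> > 0 \<Longrightarrow> \<exists>E. approx_basis ?J e \<delta> E"
    by (rule exists_approx_basis[OF J]) blast
  obtain S where S: "S > 0" "\<And>x :: 'k. coord_norm x \<le> S * sum_norm x" using coord_norm_le_sum_norm by blast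
  define m where "m = real (card ?J)"
  have m0: "m \<ge> 0" by (simp add: m_def)
  define P where "P = S * (m * (B + 1)) + 1"
  have P0: "P > 0" unfolding P_def using S B m0 by (intro add_nonneg_pos mult_nonneg_nonneg) auto
  define D where "D = (\<Sum>w\<in>?J. \<Sum>i<?n. w (qbasis i :: 'k)) + 1"
  have nn: "0 \<le> w x" if "w \<in> ?J" for w x using that exts_av av_nonneg by blast
  have D0: "D \<ge> 1" unfolding D_def by (simp add: sum_nonneg nn)
  have Dle: "w (qbasis i) + 1 \<le> D" if "w \<in> ?J" "i < ?n" for w i
  proof -
    have "w (qbasis i) \<le> (\<Sum>i<?n. w (qbasis i :: 'k))" using that by (intro member_le_sum nn) auto
    also have "\<dots> \<le> (\<Sum>w\<in>?J. \<Sum>i<?n. w (qbasis i :: 'k))" using that J by (intro member_le_sum[of w] sum_nonneg nn) auto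
    finally show ?thesis by (simp add: D_def)
  qed
  obtain f where f: "bij_betw f {..<?n} ?I"
    using ex_bij_betw_nat_finite[of ?I] J cardI by (auto simp: lessThan_atLeast0)
  have fI: "f k \<in> ?I" if "k < ?n" for k using f that by (auto simp: bij_betw_def)
  define C where "C = fact ?n * (D / c) ^ ?n * (fact ?n * P ^ ?n)"
  have C0: "C > 0" unfolding C_def using P0 D0 c by (intro mult_pos_pos zero_less_power) auto
  have "v (field_norm a) \<le> C * (\<Prod>w\<in>?J. w a ^ local_dim w)" if a: "a \<noteq> 0" for a :: 'k
  proof -
    have wpos: "w a > 0" if "w \<in> ?J" for w using av_pos[OF exts_av[OF that] a] .
    define M where "M = (\<Sum>i<?n. sum_norm (a * qbasis i)) + 1"
    have M0: "M > 0" unfolding M_def by (intro add_nonneg_pos sum_nonneg sum_norm_nonneg) auto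
    define \<mu> where "\<mu> = Min (insert 1 ((\<lambda>w. w a) ` ?J))"
    have \<mu>0: "\<mu> > 0" unfolding \<mu>_def using J wpos by (subst Min_gr_iff) auto
    have \<mu>le: "\<mu> \<le> w a" if "w \<in> ?J" for w unfolding \<mu>_def using J that by (intro Min_le) auto
    \<comment> \<open>The bound 1 keeps the elements \<open>E p\<close> bounded independently of
      \<open>a\<close>, the second makes them a basis, and the third makes the error in the
      coefficients at most \<open>\<mu>\<close>, hence at most \<open>w a\<close> at every
      place.\<close>
    define \<delta> where "\<delta> = min 1 (min (c / (4 * m + 4)) (\<mu> * c / (2 * M)))"
    have \<delta>: "\<delta> > 0" "\<delta> \<le> 1" unfolding \<delta>_def using c \<mu>0 M0 m0 by auto
    have "\<delta> \<le> c / (4 * m + 4)" "\<delta> \<le> \<mu> * c / (2 * M)" unfolding \<delta>_def by linarith+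
    hence \<delta>2: "\<delta> * (4 * m + 4) \<le> c" "\<delta> * (2 * M) \<le> \<mu> * c" using m0 M0 by (simp_all add: pos_le_divide_eq)
    obtain E where E: "approx_basis ?J e \<delta> E" using Ex[OF \<delta>(1)] by blast
    have span: "Qv.span (E ` ?I) = UNIV"
      by (rule approx_basis_span[OF refl E clow dense c \<delta>(1)]) (use \<delta>2 \<delta> in \<open>auto simp: m_def algebra_simps\<close>)
    have free: "inj_on E ?I" "Qv.independent (E ` ?I)"
    proof -
      have d: "real (card ?J) * \<delta> < c"
      proof -
        have "0 \<le> m * \<delta>" using \<delta> m0 by simp
        moreover have "\<delta> * (4 * m + 4) = 4 * (m * \<delta>) + 4 * \<delta>" by (simp add: algebra_simps)
        ultimately have "m * \<delta> < \<delta> * (4 * m + 4)" using \<delta> by linarith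
        thus ?thesis using \<delta>2 unfolding m_def by linarith
      qed
      show "inj_on E ?I" "Qv.independent (E ` ?I)"
        using free_family(1,2)[OF _ approx_basis_free[OF J E clow d]] J by auto
    qed
    define Q where "Q i p = Qv.representation (E ` ?I) (a * qbasis i) (E p)" for i p
    have Qsum: "a * qbasis i = (\<Sum>p\<in>?I. of_rat (Q i p) * E p)" for i
    proof -
      have "(\<Sum>b\<in>E ` ?I. of_rat (Qv.representation (E ` ?I) (a * qbasis i) b) * b) = a * qbasis i"
        by (rule Qv.sum_representation_eq) (use free span J in auto)
      thus ?thesis unfolding Q_def by (simp add: sum.reindex[OF free(1)])
    qed
    have Qbound: "v (Q i (w, j)) \<le> D / c * w a" if i: "i < ?n" and w: "(w, j) \<in> ?I" for i w j
    proof -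
      have wJ: "w \<in> ?J" using w by auto
      let ?V = "\<Sum>p\<in>?I. v (Q i p)"
      have V0: "?V \<ge> 0" by (intro sum_nonneg av_nonneg[OF av])
      have "(c - m * \<delta>) * ?V \<le> sum_norm (a * qbasis i)"
        using approx_basis_total[OF J E clow, of "Q i"] unfolding Qsum[symmetric] sum_norm_def m_def .
      also have "\<dots> \<le> M"
      proof -
        have "sum_norm (a * qbasis i) \<le> (\<Sum>i<?n. sum_norm (a * qbasis i))" using i by (intro member_le_sum sum_norm_nonneg) auto
        thus ?thesis unfolding M_def by linarith
      qed
      finally have "(c - m * \<delta>) * ?V \<le> M" .
      moreover have "c / 2 \<le> c - m * \<delta>"
      proof -
        have "0 \<le> m * \<delta>" using \<delta> m0 by simp
        moreover have "\<delta> * (4 * m + 4) = 4 * (m * \<delta>) + 4 * \<delta>" by (simp add: algebra_simps)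
        ultimately show ?thesis using \<delta> \<delta>2(1) by linarith
      qed
      hence "c / 2 * ?V \<le> (c - m * \<delta>) * ?V" using V0 by (rule mult_right_mono)
      ultimately have "c / 2 * ?V \<le> M" by linarith
      hence V: "?V \<le> 2 * M / c" using c by (simp add: field_simps)
      have "\<delta> * ?V \<le> \<delta> * (2 * M / c)" using V \<delta> by (intro mult_left_mono) auto
      also have "\<dots> \<le> \<mu>" using \<delta>2(2) c by (simp add: field_simps)
      also have "\<dots> \<le> w a" by (rule \<mu>le[OF wJ])
      finally have \<delta>V: "\<delta> * ?V \<le> w a" .
      have "v (Q i (w, j)) \<le> (\<Sum>j<local_dim w. v (Q i (w, j)))"
        using w by (intro member_le_sum[of j _ "\<lambda>j. v (Q i (w, j))"] av_nonneg[OF av]) auto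
      hence "c * v (Q i (w, j)) \<le> c * (\<Sum>j<local_dim w. v (Q i (w, j)))" using c by (intro mult_left_mono) auto
      also have "\<dots> \<le> w (a * qbasis i) + \<delta> * ?V"
        using approx_basis_lower[OF J E clow wJ, of "Q i"] unfolding Qsum[symmetric] .
      also have "\<dots> \<le> w a * (w (qbasis i) + 1)" using \<delta>V av_mult[OF exts_av[OF wJ], of a "qbasis i"] by (simp add: algebra_simps)
      also have "\<dots> \<le> w a * D" using Dle[OF wJ i] wpos[OF wJ] by (intro mult_left_mono) auto
      finally show ?thesis using c by (simp add: field_simps)
    qed
    have nuE: "coord_norm (E p) \<le> P" if p: "p \<in> ?I" for p
    proof -
      obtain w i where wi: "p = (w, i)" "w \<in> ?J" "i < local_dim w" using p by auto
      have "w' (E p) \<le> B + 1" if w': "w' \<in> ?J" for w'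
      proof -
        have wa: "absolute_value w'" using w' exts_av by auto
        let ?z = "if w' = w then e w i else 0"
        have "w' (E p) \<le> w' (E p - ?z) + w' ?z" using av_triangle[OF wa, of "E p - ?z" ?z] by simp
        moreover have "w' (E p - ?z) \<le> 1" using E wi w' \<delta> unfolding approx_basis_def by (meson order_trans)
        moreover have "w' ?z \<le> B" using Bup[OF wi(2) w' wi(3)] B av_zero[OF wa] by auto
        ultimately show ?thesis by linarith
      qed
      hence "sum_norm (E p) \<le> (\<Sum>w'\<in>?J. B + 1)" unfolding sum_norm_def by (intro sum_mono)
      hence "sum_norm (E p) \<le> m * (B + 1)" by (simp add: m_def)
      hence "S * sum_norm (E p) \<le> S * (m * (B + 1))" using S by (intro mult_left_mono) auto
      thus ?thesis using S(2)[of "E p"] unfolding P_def by linarith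
    qed
    let ?Q = "mat ?n ?n (\<lambda>(i, j). Q i (f j))"
    have "coord_mat (\<lambda>i. a * (qbasis i :: 'k)) = ?Q * coord_mat (\<lambda>k. E (f k))"
    proof (rule coord_mat_mult)
      fix i
      show "a * (qbasis i :: 'k) = (\<Sum>k<?n. of_rat (Q i (f k)) * E (f k))"
        unfolding Qsum[of i] using sum.reindex_bij_betw[OF f, of "\<lambda>p. of_rat (Q i p) * E p"] by simp
    qed
    hence "field_norm a = Determinant.det ?Q * Determinant.det (coord_mat (\<lambda>k. E (f k)))"
      unfolding field_norm_def by (simp add: det_mult[where n="?n"])
    \<comment> \<open>After transposition each row belongs to one place \<open>w\<close>, so the row
      bound of \<open>det_bound\<close> carries the factor \<open>w a\<close>.\<close>
    hence "v (field_norm a) = v (Determinant.det (transpose_mat ?Q)) * v (Determinant.det (coord_mat (\<lambda>k. E (f k))))"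
      by (simp add: av_mult[OF av] det_transpose[where n="?n"])
    also have "\<dots> \<le> (fact ?n * (\<Prod>k<?n. D / c * fst (f k) a)) * (fact ?n * (\<Prod>k<?n. P))"
    proof (rule mult_mono)
      show "v (Determinant.det (transpose_mat ?Q)) \<le> fact ?n * (\<Prod>k<?n. D / c * fst (f k) a)"
      proof (rule det_bound)
        fix i j assume ij: "i < ?n" "j < ?n"
        show "v (transpose_mat ?Q $$ (i, j)) \<le> D / c * fst (f i) a"
          using Qbound[OF ij(2), of "fst (f i)" "snd (f i)"] fI[OF ij(1)] ij by simp
      qed simp
      show "v (Determinant.det (coord_mat (\<lambda>k. E (f k)))) \<le> fact ?n * (\<Prod>k<?n. P)"
        by (rule det_bound[OF coord_mat_carrier]) (auto intro: order_trans[OF coord_norm_ge_coord nuE] fI)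
      show "0 \<le> fact ?n * (\<Prod>k<?n. D / c * fst (f k) a)"
        using D0 c fI by (intro mult_nonneg_nonneg prod_nonneg ballI) (auto intro!: nn simp: mem_Times_iff, force)
      show "0 \<le> v (Determinant.det (coord_mat (\<lambda>k. E (f k))))" by (rule av_nonneg[OF av])
    qed
    also have "(\<Prod>k<?n. D / c * fst (f k) a) = (D / c) ^ ?n * (\<Prod>p\<in>?I. fst p a)"
      using prod.reindex_bij_betw[OF f, of "\<lambda>p. fst p a"] by (simp only: prod.distrib prod_constant card_lessThan)
    also have "(\<Prod>p\<in>?I. fst p a) = (\<Prod>w\<in>?J. w a ^ local_dim w)"
      using prod.Sigma[of ?J "\<lambda>w. {..<local_dim w}" "\<lambda>w i. w a"] J by (simp add: case_prod_beta)
    finally show ?thesis unfolding C_def by (simp add: mult_ac)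
  qed
  thus ?thesis using C0 by blast
qed

text \<open>Both sides are multiplicative, so the inequality for all powers of \<open>a\<close>
  loses its constant; applied to \<open>inverse a\<close> it gives the reverse inequality.\<close>

lemma local_norm_formula:
  assumes "a \<noteq> (0 :: 'k::number_field)"
  shows "(\<Prod>w\<in>exts. w a ^ local_dim w) = v (field_norm a)"
proof -
  obtain C where C: "C > 0" "\<And>a::'k. a \<noteq> 0 \<Longrightarrow> v (field_norm a) \<le> C * (\<Prod>w\<in>exts. w a ^ local_dim w)"
    using field_norm_le_const by blast
  have le: "v (field_norm a) \<le> (\<Prod>w\<in>exts. w a ^ local_dim w)" if a: "a \<noteq> 0" for a :: 'k
  proof (rule power_growth_le[of 1 _ C])
    fix n
    have "v (field_norm (a ^ n)) \<le> C * (\<Prod>w\<in>exts. w (a ^ n) ^ local_dim w)" using C a by simp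
    also have "(\<Prod>w\<in>(exts :: ('k \<Rightarrow> real) set). w (a ^ n) ^ local_dim w) = (\<Prod>w\<in>exts. w a ^ local_dim w) ^ n"
      unfolding prod_power_distrib
      by (intro prod.cong refl) (simp add: av_power[OF exts_av] power_mult[symmetric] mult.commute)
    finally show "1 * v (field_norm a) ^ n \<le> C * (\<Prod>w\<in>exts. w a ^ local_dim w) ^ n"
      by (simp add: field_norm_power av_power[OF av])
    show "0 < (\<Prod>w\<in>(exts :: ('k \<Rightarrow> real) set). w a ^ local_dim w)"
      using a by (intro prod_pos zero_less_power av_pos exts_av) auto
  qed simp
  let ?g = "\<Prod>w\<in>(exts :: ('k \<Rightarrow> real) set). w a ^ local_dim w"
  have g0: "?g > 0" using assms by (intro prod_pos zero_less_power av_pos exts_av) auto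
  have "field_norm a * field_norm (inverse a) = 1"
    using assms by (simp add: field_norm_mult[symmetric] field_norm_one)
  hence "field_norm (inverse a) = inverse (field_norm a)" by (metis inverse_unique)
  hence "inverse (v (field_norm a)) = v (field_norm (inverse a))" by (simp add: av_inverse[OF av])
  also have "\<dots> \<le> (\<Prod>w\<in>(exts :: ('k \<Rightarrow> real) set). w (inverse a) ^ local_dim w)" using le[of "inverse a"] assms by simp
  also have "\<dots> = inverse ?g"
    unfolding prod_inversef[symmetric] o_def by (intro prod.cong refl) (simp add: av_inverse[OF exts_av] power_inverse)
  finally have "?g \<le> v (field_norm a)"
    using g0 av_pos[OF av field_norm_nonzero[OF assms]] by (simp add: le_imp_inverse_le field_simps)
  thus ?thesis using le[OF assms] by (rule antisym)
qed

end

section \<open>The degree of the completion\<close>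

definition cauchy_seq :: "('k::field \<Rightarrow> real) \<Rightarrow> (nat \<Rightarrow> 'k) \<Rightarrow> bool" where
  "cauchy_seq w s \<longleftrightarrow> (\<forall>e>0. \<exists>n0. \<forall>m\<ge>n0. \<forall>n\<ge>n0. w (s m - s n) < e)"

lemma carrier_cauchy_ring: "carrier (cauchy_ring w) = {s. cauchy_seq w s}"
  by (simp add: cauchy_ring_def cauchy_seq_def)

lemma cauchy_ring_simps [simp]:
  "s \<oplus>\<^bsub>cauchy_ring w\<^esub> t = (\<lambda>n. s n + t n)"
  "s \<otimes>\<^bsub>cauchy_ring w\<^esub> t = (\<lambda>n. s n * t n)"
  "\<zero>\<^bsub>cauchy_ring w\<^esub> = (\<lambda>_. 0)" "\<one>\<^bsub>cauchy_ring w\<^esub> = (\<lambda>_. 1)"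
  by (simp_all add: cauchy_ring_def)

context
  fixes w :: "'k::number_field \<Rightarrow> real"
  assumes w: "absolute_value w"
begin

lemma cauchy_seq_const: "cauchy_seq w (\<lambda>_. a)"
  by (simp add: cauchy_seq_def av_zero[OF w])

lemma cauchy_seq_uminus: "cauchy_seq w s \<Longrightarrow> cauchy_seq w (\<lambda>n. - s n)"
  unfolding cauchy_seq_def using av_uminus[OF w] by (metis minus_diff_minus)

lemma cauchy_seq_add: assumes "cauchy_seq w s" "cauchy_seq w t" shows "cauchy_seq w (\<lambda>n. s n + t n)"
  unfolding cauchy_seq_def
proof (intro allI impI)
  fix e :: real assume "e > 0"
  hence e: "e / 2 > 0" by simp
  obtain n1 where n1: "\<And>m n. m \<ge> n1 \<Longrightarrow> n \<ge> n1 \<Longrightarrow> w (s m - s n) < e / 2" using assms(1) e unfolding cauchy_seq_def by metis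
  obtain n2 where n2: "\<And>m n. m \<ge> n2 \<Longrightarrow> n \<ge> n2 \<Longrightarrow> w (t m - t n) < e / 2" using assms(2) e unfolding cauchy_seq_def by metis
  have "w (s m + t m - (s n + t n)) < e" if "m \<ge> max n1 n2" "n \<ge> max n1 n2" for m n
    using av_triangle[OF w, of "s m - s n" "t m - t n"] n1[of m n] n2[of m n] that by (simp add: algebra_simps)
  thus "\<exists>n0. \<forall>m\<ge>n0. \<forall>n\<ge>n0. w (s m + t m - (s n + t n)) < e" by blast
qed

lemma cauchy_seq_bounded: assumes "cauchy_seq w s" shows "\<exists>B>0. \<forall>n. w (s n) \<le> B"
proof -
  obtain n0 where n0: "\<And>m n. m \<ge> n0 \<Longrightarrow> n \<ge> n0 \<Longrightarrow> w (s m - s n) < 1"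
    using assms[unfolded cauchy_seq_def, rule_format, of 1] by auto
  define B where "B = (\<Sum>i\<le>n0. w (s i)) + 1"
  have s0: "(\<Sum>i\<le>n0. w (s i)) \<ge> 0" by (intro sum_nonneg av_nonneg[OF w])
  have le: "w (s n) \<le> (\<Sum>i\<le>n0. w (s i))" if "n \<le> n0" for n
    using that by (intro member_le_sum[of n _ "\<lambda>i. w (s i)"] av_nonneg[OF w]) auto
  have "w (s n) \<le> B" for n
  proof (cases "n \<le> n0")
    case True thus ?thesis using le[of n] by (simp add: B_def)
  next
    case False
    have "w (s n) \<le> w (s n - s n0) + w (s n0)" using av_triangle[OF w, of "s n - s n0" "s n0"] by simp
    thus ?thesis using n0[of n n0] False le[of n0] by (simp add: B_def)
  qed
  thus ?thesis using s0 by (intro exI[of _ B]) (auto simp: B_def)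
qed

lemma cauchy_seq_mult: assumes "cauchy_seq w s" "cauchy_seq w t" shows "cauchy_seq w (\<lambda>n. s n * t n)"
  unfolding cauchy_seq_def
proof (intro allI impI)
  fix e :: real assume e0: "e > 0"
  obtain A where A: "A > 0" "\<And>n. w (s n) \<le> A" using cauchy_seq_bounded[OF assms(1)] by blast
  obtain B where B: "B > 0" "\<And>n. w (t n) \<le> B" using cauchy_seq_bounded[OF assms(2)] by blast
  have e: "e / (2 * B) > 0" "e / (2 * A) > 0" using e0 A B by auto
  obtain n1 where n1: "\<And>m n. m \<ge> n1 \<Longrightarrow> n \<ge> n1 \<Longrightarrow> w (s m - s n) < e / (2 * B)" using assms(1) e unfolding cauchy_seq_def by metis
  obtain n2 where n2: "\<And>m n. m \<ge> n2 \<Longrightarrow> n \<ge> n2 \<Longrightarrow> w (t m - t n) < e / (2 * A)" using assms(2) e unfolding cauchy_seq_def by metis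
  have "w (s m * t m - s n * t n) < e" if mat_norm: "m \<ge> max n1 n2" "n \<ge> max n1 n2" for m n
  proof -
    have "s m * t m - s n * t n = (s m - s n) * t m + s n * (t m - t n)" by (simp add: algebra_simps)
    hence "w (s m * t m - s n * t n) \<le> w (s m - s n) * w (t m) + w (s n) * w (t m - t n)"
      using av_triangle[OF w, of "(s m - s n) * t m" "s n * (t m - t n)"] by (simp add: av_mult[OF w])
    also have "w (s m - s n) * w (t m) \<le> w (s m - s n) * B" by (intro mult_left_mono B av_nonneg[OF w])
    also have "\<dots> < e / (2 * B) * B" using n1[of m n] mat_norm B by (intro mult_strict_right_mono) auto
    also have "\<dots> = e / 2" using B by simp
    also have "w (s n) * w (t m - t n) \<le> A * w (t m - t n)" by (intro mult_right_mono A av_nonneg[OF w])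
    also have "\<dots> \<le> A * (e / (2 * A))" using n2[of m n] mat_norm A by (intro mult_left_mono) auto
    also have "\<dots> = e / 2" using A by simp
    finally show ?thesis by simp
  qed
  thus "\<exists>n0. \<forall>m\<ge>n0. \<forall>n\<ge>n0. w (s m * t m - s n * t n) < e" by blast
qed

lemma null_cauchy_seq: assumes "(\<lambda>n. w (s n)) \<longlonglongrightarrow> 0" shows "cauchy_seq w s"
  unfolding cauchy_seq_def
proof (intro allI impI)
  fix e :: real assume "e > 0"
  hence "\<forall>\<^sub>F n in sequentially. w (s n) < e / 2" by (intro order_tendstoD(2)[OF assms]) simp
  then obtain n0 where n0: "\<And>n. n \<ge> n0 \<Longrightarrow> w (s n) < e / 2" by (auto simp: eventually_sequentially)
  have "w (s m - s n) < e" if "m \<ge> n0" "n \<ge> n0" for m n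
    using av_diff[OF w, of "s m" "s n"] n0[OF that(1)] n0[OF that(2)] by linarith
  thus "\<exists>n0. \<forall>m\<ge>n0. \<forall>n\<ge>n0. w (s m - s n) < e" by blast
qed

lemma null_add:
  assumes "(\<lambda>n. w (s n)) \<longlonglongrightarrow> 0" "(\<lambda>n. w (t n)) \<longlonglongrightarrow> 0"
  shows "(\<lambda>n. w (s n + t n)) \<longlonglongrightarrow> 0"
proof (rule tendsto_sandwich[OF _ _ tendsto_const])
  show "(\<lambda>n. w (s n) + w (t n)) \<longlonglongrightarrow> 0" using tendsto_add[OF assms] by simp
qed (auto intro!: always_eventually av_nonneg[OF w] av_triangle[OF w])

lemma null_mult:
  assumes "(\<lambda>n. w (s n)) \<longlonglongrightarrow> 0" "cauchy_seq w t"
  shows "(\<lambda>n. w (s n * t n)) \<longlonglongrightarrow> 0"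
proof -
  obtain B where B: "B > 0" "\<And>n. w (t n) \<le> B" using cauchy_seq_bounded[OF assms(2)] by blast
  show ?thesis
  proof (rule tendsto_sandwich[OF _ _ tendsto_const])
    show "(\<lambda>n. w (s n) * B) \<longlonglongrightarrow> 0" using tendsto_mult[OF assms(1) tendsto_const[of B]] by simp
    show "\<forall>\<^sub>F n in sequentially. w (s n * t n) \<le> w (s n) * B"
      by (intro always_eventually allI) (simp add: av_mult[OF w] mult_left_mono B av_nonneg[OF w])
  qed (auto intro!: always_eventually av_nonneg[OF w])
qed

lemma cring_cauchy: "cring (cauchy_ring w)"
proof (rule cringI)
  have c: "carrier (cauchy_ring w) = {s. cauchy_seq w s}" by (rule carrier_cauchy_ring)
  show "abelian_group (cauchy_ring w)"
  proof (rule abelian_groupI)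
    fix x assume "x \<in> carrier (cauchy_ring w)"
    thus "\<exists>y\<in>carrier (cauchy_ring w). y \<oplus>\<^bsub>cauchy_ring w\<^esub> x = \<zero>\<^bsub>cauchy_ring w\<^esub>"
      unfolding c by (intro bexI[of _ "\<lambda>n. - x n"]) (auto simp: cauchy_ring_def intro: cauchy_seq_uminus)
  qed (auto simp: c, auto simp: cauchy_ring_def algebra_simps intro: cauchy_seq_add cauchy_seq_const)
  show "Group.comm_monoid (cauchy_ring w)"
    by (rule Group.comm_monoidI) (auto simp: c, auto simp: cauchy_ring_def algebra_simps intro: cauchy_seq_mult cauchy_seq_const)
qed (auto simp: cauchy_ring_def algebra_simps)

lemma ring_cauchy: "ring (cauchy_ring w)"
  using cring_cauchy by (rule cring.axioms)

lemma cauchy_ring_uminus: assumes "cauchy_seq w s" shows "\<ominus>\<^bsub>cauchy_ring w\<^esub> s = (\<lambda>n. - s n)"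
proof -
  interpret cring "cauchy_ring w" by (rule cring_cauchy)
  show ?thesis using assms by (intro sum_zero_eq_neg[symmetric]) (auto simp: carrier_cauchy_ring cauchy_seq_uminus)
qed

lemma ideal_null: "ideal (null_ideal w) (cauchy_ring w)"
proof (rule idealI[OF ring_cauchy])
  interpret cring "cauchy_ring w" by (rule cring_cauchy)
  show "subgroup (null_ideal w) (add_monoid (cauchy_ring w))"
  proof (rule add.subgroupI)
    show "null_ideal w \<subseteq> carrier (cauchy_ring w)" by (auto simp: null_ideal_def carrier_cauchy_ring null_cauchy_seq)
    show "null_ideal w \<noteq> {}" using av_zero[OF w] by (auto simp: null_ideal_def intro!: exI[of _ "\<lambda>_. 0"])
    show "\<ominus>\<^bsub>cauchy_ring w\<^esub> a \<in> null_ideal w" if "a \<in> null_ideal w" for a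
      using that cauchy_ring_uminus[of a] null_cauchy_seq[of a]
      by (simp add: null_ideal_def av_uminus[OF w])
  qed (auto simp: null_ideal_def null_add)
qed (auto simp: null_ideal_def carrier_cauchy_ring null_mult mult.commute)

abbreviation limit_class :: "(nat \<Rightarrow> 'k) \<Rightarrow> (nat \<Rightarrow> 'k) set" where
  "limit_class s \<equiv> null_ideal w +>\<^bsub>cauchy_ring w\<^esub> s"

lemma limit_class_hom: "ring_hom_ring (cauchy_ring w) (completion w) limit_class"
proof -
  interpret ideal "null_ideal w" "cauchy_ring w" by (rule ideal_null)
  show ?thesis unfolding completion_def by (rule rcos_ring_hom_ring)
qed

lemma limit_class_eq_zero: assumes "cauchy_seq w s" shows "limit_class s = \<zero>\<^bsub>completion w\<^esub> \<longleftrightarrow> (\<lambda>n. w (s n)) \<longlonglongrightarrow> 0"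
proof -
  interpret ideal "null_ideal w" "cauchy_ring w" by (rule ideal_null)
  interpret h: ring_hom_ring "cauchy_ring w" "completion w" limit_class by (rule limit_class_hom)
  have "limit_class s = limit_class (\<lambda>_. 0) \<longleftrightarrow> s \<ominus>\<^bsub>cauchy_ring w\<^esub> (\<lambda>_. 0) \<in> null_ideal w"
    by (rule quotient_eq_iff_same_a_r_cos[OF ideal_axioms, symmetric]) (use assms in \<open>auto simp: carrier_cauchy_ring cauchy_seq_const\<close>)
  moreover have "s \<ominus>\<^bsub>cauchy_ring w\<^esub> (\<lambda>_. 0) = s"
    using cauchy_ring_uminus[OF cauchy_seq_const, of 0] by (simp add: a_minus_def)
  moreover have "limit_class (\<lambda>_. 0) = \<zero>\<^bsub>completion w\<^esub>" using h.hom_zero by simp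
  ultimately show ?thesis by (simp add: null_ideal_def)
qed

lemma limit_class_eq: assumes "cauchy_seq w s" "cauchy_seq w t" shows "limit_class s = limit_class t \<longleftrightarrow> (\<lambda>n. w (s n - t n)) \<longlonglongrightarrow> 0"
proof -
  interpret ideal "null_ideal w" "cauchy_ring w" by (rule ideal_null)
  have "limit_class s = limit_class t \<longleftrightarrow> s \<ominus>\<^bsub>cauchy_ring w\<^esub> t \<in> null_ideal w"
    by (rule quotient_eq_iff_same_a_r_cos[OF ideal_axioms, symmetric]) (use assms in \<open>auto simp: carrier_cauchy_ring\<close>)
  thus ?thesis using cauchy_ring_uminus[OF assms(2)] by (simp add: a_minus_def null_ideal_def)
qed

lemma carrier_completion: "carrier (completion w) = limit_class ` {s. cauchy_seq w s}"
  by (auto simp: completion_def FactRing_def A_RCOSETS_def' carrier_cauchy_ring)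

lemma rat_completion_image: "rat_completion w = limit_class ` {s. cauchy_seq w s \<and> range s \<subseteq> \<rat>}"
  by (auto simp: rat_completion_def carrier_cauchy_ring)

text \<open>Independence and spanning over a subfield are tested on \<open>ring.combine\<close>; for
  constant vectors it is computed term by term on representing sequences.\<close>

lemma combine_limit_class:
  assumes "length ts = length es" "\<And>t. t \<in> set ts \<Longrightarrow> cauchy_seq w t"
  shows "ring.combine (completion w) (map limit_class ts) (map (\<lambda>a. limit_class (\<lambda>_. a)) es)
    = limit_class (\<lambda>n. \<Sum>i<length es. (ts ! i) n * es ! i) \<and> cauchy_seq w (\<lambda>n. \<Sum>i<length es. (ts ! i) n * es ! i)"
proof -
  interpret S: ring "completion w" using limit_class_hom by (rule ring_hom_ring.axioms)
  interpret h: ring_hom_ring "cauchy_ring w" "completion w" limit_class by (rule limit_class_hom)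
  show ?thesis using assms
  proof (induction ts es rule: list_induct2)
    case Nil
    show ?case using h.hom_zero by (simp add: cauchy_seq_const)
  next
    case (Cons t ts a es)
    let ?r = "\<lambda>n. \<Sum>i<length es. (ts ! i) n * es ! i"
    have IH: "S.combine (map limit_class ts) (map (\<lambda>a. limit_class (\<lambda>_. a)) es) = limit_class ?r" "cauchy_seq w ?r" using Cons by auto
    have t: "cauchy_seq w t" "cauchy_seq w (\<lambda>n. t n * a)" using Cons.prems cauchy_seq_mult[OF _ cauchy_seq_const, of t a] by auto
    have "limit_class (\<lambda>n. t n * a + ?r n) = limit_class t \<otimes>\<^bsub>completion w\<^esub> limit_class (\<lambda>_. a) \<oplus>\<^bsub>completion w\<^esub> limit_class ?r"
      using h.hom_add[of "\<lambda>n. t n * a" ?r] h.hom_mult[of t "\<lambda>_. a"] t IH(2) cauchy_seq_const[of a]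
      by (simp add: carrier_cauchy_ring)
    moreover have "(\<lambda>n. \<Sum>i<length (a # es). ((t # ts) ! i) n * (a # es) ! i) = (\<lambda>n. t n * a + ?r n)"
      by (simp add: sum.lessThan_Suc_shift del: sum.lessThan_Suc)
    ultimately show ?case using IH t(2) cauchy_seq_add[OF t(2) IH(2)] by simp
  qed
qed

end

context rat_abs
begin

text \<open>The point is inversion: a rational Cauchy sequence that is not null stays away from 0
  eventually, so its termwise inverses form a Cauchy sequence.\<close>

lemma subfield_rat_completion:
  assumes we: "w \<in> (exts :: ('k::number_field \<Rightarrow> real) set)"
  shows "subfield (rat_completion w) (completion w)"
proof -
  note w = exts_av[OF we]
  interpret R: cring "cauchy_ring w" by (rule cring_cauchy[OF w])
  interpret S: ring "completion w" using limit_class_hom[OF w] by (rule ring_hom_ring.axioms)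
  interpret h: ring_hom_ring "cauchy_ring w" "completion w" "\<lambda>s. null_ideal w +>\<^bsub>cauchy_ring w\<^esub> s" by (rule limit_class_hom[OF w])
  let ?\<phi> = "\<lambda>s. null_ideal w +>\<^bsub>cauchy_ring w\<^esub> s"
  have "subring {s. cauchy_seq w s \<and> range s \<subseteq> \<rat>} (cauchy_ring w)"
  proof (rule R.subringI)
    show "\<ominus>\<^bsub>cauchy_ring w\<^esub> h \<in> {s. cauchy_seq w s \<and> range s \<subseteq> \<rat>}" if "h \<in> {s. cauchy_seq w s \<and> range s \<subseteq> \<rat>}" for h
      using that cauchy_ring_uminus[OF w, of h] cauchy_seq_uminus[OF w, of h] by auto
    fix h k assume that: "h \<in> {s. cauchy_seq w s \<and> range s \<subseteq> \<rat>}" "k \<in> {s. cauchy_seq w s \<and> range s \<subseteq> \<rat>}"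
    show "h \<otimes>\<^bsub>cauchy_ring w\<^esub> k \<in> {s. cauchy_seq w s \<and> range s \<subseteq> \<rat>}"
      and "h \<oplus>\<^bsub>cauchy_ring w\<^esub> k \<in> {s. cauchy_seq w s \<and> range s \<subseteq> \<rat>}"
    proof -
      have "h n \<in> \<rat>" "k n \<in> \<rat>" for n using that by auto
      thus "h \<otimes>\<^bsub>cauchy_ring w\<^esub> k \<in> {s. cauchy_seq w s \<and> range s \<subseteq> \<rat>}"
        and "h \<oplus>\<^bsub>cauchy_ring w\<^esub> k \<in> {s. cauchy_seq w s \<and> range s \<subseteq> \<rat>}"
        using that cauchy_seq_mult[OF w, of h k] cauchy_seq_add[OF w, of h k] by (auto simp: cauchy_ring_simps)
    qed
  qed (auto simp: carrier_cauchy_ring cauchy_ring_simps cauchy_seq_const[OF w])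
  hence sr: "subring (rat_completion w) (completion w)"
    unfolding rat_completion_image[OF w] by (rule h.img_is_subring)
  have comm: "a \<otimes>\<^bsub>completion w\<^esub> b = b \<otimes>\<^bsub>completion w\<^esub> a" if "a \<in> rat_completion w" "b \<in> rat_completion w" for a b
  proof -
    obtain s t where "a = ?\<phi> s" "b = ?\<phi> t" "cauchy_seq w s" "cauchy_seq w t" using \<open>a \<in> _\<close> \<open>b \<in> _\<close> unfolding rat_completion_image[OF w] by auto
    thus ?thesis using h.hom_mult[of s t] h.hom_mult[of t s] R.m_comm[of s t] by (simp add: carrier_cauchy_ring)
  qed
  have one: "\<one>\<^bsub>completion w\<^esub> = ?\<phi> (\<lambda>_. 1)" using h.hom_one by (simp add: cauchy_ring_simps)
  have "\<not> (\<lambda>n. w 1) \<longlonglongrightarrow> 0" by (simp add: av_one[OF w] LIMSEQ_const_iff)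
  hence one_nz: "\<one>\<^bsub>completion w\<^esub> \<noteq> \<zero>\<^bsub>completion w\<^esub>" unfolding one using limit_class_eq_zero[OF w cauchy_seq_const[OF w], of 1] by simp
  have inv: "\<exists>b\<in>rat_completion w. a \<otimes>\<^bsub>completion w\<^esub> b = \<one>\<^bsub>completion w\<^esub>"
    if a: "a \<in> rat_completion w" "a \<noteq> \<zero>\<^bsub>completion w\<^esub>" for a
  proof -
    obtain s where s: "a = ?\<phi> s" "cauchy_seq w s" "range s \<subseteq> \<rat>" using a unfolding rat_completion_image[OF w] by auto
    have nn: "\<not> (\<lambda>n. w (s n)) \<longlonglongrightarrow> 0" using a s limit_class_eq_zero[OF w s(2)] by simp
    obtain e where e: "e > 0" "\<And>n0. \<exists>n\<ge>n0. e \<le> w (s n)"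
      using nn av_nonneg[OF w] unfolding LIMSEQ_iff by (auto simp: not_less)
    obtain n0 where n0: "\<And>m n. m \<ge> n0 \<Longrightarrow> n \<ge> n0 \<Longrightarrow> w (s m - s n) < e / 2"
      using s(2) e(1) unfolding cauchy_seq_def by (metis half_gt_zero)
    obtain n1 where n1: "n1 \<ge> n0" "e \<le> w (s n1)" using e(2) by blast
    have low: "w (s n) \<ge> e / 2" if "n \<ge> n0" for n
      using av_diff_ge[OF w, of "s n1" "s n"] n0[OF n1(1) that] n1(2) by linarith
    have nz: "s n \<noteq> 0" if "n \<ge> n0" for n using low[OF that] e(1) av_zero[OF w] by auto
    \<comment> \<open>Finitely many terms may vanish; there \<open>inverse 0 = 0\<close> keeps the
      sequence total and rational.\<close>
    define t where "t n = inverse (s n)" for n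
    have "cauchy_seq w t" unfolding cauchy_seq_def
    proof (intro allI impI)
      fix d :: real assume d: "d > 0"
      hence "d * (e / 2 * (e / 2)) > 0" using e by simp
      then obtain n2 where n2: "\<And>m n. m \<ge> n2 \<Longrightarrow> n \<ge> n2 \<Longrightarrow> w (s m - s n) < d * (e / 2 * (e / 2))"
        using s(2) unfolding cauchy_seq_def by metis
      have "w (t m - t n) < d" if mat_norm: "m \<ge> max n0 n2" "n \<ge> max n0 n2" for m n
      proof -
        have "t m - t n = (s n - s m) / (s m * s n)" using nz[of m] nz[of n] mat_norm unfolding t_def by (simp add: field_simps)
        hence "w (t m - t n) = w (s n - s m) / (w (s m) * w (s n))" by (simp add: av_divide[OF w] av_mult[OF w])
        also have "\<dots> \<le> w (s n - s m) / (e / 2 * (e / 2))"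
          using low[of m] low[of n] mat_norm e by (intro divide_left_mono mult_mono mult_pos_pos) (auto intro: av_nonneg[OF w])
        also have "\<dots> < d" using n2[of n m] mat_norm e by (simp add: pos_divide_less_eq)
        finally show ?thesis .
      qed
      thus "\<exists>n0. \<forall>m\<ge>n0. \<forall>n\<ge>n0. w (t m - t n) < d" by blast
    qed
    moreover have "range t \<subseteq> \<rat>" using s(3) unfolding t_def by (auto intro!: Rats_inverse)
    ultimately have tK: "?\<phi> t \<in> rat_completion w" "cauchy_seq w t" unfolding rat_completion_image[OF w] by auto
    have "(\<lambda>n. w (s n * t n - 1)) \<longlonglongrightarrow> 0"
      by (rule tendsto_eventually) (use nz in \<open>auto simp: eventually_sequentially t_def av_zero[OF w] intro!: exI[of _ n0]\<close>)
    hence "?\<phi> (\<lambda>n. s n * t n) = \<one>\<^bsub>completion w\<^esub>"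
      unfolding one using limit_class_eq[OF w cauchy_seq_mult[OF w s(2) tK(2)] cauchy_seq_const[OF w], of 1] by simp
    moreover have "?\<phi> (\<lambda>n. s n * t n) = a \<otimes>\<^bsub>completion w\<^esub> ?\<phi> t"
      using h.hom_mult[of s t] s(1,2) tK(2) by (simp add: carrier_cauchy_ring cauchy_ring_simps)
    ultimately show ?thesis using tK(1) by auto
  qed
  show ?thesis
  proof (rule S.subfieldI)
    show sc: "subcring (rat_completion w) (completion w)" by (rule S.subcringI[OF sr comm])
    show "Units (completion w\<lparr>carrier := rat_completion w\<rparr>) = rat_completion w - {\<zero>\<^bsub>completion w\<^esub>}"
    proof (intro equalityI subsetI)
      fix a assume "a \<in> Units (completion w\<lparr>carrier := rat_completion w\<rparr>)"
      then obtain b where ab: "a \<in> rat_completion w" "b \<in> rat_completion w" "b \<otimes>\<^bsub>completion w\<^esub> a = \<one>\<^bsub>completion w\<^esub>"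
        by (auto simp: Units_def)
      have "b \<in> carrier (completion w)" using ab(2) subringE(1)[OF sr] by blast
      hence "a \<noteq> \<zero>\<^bsub>completion w\<^esub>" using one_nz S.r_null[of b] ab(3) by metis
      thus "a \<in> rat_completion w - {\<zero>\<^bsub>completion w\<^esub>}" using ab(1) by blast
    next
      fix a assume "a \<in> rat_completion w - {\<zero>\<^bsub>completion w\<^esub>}"
      then obtain b where ab: "a \<in> rat_completion w" "b \<in> rat_completion w" "a \<otimes>\<^bsub>completion w\<^esub> b = \<one>\<^bsub>completion w\<^esub>"
        using inv by blast
      moreover have "b \<otimes>\<^bsub>completion w\<^esub> a = \<one>\<^bsub>completion w\<^esub>" using comm[OF ab(1,2)] ab(3) by metis
      ultimately show "a \<in> Units (completion w\<lparr>carrier := rat_completion w\<rparr>)" by (auto simp: Units_def)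
    qed
  qed
qed

text \<open>The constant sequences of a maximal \<open>w_indep\<close> family form a basis of the
  completion. The uniform lower bound \<open>c\<close> gives independence and also makes the
  coefficient sequences of an approximation Cauchy; density then gives spanning.\<close>

lemma local_degree_eq:
  assumes we: "w \<in> (exts :: ('k::number_field \<Rightarrow> real) set)"
  shows "local_degree w = local_dim w"
proof -
  note w = exts_av[OF we]
  interpret R: cring "cauchy_ring w" by (rule cring_cauchy[OF w])
  interpret S: ring "completion w" using limit_class_hom[OF w] by (rule ring_hom_ring.axioms)
  interpret h: ring_hom_ring "cauchy_ring w" "completion w" "\<lambda>s. null_ideal w +>\<^bsub>cauchy_ring w\<^esub> s" by (rule limit_class_hom[OF w])
  let ?\<phi> = "\<lambda>s. null_ideal w +>\<^bsub>cauchy_ring w\<^esub> s" and ?K = "rat_completion w"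
  note sf = subfield_rat_completion[OF we]
  obtain e c where c: "c > 0" and ind: "\<And>q. c * (\<Sum>i<local_dim w. v (q i)) \<le> w (\<Sum>i<local_dim w. of_rat (q i) * e i)"
    and dense: "\<And>x \<epsilon>. \<epsilon> > 0 \<Longrightarrow> \<exists>q. w (x - (\<Sum>i<local_dim w. of_rat (q i) * e i)) < \<epsilon>"
    by (rule local_dim_basis[OF we]) blast
  define es where "es = map e [0..<local_dim w]"
  have les: "length es = local_dim w" and nes: "\<And>i. i < local_dim w \<Longrightarrow> es ! i = e i" by (auto simp: es_def)
  define Us where "Us = map (\<lambda>a. ?\<phi> (\<lambda>_. a)) es"
  have lUs: "length Us = local_dim w" by (simp add: Us_def les)
  have UsC: "set Us \<subseteq> carrier (completion w)"
    unfolding Us_def carrier_completion[OF w] using cauchy_seq_const[OF w] by auto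
  have KC: "?K \<subseteq> carrier (completion w)" using subfieldE(3)[OF sf] .
  have indep: "S.independent ?K Us"
  proof (rule S.trivial_combine_imp_independent[OF sf UsC])
    fix Ks assume Ks: "set Ks \<subseteq> ?K" "S.combine Ks Us = \<zero>\<^bsub>completion w\<^esub>"
    \<comment> \<open>The coefficient list may have any length, and \<open>ring.combine\<close>
      stops at the shorter argument; padding with zeros and truncating gives the length of
      \<open>Us\<close>.\<close>
    define Ks' where "Ks' = take (length Us) (Ks @ replicate (length Us) \<zero>\<^bsub>completion w\<^esub>)"
    have lK: "length Ks' = length es" by (simp add: Ks'_def lUs les)
    have "set Ks' \<subseteq> ?K"
      using Ks(1) subringE(2)[OF subfieldE(1)[OF sf]] unfolding Ks'_def
      by (auto dest!: in_set_takeD split: if_splits)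
    hence "Ks' \<in> lists (?\<phi> ` {s. cauchy_seq w s \<and> range s \<subseteq> \<rat>})" unfolding rat_completion_image[OF w] by auto
    then obtain ts where ts: "Ks' = map ?\<phi> ts" "set ts \<subseteq> {s. cauchy_seq w s \<and> range s \<subseteq> \<rat>}"
      unfolding lists_image by auto
    have lts: "length ts = length es" using ts(1) lK by simp
    have tc: "cauchy_seq w t" if "t \<in> set ts" for t using ts(2) that by auto
    have "S.combine Ks' Us = \<zero>\<^bsub>completion w\<^esub>"
      unfolding Ks'_def S.combine_take S.combine_append_replicate[OF UsC] by (rule Ks)
    hence "?\<phi> (\<lambda>n. \<Sum>i<length es. (ts ! i) n * es ! i) = \<zero>\<^bsub>completion w\<^esub>"
      using combine_limit_class[OF w lts tc] unfolding ts(1) Us_def by simp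
    hence lim: "(\<lambda>n. w (\<Sum>i<length es. (ts ! i) n * es ! i)) \<longlonglongrightarrow> 0"
      using limit_class_eq_zero[OF w, of "\<lambda>n. \<Sum>i<length es. (ts ! i) n * es ! i"] combine_limit_class[OF w lts tc] by blast
    define q where "q n i = (SOME r. (ts ! i) n = of_rat r)" for n i
    have q: "(ts ! i) n = of_rat (q n i)" if i: "i < local_dim w" for n i
    proof -
      have "ts ! i \<in> set ts" using i lts les by simp
      hence "(ts ! i) n \<in> \<rat>" using ts(2) by auto
      hence "\<exists>r. (ts ! i) n = of_rat r" by (auto elim: Rats_cases)
      thus ?thesis unfolding q_def by (rule someI_ex)
    qed
    have "?\<phi> (ts ! i) = \<zero>\<^bsub>completion w\<^esub>" if i: "i < local_dim w" for i
    proof -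
      have le: "w ((ts ! i) n) \<le> w (\<Sum>i<length es. (ts ! i) n * es ! i) / c" for n
      proof -
        have "c * w ((ts ! i) n) = c * v (q n i)" using q[OF i] exts_rat[OF we] by simp
        also have "\<dots> \<le> c * (\<Sum>i<local_dim w. v (q n i))"
          using i c by (intro mult_left_mono member_le_sum[of i _ "\<lambda>i. v (q n i)"] av_nonneg[OF av]) auto
        also have "\<dots> \<le> w (\<Sum>i<local_dim w. of_rat (q n i) * e i)" by (rule ind)
        also have "(\<Sum>i<local_dim w. of_rat (q n i) * e i) = (\<Sum>i<length es. (ts ! i) n * es ! i)"
          unfolding les by (intro sum.cong) (auto simp: q nes)
        finally show ?thesis using c by (simp add: field_simps)
      qed
      have "(\<lambda>n. w ((ts ! i) n)) \<longlonglongrightarrow> 0"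
      proof (rule tendsto_sandwich[OF _ _ tendsto_const])
        show "(\<lambda>n. w (\<Sum>i<length es. (ts ! i) n * es ! i) / c) \<longlonglongrightarrow> 0"
          using tendsto_divide[OF lim tendsto_const[of c]] c by simp
      qed (auto intro!: always_eventually av_nonneg[OF w] le)
      moreover have "cauchy_seq w (ts ! i)" using i lts les by (intro tc) simp
      ultimately show ?thesis using limit_class_eq_zero[OF w] by blast
    qed
    hence "set Ks' \<subseteq> {\<zero>\<^bsub>completion w\<^esub>}"
      unfolding ts(1) using lts les by (auto simp: in_set_conv_nth)
    moreover have "set (take (length Us) Ks) \<subseteq> set Ks'" by (simp add: Ks'_def)
    ultimately show "set (take (length Us) Ks) \<subseteq> {\<zero>\<^bsub>completion w\<^esub>}" by blast
  qed
  have "S.Span ?K Us = carrier (completion w)"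
  proof
    show "S.Span ?K Us \<subseteq> carrier (completion w)" using S.Span_in_carrier[OF KC UsC] .
    show "carrier (completion w) \<subseteq> S.Span ?K Us"
    proof
      fix a assume "a \<in> carrier (completion w)"
      then obtain s where s: "a = ?\<phi> s" "cauchy_seq w s" unfolding carrier_completion[OF w] by auto
      have "\<forall>n. \<exists>q. w (s n - (\<Sum>i<local_dim w. of_rat (q i) * e i)) < 1 / (real n + 1)" using dense by simp
      from choice[OF this] obtain q where q: "\<forall>n. w (s n - (\<Sum>i<local_dim w. of_rat (q n i) * e i)) < 1 / (real n + 1)" ..
      have l0: "(\<lambda>n. 1 / (real n + 1)) \<longlonglongrightarrow> 0" using LIMSEQ_inverse_real_of_nat by (simp add: inverse_eq_divide add.commute)
      define ts where "ts = map (\<lambda>i n. of_rat (q n i) :: 'k) [0..<local_dim w]"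
      define y where "y n = (\<Sum>i<local_dim w. of_rat (q n i) * e i)" for n
      have nul: "(\<lambda>n. w (s n - y n)) \<longlonglongrightarrow> 0"
        by (rule tendsto_sandwich[OF _ _ tendsto_const l0])
          (use q in \<open>auto intro!: always_eventually av_nonneg[OF w] less_imp_le simp: y_def\<close>)
      have ycau: "cauchy_seq w y"
        using cauchy_seq_add[OF w s(2) cauchy_seq_uminus[OF w null_cauchy_seq[OF w nul]]] by simp
      have tcau: "cauchy_seq w (\<lambda>n. of_rat (q n i))" if i: "i < local_dim w" for i
        unfolding cauchy_seq_def
      proof (intro allI impI)
        fix d :: real assume "d > 0"
        hence "c * d > 0" using c by simp
        then obtain n0 where n0: "\<And>m n. m \<ge> n0 \<Longrightarrow> n \<ge> n0 \<Longrightarrow> w (y m - y n) < c * d" using ycau unfolding cauchy_seq_def by metis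
        have "w (of_rat (q m i) - of_rat (q n i)) < d" if "m \<ge> n0" "n \<ge> n0" for m n
        proof -
          have "w (of_rat (q m i) - of_rat (q n i)) = v (q m i - q n i)"
            using exts_rat[OF we, of "q m i - q n i"] by (simp add: of_rat_diff)
          also have "c * \<dots> \<le> c * (\<Sum>i<local_dim w. v (q m i - q n i))"
            using i c by (intro mult_left_mono member_le_sum[of i _ "\<lambda>i. v (q m i - q n i)"] av_nonneg[OF av]) auto
          also have "\<dots> \<le> w (\<Sum>i<local_dim w. of_rat (q m i - q n i) * e i)" by (rule ind)
          also have "(\<Sum>i<local_dim w. of_rat (q m i - q n i) * e i) = y m - y n"
            by (simp add: y_def of_rat_diff left_diff_distrib sum_subtractf)
          also have "w (y m - y n) < c * d" using n0 that by blast
          finally show ?thesis using c by simp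
        qed
        thus "\<exists>n0. \<forall>m\<ge>n0. \<forall>n\<ge>n0. w (of_rat (q m i) - of_rat (q n i)) < d" by blast
      qed
      have comb: "S.combine (map ?\<phi> ts) Us = ?\<phi> (\<lambda>n. \<Sum>i<local_dim w. (ts ! i) n * es ! i)"
      proof -
        have 1: "length ts = length es" by (simp add: ts_def les)
        have 2: "cauchy_seq w t" if "t \<in> set ts" for t using that tcau by (auto simp: ts_def)
        from combine_limit_class[OF w 1 2] show ?thesis unfolding Us_def les by (rule conjunct1)
      qed
      have "(\<lambda>n. \<Sum>i<local_dim w. (ts ! i) n * es ! i) = y"
        by (auto simp: ts_def nes y_def intro!: ext sum.cong)
      hence "S.combine (map ?\<phi> ts) Us = a"
        unfolding comb s(1) using limit_class_eq[OF w s(2) ycau] nul by simp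
      moreover have "set (map ?\<phi> ts) \<subseteq> ?K" unfolding rat_completion_image[OF w] using tcau by (auto simp: ts_def)
      moreover have "length (map ?\<phi> ts) = length Us" by (simp add: ts_def lUs)
      ultimately show "a \<in> S.Span ?K Us"
        unfolding S.Span_eq_combine_set_length_version[OF sf UsC] by blast
    qed
  qed
  hence dim: "S.dimension (local_dim w) ?K (carrier (completion w))"
    using S.dimension_independent[OF indep] lUs by simp
  thus ?thesis unfolding local_degree_def S.dim_def
    using S.dimension_is_inj[OF sf] by (intro the_equality) auto
qed

end

section \<open>Places and the product formula\<close>

text \<open>The definition uses the reduced fraction. Cross-multiplication with the given fraction
  shows that the difference of multiplicities is the same.\<close>

lemma padic_abs_frac:
  assumes p: "prime p" and ab: "a \<noteq> 0" "b \<noteq> 0"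
  shows "padic_abs p (of_int a / of_int b) = real p powi (int (multiplicity (int p) b) - int (multiplicity (int p) a))"
proof -
  define n d where "n = fst (quotient_of (of_int a / of_int b))" and "d = snd (quotient_of (of_int a / of_int b))"
  have q: "quotient_of (of_int a / of_int b) = (n, d)" by (simp add: n_def d_def)
  have d: "d > 0" using quotient_of_denom_pos[OF q] .
  have e: "(of_int a / of_int b :: rat) = of_int n / of_int d" using quotient_of_div[OF q] .
  hence "(of_int (a * d) :: rat) = of_int (n * b)" using ab d by (simp add: field_simps)
  hence ad: "a * d = n * b" by (simp only: of_int_eq_iff)
  have n: "n \<noteq> 0" using ad ab d by auto
  have pe: "prime_elem (int p)" using p by simp
  have "multiplicity (int p) a + multiplicity (int p) d = multiplicity (int p) n + multiplicity (int p) b"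
    using prime_elem_multiplicity_mult_distrib[OF pe, of a d] prime_elem_multiplicity_mult_distrib[OF pe, of n b] ab n d ad by simp
  hence "int (multiplicity (int p) d) - int (multiplicity (int p) n) = int (multiplicity (int p) b) - int (multiplicity (int p) a)"
    by linarith
  moreover have "(of_int a / of_int b :: rat) \<noteq> 0" using ab by simp
  ultimately show ?thesis by (simp add: padic_abs_def q)
qed

lemma rat_frac: obtains a b where "b \<noteq> 0" "q = (of_int a / of_int b :: rat)"
  using quotient_of_div[of q] quotient_of_denom_pos[of q] by (metis less_irrefl surj_pair)

lemma padic_abs_zero [simp]: "padic_abs p 0 = 0" by (simp add: padic_abs_def)

lemma padic_abs_pos: "prime p \<Longrightarrow> q \<noteq> 0 \<Longrightarrow> padic_abs p q > 0"
  using prime_gt_0_nat[of p] by (simp add: padic_abs_def)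

lemma padic_abs_nonneg: "prime p \<Longrightarrow> padic_abs p q \<ge> 0"
  using padic_abs_pos[of p q] by (cases "q = 0") (auto intro: less_imp_le)

lemma padic_abs_mult:
  assumes p: "prime p" shows "padic_abs p (x * y) = padic_abs p x * padic_abs p y"
proof (cases "x = 0 \<or> y = 0")
  case False
  obtain a b where ab: "b \<noteq> 0" "x = of_int a / of_int b" by (rule rat_frac)
  obtain c d where cd: "d \<noteq> 0" "y = of_int c / of_int d" by (rule rat_frac)
  have nz: "a \<noteq> 0" "c \<noteq> 0" using False ab cd by auto
  have xy: "x * y = of_int (a * c) / of_int (b * d)" by (simp add: ab cd)
  have pe: "prime_elem (int p)" using p by simp
  have p0: "real p \<noteq> 0" using p prime_gt_0_nat by auto
  let ?M = "multiplicity (int p)"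
  have "padic_abs p (x * y) = real p powi (int (?M (b * d)) - int (?M (a * c)))"
    unfolding xy using nz ab(1) cd(1) by (intro padic_abs_frac[OF p]) auto
  moreover have "padic_abs p x = real p powi (int (?M b) - int (?M a))"
    unfolding ab(2) using nz ab(1) by (intro padic_abs_frac[OF p])
  moreover have "padic_abs p y = real p powi (int (?M d) - int (?M c))"
    unfolding cd(2) using nz cd(1) by (intro padic_abs_frac[OF p])
  moreover have "int (?M (b * d)) - int (?M (a * c)) = (int (?M b) - int (?M a)) + (int (?M d) - int (?M c))"
    using nz ab(1) cd(1) by (simp add: prime_elem_multiplicity_mult_distrib[OF pe])
  ultimately show ?thesis using p0 by (simp only: power_int_add simp_thms)
qed auto

lemma padic_abs_ultra:
  assumes p: "prime p" shows "padic_abs p (x + y) \<le> max (padic_abs p x) (padic_abs p y)"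
proof (cases "x = 0 \<or> y = 0 \<or> x + y = 0")
  case True
  thus ?thesis using padic_abs_nonneg[OF p, of x] padic_abs_nonneg[OF p, of y] by auto
next
  case False
  obtain a b where ab: "b \<noteq> 0" "x = of_int a / of_int b" by (rule rat_frac)
  obtain c d where cd: "d \<noteq> 0" "y = of_int c / of_int d" by (rule rat_frac)
  define m where "m = b * d"
  have m: "m \<noteq> 0" using ab cd by (simp add: m_def)
  define a' c' where "a' = a * d" and "c' = c * b"
  have x: "x = of_int a' / of_int m" and y: "y = of_int c' / of_int m" using ab cd by (simp_all add: a'_def c'_def m_def)
  have xy: "x + y = of_int (a' + c') / of_int m" by (simp add: x y add_divide_distrib)
  have nz: "a' \<noteq> 0" "c' \<noteq> 0" "a' + c' \<noteq> 0" using False unfolding x y xy by (auto simp: add_divide_distrib[symmetric] simp flip: of_int_add)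
  let ?M = "multiplicity (int p)"
  have "\<not> is_unit (int p)" using p prime_gt_1_nat[of p] by simp
  moreover have "int p ^ min (?M a') (?M c') dvd a' + c'"
    by (intro dvd_add dvd_trans[OF le_imp_power_dvd multiplicity_dvd]) auto
  ultimately have "min (?M a') (?M c') \<le> ?M (a' + c')" using nz(3) by (intro multiplicity_geI) auto
  hence "int (?M m) - int (?M (a' + c')) \<le> max (int (?M m) - int (?M a')) (int (?M m) - int (?M c'))" by linarith
  hence "real p powi (int (?M m) - int (?M (a' + c'))) \<le> real p powi (max (int (?M m) - int (?M a')) (int (?M m) - int (?M c')))"
    using p prime_gt_1_nat[of p] by (intro power_int_increasing) auto
  thus ?thesis unfolding x y xy[unfolded x y] padic_abs_frac[OF p nz(1) m] padic_abs_frac[OF p nz(2) m] padic_abs_frac[OF p nz(3) m]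
    by (auto simp: max_def split: if_splits)
qed

lemma padic_abs_av: assumes p: "prime p" shows "absolute_value (padic_abs p)"
  unfolding absolute_value_def
proof (intro conjI allI)
  fix x y
  show "padic_abs p (x + y) \<le> padic_abs p x + padic_abs p y"
    using padic_abs_ultra[OF p, of x y] padic_abs_nonneg[OF p, of x] padic_abs_nonneg[OF p, of y] by linarith
  show "padic_abs p x = 0 \<longleftrightarrow> x = 0" using padic_abs_pos[OF p, of x] by (cases "x = 0") auto
qed (auto simp: padic_abs_nonneg[OF p] padic_abs_mult[OF p])

lemma padic_abs_of_int: assumes p: "prime p" shows "padic_abs p (of_int n) \<le> 1"
proof (cases "n = 0")
  case False
  have "real p powi (- int (multiplicity (int p) n)) \<le> real p powi 0"
    using p prime_gt_1_nat[of p] by (intro power_int_increasing) auto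
  thus ?thesis using padic_abs_frac[OF p False, of 1] by simp
qed simp

lemma padic_abs_self: assumes p: "prime p" shows "padic_abs p (of_nat p) = 1 / real p"
  using padic_abs_frac[OF p, of "int p" 1] p prime_gt_0_nat[OF p]
  by (simp add: power_int_minus inverse_eq_divide)

text \<open>The index \<open>0\<close> stands for the infinite place of the rationals.\<close>
definition rat_abs_at :: "nat \<Rightarrow> rat \<Rightarrow> real" where
  "rat_abs_at p = (if p = 0 then (\<lambda>q. \<bar>real_of_rat q\<bar>) else padic_abs p)"

section \<open>Places of the field above a place of the rationals\<close>

abbreviation qplace :: "nat \<Rightarrow> bool" where "qplace p \<equiv> p = 0 \<or> prime p"

lemma rat_abs_rat_abs_at: "qplace p \<Longrightarrow> rat_abs (rat_abs_at p)"
proof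
  assume p: "qplace p"
  show "absolute_value (rat_abs_at p)"
  proof (cases "p = 0")
    case True
    thus ?thesis unfolding absolute_value_def rat_abs_at_def
      by (auto simp: of_rat_mult abs_mult of_rat_add[symmetric] of_rat_less_eq abs_triangle_ineq)
  next
    case False thus ?thesis using p padic_abs_av by (simp add: rat_abs_at_def)
  qed
  note av = this
  show "\<exists>q. 1 < rat_abs_at p q"
  proof (cases "p = 0")
    case True thus ?thesis by (intro exI[of _ 2]) (simp add: rat_abs_at_def)
  next
    case False
    hence pp: "prime p" using p by simp
    have "rat_abs_at p (inverse (of_nat p)) = real p"
      using av_inverse[OF av, of "of_nat p"] padic_abs_self[OF pp] False by (simp add: rat_abs_at_def)
    thus ?thesis using prime_gt_1_nat[OF pp] by (intro exI[of _ "inverse (of_nat p)"]) simp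
  qed
qed

lemma rat_abs_at_prime: "prime p \<Longrightarrow> rat_abs_at p = padic_abs p"
  by (auto simp: rat_abs_at_def)

abbreviation qexts :: "nat \<Rightarrow> ('k::number_field \<Rightarrow> real) set" where
  "qexts p \<equiv> rat_abs.exts (rat_abs_at p)"

lemma qexts_iff: "qplace p \<Longrightarrow> w \<in> qexts p \<longleftrightarrow> absolute_value w \<and> (\<forall>q. w (of_rat q) = rat_abs_at p q)"
  using rat_abs.exts_def[OF rat_abs_rat_abs_at, of p, where 'k='a] by blast

lemma qextsI: "qplace p \<Longrightarrow> absolute_value w \<Longrightarrow> (\<And>q. w (of_rat q) = rat_abs_at p q) \<Longrightarrow> w \<in> qexts p"
  using qexts_iff by blast

lemma qexts_rat: "qplace p \<Longrightarrow> w \<in> qexts p \<Longrightarrow> w (of_rat q) = rat_abs_at p q"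
  using qexts_iff by blast

lemma qexts_av: "qplace p \<Longrightarrow> w \<in> qexts p \<Longrightarrow> absolute_value w"
  using qexts_iff by blast

lemma places_qexts: "(places :: ('k::number_field \<Rightarrow> real) set) = (\<Union>p\<in>{p. qplace p}. qexts p)"
proof (intro equalityI subsetI)
  fix w :: "'k \<Rightarrow> real" assume "w \<in> places"
  hence w: "absolute_value w" "archimedean w \<or> (\<exists>p. prime p \<and> (\<forall>q. w (of_rat q) = padic_abs p q))"
    by (auto simp: places_def)
  show "w \<in> (\<Union>p\<in>{p. qplace p}. qexts p)"
  proof (cases "archimedean w")
    case True
    hence "w \<in> qexts 0" using w by (intro qextsI) (auto simp: archimedean_def rat_abs_at_def)
    thus ?thesis by auto
  next
    case False
    then obtain p where "prime p" "\<forall>q. w (of_rat q) = padic_abs p q" using w by auto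
    hence "w \<in> qexts p" using w by (intro qextsI) (auto simp: rat_abs_at_prime)
    thus ?thesis using \<open>prime p\<close> by auto
  qed
next
  fix w :: "'k \<Rightarrow> real" assume "w \<in> (\<Union>p\<in>{p. qplace p}. qexts p)"
  then obtain p where p: "qplace p" "w \<in> qexts p" by auto
  hence "absolute_value w" "\<forall>q. w (of_rat q) = rat_abs_at p q" by (auto simp: qexts_iff)
  thus "w \<in> places" using p(1) unfolding places_def archimedean_def
    by (cases "p = 0") (auto simp: rat_abs_at_def)
qed

lemma place_av: "w \<in> places \<Longrightarrow> absolute_value w"
  by (simp add: places_def)

lemma archimedean_iff: assumes "qplace p" "w \<in> qexts p" shows "archimedean w \<longleftrightarrow> p = 0"
proof
  assume a: "archimedean w"
  show "p = 0"
  proof (rule ccontr)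
    assume "p \<noteq> 0"
    hence p: "prime p" using assms by simp
    have "w (of_rat 2) = padic_abs p 2" using qexts_rat[OF assms, of 2] rat_abs_at_prime[OF p] by metis
    moreover have "w (of_rat 2) = 2" using a unfolding archimedean_def by (metis abs_numeral of_rat_numeral_eq)
    ultimately show False using padic_abs_of_int[OF p, of 2] by simp
  qed
next
  assume "p = 0" thus "archimedean w" using qexts_rat[OF assms] unfolding archimedean_def rat_abs_at_def by metis
qed

text \<open>An archimedean place lies only above 0. For distinct primes, the number \<open>p\<close>
  has p-adic value \<open>1 / p\<close> and q-adic value 1.\<close>

lemma qexts_disjoint: assumes "qplace p" "qplace q" "p \<noteq> q" shows "qexts p \<inter> qexts q = {}"
proof (rule ccontr)
  assume "qexts p \<inter> qexts q \<noteq> ({} :: ('a \<Rightarrow> real) set)"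
  then obtain w :: "'a \<Rightarrow> real" where w: "w \<in> qexts p" "w \<in> qexts q" by auto
  hence nz: "p \<noteq> 0" "q \<noteq> 0" using archimedean_iff[OF assms(1) w(1)] archimedean_iff[OF assms(2) w(2)] assms(3) by auto
  hence pq: "prime p" "prime q" using assms by auto
  have "w (of_rat (of_nat p)) = padic_abs p (of_nat p)" "w (of_rat (of_nat p)) = padic_abs q (of_nat p)"
    using qexts_rat[OF assms(1) w(1), of "of_nat p"] qexts_rat[OF assms(2) w(2), of "of_nat p"] rat_abs_at_prime pq by metis+
  hence "padic_abs q (of_nat p) = 1 / real p" using padic_abs_self[OF pq(1)] by simp
  moreover have "\<not> q dvd p" using primes_dvd_imp_eq[OF pq(2,1)] assms(3) by auto
  hence "multiplicity (int q) (int p) = 0" by (intro not_dvd_imp_multiplicity_0) simp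
  hence "padic_abs q (of_nat p) = 1" using padic_abs_frac[OF pq(2), of "int p" 1] nz by simp
  ultimately show False using prime_gt_1_nat[OF pq(1)] by simp
qed

lemma finite_qexts: "qplace p \<Longrightarrow> finite (qexts p)"
  by (rule rat_abs.finite_exts[OF rat_abs_rat_abs_at])

lemma sum_local_degree: "qplace p \<Longrightarrow> (\<Sum>w\<in>(qexts p :: ('k::number_field \<Rightarrow> real) set). local_degree w) = degree_K TYPE('k)"
  using rat_abs.sum_local_dim[OF rat_abs_rat_abs_at, of p, where 'k='k] rat_abs.local_degree_eq[OF rat_abs_rat_abs_at, of p, where 'k='k] by simp

lemma local_degree_pos: assumes "w \<in> places" shows "local_degree w > 0"
proof -
  obtain p where "qplace p" "w \<in> qexts p" using assms unfolding places_qexts by auto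
  thus ?thesis using rat_abs.local_dim_pos[OF rat_abs_rat_abs_at, of p w] rat_abs.local_degree_eq[OF rat_abs_rat_abs_at, of p w] by simp
qed

lemma local_norm: "qplace p \<Longrightarrow> a \<noteq> 0 \<Longrightarrow> (\<Prod>w\<in>qexts p. w a ^ local_degree w) = rat_abs_at p (field_norm (a::'k::number_field))"
  using rat_abs.local_norm_formula[OF rat_abs_rat_abs_at, of p a] rat_abs.local_degree_eq[OF rat_abs_rat_abs_at, of p, where 'k='k] by simp

section \<open>The product formula\<close>

lemma prime_int_image: "prime_factors (n :: int) \<subseteq> int ` S" if "\<And>p. prime p \<Longrightarrow> int p dvd n \<Longrightarrow> p \<in> S"
proof
  fix x assume "x \<in> prime_factors n"
  hence x: "prime x" "x dvd n" by auto
  hence "int (nat x) = x" using prime_ge_0_int[OF x(1)] by simp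
  moreover have "prime (nat x)" using x(1) prime_int_nat_transfer by blast
  ultimately show "x \<in> int ` S" using that[of "nat x"] x(2) by (metis imageI)
qed

lemma abs_int_prod:
  assumes n: "n \<noteq> (0::int)" and S: "finite S" "\<And>p. p \<in> S \<Longrightarrow> prime p" "\<And>p. prime p \<Longrightarrow> int p dvd n \<Longrightarrow> p \<in> S"
  shows "real_of_int \<bar>n\<bar> = (\<Prod>p\<in>S. real p ^ multiplicity (int p) n)"
proof -
  have "\<bar>n\<bar> = (\<Prod>p\<in>prime_factors n. p ^ multiplicity p n)" using prod_prime_factors[OF n] by simp
  also have "\<dots> = (\<Prod>p\<in>int ` S. p ^ multiplicity p n)"
  proof (rule prod.mono_neutral_left)
    show "prime_factors n \<subseteq> int ` S" using S(3) by (rule prime_int_image)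
    show "\<forall>i\<in>int ` S - prime_factors n. i ^ multiplicity i n = 1"
      using n S(2) by (auto simp: prime_factors_multiplicity)
  qed (use S in auto)
  also have "\<dots> = (\<Prod>p\<in>S. int p ^ multiplicity (int p) n)" by (subst prod.reindex) auto
  finally have "\<bar>n\<bar> = (\<Prod>p\<in>S. int p ^ multiplicity (int p) n)" .
  hence "real_of_int \<bar>n\<bar> = real_of_int (\<Prod>p\<in>S. int p ^ multiplicity (int p) n)" by simp
  thus ?thesis by simp
qed

lemma finite_prime_dvd: "n \<noteq> (0::int) \<Longrightarrow> finite {p. prime p \<and> int p dvd n}"
  by (rule finite_subset[of _ "{..nat \<bar>n\<bar>}"]) (auto dest!: dvd_imp_le_int simp: nat_le_iff)

lemma padic_abs_eq_1_finite: assumes "q \<noteq> 0" shows "finite {p. prime p \<and> padic_abs p q \<noteq> 1}"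
proof -
  obtain a b where ab: "b \<noteq> 0" "q = of_int a / of_int b" by (rule rat_frac)
  hence a: "a \<noteq> 0" using assms by auto
  have "{p. prime p \<and> padic_abs p q \<noteq> 1} \<subseteq> {p. prime p \<and> int p dvd a} \<union> {p. prime p \<and> int p dvd b}"
  proof (rule subsetI, rule ccontr)
    fix p assume p: "p \<in> {p. prime p \<and> padic_abs p q \<noteq> 1}" "p \<notin> {p. prime p \<and> int p dvd a} \<union> {p. prime p \<and> int p dvd b}"
    hence "multiplicity (int p) a = 0" "multiplicity (int p) b = 0" by (auto intro: not_dvd_imp_multiplicity_0)
    thus False using p padic_abs_frac[of p a b] a ab by simp
  qed
  thus ?thesis using finite_prime_dvd[OF a] finite_prime_dvd[OF ab(1)] by (meson finite_UnI finite_subset)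
qed

lemma rat_product_formula:
  assumes q: "q \<noteq> 0" and S: "finite S" "{p. qplace p \<and> rat_abs_at p q \<noteq> 1} \<subseteq> S" "S \<subseteq> {p. qplace p}"
  shows "(\<Prod>p\<in>S. rat_abs_at p q) = 1"
proof -
  obtain a b where ab: "b \<noteq> 0" "q = of_int a / of_int b" by (rule rat_frac)
  hence a: "a \<noteq> 0" using q by auto
  define T where "T = {p. prime p \<and> int p dvd a} \<union> {p. prime p \<and> int p dvd b} \<union> (S - {0})"
  have fT: "finite T" using finite_prime_dvd[OF a] finite_prime_dvd[OF ab(1)] S(1) by (simp add: T_def)
  have Tp: "prime p" if "p \<in> T" for p using that S(3) by (auto simp: T_def)
  have T0: "0 \<notin> T" using Tp by fastforce
  have "(\<Prod>p\<in>S. rat_abs_at p q) = (\<Prod>p\<in>insert 0 T. rat_abs_at p q)"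
  proof (rule prod.mono_neutral_left)
    show "S \<subseteq> insert 0 T" by (auto simp: T_def)
    show "\<forall>p\<in>insert 0 T - S. rat_abs_at p q = 1" using S(2) Tp by blast
  qed (use fT in auto)
  also have "\<dots> = rat_abs_at 0 q * (\<Prod>p\<in>T. rat_abs_at p q)" by (rule prod.insert[OF fT T0])
  also have "(\<Prod>p\<in>T. rat_abs_at p q) = (\<Prod>p\<in>T. padic_abs p q)" by (intro prod.cong refl) (simp add: rat_abs_at_prime Tp)
  also have "rat_abs_at 0 q = \<bar>real_of_rat q\<bar>" unfolding rat_abs_at_def by simp
  also have "(\<Prod>p\<in>T. padic_abs p q) = (\<Prod>p\<in>T. real p ^ multiplicity (int p) b / real p ^ multiplicity (int p) a)"
  proof (rule prod.cong[OF refl])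
    fix p assume "p \<in> T"
    hence p: "prime p" "real p \<noteq> 0" using Tp prime_gt_0_nat by auto
    show "padic_abs p q = real p ^ multiplicity (int p) b / real p ^ multiplicity (int p) a"
      unfolding ab(2) padic_abs_frac[OF p(1) a ab(1)] using p(2) by (simp add: power_int_diff)
  qed
  also have "\<dots> = real_of_int \<bar>b\<bar> / real_of_int \<bar>a\<bar>"
    unfolding prod_dividef using abs_int_prod[OF a fT Tp] abs_int_prod[OF ab(1) fT Tp] by (simp add: T_def)
  also have "\<bar>real_of_rat q\<bar> = real_of_int \<bar>a\<bar> / real_of_int \<bar>b\<bar>" unfolding ab(2) by (simp add: of_rat_divide)
  finally show ?thesis using a ab(1) by simp
qed

text \<open>Integers being small, the binomial formula bounds \<open>w (x + y) ^ n\<close> by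
  \<open>n + 1\<close> times the \<open>n\<close>-th power of the maximum. By Bernoulli's inequality
  \<open>n + 1\<close> grows no faster than a multiple of \<open>(1 + e) ^ n\<close>, for every
  positive \<open>e\<close>.\<close>

lemma av_ultrametric:
  assumes w: "absolute_value w" and nat: "\<And>n. w (of_nat n) \<le> 1"
  shows "w (x + y) \<le> max (w x) (w y)"
proof (cases "x = 0 \<and> y = 0")
  case True thus ?thesis by (simp add: av_zero[OF w])
next
  case False
  define M where "M = max (w x) (w y)"
  have M: "M > 0" using False av_pos[OF w, of x] av_pos[OF w, of y] by (auto simp: M_def less_max_iff_disj)
  have b: "w (x + y) ^ n \<le> (real n + 1) * M ^ n" for n
  proof -
    have "w (x + y) ^ n = w (\<Sum>k\<le>n. of_nat (n choose k) * x ^ k * y ^ (n - k))"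
      by (simp add: av_power[OF w, symmetric] binomial_ring)
    also have "\<dots> \<le> (\<Sum>k\<le>n. w (of_nat (n choose k) * x ^ k * y ^ (n - k)))" by (rule av_sum[OF w])
    also have "\<dots> \<le> (\<Sum>k\<le>n. M ^ n)"
    proof (rule sum_mono)
      fix k assume k: "k \<in> {..n}"
      have "w (of_nat (n choose k) * x ^ k * y ^ (n - k)) \<le> 1 * M ^ k * M ^ (n - k)"
        unfolding av_mult[OF w] av_power[OF w]
        by (intro mult_mono power_mono nat) (auto simp: M_def intro!: av_nonneg[OF w] mult_nonneg_nonneg zero_le_power le_max_iff_disj[THEN iffD2] disjI1)
      thus "w (of_nat (n choose k) * x ^ k * y ^ (n - k)) \<le> M ^ n" using k by (simp add: power_add[symmetric])
    qed
    finally show ?thesis by (simp add: add.commute)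
  qed
  have "w (x + y) \<le> M * (1 + e)" if e: "e > 0" for e
  proof (rule power_growth_le[of 1 _ "1 / e + 1"])
    fix n
    have "real n + 1 \<le> (1 / e + 1) * (1 + real n * e)" using e by (simp add: field_simps)
    also have "\<dots> \<le> (1 / e + 1) * (1 + e) ^ n"
      using e Bernoulli_inequality[of e n] by (intro mult_left_mono) auto
    finally have "(real n + 1) * M ^ n \<le> (1 / e + 1) * (1 + e) ^ n * M ^ n" using M by (intro mult_right_mono) auto
    thus "1 * w (x + y) ^ n \<le> (1 / e + 1) * (M * (1 + e)) ^ n"
      using b[of n] by (simp add: power_mult_distrib mult_ac)
  qed (use M e in auto)
  hence "w (x + y) / M \<le> 1 + e" if "e > 0" for e using that M by (simp add: pos_divide_le_eq mult.commute)
  hence "w (x + y) / M \<le> 1" by (rule field_le_epsilon)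
  thus ?thesis using M by (simp add: M_def[symmetric] field_simps)
qed

lemma nonarch_of_int:
  assumes "w \<in> places" "\<not> archimedean w" shows "w (of_int n) \<le> 1"
proof -
  obtain p where p: "qplace p" "w \<in> qexts p" using assms unfolding places_qexts by auto
  hence pp: "prime p" using archimedean_iff assms by metis
  have "w (of_rat (of_int n)) = padic_abs p (of_int n)" using qexts_rat[OF p, of "of_int n"] rat_abs_at_prime[OF pp] by metis
  thus ?thesis using padic_abs_of_int[OF pp, of n] by simp
qed

lemma nonarch_add:
  assumes "w \<in> places" "\<not> archimedean w" shows "w (x + y) \<le> max (w x) (w y)"
  by (rule av_ultrametric[OF place_av[OF assms(1)]]) (use nonarch_of_int[OF assms, of "int _"] in simp)

lemma nonarch_sum:
  assumes "w \<in> places" "\<not> archimedean w" and "\<And>i. i \<in> I \<Longrightarrow> w (f i) \<le> B" "B \<ge> 0"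
  shows "w (\<Sum>i\<in>I. f i) \<le> B"
  using assms(3)
proof (induction I rule: infinite_finite_induct)
  case (insert i I)
  thus ?case using nonarch_add[OF assms(1,2), of "f i" "sum f I"] by force
qed (simp_all add: av_zero[OF place_av[OF assms(1)]] assms(4))

text \<open>Outside finitely many primes the structure constants of the basis and the coordinates of
  \<open>a\<close> have absolute value at most 1. Then the maximum \<open>M\<close> over the basis
  satisfies \<open>M * M \<le> M\<close>, hence \<open>M \<le> 1\<close>.\<close>

lemma almost_all_le_1:
  "\<exists>S. finite S \<and> (\<forall>p. prime p \<longrightarrow> p \<notin> S \<longrightarrow> (\<forall>w\<in>qexts p. w (a :: 'k::number_field) \<le> 1))"
proof -
  let ?n = "degree_K TYPE('k)"
  define Q where "Q = (\<lambda>(i, j, k). coord (qbasis i * qbasis j :: 'k) k) ` ({..<?n} \<times> {..<?n} \<times> {..<?n}) \<union> coord a ` {..<?n} - {0}"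
  define S where "S = (\<Union>q\<in>Q. {p. prime p \<and> padic_abs p q \<noteq> 1})"
  have "finite Q" unfolding Q_def by auto
  hence fS: "finite S" unfolding S_def using padic_abs_eq_1_finite by (auto simp: Q_def)
  moreover have "w a \<le> 1" if p: "prime p" "p \<notin> S" and w: "w \<in> qexts p" for p and w :: "'k \<Rightarrow> real"
  proof -
    have wp: "w \<in> places" using w p unfolding places_qexts by auto
    note wa = place_av[OF wp]
    have na: "\<not> archimedean w" using archimedean_iff[of p w] p w by auto
    have rat: "w (of_rat q) = padic_abs p q" for q using qexts_rat[OF _ w, of q] rat_abs_at_prime[OF p(1)] p(1) by metis
    have Qle: "padic_abs p q \<le> 1" if "q \<in> insert 0 Q" for q using that p unfolding S_def by auto
    define M where "M = Max ((\<lambda>i. w (qbasis i)) ` {..<?n})"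
    have ne: "{..<?n} \<noteq> {}" using degree_pos[where 'k='k] by auto
    have Mle: "w (qbasis i) \<le> M" if "i < ?n" for i unfolding M_def using that by (intro Max_ge) auto
    have "M \<in> (\<lambda>i. w (qbasis i)) ` {..<?n}" unfolding M_def using ne by (intro Max_in) auto
    then obtain i where i: "i < ?n" "M = w (qbasis i)" by auto
    have M0: "M \<ge> 0" using i av_nonneg[OF wa] by simp
    have "w (qbasis i * qbasis i) \<le> M"
    proof (subst coord_expand, rule nonarch_sum[OF wp na _ M0])
      fix k assume k: "k \<in> {..<?n}"
      have "coord (qbasis i * qbasis i :: 'k) k \<in> insert 0 Q"
      proof -
        have "coord (qbasis i * qbasis i :: 'k) k \<in> (\<lambda>(i, j, k). coord (qbasis i * qbasis j :: 'k) k) ` ({..<?n} \<times> {..<?n} \<times> {..<?n})"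
          by (rule image_eqI[of _ _ "(i, i, k)"]) (use i k in auto)
        thus ?thesis unfolding Q_def by blast
      qed
      hence "padic_abs p (coord (qbasis i * qbasis i :: 'k) k) * w (qbasis k) \<le> 1 * M"
        using k by (intro mult_mono Qle Mle av_nonneg[OF wa]) auto
      thus "w (of_rat (coord (qbasis i * qbasis i :: 'k) k) * qbasis k) \<le> M" by (simp add: av_mult[OF wa] rat)
    qed
    hence "M * M \<le> M" using i by (simp add: av_mult[OF wa])
    hence M1: "M \<le> 1" using M0 by (metis mult_le_cancel_left_pos mult.right_neutral order_le_less zero_le_one)
    show "w a \<le> 1"
    proof (subst coord_expand, rule nonarch_sum[OF wp na])
      fix k assume k: "k \<in> {..<?n}"
      have "coord a k \<in> insert 0 Q" unfolding Q_def using k by blast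
      hence "padic_abs p (coord a k) * w (qbasis k) \<le> 1 * 1"
        using k M1 by (intro mult_mono Qle order_trans[OF Mle] av_nonneg[OF wa]) auto
      thus "w (of_rat (coord a k) * qbasis k) \<le> 1" by (simp add: av_mult[OF wa] rat)
    qed simp
  qed
  ultimately show ?thesis by blast
qed

text \<open>The bound by 1 is applied to \<open>a\<close> and to its inverse; above each exceptional
  rational place there are only finitely many places.\<close>

lemma finite_places_neq_1: assumes "a \<noteq> (0 :: 'k::number_field)" shows "finite {w \<in> places. w a \<noteq> 1}"
proof -
  obtain S where S: "finite S" "\<And>p w. prime p \<Longrightarrow> p \<notin> S \<Longrightarrow> w \<in> qexts p \<Longrightarrow> w a \<le> 1"
    using almost_all_le_1[of a] by blast
  obtain T where T: "finite T" "\<And>p w. prime p \<Longrightarrow> p \<notin> T \<Longrightarrow> w \<in> qexts p \<Longrightarrow> w (inverse a) \<le> 1"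
    using almost_all_le_1[of "inverse a"] by blast
  have "{w \<in> places. w a \<noteq> 1} \<subseteq> (\<Union>p\<in>insert 0 (S \<union> T) \<inter> {p. qplace p}. qexts p)"
  proof
    fix w assume "w \<in> {w \<in> places. w a \<noteq> 1}"
    then obtain p where p: "qplace p" "w \<in> qexts p" "w a \<noteq> 1" unfolding places_qexts by auto
    have wa: "absolute_value w" using p by (simp add: qexts_iff)
    have "p \<in> insert 0 (S \<union> T)"
    proof (rule ccontr)
      assume n: "p \<notin> insert 0 (S \<union> T)"
      hence "w a \<le> 1" "w (inverse a) \<le> 1" using S(2)[of p w] T(2)[of p w] p by auto
      hence "w a = 1" using av_pos[OF wa assms] by (simp add: av_inverse[OF wa] inverse_le_1_iff)
      thus False using p by simp
    qed
    thus "w \<in> (\<Union>p\<in>insert 0 (S \<union> T) \<inter> {p. qplace p}. qexts p)" using p by auto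
  qed
  moreover have "finite (\<Union>p\<in>insert 0 (S \<union> T) \<inter> {p. qplace p}. (qexts p :: ('k \<Rightarrow> real) set))"
    using S(1) T(1) finite_qexts by auto
  ultimately show ?thesis by (rule finite_subset)
qed

text \<open>Grouping the places by the rational place below turns each group into an absolute value
  of \<open>field_norm a\<close>, and the formula over the rationals applies. The set
  \<open>S\<close> is finite because it lies in the image of the nontrivial places.\<close>

theorem product_formula:
  assumes a: "a \<noteq> (0 :: 'k::number_field)"
  shows "(\<Prod>w | w \<in> places \<and> w a \<noteq> 1. w a ^ local_degree w) = 1"
proof -
  let ?B = "{w \<in> places. w a \<noteq> 1}"
  have fB: "finite ?B" by (rule finite_places_neq_1[OF a])
  define S where "S = {p. qplace p \<and> (\<exists>w\<in>qexts p. w a \<noteq> 1)}"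
  have "\<forall>w\<in>?B. \<exists>p. qplace p \<and> w \<in> qexts p" unfolding places_qexts by auto
  from bchoice[OF this] obtain f where f: "\<forall>w\<in>?B. qplace (f w) \<and> w \<in> qexts (f w)" ..
  have "S \<subseteq> f ` ?B"
  proof
    fix p assume "p \<in> S"
    then obtain w where w: "qplace p" "w \<in> qexts p" "w a \<noteq> 1" unfolding S_def by auto
    hence wB: "w \<in> ?B" unfolding places_qexts by auto
    have "f w = p" using qexts_disjoint[of "f w" p, where 'a='k] f wB w by blast
    thus "p \<in> f ` ?B" using wB by blast
  qed
  hence fS: "finite S" using fB by (meson finite_imageI finite_subset)
  have "(\<Prod>w\<in>?B. w a ^ local_degree w) = (\<Prod>w\<in>(\<Union>p\<in>S. qexts p). w a ^ local_degree w)"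
  proof (rule prod.mono_neutral_left)
    show "finite (\<Union>p\<in>S. (qexts p :: ('k \<Rightarrow> real) set))" using fS finite_qexts by (auto simp: S_def)
    show "?B \<subseteq> (\<Union>p\<in>S. qexts p)" unfolding places_qexts S_def by auto
    show "\<forall>w\<in>(\<Union>p\<in>S. qexts p) - ?B. w a ^ local_degree w = 1" unfolding places_qexts S_def by auto
  qed
  also have "\<dots> = (\<Prod>p\<in>S. \<Prod>w\<in>qexts p. w a ^ local_degree w)"
    by (rule prod.UNION_disjoint) (use fS finite_qexts qexts_disjoint in \<open>auto simp: S_def\<close>)
  also have "\<dots> = (\<Prod>p\<in>S. rat_abs_at p (field_norm a))"
    by (rule prod.cong) (auto simp: local_norm a S_def)
  also have "\<dots> = 1"
  proof (rule rat_product_formula[OF field_norm_nonzero[OF a] fS])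
    show "{p. qplace p \<and> rat_abs_at p (field_norm a) \<noteq> 1} \<subseteq> S"
    proof (rule subsetI, rule ccontr)
      fix p assume p: "p \<in> {p. qplace p \<and> rat_abs_at p (field_norm a) \<noteq> 1}" "p \<notin> S"
      hence "\<forall>w\<in>(qexts p :: ('k \<Rightarrow> real) set). w a ^ local_degree w = 1" by (auto simp: S_def)
      hence "(\<Prod>w\<in>(qexts p :: ('k \<Rightarrow> real) set). w a ^ local_degree w) = 1" by (rule prod.neutral)
      thus False using local_norm[of p a] a p by auto
    qed
  qed (auto simp: S_def)
  finally show ?thesis .
qed

section \<open>Heights as products over the places\<close>

definition local_exponent :: "('k::number_field \<Rightarrow> real) \<Rightarrow> real" where
  "local_exponent w = real (local_degree w) / real (degree_K TYPE('k))"

text \<open>The functions of a place whose weighted product over all places is finite; \<open>global_height\<close> is that product.\<close>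
definition adelic :: "(('k::number_field \<Rightarrow> real) \<Rightarrow> real) \<Rightarrow> bool" where
  "adelic g \<longleftrightarrow> (\<forall>w\<in>places. g w > 0) \<and> finite {w \<in> places. g w \<noteq> 1}"

definition global_height :: "(('k::number_field \<Rightarrow> real) \<Rightarrow> real) \<Rightarrow> real" where
  "global_height g = (\<Prod>w | w \<in> places \<and> g w \<noteq> 1. g w powr local_exponent w)"

lemma local_exponent_pos: "w \<in> places \<Longrightarrow> local_exponent w > 0"
  unfolding local_exponent_def using local_degree_pos degree_pos by (intro divide_pos_pos) auto

lemma adelic_pos: "adelic g \<Longrightarrow> w \<in> places \<Longrightarrow> g w > 0"
  by (simp add: adelic_def)

lemma global_height_superset:
  assumes "finite T" "T \<subseteq> places" "{w \<in> places. g w \<noteq> 1} \<subseteq> T"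
  shows "global_height g = (\<Prod>w\<in>T. g w powr local_exponent w)"
  unfolding global_height_def by (rule prod.mono_neutral_left) (use assms in auto)

lemma adelic_one: "adelic (\<lambda>_. 1)" by (simp add: adelic_def)

lemma global_height_one: "global_height (\<lambda>_. 1) = 1" by (simp add: global_height_def)

lemma adelic_mult: assumes "adelic g" "adelic h" shows "adelic (\<lambda>w. g w * h w)"
proof -
  have "{w \<in> places. g w * h w \<noteq> 1} \<subseteq> {w \<in> places. g w \<noteq> 1} \<union> {w \<in> places. h w \<noteq> 1}" by auto
  thus ?thesis using assms unfolding adelic_def by (auto intro: finite_subset)
qed

lemma global_height_mult: assumes "adelic g" "adelic h" shows "global_height (\<lambda>w. g w * h w) = global_height g * global_height h"
proof -
  define T where "T = {w \<in> places. g w \<noteq> 1} \<union> {w \<in> places. h w \<noteq> 1}"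
  have T: "finite T" "T \<subseteq> places" using assms by (auto simp: T_def adelic_def)
  have "global_height (\<lambda>w. g w * h w) = (\<Prod>w\<in>T. (g w * h w) powr local_exponent w)"
    by (rule global_height_superset[OF T]) (auto simp: T_def)
  also have "\<dots> = (\<Prod>w\<in>T. g w powr local_exponent w * h w powr local_exponent w)"
    by (intro prod.cong refl powr_mult)
  also have "\<dots> = global_height g * global_height h"
    using global_height_superset[OF T, of g] global_height_superset[OF T, of h] unfolding prod.distrib by (auto simp: T_def)
  finally show ?thesis .
qed

lemma adelic_power: "adelic g \<Longrightarrow> adelic (\<lambda>w. g w ^ n)"
  by (induction n) (simp_all add: adelic_one adelic_mult)

lemma global_height_power: "adelic g \<Longrightarrow> global_height (\<lambda>w. g w ^ n) = global_height g ^ n"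
  by (induction n) (simp_all add: global_height_one global_height_mult adelic_power)

lemma global_height_mono:
  assumes "adelic g" "adelic h" "\<And>w. w \<in> places \<Longrightarrow> g w \<le> h w"
  shows "global_height g \<le> global_height h"
proof -
  define T where "T = {w \<in> places. g w \<noteq> 1} \<union> {w \<in> places. h w \<noteq> 1}"
  have T: "finite T" "T \<subseteq> places" using assms by (auto simp: T_def adelic_def)
  have "global_height g = (\<Prod>w\<in>T. g w powr local_exponent w)" "global_height h = (\<Prod>w\<in>T. h w powr local_exponent w)"
    by (rule global_height_superset[OF T], force simp: T_def)+
  moreover have "(\<Prod>w\<in>T. g w powr local_exponent w) \<le> (\<Prod>w\<in>T. h w powr local_exponent w)"
    using T assms local_exponent_pos by (intro prod_mono conjI powr_mono2 powr_ge_zero) (auto intro: less_imp_le[OF adelic_pos] less_imp_le)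
  ultimately show ?thesis by simp
qed

lemma global_height_cong: "(\<And>w. w \<in> places \<Longrightarrow> g w = h w) \<Longrightarrow> global_height g = global_height h"
  unfolding global_height_def by (rule prod.cong) auto

lemma global_height_pos: "adelic g \<Longrightarrow> global_height g > 0"
  unfolding global_height_def by (intro prod_pos) (auto dest: adelic_pos)

lemma adelic_principal: "a \<noteq> 0 \<Longrightarrow> adelic (\<lambda>w. w (a :: 'k::number_field))"
  unfolding adelic_def using finite_places_neq_1[of a] av_pos place_av by blast

lemma global_height_principal: assumes "a \<noteq> 0" shows "global_height (\<lambda>w. w (a :: 'k::number_field)) = 1"
proof -
  let ?d = "real (degree_K TYPE('k))"
  have "global_height (\<lambda>w. w a) = (\<Prod>w | w \<in> places \<and> w a \<noteq> 1. (w a ^ local_degree w) powr (1 / ?d))"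
    unfolding global_height_def
  proof (rule prod.cong[OF refl])
    fix w :: "'k \<Rightarrow> real" assume "w \<in> {w. w \<in> places \<and> w a \<noteq> 1}"
    hence "w a > 0" using av_pos[OF place_av assms] by auto
    thus "w a powr local_exponent w = (w a ^ local_degree w) powr (1 / ?d)"
      by (simp add: local_exponent_def powr_powr flip: powr_realpow)
  qed
  also have "\<dots> = (\<Prod>w | w \<in> places \<and> w a \<noteq> 1. w a ^ local_degree w) powr (1 / ?d)"
    by (rule prod_powr_distrib[symmetric])
  also have "\<dots> = 1" using product_formula[OF assms] by simp
  finally show ?thesis .
qed

text \<open>Inequalities between local norms that lose a factor \<open>C\<close> at the infinite places and none at the finite
  ones lose exactly \<open>C\<close> globally.\<close>
definition arch_const :: "real \<Rightarrow> ('k::number_field \<Rightarrow> real) \<Rightarrow> real" where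
  "arch_const C w = (if archimedean w then C else 1)"

lemma archimedean_places: "{w \<in> (places :: ('k::number_field \<Rightarrow> real) set). archimedean w} = qexts 0"
proof (intro equalityI subsetI)
  fix w :: "'k \<Rightarrow> real" assume w: "w \<in> {w \<in> places. archimedean w}"
  then obtain p where p: "qplace p" "w \<in> qexts p" unfolding places_qexts by auto
  thus "w \<in> qexts 0" using archimedean_iff[OF p] w by simp
next
  fix w :: "'k \<Rightarrow> real" assume w: "w \<in> qexts 0"
  thus "w \<in> {w \<in> places. archimedean w}" using archimedean_iff[of 0 w] unfolding places_qexts by auto
qed

lemma adelic_arch_const: assumes "C > 0" shows "adelic (arch_const C :: ('k::number_field \<Rightarrow> real) \<Rightarrow> real)"
proof -
  have "{w \<in> (places :: ('k \<Rightarrow> real) set). arch_const C w \<noteq> 1} \<subseteq> qexts 0"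
    unfolding archimedean_places[symmetric] by (auto simp: arch_const_def split: if_splits)
  hence "finite {w \<in> (places :: ('k \<Rightarrow> real) set). arch_const C w \<noteq> 1}"
    by (rule finite_subset) (simp add: finite_qexts)
  thus ?thesis using assms unfolding adelic_def by (auto simp: arch_const_def)
qed

text \<open>The exponents \<open>local_exponent w\<close> of the infinite places add up to
  1.\<close>

lemma global_height_arch_const: assumes "C > 0" shows "global_height (arch_const C :: ('k::number_field \<Rightarrow> real) \<Rightarrow> real) = C"
proof -
  let ?T = "qexts 0 :: ('k \<Rightarrow> real) set"
  have "global_height (arch_const C :: ('k \<Rightarrow> real) \<Rightarrow> real) = (\<Prod>w\<in>?T. arch_const C w powr local_exponent w)"
  proof (rule global_height_superset)
    show "finite ?T" by (simp add: finite_qexts)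
  qed (auto simp: arch_const_def archimedean_places[symmetric] split: if_splits)
  also have "\<dots> = (\<Prod>w\<in>?T. C powr local_exponent w)"
    by (rule prod.cong) (auto simp: arch_const_def archimedean_places[symmetric])
  also have "\<dots> = C powr (\<Sum>w\<in>?T. local_exponent w)" using assms by (simp add: powr_sum finite_qexts)
  also have "(\<Sum>w\<in>?T. local_exponent w) = 1"
    unfolding local_exponent_def sum_divide_distrib[symmetric] of_nat_sum[symmetric]
    using sum_local_degree[of 0, where 'k='k] degree_pos[where 'k='k] by simp
  finally show ?thesis using assms by simp
qed

text \<open>The Euclidean norm of infinite places and the maximum norm of finite ones obey the same
  rules, so estimates for vectors and matrices can be stated for all places at once.\<close>

definition l2_or_max :: "bool \<Rightarrow> 'i set \<Rightarrow> ('i \<Rightarrow> real) \<Rightarrow> real" where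
  "l2_or_max a I f = (if a then L2_set f I else Max (f ` I))"

lemma l2_or_max_nonneg:
  assumes "finite I" "I \<noteq> {}" "\<And>i. i \<in> I \<Longrightarrow> 0 \<le> f i" shows "0 \<le> l2_or_max a I f"
proof (cases a)
  case False
  obtain i where "i \<in> I" using assms by auto
  hence "f i \<le> Max (f ` I)" using assms by (intro Max_ge) auto
  thus ?thesis using False assms(3)[OF \<open>i \<in> I\<close>] by (simp add: l2_or_max_def)
qed (simp add: l2_or_max_def L2_set_nonneg)

lemma l2_or_max_ge:
  assumes "finite I" "i \<in> I" "\<And>i. i \<in> I \<Longrightarrow> 0 \<le> f i" shows "f i \<le> l2_or_max a I f"
  using assms member_le_L2_set[of I i f] by (auto simp: l2_or_max_def)

lemma l2_or_max_mono:
  assumes "finite I" "I \<noteq> {}" "\<And>i. i \<in> I \<Longrightarrow> 0 \<le> f i" "\<And>i. i \<in> I \<Longrightarrow> f i \<le> g i"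
  shows "l2_or_max a I f \<le> l2_or_max a I g"
proof (cases a)
  case True thus ?thesis using assms by (simp add: l2_or_max_def L2_set_mono)
next
  case False
  have "f i \<le> Max (g ` I)" if "i \<in> I" for i using assms that by (intro order_trans[OF assms(4)] Max_ge) auto
  thus ?thesis using False assms by (auto simp: l2_or_max_def)
qed

lemma l2_or_max_scale:
  assumes "finite I" "I \<noteq> {}" "c \<ge> 0" shows "l2_or_max a I (\<lambda>i. c * f i) = c * l2_or_max a I f"
proof (cases a)
  case True thus ?thesis using assms by (simp add: l2_or_max_def L2_set_right_distrib)
next
  case False
  have "mono ((*) c)" using assms by (auto intro!: monoI mult_left_mono)
  hence "c * Max (f ` I) = Max ((*) c ` f ` I)" using assms by (intro mono_Max_commute) auto
  thus ?thesis using False by (simp add: l2_or_max_def image_image)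
qed

lemma l2_or_max_add:
  assumes "finite I" "I \<noteq> {}" "\<And>i. i \<in> I \<Longrightarrow> 0 \<le> f i" "\<And>i. i \<in> I \<Longrightarrow> 0 \<le> g i"
  shows "l2_or_max a I (\<lambda>i. f i + g i) \<le> l2_or_max a I f + l2_or_max a I g"
proof (cases a)
  case True thus ?thesis by (simp add: l2_or_max_def L2_set_triangle_ineq)
next
  case False
  have "f i + g i \<le> Max (f ` I) + Max (g ` I)" if "i \<in> I" for i
    using assms that by (intro add_mono Max_ge) auto
  thus ?thesis using False assms by (auto simp: l2_or_max_def)
qed

lemma l2_or_max_Times:
  assumes "finite I" "I \<noteq> {}" "finite J" "J \<noteq> {}" "\<And>i j. i \<in> I \<Longrightarrow> j \<in> J \<Longrightarrow> 0 \<le> f i j"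
  shows "l2_or_max a (I \<times> J) (\<lambda>(i, j). f i j) = l2_or_max a I (\<lambda>i. l2_or_max a J (f i))"
proof (cases a)
  case True
  have "(\<Sum>i\<in>I. (sqrt (\<Sum>j\<in>J. (f i j)\<^sup>2))\<^sup>2) = (\<Sum>i\<in>I. \<Sum>j\<in>J. (f i j)\<^sup>2)"
    by (intro sum.cong refl real_sqrt_pow2 sum_nonneg) auto
  also have "\<dots> = (\<Sum>p\<in>I \<times> J. (case p of (i, j) \<Rightarrow> f i j)\<^sup>2)"
    by (simp add: sum.cartesian_product case_prod_beta)
  finally show ?thesis using True by (simp add: l2_or_max_def L2_set_def)
next
  case False
  have "Max ((\<lambda>(i, j). f i j) ` (I \<times> J)) = Max ((\<lambda>i. Max (f i ` J)) ` I)"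
  proof (rule antisym)
    show "Max ((\<lambda>(i, j). f i j) ` (I \<times> J)) \<le> Max ((\<lambda>i. Max (f i ` J)) ` I)"
    proof (rule Max.boundedI)
      fix a assume "a \<in> (\<lambda>(i, j). f i j) ` (I \<times> J)"
      then obtain i j where ij: "i \<in> I" "j \<in> J" "a = f i j" by auto
      have "a \<le> Max (f i ` J)" using ij assms by (auto intro: Max_ge)
      also have "\<dots> \<le> Max ((\<lambda>i. Max (f i ` J)) ` I)" using ij assms by (auto intro: Max_ge)
      finally show "a \<le> Max ((\<lambda>i. Max (f i ` J)) ` I)" .
    qed (use assms in auto)
    show "Max ((\<lambda>i. Max (f i ` J)) ` I) \<le> Max ((\<lambda>(i, j). f i j) ` (I \<times> J))"
    proof (rule Max.boundedI)
      fix a assume "a \<in> (\<lambda>i. Max (f i ` J)) ` I"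
      then obtain i where i: "i \<in> I" "a = Max (f i ` J)" by auto
      have "f i j \<le> Max ((\<lambda>(i, j). f i j) ` (I \<times> J))" if "j \<in> J" for j
        using i that assms by (intro Max_ge) (auto intro!: image_eqI[of _ _ "(i, j)"])
      thus "a \<le> Max ((\<lambda>(i, j). f i j) ` (I \<times> J))" unfolding i(2) using assms by auto
    qed (use assms in auto)
  qed
  thus ?thesis using False by (simp add: l2_or_max_def)
qed

lemma l2_or_max_swap:
  assumes "finite I" "I \<noteq> {}" "finite J" "J \<noteq> {}" "\<And>i j. i \<in> I \<Longrightarrow> j \<in> J \<Longrightarrow> 0 \<le> f i j"
  shows "l2_or_max a I (\<lambda>i. l2_or_max a J (\<lambda>j. f i j)) = l2_or_max a J (\<lambda>j. l2_or_max a I (\<lambda>i. f i j))"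
proof -
  have "l2_or_max a (I \<times> J) (\<lambda>(i, j). f i j) = l2_or_max a (J \<times> I) (\<lambda>(j, i). f i j)"
  proof (cases a)
    case True
    have "(\<Sum>p\<in>I \<times> J. (case p of (i, j) \<Rightarrow> f i j)\<^sup>2) = (\<Sum>p\<in>J \<times> I. (case p of (j, i) \<Rightarrow> f i j)\<^sup>2)"
      by (rule sum.reindex_bij_witness[of _ prod.swap prod.swap]) auto
    thus ?thesis using True by (simp add: l2_or_max_def L2_set_def)
  next
    case False
    have "(\<lambda>(i, j). f i j) ` (I \<times> J) = (\<lambda>(j, i). f i j) ` (J \<times> I)" by (auto simp: image_iff)
    thus ?thesis using False by (simp add: l2_or_max_def)
  qed
  thus ?thesis using assms by (simp add: l2_or_max_Times)
qed

section \<open>Local norms of families, vectors and matrices\<close>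

definition place_norm :: "('k::number_field \<Rightarrow> real) \<Rightarrow> 'i set \<Rightarrow> ('i \<Rightarrow> 'k) \<Rightarrow> real" where
  "place_norm w I x = l2_or_max (archimedean w) I (\<lambda>i. w (x i))"

context
  fixes w :: "'k::number_field \<Rightarrow> real" assumes wp: "w \<in> places"
begin

lemma w_nonneg: "0 \<le> w x" by (rule av_nonneg[OF place_av[OF wp]])

lemma place_norm_nonneg: "finite I \<Longrightarrow> I \<noteq> {} \<Longrightarrow> 0 \<le> place_norm w I x"
  unfolding place_norm_def by (rule l2_or_max_nonneg) (auto simp: w_nonneg)

lemma place_norm_ge: "finite I \<Longrightarrow> i \<in> I \<Longrightarrow> w (x i) \<le> place_norm w I x"
  unfolding place_norm_def by (rule l2_or_max_ge[where f="\<lambda>i. w (x i)"]) (auto simp: w_nonneg)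

lemma place_norm_pos: assumes "finite I" "i \<in> I" "x i \<noteq> 0" shows "place_norm w I x > 0"
  using place_norm_ge[OF assms(1,2), of x] av_pos[OF place_av[OF wp] assms(3)] by linarith

lemma place_norm_scale: assumes "finite I" "I \<noteq> {}" shows "place_norm w I (\<lambda>i. c * x i) = w c * place_norm w I x"
  unfolding place_norm_def av_mult[OF place_av[OF wp]] using assms by (intro l2_or_max_scale w_nonneg)

text \<open>A maximum with the factor \<open>arch_const 2\<close> replaces the sum of norms, so that
  the inequality has one shape at all places and costs the factor 2 globally.\<close>

lemma place_norm_add: assumes "finite I" "I \<noteq> {}"
  shows "place_norm w I (\<lambda>i. x i + y i) \<le> arch_const 2 w * max (place_norm w I x) (place_norm w I y)"
proof (cases "archimedean w")
  case True
  have "place_norm w I (\<lambda>i. x i + y i) \<le> l2_or_max True I (\<lambda>i. w (x i) + w (y i))"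
    unfolding place_norm_def using True assms by (auto intro!: l2_or_max_mono w_nonneg av_triangle place_av wp)
  also have "\<dots> \<le> place_norm w I x + place_norm w I y"
    unfolding place_norm_def using True assms by (auto intro!: l2_or_max_add w_nonneg)
  finally show ?thesis using True by (auto simp: arch_const_def max_def)
next
  case False
  have "w (x i + y i) \<le> max (place_norm w I x) (place_norm w I y)" if "i \<in> I" for i
    using nonarch_add[OF wp False, of "x i" "y i"] place_norm_ge[OF assms(1) that, of x] place_norm_ge[OF assms(1) that, of y] by linarith
  thus ?thesis using False assms by (auto simp: arch_const_def place_norm_def l2_or_max_def)
qed

text \<open>The Cauchy-Schwarz inequality at infinite places and the ultrametric inequality at
  finite ones.\<close>

lemma dot_le:
  assumes "finite I" "I \<noteq> {}" shows "w (\<Sum>i\<in>I. x i * y i) \<le> place_norm w I x * place_norm w I y"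
proof (cases "archimedean w")
  case True
  have "w (\<Sum>i\<in>I. x i * y i) \<le> (\<Sum>i\<in>I. \<bar>w (x i)\<bar> * \<bar>w (y i)\<bar>)"
    using av_sum[OF place_av[OF wp], of "\<lambda>i. x i * y i" I] by (simp add: av_mult[OF place_av[OF wp]] w_nonneg)
  also have "\<dots> \<le> place_norm w I x * place_norm w I y" unfolding place_norm_def l2_or_max_def using True by (simp add: L2_set_mult_ineq)
  finally show ?thesis .
next
  case False
  show ?thesis
  proof (rule nonarch_sum[OF wp False])
    fix i assume "i \<in> I"
    thus "w (x i * y i) \<le> place_norm w I x * place_norm w I y"
      unfolding av_mult[OF place_av[OF wp]] using assms by (intro mult_mono place_norm_ge place_norm_nonneg w_nonneg)
  qed (use assms in \<open>simp add: place_norm_nonneg\<close>)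
qed

end

lemma adelic_place_norm:
  assumes I: "finite I" "i0 \<in> I" "x i0 \<noteq> 0"
  shows "adelic (\<lambda>w. place_norm w I (x :: 'i \<Rightarrow> 'k::number_field))"
  unfolding adelic_def
proof (intro conjI ballI)
  fix w :: "'k \<Rightarrow> real" assume "w \<in> places"
  thus "0 < place_norm w I x" by (rule place_norm_pos[where i=i0]) (use I in auto)
next
  let ?T = "qexts 0 \<union> (\<Union>i\<in>{i\<in>I. x i \<noteq> 0}. {w \<in> places. w (x i) \<noteq> 1})"
  have "finite ?T" using I finite_qexts finite_places_neq_1 by auto
  moreover have "{w \<in> places. place_norm w I x \<noteq> 1} \<subseteq> ?T"
  proof (rule subsetI, rule ccontr)
    fix w assume w: "w \<in> {w \<in> places. place_norm w I x \<noteq> 1}" "w \<notin> ?T"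
    have na: "\<not> archimedean w" using w archimedean_places by auto
    have wx: "w (x i) = (if x i = 0 then 0 else 1)" if "i \<in> I" for i
      using w that av_zero[OF place_av] by auto
    have "Max ((\<lambda>i. w (x i)) ` I) = 1"
    proof (rule Max_eqI)
      show "1 \<in> (\<lambda>i. w (x i)) ` I" by (rule image_eqI[OF _ I(2)]) (use wx[OF I(2)] I(3) in simp)
    qed (use I wx in auto)
    thus False using w na by (simp add: place_norm_def l2_or_max_def)
  qed
  ultimately show "finite {w \<in> places. place_norm w I x \<noteq> 1}" by (rule finite_subset[rotated])
qed

lemma local_height_eq:
  assumes w: "w \<in> places" and I: "finite I" "I \<noteq> {}"
  shows "local_height w I (x :: 'i \<Rightarrow> 'k::number_field) = place_norm w I x powr local_exponent w"
proof (cases "archimedean w")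
  case True
  have "(\<Sum>i\<in>I. (w (x i))\<^sup>2) powr (real (local_degree w) / (2 * real (degree_K TYPE('k))))
     = ((\<Sum>i\<in>I. (w (x i))\<^sup>2) powr (1/2)) powr local_exponent w"
    by (simp add: powr_powr local_exponent_def)
  thus ?thesis using True by (simp add: local_height_def place_norm_def l2_or_max_def L2_set_def powr_half_sqrt sum_nonneg)
next
  case False
  let ?A = "(\<lambda>i. w (x i)) ` I"
  have A: "finite ?A" "?A \<noteq> {}" using I by auto
  have nn: "0 \<le> a" if "a \<in> ?A" for a using that w_nonneg[OF w] by auto
  have "Max ((\<lambda>i. w (x i) powr local_exponent w) ` I) = Max ?A powr local_exponent w"
  proof (rule Max_eqI)
    fix y assume "y \<in> (\<lambda>i. w (x i) powr local_exponent w) ` I"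
    then obtain i where i: "i \<in> I" "y = w (x i) powr local_exponent w" by auto
    have "w (x i) \<le> Max ?A" using A(1) i(1) by (intro Max_ge) auto
    thus "y \<le> Max ?A powr local_exponent w"
      unfolding i(2) by (rule powr_mono2[OF less_imp_le[OF local_exponent_pos[OF w]] w_nonneg[OF w]])
  next
    have "Max ?A \<in> ?A" by (rule Max_in[OF A])
    thus "Max ?A powr local_exponent w \<in> (\<lambda>i. w (x i) powr local_exponent w) ` I" by auto
  qed (use I in auto)
  thus ?thesis using False by (simp add: local_height_def place_norm_def l2_or_max_def local_exponent_def)
qed

lemma height_eq:
  assumes I: "finite I" "i0 \<in> I" "x i0 \<noteq> 0"
  shows "height I (x :: 'i \<Rightarrow> 'k::number_field) = global_height (\<lambda>w. place_norm w I x)"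
proof -
  have ne: "I \<noteq> {}" using I by auto
  have "local_height w I x = 1 \<longleftrightarrow> place_norm w I x = 1" if w: "w \<in> places" for w
  proof -
    have "place_norm w I x > 0" by (rule place_norm_pos[OF w, where i=i0]) (use I in auto)
    thus ?thesis unfolding local_height_eq[OF w I(1) ne] using local_exponent_pos[OF w] by (simp add: powr_def)
  qed
  thus ?thesis unfolding height_def global_height_def
    by (intro prod.cong) (auto simp: local_height_eq[OF _ I(1) ne])
qed

text \<open>Each local norm is at least that of the nonzero coordinate \<open>x i0\<close>, whose
  absolute values multiply to 1 by the product formula.\<close>

lemma height_ge_1:
  assumes I: "finite I" "i0 \<in> I" "x i0 \<noteq> 0"
  shows "height I (x :: 'i \<Rightarrow> 'k::number_field) \<ge> 1"
proof -
  have "global_height (\<lambda>w. w (x i0)) \<le> global_height (\<lambda>w. place_norm w I x)"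
    using I by (intro global_height_mono adelic_principal adelic_place_norm place_norm_ge) auto
  thus ?thesis using global_height_principal[OF I(3)] height_eq[of I i0 x] I by simp
qed

abbreviation vec_norm :: "('k::number_field \<Rightarrow> real) \<Rightarrow> 'k ^ 'n \<Rightarrow> real" where
  "vec_norm w x \<equiv> place_norm w UNIV (\<lambda>i. x $ i)"

abbreviation mat_norm :: "('k::number_field \<Rightarrow> real) \<Rightarrow> 'k ^ 'n ^ 'm \<Rightarrow> real" where
  "mat_norm w A \<equiv> place_norm w UNIV (\<lambda>(i, j). A $ i $ j)"

lemma mat_norm_rows: assumes w: "w \<in> places"
  shows "mat_norm w (A :: 'k::number_field ^ 'n ^ 'm) = l2_or_max (archimedean w) UNIV (\<lambda>i. vec_norm w (A $ i))"
proof -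
  have "mat_norm w A = l2_or_max (archimedean w) (UNIV \<times> UNIV) (\<lambda>(i, j). w (A $ i $ j))"
    unfolding place_norm_def UNIV_Times_UNIV by (rule arg_cong[of _ _ "l2_or_max _ _"]) auto
  also have "\<dots> = l2_or_max (archimedean w) UNIV (\<lambda>i. l2_or_max (archimedean w) UNIV (\<lambda>j. w (A $ i $ j)))"
    by (rule l2_or_max_Times) (auto simp: w_nonneg[OF w])
  finally show ?thesis by (simp add: place_norm_def)
qed

lemma vec_norm_mult: assumes w: "w \<in> places"
  shows "vec_norm w (A *v x) \<le> mat_norm w (A :: 'k::number_field ^ 'n ^ 'm) * vec_norm w x"
proof -
  have "vec_norm w (A *v x) \<le> l2_or_max (archimedean w) UNIV (\<lambda>i. vec_norm w x * vec_norm w (A $ i))"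
    unfolding place_norm_def[of w UNIV "\<lambda>i. (A *v x) $ i"]
  proof (rule l2_or_max_mono)
    fix i
    show "w ((A *v x) $ i) \<le> vec_norm w x * vec_norm w (A $ i)"
      using dot_le[OF w, of UNIV "\<lambda>j. x $ j" "\<lambda>j. A $ i $ j"] by (simp add: matrix_vector_mult_def mult.commute)
  qed (auto simp: w_nonneg[OF w])
  also have "\<dots> = vec_norm w x * mat_norm w A" unfolding mat_norm_rows[OF w] by (rule l2_or_max_scale) (auto simp: place_norm_nonneg[OF w])
  finally show ?thesis by (simp add: mult.commute)
qed

lemma mat_norm_transpose: assumes w: "w \<in> places"
  shows "mat_norm w (transpose A) = mat_norm w (A :: 'k::number_field ^ 'n ^ 'm)"
proof -
  have "l2_or_max a UNIV (\<lambda>i. l2_or_max a UNIV (\<lambda>j. w (A $ j $ i))) = l2_or_max a UNIV (\<lambda>j. l2_or_max a UNIV (\<lambda>i. w (A $ j $ i)))" for a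
    by (rule l2_or_max_swap) (auto simp: w_nonneg[OF w])
  thus ?thesis unfolding mat_norm_rows[OF w] by (simp add: place_norm_def transpose_def)
qed

lemma mat_norm_mult: assumes w: "w \<in> places"
  shows "mat_norm w (A ** B) \<le> mat_norm w (A :: 'k::number_field ^ 'n ^ 'm) * mat_norm w (B :: 'k ^ 'l ^ 'n)"
proof -
  let ?a = "archimedean w"
  have "mat_norm w (A ** B) \<le> l2_or_max ?a UNIV (\<lambda>i. mat_norm w B * vec_norm w (A $ i))"
    unfolding mat_norm_rows[OF w, of "A ** B"]
  proof (rule l2_or_max_mono)
    fix i
    have "(A ** B) $ i = transpose B *v (A $ i)"
      by (simp add: Finite_Cartesian_Product.vec_eq_iff matrix_matrix_mult_def matrix_vector_mult_def transpose_def mult.commute)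
    thus "vec_norm w ((A ** B) $ i) \<le> mat_norm w B * vec_norm w (A $ i)"
      using vec_norm_mult[OF w, of "transpose B" "A $ i"] by (simp add: mat_norm_transpose[OF w])
  qed (auto simp: place_norm_nonneg[OF w])
  also have "\<dots> = mat_norm w B * mat_norm w A" unfolding mat_norm_rows[OF w, of A] by (rule l2_or_max_scale) (auto simp: place_norm_nonneg[OF w])
  finally show ?thesis by (simp add: mult.commute)
qed

lemma bilin_dot: "bilin F x y = (\<Sum>i\<in>UNIV. x $ i * (F *v y) $ i)"
  unfolding bilin_def matrix_vector_mult_def by (simp add: sum_distrib_left mult_ac)

lemma bilin_le: assumes w: "w \<in> places"
  shows "w (bilin F x y) \<le> mat_norm w F * vec_norm w x * vec_norm w (y :: 'k::number_field ^ 'n)"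
proof -
  have "w (bilin F x y) \<le> vec_norm w x * vec_norm w (F *v y)" unfolding bilin_dot by (rule dot_le[OF w]) auto
  also have "\<dots> \<le> vec_norm w x * (mat_norm w F * vec_norm w y)" by (intro mult_left_mono vec_norm_mult w place_norm_nonneg[OF w]) auto
  finally show ?thesis by (simp add: mult_ac)
qed

lemma vec_norm_add: "w \<in> places \<Longrightarrow> vec_norm w (x + y) \<le> arch_const 2 w * max (vec_norm w x) (vec_norm w (y :: 'k::number_field ^ 'n))"
  using place_norm_add[of w UNIV "\<lambda>i. x $ i" "\<lambda>i. y $ i"] by simp

lemma vec_norm_uminus: "w \<in> places \<Longrightarrow> vec_norm w (- x) = vec_norm w (x :: 'k::number_field ^ 'n)"
  by (simp add: place_norm_def av_uminus place_av)

lemma adelic_vec_norm: assumes "x \<noteq> 0" shows "adelic (\<lambda>w. vec_norm w (x :: 'k::number_field ^ 'n))"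
proof -
  obtain i where "x $ i \<noteq> 0" using assms by (auto simp: Finite_Cartesian_Product.vec_eq_iff)
  thus ?thesis by (intro adelic_place_norm[of _ i]) auto
qed

lemma adelic_mat_norm: assumes "A \<noteq> 0" shows "adelic (\<lambda>w. mat_norm w (A :: 'k::number_field ^ 'n ^ 'm))"
proof -
  obtain i j where "A $ i $ j \<noteq> 0" using assms by (auto simp: Finite_Cartesian_Product.vec_eq_iff)
  thus ?thesis by (intro adelic_place_norm[of _ "(i, j)"]) auto
qed

lemma matrix_height_eq: assumes "A \<noteq> 0"
  shows "matrix_height (A :: 'k::number_field ^ 'n ^ 'm) = global_height (\<lambda>w. mat_norm w A)"
proof -
  obtain i j where "A $ i $ j \<noteq> 0" using assms by (auto simp: Finite_Cartesian_Product.vec_eq_iff)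
  thus ?thesis unfolding matrix_height_def by (intro height_eq[of _ "(i, j)"]) auto
qed

lemma matrix_height_ge_1: assumes "A \<noteq> 0" shows "matrix_height (A :: 'k::number_field ^ 'n ^ 'm) \<ge> 1"
proof -
  obtain i j where "A $ i $ j \<noteq> 0" using assms by (auto simp: Finite_Cartesian_Product.vec_eq_iff)
  thus ?thesis unfolding matrix_height_def by (intro height_ge_1[of _ "(i, j)"]) auto
qed

section \<open>The discriminant is a nonzero integer\<close>

text \<open>Cramer's rule. It expresses coefficients with respect to \<open>e\<close> by the
  determinants that the exchange argument for an integral basis compares.\<close>

lemma coord_mat_expand:
  fixes e :: "nat \<Rightarrow> 'k::number_field"
  defines "n \<equiv> degree_K TYPE('k)" and "D \<equiv> Determinant.det (coord_mat e)"
  assumes D: "D \<noteq> 0"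
  shows "x = (\<Sum>i<n. of_rat (Determinant.det (coord_mat (e(i := x))) / D) * e i)"
proof -
  let ?P = "coord_mat e" and ?q = "\<lambda>i. Determinant.det (coord_mat (e(i := x))) / D"
  have P: "?P \<in> carrier_mat n n" unfolding n_def by simp
  have "coord (\<Sum>i<n. of_rat (?q i) * e i) j = coord x j" if j: "j < n" for j
  proof -
    have "coord (\<Sum>i<n. of_rat (?q i) * e i) j = (\<Sum>i<n. (\<Sum>k<n. coord x k * cofactor ?P i k) / D * coord (e i) j)"
      unfolding coord_sum coord_scale n_def by (intro sum.cong refl) (simp add: det_coord_mat_update)
    also have "\<dots> = (\<Sum>i<n. \<Sum>k<n. coord x k * (cofactor ?P i k * coord (e i) j) / D)"
      by (simp only: sum_divide_distrib sum_distrib_right) (simp add: mult_ac)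
    also have "\<dots> = (\<Sum>k<n. \<Sum>i<n. coord x k * (cofactor ?P i k * coord (e i) j) / D)" by (rule sum.swap)
    also have "\<dots> = (\<Sum>k<n. if k = j then coord x k else 0)"
    proof (rule sum.cong[OF refl])
      fix k assume k: "k \<in> {..<n}"
      have "(adj_mat ?P * ?P) $$ (k, j) = (\<Sum>i<n. cofactor ?P i k * coord (e i) j)"
        using k j P adj_mat(1)[OF P]
        by (auto simp: scalar_prod_def adj_mat_def n_def lessThan_atLeast0 intro!: sum.cong)
      moreover have "(adj_mat ?P * ?P) $$ (k, j) = (if k = j then D else 0)"
        using k j unfolding adj_mat(3)[OF P] D_def by simp
      ultimately have "(\<Sum>i<n. cofactor ?P i k * coord (e i) j) = (if k = j then D else 0)" by metis
      hence "coord x k * (\<Sum>i<n. cofactor ?P i k * coord (e i) j) / D = (if k = j then coord x k else 0)" using D by simp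
      thus "(\<Sum>i<n. coord x k * (cofactor ?P i k * coord (e i) j) / D) = (if k = j then coord x k else 0)"
        by (simp only: sum_divide_distrib sum_distrib_left)
    qed
    also have "\<dots> = coord x j" using j by simp
    finally show ?thesis .
  qed
  note coeq = this
  have "x = (\<Sum>j<n. of_rat (coord x j) * qbasis j)" unfolding n_def by (rule coord_expand)
  also have "\<dots> = (\<Sum>j<n. of_rat (coord (\<Sum>i<n. of_rat (?q i) * e i) j) * qbasis j)"
    by (rule sum.cong) (simp_all only: coeq lessThan_iff)
  also have "\<dots> = (\<Sum>i<n. of_rat (?q i) * e i)" unfolding n_def by (rule coord_expand[symmetric])
  finally show ?thesis .
qed

lemma coord_mat_unique:
  fixes e :: "nat \<Rightarrow> 'k::number_field"
  assumes D: "Determinant.det (coord_mat e) \<noteq> 0" and i: "i < degree_K TYPE('k)"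
  shows "Determinant.det (coord_mat (e(i := (\<Sum>k<degree_K TYPE('k). of_rat (q k) * e k)))) = q i * Determinant.det (coord_mat e)"
proof -
  let ?n = "degree_K TYPE('k)" and ?P = "coord_mat e"
  have P: "?P \<in> carrier_mat ?n ?n" by simp
  have "Determinant.det (coord_mat (e(i := (\<Sum>k<?n. of_rat (q k) * e k)))) = (\<Sum>j<?n. \<Sum>k<?n. q k * (coord (e k) j * cofactor ?P i j))"
    unfolding det_coord_mat_update[OF i] coord_sum coord_scale by (simp only: sum_distrib_right) (simp only: mult_ac)
  also have "\<dots> = (\<Sum>k<?n. q k * (\<Sum>j<?n. coord (e k) j * cofactor ?P i j))"
    by (subst sum.swap) (simp add: sum_distrib_left)
  also have "\<dots> = (\<Sum>k<?n. if k = i then q k * Determinant.det ?P else 0)"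
  proof (rule sum.cong[OF refl])
    fix k assume k: "k \<in> {..<?n}"
    have "(?P * adj_mat ?P) $$ (k, i) = (\<Sum>j<?n. coord (e k) j * cofactor ?P i j)"
      using k i P adj_mat(1)[OF P] by (auto simp: scalar_prod_def adj_mat_def lessThan_atLeast0 intro!: sum.cong)
    moreover have "(?P * adj_mat ?P) $$ (k, i) = (if k = i then Determinant.det ?P else 0)"
      using k i unfolding adj_mat(2)[OF P] by simp
    ultimately have "(\<Sum>j<?n. coord (e k) j * cofactor ?P i j) = (if k = i then Determinant.det ?P else 0)" by metis
    thus "q k * (\<Sum>j<?n. coord (e k) j * cofactor ?P i j) = (if k = i then q k * Determinant.det ?P else 0)" by simp
  qed
  also have "\<dots> = q i * Determinant.det ?P" using i by simp
  finally show ?thesis .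
qed

section \<open>Gram matrices of the trace form\<close>

definition gram :: "(nat \<Rightarrow> 'k::number_field) \<Rightarrow> nat \<Rightarrow> rat mat" where
  "gram e n = mat n n (\<lambda>(i, j). field_trace (e i * e j))"

lemma gram_carrier [simp]: "gram e n \<in> carrier_mat n n" by (simp add: gram_def)

lemma gram_dim [simp]: "dim_row (gram e n) = n" "dim_col (gram e n) = n" by (simp_all add: gram_def)

text \<open>The Gram matrix of \<open>e\<close> is \<open>coord_mat e\<close> times that of
  \<open>qbasis\<close> times the transpose of \<open>coord_mat e\<close>.\<close>

lemma det_gram:
  fixes e :: "nat \<Rightarrow> 'k::number_field"
  shows "Determinant.det (gram e (degree_K TYPE('k))) =
    (Determinant.det (coord_mat e))\<^sup>2 * Determinant.det (gram (qbasis :: nat \<Rightarrow> 'k) (degree_K TYPE('k)))"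
proof -
  let ?n = "degree_K TYPE('k)"
  have tr: "field_trace (x * y) = (\<Sum>k<?n. \<Sum>l<?n. coord x k * (field_trace (qbasis k * qbasis l :: 'k) * coord y l))" for x y :: 'k
  proof -
    have "x * y = (\<Sum>k<?n. \<Sum>l<?n. of_rat (coord x k * coord y l) * (qbasis k * qbasis l))"
      by (subst (1) coord_expand[of x], subst (1) coord_expand[of y]) (simp add: sum_product of_rat_mult algebra_simps)
    hence "field_trace (x * y) = (\<Sum>k<?n. \<Sum>l<?n. (coord x k * coord y l) * field_trace (qbasis k * qbasis l :: 'k))"
      by (simp only: trace_sum trace_scale)
    thus ?thesis by (simp only: mult_ac)
  qed
  have "gram e ?n = coord_mat e * (gram (qbasis :: nat \<Rightarrow> 'k) ?n * transpose_mat (coord_mat e))"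
  proof (rule eq_matI)
    let ?G = "gram (qbasis :: nat \<Rightarrow> 'k) ?n * transpose_mat (coord_mat e)"
    fix i j assume "i < dim_row (coord_mat e * ?G)" "j < dim_col (coord_mat e * ?G)"
    hence ij: "i < ?n" "j < ?n" by auto
    have G: "?G $$ (k, j) = (\<Sum>l<?n. field_trace (qbasis k * qbasis l :: 'k) * coord (e j) l)" if "k < ?n" for k
      using that ij by (auto simp: gram_def scalar_prod_def lessThan_atLeast0 intro!: sum.cong)
    have "scalar_prod (Matrix.row (coord_mat e) i) (Matrix.col ?G j) = (\<Sum>k<?n. coord (e i) k * ?G $$ (k, j))"
      unfolding scalar_prod_def lessThan_atLeast0 by (rule sum.cong) (use ij in \<open>simp_all del: index_mult_mat(1)\<close>)
    hence "(coord_mat e * ?G) $$ (i, j) = (\<Sum>k<?n. coord (e i) k * ?G $$ (k, j))" using ij by (subst index_mult_mat(1)) auto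
    also have "\<dots> = (\<Sum>k<?n. \<Sum>l<?n. coord (e i) k * (field_trace (qbasis k * qbasis l :: 'k) * coord (e j) l))"
      by (rule sum.cong) (simp_all add: G sum_distrib_left)
    also have "\<dots> = field_trace (e i * e j)" by (rule tr[symmetric])
    also have "\<dots> = gram e ?n $$ (i, j)" using ij by (simp add: gram_def)
    finally show "gram e ?n $$ (i, j) = (coord_mat e * ?G) $$ (i, j)" by (rule sym)
  qed (auto simp: gram_def)
  moreover have T: "transpose_mat (coord_mat e) \<in> carrier_mat ?n ?n" by simp
  ultimately have "Determinant.det (gram e ?n) = Determinant.det (coord_mat e) *
      (Determinant.det (gram (qbasis :: nat \<Rightarrow> 'k) ?n) * Determinant.det (transpose_mat (coord_mat e)))"
    using det_mult[OF coord_mat_carrier mult_carrier_mat[OF gram_carrier T], of e] det_mult[OF gram_carrier T] by metis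
  thus ?thesis by (simp add: det_transpose[OF coord_mat_carrier] power2_eq_square)
qed

text \<open>The transposed coordinate matrix of the dual basis inverts this Gram matrix.\<close>

lemma det_gram_qbasis: "Determinant.det (gram (qbasis :: nat \<Rightarrow> 'k::number_field) (degree_K TYPE('k))) \<noteq> 0"
proof -
  let ?n = "degree_K TYPE('k)"
  obtain dl :: "nat \<Rightarrow> 'k" where dl: "\<And>i x. i < ?n \<Longrightarrow> coord x i = field_trace (x * dl i)"
    using dual_basis by blast
  have "gram (qbasis :: nat \<Rightarrow> 'k) ?n * transpose_mat (coord_mat dl) = 1\<^sub>m ?n"
  proof (rule eq_matI)
    fix i j assume ij: "i < dim_row (1\<^sub>m ?n :: rat mat)" "j < dim_col (1\<^sub>m ?n :: rat mat)"
    have "(gram (qbasis :: nat \<Rightarrow> 'k) ?n * transpose_mat (coord_mat dl)) $$ (i, j) = (\<Sum>k<?n. field_trace (qbasis i * qbasis k :: 'k) * coord (dl j) k)"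
      using ij by (auto simp: gram_def scalar_prod_def lessThan_atLeast0 intro!: sum.cong)
    also have "\<dots> = field_trace (\<Sum>k<?n. of_rat (coord (dl j) k) * (qbasis i * qbasis k :: 'k))"
      by (simp only: trace_sum trace_scale) (simp only: mult.commute)
    also have "(\<Sum>k<?n. of_rat (coord (dl j) k) * (qbasis i * qbasis k :: 'k)) = (qbasis i :: 'k) * dl j"
      by (subst (2) coord_expand[of "dl j"]) (simp add: sum_distrib_left mult_ac)
    also have "field_trace (qbasis i * dl j) = coord (qbasis i :: 'k) j" using dl[of j "qbasis i"] ij by simp
    finally show "(gram (qbasis :: nat \<Rightarrow> 'k) ?n * transpose_mat (coord_mat dl)) $$ (i, j) = 1\<^sub>m ?n $$ (i, j)"
      using ij by (simp add: coord_qbasis)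
  qed (auto simp: gram_def)
  hence "Determinant.det (gram (qbasis :: nat \<Rightarrow> 'k) ?n) * Determinant.det (transpose_mat (coord_mat dl)) = 1"
    using det_mult[of "gram (qbasis :: nat \<Rightarrow> 'k) ?n" ?n "transpose_mat (coord_mat dl)"] by simp
  thus ?thesis by auto
qed

text \<open>A local description of the ring of integers; \<open>integers_K_eq\<close> identifies it with the algebraic integers.\<close>
definition integers_K :: "'k::number_field set" where
  "integers_K = {x. \<forall>w\<in>places. \<not> archimedean w \<longrightarrow> w x \<le> 1}"

lemma integers_of_int: "of_int n \<in> integers_K"
  using nonarch_of_int by (auto simp: integers_K_def)

lemma integers_mult: "x \<in> integers_K \<Longrightarrow> y \<in> integers_K \<Longrightarrow> x * y \<in> integers_K"
  unfolding integers_K_def by (auto simp: av_mult[OF place_av] intro!: mult_le_one av_nonneg[OF place_av])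

lemma integers_add: "x \<in> integers_K \<Longrightarrow> y \<in> integers_K \<Longrightarrow> x + y \<in> integers_K"
proof -
  assume xy: "x \<in> integers_K" "y \<in> integers_K"
  have "w (x + y) \<le> 1" if "w \<in> places" "\<not> archimedean w" for w
  proof -
    have "w x \<le> 1" "w y \<le> 1" using xy that by (auto simp: integers_K_def)
    thus ?thesis using nonarch_add[OF that, of x y] by linarith
  qed
  thus ?thesis by (simp add: integers_K_def)
qed

lemma integers_uminus: "x \<in> integers_K \<Longrightarrow> - x \<in> integers_K"
  using integers_mult[OF integers_of_int[of "-1"], of x] by simp

lemma integers_diff: "x \<in> integers_K \<Longrightarrow> y \<in> integers_K \<Longrightarrow> x - y \<in> integers_K"
  using integers_add[of x "-y"] integers_uminus[of y] by simp

lemma integers_sum: "(\<And>i. i \<in> I \<Longrightarrow> f i \<in> integers_K) \<Longrightarrow> (\<Sum>i\<in>I. f i) \<in> integers_K"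
proof (induction I rule: infinite_finite_induct)
  case (insert i I) thus ?case by (auto intro: integers_add)
qed (use integers_of_int[of 0] in auto)

text \<open>The trace is bounded by the spectral radius, and some extension reaches the spectral
  radius at \<open>y\<close>. Having a single place on the right, not a sum over places, is what the
  integrality of traces and Northcott's theorem use.\<close>

lemma trace_place:
  assumes "prime p" "y \<noteq> (0 :: 'k::number_field)"
  shows "\<exists>w\<in>qexts p. padic_abs p (field_trace y) \<le> w y"
proof -
  have qp: "qplace p" using assms by simp
  obtain w where w: "w \<in> qexts p" "rat_abs.spec_rad (rat_abs_at p) y \<le> w y"
    using rat_abs.exists_ext_ge[OF rat_abs_rat_abs_at[OF qp] assms(2)] by blast
  have "rat_abs_at p (field_trace y) \<le> rat_abs.spec_rad (rat_abs_at p) y"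
    by (rule rat_abs.trace_bound_ultrametric[OF rat_abs_rat_abs_at[OF qp]]) (simp add: rat_abs_at_prime assms padic_abs_ultra)
  hence "padic_abs p (field_trace y) \<le> w y" using w rat_abs_at_prime[OF assms(1)] by simp
  thus ?thesis using w by blast
qed

lemma trace_place_arch:
  assumes "y \<noteq> (0 :: 'k::number_field)"
  shows "\<exists>w\<in>qexts 0. \<bar>real_of_rat (field_trace y)\<bar> \<le> real (degree_K TYPE('k)) * w y"
proof -
  have r: "rat_abs (rat_abs_at 0)" by (rule rat_abs_rat_abs_at) simp
  obtain w where w: "w \<in> qexts 0" "rat_abs.spec_rad (rat_abs_at 0) y \<le> w y"
    using rat_abs.exists_ext_ge[OF r assms] by blast
  have "rat_abs_at 0 (field_trace y) \<le> real (degree_K TYPE('k)) * rat_abs.spec_rad (rat_abs_at 0) y"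
    by (rule rat_abs.trace_bound[OF r])
  also have "\<dots> \<le> real (degree_K TYPE('k)) * w y" using w by (intro mult_left_mono) auto
  finally show ?thesis using w by (auto simp: rat_abs_at_def)
qed

lemma padic_abs_denom:
  assumes p: "prime p" "q \<noteq> 0" and dvd: "int p dvd snd (quotient_of q)"
  shows "padic_abs p q = real p ^ multiplicity (int p) (snd (quotient_of q))"
proof -
  obtain n d where q: "quotient_of q = (n, d)" by force
  have "coprime n d" by (rule quotient_of_coprime[OF q])
  hence "\<not> int p dvd n" using dvd p(1) unfolding q
    by (metis coprime_common_divisor not_prime_unit prime_nat_int_transfer snd_conv)
  hence "multiplicity (int p) n = 0" by (rule not_dvd_imp_multiplicity_0)
  thus ?thesis using p by (simp add: padic_abs_def q)
qed

text \<open>The numerator is coprime to the denominator, so at a prime dividing the denominator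
  \<open>padic_abs p q\<close> is exactly the power of \<open>p\<close> in it.\<close>

lemma denominator_le:
  assumes q: "q \<noteq> 0" and S: "finite S" "\<And>p. p \<in> S \<Longrightarrow> prime p"
    "\<And>p. prime p \<Longrightarrow> int p dvd snd (quotient_of q) \<Longrightarrow> p \<in> S"
    and g: "\<And>p. p \<in> S \<Longrightarrow> padic_abs p q \<le> g p" "\<And>p. p \<in> S \<Longrightarrow> 1 \<le> g p"
  shows "real_of_int (snd (quotient_of q)) \<le> (\<Prod>p\<in>S. g p)"
proof -
  let ?d = "snd (quotient_of q)"
  have d: "?d > 0" using quotient_of_denom_pos' by blast
  have "real_of_int \<bar>?d\<bar> = (\<Prod>p\<in>S. real p ^ multiplicity (int p) ?d)"
    by (rule abs_int_prod) (use d S in auto)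
  also have "\<dots> \<le> (\<Prod>p\<in>S. g p)"
  proof (rule prod_mono)
    fix p assume p: "p \<in> S"
    show "0 \<le> real p ^ multiplicity (int p) ?d \<and> real p ^ multiplicity (int p) ?d \<le> g p"
    proof (cases "int p dvd ?d")
      case True
      thus ?thesis using padic_abs_denom[OF S(2)[OF p] q True] g(1)[OF p] by simp
    next
      case False
      thus ?thesis using g(2)[OF p] by (simp add: not_dvd_imp_multiplicity_0)
    qed
  qed
  finally show ?thesis using d by simp
qed

lemma rat_int_of_padic:
  assumes "\<And>p. prime p \<Longrightarrow> padic_abs p q \<le> 1" shows "q \<in> \<int>"
proof (cases "q = 0")
  case False
  let ?d = "snd (quotient_of q)"
  have d: "?d > 0" using quotient_of_denom_pos' by blast
  have "real_of_int ?d \<le> (\<Prod>p\<in>{p. prime p \<and> int p dvd ?d}. 1)"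
    by (rule denominator_le[OF False]) (use d assms finite_prime_dvd[of ?d] in auto)
  hence "?d = 1" using d by simp
  hence "q = of_int (fst (quotient_of q))"
    using quotient_of_div[of q "fst (quotient_of q)" ?d, OF prod.collapse[symmetric]] by simp
  thus ?thesis by (metis Ints_of_int)
qed simp

lemma trace_integer: assumes "x \<in> integers_K" shows "field_trace x \<in> \<int>"
proof (cases "x = 0")
  case False
  show ?thesis
  proof (rule rat_int_of_padic)
    fix p :: nat assume p: "prime p"
    obtain w where w: "w \<in> qexts p" "padic_abs p (field_trace x) \<le> w x" using trace_place[OF p False] by blast
    have "w \<in> places" "\<not> archimedean w" using w p archimedean_iff[of p w] unfolding places_qexts by auto
    hence "w x \<le> 1" using assms by (auto simp: integers_K_def)
    thus "padic_abs p (field_trace x) \<le> 1" using w by linarith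
  qed
qed simp

text \<open>Only finitely many primes obstruct integrality. At each of them a prime has value at
  most 1/2, so the \<open>k\<close>-th power of their product outweighs the bound
  \<open>X < 2 ^ k\<close> for the values of \<open>x\<close>.\<close>

lemma integer_multiple: "\<exists>m>0. of_nat m * x \<in> (integers_K :: 'k::number_field set)"
proof -
  obtain S where S: "finite S" "\<And>p w. prime p \<Longrightarrow> p \<notin> S \<Longrightarrow> w \<in> qexts p \<Longrightarrow> w x \<le> 1"
    using almost_all_le_1[of x] by blast
  define T where "T = {p\<in>S. prime p}"
  have T: "finite T" "\<And>p. p \<in> T \<Longrightarrow> prime p" using S by (auto simp: T_def)
  define X where "X = (\<Sum>p\<in>T. \<Sum>w\<in>(qexts p :: ('k \<Rightarrow> real) set). w x)"
  obtain k where k: "X < 2 ^ k" using real_arch_pow[of 2 X] by auto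
  define m where "m = (\<Prod>p\<in>T. p) ^ k"
  have m0: "m > 0" unfolding m_def using T prime_gt_0_nat by (auto intro!: prod_pos)
  have "w (of_nat m * x) \<le> 1" if w: "w \<in> places" "\<not> archimedean w" for w
  proof -
    note wa = place_av[OF w(1)]
    obtain p where p: "qplace p" "w \<in> qexts p" using w unfolding places_qexts by auto
    hence pp: "prime p" using archimedean_iff w by metis
    have n1: "w (of_nat n) \<le> 1" for n using nonarch_of_int[OF w, of "int n"] by simp
    show ?thesis
    proof (cases "p \<in> T")
      case False
      hence "w x \<le> 1" using S(2)[OF pp _ p(2)] pp by (auto simp: T_def)
      thus ?thesis using n1[of m] av_nonneg[OF wa] by (simp add: av_mult[OF wa] mult_le_one)
    next
      case True
      have "w x \<le> (\<Sum>w\<in>(qexts p :: ('k \<Rightarrow> real) set). w x)"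
        using p finite_qexts[OF p(1)] by (intro member_le_sum[of w _ "\<lambda>w. w x"]) (auto intro: av_nonneg[OF qexts_av[OF p(1)]])
      also have "\<dots> \<le> X" unfolding X_def
      proof (rule member_le_sum[OF True _ T(1)], rule sum_nonneg)
        fix p' and w' :: "'k \<Rightarrow> real" assume "p' \<in> T - {p}" "w' \<in> qexts p'"
        thus "0 \<le> w' x" using T(2)[of p'] av_nonneg[OF qexts_av[of p' w']] by simp
      qed
      finally have wx: "w x \<le> 2 ^ k" using k by linarith
      have "w (of_nat p) = 1 / real p"
        using qexts_rat[OF p, of "of_nat p"] rat_abs_at_prime[OF pp] padic_abs_self[OF pp] by simp
      moreover have "1 / real p \<le> 1 / 2" using prime_ge_2_nat[OF pp] by (intro frac_le) auto
      ultimately have wp: "w (of_nat p) \<le> 1 / 2" by simp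
      have "(\<Prod>p\<in>T. p) = p * (\<Prod>p\<in>T - {p}. p)" using T True by (simp add: prod.remove)
      hence "w (of_nat (\<Prod>p\<in>T. p)) = w (of_nat p) * w (of_nat (\<Prod>p\<in>T - {p}. p))" by (metis of_nat_mult av_mult[OF wa])
      also have "\<dots> \<le> 1 / 2 * 1" using wp by (intro mult_mono n1) (auto intro: av_nonneg[OF wa])
      finally have "w (of_nat (\<Prod>p\<in>T. p)) ^ k \<le> (1 / 2) ^ k" by (intro power_mono) (auto intro: av_nonneg[OF wa])
      hence "w (of_nat m) \<le> (1 / 2) ^ k" unfolding m_def of_nat_power av_power[OF wa] .
      hence "w (of_nat m) * w x \<le> (1 / 2) ^ k * 2 ^ k" using wx by (intro mult_mono) (auto intro: av_nonneg[OF wa])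
      also have "\<dots> = 1" by (simp add: power_mult_distrib[symmetric])
      finally show ?thesis by (simp add: av_mult[OF wa])
    qed
  qed
  thus ?thesis using m0 by (auto simp: integers_K_def)
qed

text \<open>If \<open>w x\<close> exceeded 1, a monic equation with integer coefficients would give
  \<open>w x ^ n \<le> w x ^ (n - 1)\<close>.\<close>

lemma algebraic_int_imp_integer:
  assumes "algebraic_int (x :: 'k::number_field)" shows "x \<in> integers_K"
  unfolding integers_K_def
proof (clarify, rule ccontr)
  fix w :: "'k \<Rightarrow> real" assume w: "w \<in> places" "\<not> archimedean w" "\<not> w x \<le> 1"
  note wa = place_av[OF w(1)]
  obtain p where p: "lead_coeff p = 1" "\<forall>i. poly.coeff p i \<in> \<int>" "poly p x = 0"
    using assms by (auto elim: algebraic_int.cases)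
  define n where "n = Polynomial.degree p"
  have "0 = (\<Sum>i\<le>n. poly.coeff p i * x ^ i)" using p(3) by (simp add: poly_altdef n_def)
  also have "\<dots> = (\<Sum>i<n. poly.coeff p i * x ^ i) + x ^ n" using p(1) by (simp add: n_def lessThan_Suc_atMost[symmetric])
  finally have xn: "x ^ n = - (\<Sum>i<n. poly.coeff p i * x ^ i)" by (simp add: eq_neg_iff_add_eq_0 add.commute)
  have n0: "n > 0" using xn by (cases "n = 0") auto
  have "w (x ^ n) \<le> w x ^ (n - 1)"
    unfolding xn av_uminus[OF wa]
  proof (rule nonarch_sum[OF w(1,2)])
    fix i assume i: "i \<in> {..<n}"
    obtain m where m: "poly.coeff p i = of_int m" using p(2) Ints_cases by blast
    have "w (poly.coeff p i * x ^ i) \<le> 1 * w x ^ i"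
      unfolding m av_mult[OF wa] av_power[OF wa] by (intro mult_right_mono nonarch_of_int w) (auto intro!: zero_le_power av_nonneg[OF wa])
    also have "\<dots> \<le> w x ^ (n - 1)" using i w(3) by (simp add: power_increasing)
    finally show "w (poly.coeff p i * x ^ i) \<le> w x ^ (n - 1)" .
  qed (auto intro!: zero_le_power av_nonneg[OF wa])
  moreover have "w x ^ (n - 1) < w x ^ n" using w(3) n0 by (intro power_strict_increasing) auto
  ultimately show False by (simp add: av_power[OF wa])
qed

lemma gram_integer:
  assumes "\<And>i. i < n \<Longrightarrow> e i \<in> integers_K" shows "Determinant.det (gram e n) \<in> \<int>"
proof -
  define M where "M = mat n n (\<lambda>(i, j). \<lfloor>field_trace (e i * e j)\<rfloor>)"
  have "gram e n = map_mat of_int M"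
  proof (rule eq_matI)
    fix i j assume "i < dim_row (map_mat rat_of_int M)" "j < dim_col (map_mat rat_of_int M)"
    hence ij: "i < n" "j < n" by (auto simp: M_def)
    have "field_trace (e i * e j) \<in> \<int>" by (intro trace_integer integers_mult assms ij)
    thus "gram e n $$ (i, j) = map_mat rat_of_int M $$ (i, j)" using ij by (simp add: gram_def M_def)
  qed (auto simp: gram_def M_def)
  thus ?thesis by (simp add: of_int_hom.hom_det)
qed

text \<open>Among the bases consisting of integers, one whose discriminant has minimal absolute value spans the
  integers: a fractional coordinate would allow an exchange that makes the discriminant smaller.\<close>
lemma integer_basis:
  obtains e :: "nat \<Rightarrow> 'k::number_field" where "\<And>i. i < degree_K TYPE('k) \<Longrightarrow> e i \<in> integers_K"
    "Determinant.det (coord_mat e) \<noteq> 0"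
    "\<And>x. x \<in> integers_K \<Longrightarrow> \<exists>c. x = (\<Sum>i<degree_K TYPE('k). of_int (c i) * e i)"
proof -
  let ?n = "degree_K TYPE('k)"
  let ?D = "\<lambda>e. Determinant.det (gram (e :: nat \<Rightarrow> 'k) ?n)"
  define E where "E = {e :: nat \<Rightarrow> 'k. (\<forall>i<?n. e i \<in> integers_K) \<and> Determinant.det (coord_mat e) \<noteq> 0}"
  have "\<exists>e. e \<in> E"
  proof -
    have "\<forall>i. \<exists>m>0. of_nat m * qbasis i \<in> (integers_K :: 'k set)" using integer_multiple by blast
    from choice[OF this] obtain m where m: "\<forall>i. m i > 0 \<and> of_nat (m i) * qbasis i \<in> (integers_K :: 'k set)" ..
    have "coord_mat (\<lambda>i. of_nat (m i) * qbasis i :: 'k) = mat ?n ?n (\<lambda>(i, j). if i = j then of_nat (m i) else 0)"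
      using coord_scale[of "of_nat _", where 'a='k] by (intro eq_matI) (auto simp: coord_mat_def coord_qbasis)
    moreover have "Determinant.det (mat ?n ?n (\<lambda>(i, j). if i = j then of_nat (m i) else (0::rat))) =
        prod_list (diag_mat (mat ?n ?n (\<lambda>(i, j). if i = j then of_nat (m i) else (0::rat))))"
      by (rule det_upper_triangular) auto
    moreover have mnz: "m i \<noteq> 0" for i using m by (metis less_irrefl)
    have "prod_list (diag_mat (mat ?n ?n (\<lambda>(i, j). if i = j then of_nat (m i) else (0::rat)))) \<noteq> 0"
      by (auto simp: diag_mat_def prod_list_zero_iff mnz)
    ultimately show ?thesis using m unfolding E_def by (intro exI[of _ "\<lambda>i. of_nat (m i) * qbasis i"]) auto
  qed
  \<comment> \<open>The absolute determinants are integers on \<open>E\<close>, so rounding them to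
    \<open>nat\<close> loses nothing and a least value exists.\<close>
  then obtain e where e: "e \<in> E" and emin: "\<And>f. f \<in> E \<Longrightarrow> nat \<lfloor>\<bar>?D e\<bar>\<rfloor> \<le> nat \<lfloor>\<bar>?D f\<bar>\<rfloor>"
    using ex_has_least_nat[of "\<lambda>e. e \<in> E" _ "\<lambda>f. nat \<lfloor>\<bar>?D f\<bar>\<rfloor>"] by blast
  have eO: "\<And>i. i < ?n \<Longrightarrow> e i \<in> integers_K" and eD: "Determinant.det (coord_mat e) \<noteq> 0" using e by (auto simp: E_def)
  have Dint: "\<bar>?D f\<bar> \<in> \<int>" if "f \<in> E" for f using gram_integer[of ?n f] that by (auto simp: E_def)
  have D0: "?D e \<noteq> 0" by (subst det_gram) (use eD det_gram_qbasis[where 'k='k] in simp)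
  have "\<exists>c. x = (\<Sum>i<?n. of_int (c i) * e i)" if x: "x \<in> integers_K" for x
  proof -
    define q where "q i = Determinant.det (coord_mat (e(i := x))) / Determinant.det (coord_mat e)" for i
    have xq: "x = (\<Sum>i<?n. of_rat (q i) * e i)" unfolding q_def by (rule coord_mat_expand[OF eD])
    have "q i \<in> \<int>" if i: "i < ?n" for i
    proof (rule ccontr)
      assume nz: "q i \<notin> \<int>"
      define r where "r = q i - of_int \<lfloor>q i\<rfloor>"
      have r: "0 < r" "r < 1"
      proof -
        have "0 \<le> r" "r < 1" unfolding r_def by linarith+
        moreover have "r \<noteq> 0" using nz unfolding r_def by (metis Ints_of_int eq_iff_diff_eq_0)
        ultimately show "0 < r" "r < 1" by auto
      qed
      define y where "y = x - of_int \<lfloor>q i\<rfloor> * e i"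
      have "y = (\<Sum>k<?n. of_rat (q k - (if k = i then of_int \<lfloor>q i\<rfloor> else 0)) * e k)"
      proof -
        have "(\<Sum>k<?n. of_rat (if k = i then of_int \<lfloor>q i\<rfloor> else 0) * e k) = (\<Sum>k<?n. if k = i then of_int \<lfloor>q i\<rfloor> * e k else 0)"
          by (rule sum.cong) auto
        also have "\<dots> = of_int \<lfloor>q i\<rfloor> * e i" using i by simp
        finally show ?thesis unfolding y_def of_rat_diff left_diff_distrib sum_subtractf xq[symmetric] by simp
      qed
      hence dy: "Determinant.det (coord_mat (e(i := y))) = r * Determinant.det (coord_mat e)"
        using coord_mat_unique[OF eD i, of "\<lambda>k. q k - (if k = i then of_int \<lfloor>q i\<rfloor> else 0)"] by (simp add: r_def)
      have "y \<in> integers_K" unfolding y_def by (intro integers_diff integers_mult integers_of_int x eO i)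
      hence fE: "e(i := y) \<in> E" using eO dy r eD by (auto simp: E_def)
      have "?D (e(i := y)) = r\<^sup>2 * ?D e" unfolding det_gram[of "e(i := y)"] det_gram[of e] dy by (simp add: power_mult_distrib)
      hence "\<bar>?D (e(i := y))\<bar> = r\<^sup>2 * \<bar>?D e\<bar>" by (simp add: abs_mult)
      also have "\<dots> < 1 * \<bar>?D e\<bar>" using r D0 by (intro mult_strict_right_mono) (auto simp: power_less_one_iff)
      finally have "\<bar>?D (e(i := y))\<bar> < \<bar>?D e\<bar>" by simp
      moreover obtain a b where "\<bar>?D (e(i := y))\<bar> = of_int a" "\<bar>?D e\<bar> = of_int b"
        using Dint[OF fE] Dint[OF e] by (meson Ints_cases)
      moreover have "0 \<le> \<bar>?D (e(i := y))\<bar>" by simp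
      ultimately have "nat \<lfloor>\<bar>?D (e(i := y))\<bar>\<rfloor> < nat \<lfloor>\<bar>?D e\<bar>\<rfloor>" by simp
      with emin[OF fE] show False by linarith
    qed
    hence "\<forall>i<?n. \<exists>c. q i = of_int c" by (auto elim: Ints_cases)
    then obtain c where c: "\<And>i. i < ?n \<Longrightarrow> q i = of_int (c i)" by metis
    have "x = (\<Sum>i<?n. of_int (c i) * e i)" by (subst xq) (rule sum.cong, auto simp: c)
    thus ?thesis by blast
  qed
  thus ?thesis using that eO eD by blast
qed

interpretation Zm: Modules.module "scale_int :: int \<Rightarrow> 'k::field_char_0 \<Rightarrow> 'k"
  by unfold_locales (auto simp: algebra_simps)

text \<open>Multiplication by \<open>x\<close> preserves the lattice spanned by an integral basis,
  so \<open>x\<close> is an eigenvalue of an integer matrix and a root of its monic characteristic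
  polynomial.\<close>

lemma integer_imp_algebraic_int:
  assumes x: "x \<in> integers_K" shows "algebraic_int (x :: 'k::number_field)"
proof -
  let ?n = "degree_K TYPE('k)"
  obtain e :: "nat \<Rightarrow> 'k" where e: "\<And>i. i < ?n \<Longrightarrow> e i \<in> integers_K" "Determinant.det (coord_mat e) \<noteq> 0"
    "\<And>x. x \<in> integers_K \<Longrightarrow> \<exists>c. x = (\<Sum>i<?n. of_int (c i) * e i)" by (rule integer_basis) blast
  have "\<forall>i\<in>{..<?n}. \<exists>c. x * e i = (\<Sum>j<?n. of_int (c j) * e j)" using e(1,3) integers_mult[OF x] by blast
  from bchoice[OF this] obtain c where c: "\<forall>i\<in>{..<?n}. x * e i = (\<Sum>j<?n. of_int (c i j) * e j)" ..
  define A where "A = mat ?n ?n (\<lambda>(i, j). c i j)"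
  have A: "A \<in> carrier_mat ?n ?n" by (simp add: A_def)
  let ?B = "map_mat of_int A :: 'k mat"
  have B: "?B \<in> carrier_mat ?n ?n" using A by simp
  have "x = 0" if "\<forall>i<?n. e i = 0" for x :: 'k
    by (subst coord_mat_expand[OF e(2), of x]) (simp add: that)
  from this[of 1] obtain i where i: "i < ?n" "e i \<noteq> 0" by auto
  have "eigenvector ?B (vec ?n e) x"
    unfolding eigenvector_def
  proof (intro conjI)
    show "vec ?n e \<in> carrier_vec (dim_row ?B)" using A by simp
    show "vec ?n e \<noteq> 0\<^sub>v (dim_row ?B)" using i A by (metis carrier_matD(1) index_map_mat(2) index_vec index_zero_vec(1))
    show "?B *\<^sub>v vec ?n e = x \<cdot>\<^sub>v vec ?n e"
      by (rule eq_vecI) (use c in \<open>auto simp: A_def scalar_prod_def lessThan_atLeast0 intro!: sum.cong\<close>)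
  qed
  hence "eigenvalue ?B x" unfolding eigenvalue_def by blast
  hence "poly (char_poly ?B) x = 0" using eigenvalue_root_char_poly[OF B] by blast
  hence "poly (map_poly of_int (char_poly A)) x = 0" by (simp add: of_int_hom.char_poly_hom[OF A])
  moreover have "lead_coeff (char_poly A) = 1" using degree_monic_char_poly[OF A] by auto
  ultimately show ?thesis unfolding algebraic_int_altdef_ipoly by blast
qed

lemma integers_K_eq: "integers_K = {x :: 'k::number_field. algebraic_int x}"
  using algebraic_int_imp_integer integer_imp_algebraic_int by blast

text \<open>This gives the choice in \<open>discriminant\<close> its defining property.\<close>

lemma integral_basis_exists: "\<exists>bs :: 'k::number_field list. integral_basis bs"
proof -
  let ?n = "degree_K TYPE('k)"
  obtain e :: "nat \<Rightarrow> 'k" where e: "\<And>i. i < ?n \<Longrightarrow> e i \<in> integers_K" "Determinant.det (coord_mat e) \<noteq> 0"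
    "\<And>x. x \<in> integers_K \<Longrightarrow> \<exists>c. x = (\<Sum>i<?n. of_int (c i) * e i)" by (rule integer_basis) blast
  have free: "\<forall>i\<in>{..<?n}. q i = 0" if "(\<Sum>i<?n. of_rat (q i) * e i) = 0" for q
  proof
    fix i assume i: "i \<in> {..<?n}"
    have "coord_mat (e(i := 0)) = coord_mat (e(i := (\<Sum>k<?n. of_rat 0 * e k)))" by simp
    hence "Determinant.det (coord_mat (e(i := 0))) = 0" using coord_mat_unique[OF e(2), of i "\<lambda>_. 0"] i by simp
    thus "q i = 0" using coord_mat_unique[OF e(2), of i q] i e(2) unfolding that by simp
  qed
  have inj: "inj_on e {..<?n}" by (rule free_family(1)) (use free in auto)
  define bs where "bs = map e [0..<?n]"
  have set: "set bs = e ` {..<?n}" by (auto simp: bs_def)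
  have "distinct bs" using inj by (simp add: bs_def distinct_map lessThan_atLeast0)
  moreover have "\<not> module.dependent scale_int (set bs)"
  proof
    assume "module.dependent scale_int (set bs)"
    then obtain u b where u: "b \<in> set bs" "u b \<noteq> 0" "(\<Sum>b\<in>set bs. of_int (u b) * b) = 0"
      using Zm.dependent_finite[of "set bs"] by auto
    have "(\<Sum>i<?n. of_rat (of_int (u (e i))) * e i) = 0" using u(3) unfolding set by (simp add: sum.reindex[OF inj])
    from free[OF this] show False using u(1,2) unfolding set by auto
  qed
  moreover have "module.span scale_int (set bs) = {x. algebraic_int x}"
  proof -
    have "Zm.span (set bs) = range (\<lambda>u. \<Sum>v\<in>set bs. of_int (u v) * v)" by (rule Zm.span_finite) simp
    also have "\<dots> = integers_K"
    proof (intro equalityI subsetI)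
      fix x assume "x \<in> range (\<lambda>u. \<Sum>v\<in>set bs. of_int (u v) * v)"
      thus "x \<in> integers_K" unfolding set using e(1) by (auto intro!: integers_sum integers_mult integers_of_int)
    next
      fix x :: 'k assume "x \<in> integers_K"
      then obtain c where c: "x = (\<Sum>i<?n. of_int (c i) * e i)" using e(3) by blast
      have "x = (\<Sum>v\<in>set bs. of_int (c (the_inv_into {..<?n} e v)) * v)"
        unfolding c set by (subst sum.reindex[OF inj]) (auto intro!: sum.cong simp: the_inv_into_f_f[OF inj])
      thus "x \<in> range (\<lambda>u. \<Sum>v\<in>set bs. of_int (u v) * v)"
        by (rule range_eqI[of _ _ "\<lambda>v. c (the_inv_into {..<?n} e v)"])
    qed
    finally show ?thesis by (simp add: integers_K_eq)
  qed
  ultimately show ?thesis unfolding integral_basis_def by blast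
qed

lemma common_denominator: "\<exists>m>(0::int). \<forall>i<(n::nat). of_int m * (q i :: rat) \<in> \<int>"
proof (induction n)
  case (Suc n)
  then obtain m where m: "m > 0" "\<forall>i<n. of_int m * q i \<in> \<int>" by blast
  obtain a b where ab: "b > 0" "q n = of_int a / of_int b"
    using quotient_of_div[of "q n"] quotient_of_denom_pos[of "q n"] by (metis surj_pair)
  have "of_int (m * b) * q i \<in> \<int>" if "i < Suc n" for i
  proof (cases "i = n")
    case True
    have "of_int (m * b) * q n = of_int (m * a)" using ab by simp
    thus ?thesis using True by (metis Ints_of_int)
  next
    case False
    hence "of_int m * q i \<in> \<int>" using m that by auto
    hence "of_int b * (of_int m * q i) \<in> \<int>" by (rule Ints_mult[OF Ints_of_int])
    moreover have "of_int (m * b) * q i = of_int b * (of_int m * q i)" by simp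
    ultimately show ?thesis by metis
  qed
  thus ?case using m ab by (intro exI[of _ "m * b"]) auto
qed (auto intro: exI[of _ 1])

text \<open>A kernel vector of the Gram matrix yields an element whose trace against all integers
  vanishes, hence against the whole field; so it is 0. Clearing denominators in the vector
  contradicts independence over the integers. The argument applies to a basis of whatever
  length.\<close>

theorem discriminant_ge_1: "\<bar>real_of_rat (discriminant TYPE('k::number_field))\<bar> \<ge> 1"
proof -
  define bs :: "'k list" where "bs = (SOME bs. integral_basis bs)"
  have bs: "integral_basis bs" unfolding bs_def by (rule someI_ex[OF integral_basis_exists])
  define n where "n = length bs"
  have disc: "discriminant TYPE('k) = Determinant.det (gram ((!) bs) n)"
    unfolding discriminant_def Let_def bs_def n_def gram_def ..
  have dist: "distinct bs" and indep: "\<not> Zm.dependent (set bs)" and span: "Zm.span (set bs) = integers_K"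
    using bs unfolding integral_basis_def integers_K_eq by auto
  have bsO: "bs ! i \<in> integers_K" if "i < n" for i
    using that span Zm.span_base[of "bs ! i" "set bs"] by (auto simp: n_def)
  have G: "gram ((!) bs) n \<in> carrier_mat n n" by simp
  have "Determinant.det (gram ((!) bs) n) \<noteq> 0"
  proof
    assume "Determinant.det (gram ((!) bs) n) = 0"
    then obtain v where v: "v \<in> carrier_vec n" "v \<noteq> 0\<^sub>v n" "gram ((!) bs) n *\<^sub>v v = 0\<^sub>v n"
      unfolding det_0_iff_vec_prod_zero_field[OF G] by blast
    define y where "y = (\<Sum>j<n. of_rat (vec_index v j) * bs ! j)"
    have ty: "field_trace (bs ! i * y) = 0" if i: "i < n" for i
    proof -
      have "field_trace (bs ! i * y) = (\<Sum>j<n. vec_index v j * field_trace (bs ! i * bs ! j))"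
      proof -
        have "bs ! i * y = (\<Sum>j<n. of_rat (vec_index v j) * (bs ! i * bs ! j))"
          unfolding y_def by (simp only: sum_distrib_left mult.left_commute)
        thus ?thesis by (simp only: trace_sum trace_scale)
      qed
      also have "\<dots> = vec_index (gram ((!) bs) n *\<^sub>v v) i"
        using i v(1) by (auto simp: gram_def scalar_prod_def lessThan_atLeast0 mult.commute intro!: sum.cong)
      finally show ?thesis using v(3) i by simp
    qed
    have t0: "field_trace (z * y) = 0" if z: "z \<in> integers_K" for z
    proof -
      have "z \<in> range (\<lambda>u. \<Sum>b\<in>set bs. of_int (u b) * b)" using z span Zm.span_finite[of "set bs"] by auto
      then obtain u where u: "z = (\<Sum>b\<in>set bs. of_int (u b) * b)" by auto
      have "field_trace (z * y) = (\<Sum>b\<in>set bs. of_int (u b) * field_trace (b * y))"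
        unfolding u sum_distrib_right mult.assoc trace_sum using trace_scale[of "of_int _" "_ * y"] by simp
      also have "\<dots> = 0" using ty by (intro sum.neutral) (auto simp: in_set_conv_nth n_def)
      finally show ?thesis .
    qed
    have "y = 0"
    proof (rule trace_nondegenerate)
      fix z :: 'k
      obtain m where m: "m > 0" "of_nat m * z \<in> integers_K" using integer_multiple by blast
      have "of_nat m * field_trace (y * z) = field_trace (of_nat m * z * y)"
        using trace_scale[of "of_nat m" "y * z"] by (simp add: mult_ac)
      also have "\<dots> = 0" by (rule t0[OF m(2)])
      finally show "field_trace (y * z) = 0" using m(1) by simp
    qed
    obtain m where m: "m > (0::int)" "\<forall>j<n. of_int m * vec_index v j \<in> \<int>" using common_denominator[of n "\<lambda>j. vec_index v j"] by blast
    define c where "c j = \<lfloor>of_int m * vec_index v j\<rfloor>" for j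
    have c: "of_int (c j) = of_int m * vec_index v j" if "j < n" for j using m(2) that by (simp add: c_def)
    have inj: "inj_on ((!) bs) {..<n}" using dist by (auto simp: inj_on_def n_def nth_eq_iff_index_eq)
    have set: "set bs = (!) bs ` {..<n}" by (auto simp: n_def in_set_conv_nth)
    define u where "u b = c (the_inv_into {..<n} ((!) bs) b)" for b
    have "(\<Sum>b\<in>set bs. of_int (u b) * b) = (\<Sum>j<n. of_int (c j) * bs ! j)"
      unfolding set u_def by (subst sum.reindex[OF inj]) (auto intro!: sum.cong simp: the_inv_into_f_f[OF inj])
    also have "\<dots> = (\<Sum>j<n. of_rat (of_int m * vec_index v j) * bs ! j)" by (intro sum.cong refl) (simp flip: c)
    also have "\<dots> = of_int m * y" unfolding y_def by (simp add: of_rat_mult sum_distrib_left mult.assoc)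
    finally have "(\<Sum>b\<in>set bs. of_int (u b) * b) = 0" using \<open>y = 0\<close> by simp
    hence u0: "\<forall>b\<in>set bs. u b = 0" using indep Zm.dependent_finite[of "set bs"] by auto
    have "vec_index v j = 0" if j: "j < n" for j
    proof -
      have "u (bs ! j) = c j" unfolding u_def using the_inv_into_f_f[OF inj, of j] j by simp
      hence "c j = 0" using u0 j by (simp add: n_def)
      thus ?thesis using c[OF j] m(1) by simp
    qed
    hence "v = 0\<^sub>v n" using v(1) by (intro eq_vecI) auto
    thus False using v(2) by simp
  qed
  moreover obtain k where k: "Determinant.det (gram ((!) bs) n) = of_int k"
    using gram_integer[of n "(!) bs"] bsO by (auto elim: Ints_cases)
  ultimately have "k \<noteq> 0" by auto
  hence "\<bar>real_of_int k\<bar> \<ge> 1" by linarith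
  thus ?thesis unfolding disc k by simp
qed

section \<open>Northcott's theorem\<close>

text \<open>The power \<open>degree_K\<close> turns the weight \<open>d\<^sub>v / d\<close> into
  \<open>d\<^sub>v\<close>, which is at least 1; as no factor is below 1, the partial product over
  \<open>U\<close> is bounded by the whole.\<close>

lemma prod_le_global_height:
  fixes g :: "('k::number_field \<Rightarrow> real) \<Rightarrow> real"
  assumes g: "adelic g" "\<And>w. w \<in> places \<Longrightarrow> 1 \<le> g w" and U: "finite U" "U \<subseteq> places"
  shows "(\<Prod>w\<in>U. g w) \<le> global_height g ^ degree_K TYPE('k)"
proof -
  let ?n = "degree_K TYPE('k)"
  define T where "T = U \<union> {w \<in> places. g w \<noteq> 1}"
  have T: "finite T" "T \<subseteq> places" using U g by (auto simp: T_def adelic_def)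
  have "(\<Prod>w\<in>U. g w) \<le> (\<Prod>w\<in>U. g w ^ local_degree w)"
  proof (rule prod_mono)
    fix w assume "w \<in> U"
    hence w: "w \<in> places" using U by auto
    show "0 \<le> g w \<and> g w \<le> g w ^ local_degree w"
      using g(2)[OF w] local_degree_pos[OF w] by (auto intro: self_le_power)
  qed
  also have "\<dots> \<le> (\<Prod>w\<in>T. g w ^ local_degree w)"
  proof (rule prod_mono2[OF T(1)])
    show "U \<subseteq> T" by (auto simp: T_def)
    show "1 \<le> g w ^ local_degree w" if "w \<in> T - U" for w using that T g(2) by (auto intro: one_le_power)
    show "0 \<le> g w ^ local_degree w" if "w \<in> U" for w using that U g(2)[of w] by auto
  qed
  also have "\<dots> = (\<Prod>w\<in>T. (g w powr local_exponent w) ^ ?n)"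
  proof (rule prod.cong[OF refl])
    fix w assume "w \<in> T"
    hence gw: "g w > 0" using T adelic_pos[OF g(1)] by auto
    have "(g w powr local_exponent w) ^ ?n = g w powr (real ?n * local_exponent w)" using gw by (simp add: powr_power)
    also have "real ?n * local_exponent w = real (local_degree w)" using degree_pos[where 'k='k] by (simp add: local_exponent_def)
    finally show "g w ^ local_degree w = (g w powr local_exponent w) ^ ?n" using gw by (simp add: powr_realpow)
  qed
  also have "\<dots> = global_height g ^ ?n"
  proof -
    have sub: "{w \<in> places. g w \<noteq> 1} \<subseteq> T" by (auto simp: T_def)
    show ?thesis unfolding global_height_superset[OF T sub] by (rule prod_power_distrib[symmetric])
  qed
  finally show ?thesis .
qed

lemma adelic_max1: "adelic (\<lambda>w. max 1 (w (a :: 'k::number_field)))"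
proof (cases "a = 0")
  case True
  have "{w \<in> places. max 1 (w a) \<noteq> 1} = {}" using True by (auto simp: av_zero[OF place_av])
  hence "finite {w \<in> places. max 1 (w a) \<noteq> 1}" by (simp only: finite.emptyI)
  moreover have "0 < max 1 (w a)" for w :: "'k \<Rightarrow> real" by (simp add: less_max_iff_disj)
  ultimately show ?thesis unfolding adelic_def by blast
next
  case False
  have "{w \<in> places. max 1 (w a) \<noteq> 1} \<subseteq> {w \<in> places. w a \<noteq> 1}" by auto
  thus ?thesis using finite_places_neq_1[OF False] unfolding adelic_def by (auto intro: finite_subset simp: less_max_iff_disj)
qed

lemma global_height_max1_ge_1: "1 \<le> global_height (\<lambda>w. max 1 (w (a :: 'k::number_field)))"
  using global_height_mono[OF adelic_one adelic_max1[of a]] by (simp add: global_height_one)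

lemma finite_rat_bounded: "finite {q :: rat. \<bar>real_of_rat q\<bar> \<le> X \<and> real_of_int (snd (quotient_of q)) \<le> X}"
proof (rule finite_subset)
  let ?A = "\<lceil>\<bar>X\<bar> * \<bar>X\<bar>\<rceil>"
  show "finite ((\<lambda>(n, m). of_int n / of_int m :: rat) ` ({-?A..?A} \<times> {0..\<lceil>\<bar>X\<bar>\<rceil>}))" by simp
  show "{q :: rat. \<bar>real_of_rat q\<bar> \<le> X \<and> real_of_int (snd (quotient_of q)) \<le> X}
    \<subseteq> (\<lambda>(n, m). of_int n / of_int m :: rat) ` ({-?A..?A} \<times> {0..\<lceil>\<bar>X\<bar>\<rceil>})"
  proof
    fix q :: rat assume q: "q \<in> {q. \<bar>real_of_rat q\<bar> \<le> X \<and> real_of_int (snd (quotient_of q)) \<le> X}"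
    obtain n m where nm: "quotient_of q = (n, m)" by force
    have m: "m > 0" using quotient_of_denom_pos[OF nm] .
    have qe: "q = of_int n / of_int m" using quotient_of_div[OF nm] .
    have mX: "real_of_int m \<le> \<bar>X\<bar>" using q nm by auto
    have "\<bar>real_of_int n\<bar> = \<bar>real_of_rat q\<bar> * real_of_int m" using m by (simp add: qe of_rat_divide)
    also have "\<dots> \<le> \<bar>X\<bar> * \<bar>X\<bar>" using q mX m by (intro mult_mono) auto
    finally have "\<bar>n\<bar> \<le> ?A" by linarith
    moreover have "m \<le> \<lceil>\<bar>X\<bar>\<rceil>" using mX by linarith
    ultimately have "(n, m) \<in> {-?A..?A} \<times> {0..\<lceil>\<bar>X\<bar>\<rceil>}" using m by auto
    thus "q \<in> (\<lambda>(n, m). of_int n / of_int m :: rat) ` ({-?A..?A} \<times> {0..\<lceil>\<bar>X\<bar>\<rceil>})"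
      using qe by (intro image_eqI[of _ _ "(n, m)"]) auto
  qed
qed

text \<open>An element of bounded height has traces against a fixed basis of bounded size and denominator,
  because each local bound on the trace is attained at a single place above each rational place.\<close>
lemma trace_height:
  fixes a b :: "'k::number_field"
  defines "n \<equiv> degree_K TYPE('k)"
  defines "Y \<equiv> (global_height (\<lambda>w. max 1 (w a)) * global_height (\<lambda>w. max 1 (w b))) ^ n"
  shows "\<bar>real_of_rat (field_trace (a * b))\<bar> \<le> real n * Y"
    and "real_of_int (snd (quotient_of (field_trace (a * b)))) \<le> real n * Y"
proof -
  define g where "g w = max 1 (w a) * max 1 (w b)" for w :: "'k \<Rightarrow> real"
  have g: "adelic g" unfolding g_def by (intro adelic_mult adelic_max1)
  have g1: "1 \<le> g w" for w unfolding g_def using mult_mono[of 1 "max 1 (w a)" 1 "max 1 (w b)"] by simp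
  have Y: "Y = global_height g ^ n" unfolding Y_def g_def by (simp add: global_height_mult adelic_max1)
  have "1 * 1 \<le> global_height (\<lambda>w. max 1 (w a)) * global_height (\<lambda>w. max 1 (w b))"
    using global_height_max1_ge_1[of a] global_height_max1_ge_1[of b] by (intro mult_mono) linarith+
  hence Y1: "Y \<ge> 1" unfolding Y_def by (intro one_le_power) simp
  have n1: "real n \<ge> 1" using degree_pos[where 'k='k] by (simp add: n_def)
  have nY: "Y \<le> real n * Y" using Y1 n1 mult_right_mono[of 1 "real n" Y] by simp
  have gle: "w (a * b) \<le> g w" if "w \<in> places" for w
    unfolding g_def av_mult[OF place_av[OF that]] using w_nonneg[OF that] by (intro mult_mono) auto
  have prodg: "(\<Prod>w\<in>U. g w) \<le> Y" if "finite U" "U \<subseteq> places" for U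
    unfolding Y n_def by (rule prod_le_global_height[OF g g1 that])
  have "\<bar>real_of_rat (field_trace (a * b))\<bar> \<le> real n * Y \<and> real_of_int (snd (quotient_of (field_trace (a * b)))) \<le> real n * Y"
  proof (cases "field_trace (a * b) = 0")
    case True
    moreover have "1 \<le> real n * Y" using Y1 nY by linarith
    ultimately show ?thesis by simp
  next
    case nz: False
    hence ab: "a * b \<noteq> 0" by auto
    obtain w0 where w0: "w0 \<in> qexts 0" "\<bar>real_of_rat (field_trace (a * b))\<bar> \<le> real n * w0 (a * b)"
      using trace_place_arch[OF ab] unfolding n_def by blast
    have w0p: "w0 \<in> places" using w0 unfolding places_qexts by auto
    have "w0 (a * b) \<le> Y" using gle[OF w0p] prodg[of "{w0}"] w0p by simp
    hence 1: "\<bar>real_of_rat (field_trace (a * b))\<bar> \<le> real n * Y"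
      using w0(2) n1 by (meson mult_left_mono of_nat_0_le_iff order_trans)
    let ?t = "field_trace (a * b)"
    define S where "S = {p. prime p \<and> int p dvd snd (quotient_of ?t)}"
    have fS: "finite S" unfolding S_def using finite_prime_dvd quotient_of_denom_pos' by (metis less_irrefl)
    have "\<forall>p\<in>S. \<exists>w\<in>qexts p. padic_abs p ?t \<le> w (a * b)" using trace_place[OF _ ab] by (auto simp: S_def)
    hence "\<forall>p\<in>S. \<exists>w. w \<in> qexts p \<and> padic_abs p ?t \<le> w (a * b)" by blast
    from bchoice[OF this] obtain f where f: "\<forall>p\<in>S. f p \<in> qexts p \<and> padic_abs p ?t \<le> f p (a * b)" ..
    have fp: "f p \<in> places" if "p \<in> S" for p using f that unfolding places_qexts S_def by auto
    \<comment> \<open>Places above different primes are different, so the product over the primes of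
      the denominator is a product over distinct places, bounded by one power of a global
      height.\<close>
    have inj: "inj_on f S"
    proof (rule inj_onI, rule ccontr)
      fix p q assume pq: "p \<in> S" "q \<in> S" "f p = f q" "p \<noteq> q"
      have "f p \<in> qexts p \<inter> qexts q" using f pq by auto
      thus False using qexts_disjoint[of p q, where 'a='k] pq by (auto simp: S_def)
    qed
    have "real_of_int (snd (quotient_of ?t)) \<le> (\<Prod>p\<in>S. g (f p))"
    proof (rule denominator_le[OF nz fS])
      show "padic_abs p ?t \<le> g (f p)" if "p \<in> S" for p using f that gle[OF fp[OF that]] by force
    qed (auto simp: S_def g1)
    also have "\<dots> = (\<Prod>w\<in>f ` S. g w)" by (simp add: prod.reindex[OF inj])
    also have "\<dots> \<le> Y" by (rule prodg) (use fS fp in auto)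
    finally show ?thesis using 1 nY by linarith
  qed
  thus "\<bar>real_of_rat (field_trace (a * b))\<bar> \<le> real n * Y"
    and "real_of_int (snd (quotient_of (field_trace (a * b)))) \<le> real n * Y" by auto
qed

text \<open>An element is determined by its traces against \<open>qbasis\<close>, and each of these
  traces ranges over a finite set of rationals.\<close>

lemma northcott_field: "finite {a :: 'k::number_field. global_height (\<lambda>w. max 1 (w a)) \<le> B}"
proof -
  let ?n = "degree_K TYPE('k)" and ?A = "{a :: 'k. global_height (\<lambda>w. max 1 (w a)) \<le> B}"
  define X where "X i = real ?n * (B * global_height (\<lambda>w. max 1 (w (qbasis i :: 'k)))) ^ ?n" for i
  define R where "R i = {q :: rat. \<bar>real_of_rat q\<bar> \<le> X i \<and> real_of_int (snd (quotient_of q)) \<le> X i}" for i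
  define \<Phi> where "\<Phi> a = (\<lambda>i\<in>{..<?n}. field_trace (a * qbasis i))" for a :: 'k
  have "\<Phi> a \<in> PiE {..<?n} R" if a: "a \<in> ?A" for a
  proof (rule PiE_I)
    fix i assume i: "i \<in> {..<?n}"
    have "global_height (\<lambda>w. max 1 (w a)) * global_height (\<lambda>w. max 1 (w (qbasis i :: 'k))) \<le> B * global_height (\<lambda>w. max 1 (w (qbasis i :: 'k)))"
      using a global_height_max1_ge_1[of "qbasis i :: 'k"] by (intro mult_right_mono) auto
    moreover have "0 \<le> global_height (\<lambda>w. max 1 (w a)) * global_height (\<lambda>w. max 1 (w (qbasis i :: 'k)))"
      using global_height_max1_ge_1[of a] global_height_max1_ge_1[of "qbasis i :: 'k"] by (intro mult_nonneg_nonneg) linarith+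
    ultimately have le: "real ?n * (global_height (\<lambda>w. max 1 (w a)) * global_height (\<lambda>w. max 1 (w (qbasis i :: 'k)))) ^ ?n \<le> X i"
      unfolding X_def by (intro mult_left_mono power_mono) auto
    have "field_trace (a * qbasis i) \<in> R i"
      unfolding R_def mem_Collect_eq using trace_height[of a "qbasis i", THEN order_trans, OF le] ..
    thus "\<Phi> a i \<in> R i" using i by (simp add: \<Phi>_def)
  qed (auto simp: \<Phi>_def)
  hence "\<Phi> ` ?A \<subseteq> PiE {..<?n} R" by blast
  moreover have "finite (PiE {..<?n} R)" unfolding R_def by (intro finite_PiE finite_rat_bounded) auto
  ultimately have "finite (\<Phi> ` ?A)" by (rule finite_subset)
  moreover have "inj_on \<Phi> ?A"
  proof (rule inj_onI)
    fix a b :: 'k assume "\<Phi> a = \<Phi> b"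
    hence "\<Phi> a i = \<Phi> b i" for i by simp
    hence "field_trace ((a - b) * qbasis i) = 0" if "i < ?n" for i
      using that unfolding \<Phi>_def by (metis (no_types, lifting) eq_iff_diff_eq_0 left_diff_distrib lessThan_iff restrict_apply' trace_diff)
    thus "a = b" using trace_nondegenerate_qbasis[of "a - b"] by simp
  qed
  ultimately show ?thesis by (rule finite_imageD)
qed

lemma finite_vec_set: assumes "finite X" shows "finite {x :: 'a ^ 'n. \<forall>i. x $ i \<in> X}"
proof (rule finite_subset)
  show "finite (vec_lambda ` (PiE (UNIV :: 'n set) (\<lambda>_. X)))" using assms by (intro finite_imageI finite_PiE) auto
  show "{x :: 'a ^ 'n. \<forall>i. x $ i \<in> X} \<subseteq> vec_lambda ` (PiE UNIV (\<lambda>_. X))"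
  proof
    fix x :: "'a ^ 'n" assume "x \<in> {x. \<forall>i. x $ i \<in> X}"
    hence "($) x \<in> PiE UNIV (\<lambda>_. X)" by auto
    moreover have "x = vec_lambda (($) x)" by simp
    ultimately show "x \<in> vec_lambda ` (PiE UNIV (\<lambda>_. X))" by blast
  qed
qed

lemma mat_norm_scale: "w \<in> places \<Longrightarrow> mat_norm w (\<chi> i j. c * A $ i $ j) = w c * mat_norm w (A :: 'k::number_field ^ 'n ^ 'm)"
  using place_norm_scale[of w UNIV c "\<lambda>(i, j). A $ i $ j"] by (simp add: case_prod_beta')

lemma matrix_height_scale:
  assumes "c \<noteq> 0" "A \<noteq> 0"
  shows "matrix_height (\<chi> i j. c * A $ i $ j) = matrix_height (A :: 'k::number_field ^ 'n ^ 'm)"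
proof -
  obtain i j where "A $ i $ j \<noteq> 0" using assms(2) by (auto simp: Finite_Cartesian_Product.vec_eq_iff)
  hence "(\<chi> i j. c * A $ i $ j) $ i $ j \<noteq> 0" using assms(1) by simp
  hence nz: "(\<chi> i j. c * A $ i $ j) \<noteq> 0" by (metis zero_index)
  have "matrix_height (\<chi> i j. c * A $ i $ j) = global_height (\<lambda>w. w c * mat_norm w A)"
    unfolding matrix_height_eq[OF nz] by (rule global_height_cong) (rule mat_norm_scale)
  also have "\<dots> = matrix_height A"
    unfolding matrix_height_eq[OF assms(2)] using assms by (simp add: global_height_mult adelic_principal adelic_mat_norm global_height_principal)
  finally show ?thesis .
qed

text \<open>Scaling preserves the height, so it is the set of heights and not the set of matrices
  that is finite. Scaling some entry to 1 bounds the height of every entry by that of the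
  matrix.\<close>

lemma northcott_matrix:
  "finite (matrix_height ` {A :: 'k::number_field ^ 'n ^ 'm. A \<noteq> 0 \<and> matrix_height A \<le> B})"
proof (rule finite_subset)
  let ?X = "{a :: 'k. global_height (\<lambda>w. max 1 (w a)) \<le> B}"
  let ?M = "{A :: 'k ^ 'n ^ 'm. \<forall>i. A $ i \<in> {x. \<forall>j. x $ j \<in> ?X}}"
  show "finite (matrix_height ` ?M)" by (intro finite_imageI finite_vec_set northcott_field)
  show "matrix_height ` {A :: 'k ^ 'n ^ 'm. A \<noteq> 0 \<and> matrix_height A \<le> B} \<subseteq> matrix_height ` ?M"
  proof (rule image_subsetI)
    fix A :: "'k ^ 'n ^ 'm" assume "A \<in> {A. A \<noteq> 0 \<and> matrix_height A \<le> B}"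
    hence A: "A \<noteq> 0" "matrix_height A \<le> B" by auto
    obtain i0 j0 where nz: "A $ i0 $ j0 \<noteq> 0" using A by (auto simp: Finite_Cartesian_Product.vec_eq_iff)
    define A' where "A' = (\<chi> i j. inverse (A $ i0 $ j0) * A $ i $ j)"
    have one: "A' $ i0 $ j0 = 1" using nz by (simp add: A'_def)
    hence A'0: "A' \<noteq> 0" by (metis zero_index zero_neq_one)
    have h: "matrix_height A' = matrix_height A" unfolding A'_def using nz A by (intro matrix_height_scale) auto
    have entries: "global_height (\<lambda>w. max 1 (w (A' $ i $ j))) \<le> B" for i j
    proof -
      have "global_height (\<lambda>w. max 1 (w (A' $ i $ j))) \<le> global_height (\<lambda>w. mat_norm w A')"
      proof (rule global_height_mono[OF adelic_max1 adelic_mat_norm[OF A'0]])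
        fix w :: "'k \<Rightarrow> real" assume w: "w \<in> places"
        show "max 1 (w (A' $ i $ j)) \<le> mat_norm w A'"
          using place_norm_ge[OF w, of UNIV "(i0, j0)" "\<lambda>(i, j). A' $ i $ j"] place_norm_ge[OF w, of UNIV "(i, j)" "\<lambda>(i, j). A' $ i $ j"]
          by (simp add: one av_one[OF place_av[OF w]])
      qed
      thus ?thesis using A(2) h matrix_height_eq[OF A'0] by simp
    qed
    have "A' \<in> ?M" by (intro CollectI allI entries)
    hence "matrix_height A' \<in> matrix_height ` ?M" by (rule imageI)
    thus "matrix_height A \<in> matrix_height ` ?M" by (simp only: h)
  qed
qed

lemma matrix_height_min:
  fixes S :: "('k::number_field ^ 'n ^ 'm) set"
  assumes "S \<noteq> {}" "\<And>A. A \<in> S \<Longrightarrow> A \<noteq> 0"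
  shows "\<exists>A\<in>S. \<forall>B\<in>S. matrix_height A \<le> matrix_height B"
proof -
  obtain A0 where A0: "A0 \<in> S" using assms(1) by blast
  let ?H = "matrix_height ` {A \<in> S. matrix_height A \<le> matrix_height A0}"
  have fin: "finite ?H"
    by (rule finite_subset[OF image_mono northcott_matrix[of "matrix_height A0"]]) (use assms(2) in blast)
  have ne: "?H \<noteq> {}" using A0 by auto
  have "Min ?H \<in> ?H" by (rule Min_in[OF fin ne])
  then obtain A where A: "A \<in> S" "matrix_height A \<le> matrix_height A0" "matrix_height A = Min ?H" by auto
  have "matrix_height A \<le> matrix_height B" if "B \<in> S" for B
  proof (cases "matrix_height B \<le> matrix_height A0")
    case True
    thus ?thesis unfolding A(3) using that by (intro Min_le[OF fin]) auto
  qed (use A(2) in auto)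
  thus ?thesis using A(1) by blast
qed

section \<open>Reflections and heights of isometries\<close>

lemma bilin_add_right: "bilin F x (y + z) = bilin F x y + bilin F x z"
  by (simp add: bilin_def ring_distribs sum.distrib)

lemma bilin_add_left: "bilin F (x + y) z = bilin F x z + bilin F y z"
  by (simp add: bilin_def ring_distribs sum.distrib)

lemma bilin_scale_right: "bilin F x (c *s y) = c * bilin F x y"
  by (simp add: bilin_def sum_distrib_left mult_ac)

lemma bilin_scale_left: "bilin F (c *s x) y = c * bilin F x y"
  by (simp add: bilin_def sum_distrib_left mult_ac)

lemma bilin_zero [simp]: "bilin F 0 y = 0" "bilin F x 0 = 0"
  by (simp_all add: bilin_def)

lemma bilin_diff_right: "bilin F x (y - z) = bilin F x y - bilin F x z"
  by (simp add: bilin_def ring_distribs sum_subtractf)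

lemma bilin_diff_left: "bilin F (x - y) z = bilin F x z - bilin F y z"
  by (simp add: bilin_def ring_distribs sum_subtractf)

lemma bilin_sym:
  assumes "transpose F = F" shows "bilin F x y = bilin F y x"
proof -
  have F: "F $ i $ j = F $ j $ i" for i j
  proof -
    have "F $ i $ j = transpose F $ i $ j" using assms by simp
    thus ?thesis by (simp add: transpose_def)
  qed
  have "bilin F x y = (\<Sum>i\<in>UNIV. \<Sum>j\<in>UNIV. F $ j $ i * y $ j * x $ i)"
    unfolding bilin_def
  proof (intro sum.cong refl)
    fix i j
    show "F $ i $ j * x $ i * y $ j = F $ j $ i * y $ j * x $ i" using F[of i j] by simp
  qed
  also have "\<dots> = bilin F y x" unfolding bilin_def by (rule sum.swap)
  finally show ?thesis .
qed

text \<open>The reflection of the whole space. For an anisotropic \<open>y\<close> in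
  \<open>Z\<close> it restricts to the reflection of \<open>Z\<close> and to the identity on the
  orthogonal complement, so it is one of its own \<open>extensions\<close>.\<close>

definition reflect :: "'k::field ^ 'n ^ 'n \<Rightarrow> 'k ^ 'n \<Rightarrow> 'k ^ 'n \<Rightarrow> 'k ^ 'n" where
  "reflect F y x = x - (2 * bilin F y x / bilin F y y) *s y"

lemma reflect_add: "reflect F y (a + b) = reflect F y a + reflect F y b"
  by (simp add: reflect_def bilin_add_right distrib_left add_divide_distrib vec.scale_left_distrib)

lemma reflect_scale: "reflect F y (c *s a) = c *s reflect F y a"
  by (simp add: reflect_def bilin_scale_right vec.scale_right_diff_distrib mult.left_commute)

lemma reflect_linear: "Vector_Spaces.linear (*s) (*s) (reflect F y)"
  by (simp add: Vector_Spaces.linear_iff reflect_add reflect_scale vec.vector_space_axioms)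

context
  fixes F :: "'k::field ^ 'n ^ 'n"
  assumes sym: "transpose F = F"
begin

lemma reflect_isometry:
  assumes "bilin F y y \<noteq> 0" shows "bilin F (reflect F y a) (reflect F y b) = bilin F a b"
  using assms bilin_sym[OF sym, of a y]
  by (simp add: reflect_def bilin_diff_left bilin_diff_right bilin_scale_left bilin_scale_right field_simps)

lemma reflect_self: assumes "bilin F y y \<noteq> 0" shows "reflect F y y = - y"
  using assms by (simp add: reflect_def Finite_Cartesian_Product.vec_eq_iff)

lemma reflect_invol:
  assumes "bilin F y y \<noteq> 0" shows "reflect F y (reflect F y a) = a"
proof -
  have "bilin F y (reflect F y a) = - bilin F y a"
    using assms by (simp add: reflect_def bilin_diff_right bilin_scale_right)
  thus ?thesis unfolding reflect_def[of F y "reflect F y a"] by (simp add: reflect_def)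
qed

lemma reflect_orth: assumes "bilin F y x = 0" shows "reflect F y x = x"
  using assms by (simp add: reflect_def)

lemma reflect_mem: assumes "vec.subspace Z" "y \<in> Z" "x \<in> Z" shows "reflect F y x \<in> Z"
  unfolding reflect_def by (intro vec.subspace_diff vec.subspace_scale assms)

lemma reflect_isometries:
  assumes Z: "vec.subspace Z" "y \<in> Z" and y: "bilin F y y \<noteq> 0"
  shows "reflect F y \<in> isometries F Z"
proof -
  have "bij_betw (reflect F y) Z Z"
    by (rule bij_betw_byWitness[where f'="reflect F y"]) (auto simp: reflect_invol[OF y] reflect_mem[OF Z])
  thus ?thesis unfolding isometries_def by (auto simp: reflect_add reflect_scale reflect_isometry[OF y])
qed

lemma reflect_reflections:
  assumes "vec.subspace Z" "y \<in> Z" "bilin F y y \<noteq> 0" shows "reflect F y \<in> reflections F Z"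
  unfolding reflections_def using reflect_isometries[OF assms] assms(2,3) by (auto simp: reflect_def)

end

lemma isometries_linear:
  assumes "\<rho> \<in> isometries F UNIV" shows "Vector_Spaces.linear (*s) (*s) \<rho>"
  using assms unfolding isometries_def by (simp add: Vector_Spaces.linear_iff vec.vector_space_axioms)

lemma isometries_bilin: "\<rho> \<in> isometries F UNIV \<Longrightarrow> bilin F (\<rho> x) (\<rho> y) = bilin F x y"
  unfolding isometries_def by simp

lemma isometries_compose:
  assumes "\<rho> \<in> isometries F Z" "\<tau> \<in> isometries F Z" shows "\<tau> \<circ> \<rho> \<in> isometries F Z"
proof -
  have b: "bij_betw \<rho> Z Z" "bij_betw \<tau> Z Z" using assms by (auto simp: isometries_def)
  have "\<rho> x \<in> Z" if "x \<in> Z" for x using b(1) that by (auto simp: bij_betw_def)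
  thus ?thesis using assms bij_betw_trans[OF b] unfolding isometries_def by auto
qed

section \<open>Heights of reflections and of vectors moved by an isometry\<close>

lemma arch_const_nonneg: "C \<ge> 0 \<Longrightarrow> 0 \<le> arch_const C w" by (simp add: arch_const_def)

lemma arch_const_mult: "arch_const (a * b) w = arch_const a w * arch_const b w" by (simp add: arch_const_def)

lemma arch_const_mono: "a \<le> b \<Longrightarrow> arch_const a w \<le> arch_const b w" by (simp add: arch_const_def)

lemma w_numeral: "w \<in> places \<Longrightarrow> w 2 \<le> arch_const 2 (w :: 'k::number_field \<Rightarrow> real)"
proof (cases "archimedean w")
  case True
  hence "w (of_rat 2) = 2" unfolding archimedean_def by (metis abs_numeral of_rat_numeral_eq)
  thus "w 2 \<le> arch_const 2 w" using True by (simp add: arch_const_def)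
next
  case False
  assume "w \<in> places"
  thus "w 2 \<le> arch_const 2 w" using nonarch_of_int[OF _ False, of 2] False by (simp add: arch_const_def)
qed

text \<open>The Euclidean norm is bounded by the sum. The resulting factor, the cardinality in place
  of its square root, still fits into the constant \<open>2 N^2\<close>.\<close>

lemma l2_or_max_le_card:
  assumes "finite I" "I \<noteq> {}" "\<And>i. i \<in> I \<Longrightarrow> 0 \<le> f i" "\<And>i. i \<in> I \<Longrightarrow> f i \<le> G" "G \<ge> 0"
  shows "l2_or_max (archimedean w) I f \<le> arch_const (real (card I)) w * G"
proof (cases "archimedean w")
  case True
  have "l2_or_max True I f \<le> (\<Sum>i\<in>I. f i)" unfolding l2_or_max_def using assms(3) L2_set_le_sum[of I f] by simp
  also have "\<dots> \<le> real (card I) * G" using assms(4) by (rule sum_bounded_above)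
  finally show ?thesis using True by (simp add: arch_const_def)
qed (use assms in \<open>auto simp: l2_or_max_def arch_const_def\<close>)

lemma mat_norm_one: assumes w: "w \<in> places"
  shows "mat_norm w (Finite_Cartesian_Product.mat 1 :: 'k::number_field ^ 'n ^ 'n) \<le> arch_const (real CARD('n)) w"
proof -
  have row: "vec_norm w ((Finite_Cartesian_Product.mat 1 :: 'k ^ 'n ^ 'n) $ i) \<le> 1" for i
  proof (cases "archimedean w")
    case True
    have "(\<Sum>j\<in>UNIV. w ((Finite_Cartesian_Product.mat 1 :: 'k ^ 'n ^ 'n) $ i $ j)) = (\<Sum>j\<in>UNIV. if j = i then 1 else 0)"
      by (rule sum.cong) (auto simp: Finite_Cartesian_Product.mat_def av_zero[OF place_av[OF w]] av_one[OF place_av[OF w]])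
    also have "\<dots> = 1" by simp
    finally show ?thesis unfolding place_norm_def l2_or_max_def
      using True L2_set_le_sum[of UNIV "\<lambda>j. w ((Finite_Cartesian_Product.mat 1 :: 'k ^ 'n ^ 'n) $ i $ j)"]
      by (simp add: w_nonneg[OF w])
  next
    case False
    thus ?thesis unfolding place_norm_def l2_or_max_def
      by (auto simp: Finite_Cartesian_Product.mat_def av_zero[OF place_av[OF w]] av_one[OF place_av[OF w]])
  qed
  have "mat_norm w (Finite_Cartesian_Product.mat 1 :: 'k ^ 'n ^ 'n) \<le> arch_const (real (card (UNIV :: 'n set))) w * 1"
    unfolding mat_norm_rows[OF w] by (rule l2_or_max_le_card) (auto simp: place_norm_nonneg[OF w] row)
  thus ?thesis by simp
qed

lemma mat_norm_outer: assumes w: "w \<in> places"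
  shows "mat_norm w (\<chi> i j. y $ i * z $ j) = vec_norm w (y :: 'k::number_field ^ 'm) * vec_norm w (z :: 'k ^ 'n)"
proof -
  have "(\<lambda>i. vec_norm w ((\<chi> i j. y $ i * z $ j) $ i)) = (\<lambda>i. vec_norm w z * w (y $ i))"
  proof
    fix i
    show "vec_norm w ((\<chi> i j. y $ i * z $ j) $ i) = vec_norm w z * w (y $ i)"
      using place_norm_scale[OF w, of UNIV "y $ i" "\<lambda>j. z $ j"] by simp
  qed
  hence "mat_norm w (\<chi> i j. y $ i * z $ j) = l2_or_max (archimedean w) UNIV (\<lambda>i. vec_norm w z * w (y $ i))"
    unfolding mat_norm_rows[OF w] by (rule arg_cong)
  also have "\<dots> = vec_norm w z * vec_norm w y" unfolding place_norm_def[of w UNIV "\<lambda>i. y $ i"]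
    by (rule l2_or_max_scale) (auto simp: place_norm_nonneg[OF w])
  finally show ?thesis by simp
qed

lemma mat_norm_add: "w \<in> places \<Longrightarrow> mat_norm w (A + B) \<le> arch_const 2 w * max (mat_norm w A) (mat_norm w (B :: 'k::number_field ^ 'n ^ 'm))"
  using place_norm_add[of w UNIV "\<lambda>(i, j). A $ i $ j" "\<lambda>(i, j). B $ i $ j"] by (simp add: case_prod_beta')

definition vec_height :: "'k::number_field ^ 'n \<Rightarrow> real" where
  "vec_height x = global_height (\<lambda>w. vec_norm w x)"

lemma matrix_refl: "matrix (reflect F y) $ i $ j =
    (Finite_Cartesian_Product.mat 1 :: 'k::field ^ 'n ^ 'n) $ i $ j - 2 * bilin F y (axis j 1) / bilin F y y * y $ i"
  by (simp add: matrix_def reflect_def axis_def Finite_Cartesian_Product.mat_def)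

lemma bilin_axis:
  assumes "transpose F = F" shows "bilin F y (axis j 1) = (F *v y) $ j"
proof -
  have "bilin F y (axis j 1) = (\<Sum>i\<in>UNIV. (axis j 1 :: 'a ^ 'b) $ i * (F *v y) $ i)"
    by (subst bilin_sym[OF assms]) (rule bilin_dot)
  also have "\<dots> = (\<Sum>i\<in>UNIV. if i = j then (F *v y) $ i else 0)"
    by (rule sum.cong) (auto simp: axis_def)
  finally show ?thesis by simp
qed

lemma reflect_matrix_nonzero:
  assumes "transpose F = F" "bilin F y y \<noteq> 0" shows "matrix (reflect F y) \<noteq> (0 :: 'k::field_char_0 ^ 'n ^ 'n)"
proof
  assume "matrix (reflect F y) = 0"
  hence "reflect F y y = 0" using matrix_works[OF reflect_linear, of F y y] by simp
  hence "y = 0" using reflect_self[OF assms] by simp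
  thus False using assms(2) by simp
qed

text \<open>By the product formula the matrix may be multiplied by \<open>bilin F y y\<close>. It
  becomes a scalar matrix minus twice the outer product of \<open>y\<close> and
  \<open>F *v y\<close>, and every term is then quadratic in \<open>y\<close> and linear in
  \<open>F\<close>.\<close>

lemma height_refl:
  fixes F :: "'k::number_field ^ 'n ^ 'n"
  assumes sym: "transpose F = F" and y: "bilin F y y \<noteq> 0" and N: "CARD('n) \<ge> 2"
  shows "matrix_height (matrix (reflect F y)) \<le> 2 * real CARD('n) * matrix_height F * vec_height y ^ 2"
proof -
  let ?N = "real CARD('n)" and ?b = "bilin F y y" and ?T = "matrix (reflect F y)"
  have F0: "F \<noteq> 0" using y by (auto simp: bilin_def)
  have y0: "y \<noteq> 0" using y by auto
  have T0: "?T \<noteq> 0" by (rule reflect_matrix_nonzero[OF sym y])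
  have local: "w ?b * mat_norm w ?T \<le> arch_const (2 * ?N) w * mat_norm w F * vec_norm w y ^ 2" if w: "w \<in> places" for w
  proof -
    define A where "A = (\<chi> i j. ?b * (Finite_Cartesian_Product.mat 1 :: 'k ^ 'n ^ 'n) $ i $ j)"
    define B where "B = (\<chi> i j. (- 2) * (\<chi> i j. y $ i * (F *v y) $ j) $ i $ j)"
    have "(\<chi> i j. ?b * ?T $ i $ j) = A + B"
      using y by (simp add: Finite_Cartesian_Product.vec_eq_iff A_def B_def matrix_refl bilin_axis[OF sym] field_simps)
    hence "w ?b * mat_norm w ?T = mat_norm w (A + B)" using mat_norm_scale[OF w, of ?b ?T] by (simp only:)
    hence "w ?b * mat_norm w ?T \<le> arch_const 2 w * max (mat_norm w A) (mat_norm w B)"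
      using mat_norm_add[OF w, of A B] by (simp only:)
    also have "\<dots> \<le> arch_const 2 w * (arch_const ?N w * (mat_norm w F * vec_norm w y ^ 2))"
    proof (intro mult_left_mono max.boundedI)
      have "mat_norm w A = w ?b * mat_norm w (Finite_Cartesian_Product.mat 1 :: 'k ^ 'n ^ 'n)" unfolding A_def by (rule mat_norm_scale[OF w])
      also have "\<dots> \<le> (mat_norm w F * vec_norm w y * vec_norm w y) * arch_const ?N w"
        by (intro mult_mono bilin_le mat_norm_one w) (auto intro!: mult_nonneg_nonneg place_norm_nonneg[OF w])
      finally show "mat_norm w A \<le> arch_const ?N w * (mat_norm w F * vec_norm w y ^ 2)" by (simp add: power2_eq_square mult_ac)
      have "mat_norm w B = w (- 2) * (vec_norm w y * vec_norm w (F *v y))" unfolding B_def mat_norm_scale[OF w] mat_norm_outer[OF w] ..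
      also have "w (- 2) = w 2" by (rule av_uminus[OF place_av[OF w]])
      \<comment> \<open>Here \<open>2 \<le> N\<close> is used: the factor 2 of the outer product is
        absorbed by the factor \<open>?N\<close> that the identity matrix costs anyway.\<close>
      also have "w 2 * (vec_norm w y * vec_norm w (F *v y)) \<le> arch_const ?N w * (vec_norm w y * (mat_norm w F * vec_norm w y))"
        using N by (intro mult_mono vec_norm_mult w order_trans[OF w_numeral[OF w]] arch_const_mono)
          (auto intro!: mult_nonneg_nonneg place_norm_nonneg[OF w] arch_const_nonneg)
      finally show "mat_norm w B \<le> arch_const ?N w * (mat_norm w F * vec_norm w y ^ 2)" by (simp add: power2_eq_square mult_ac)
    qed (simp add: arch_const_nonneg)
    finally show ?thesis by (simp add: arch_const_mult mult_ac)
  qed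
  have "matrix_height ?T = global_height (\<lambda>w. w ?b * mat_norm w ?T)"
    unfolding matrix_height_eq[OF T0] using y T0 by (simp add: global_height_mult adelic_principal adelic_mat_norm global_height_principal)
  also have "\<dots> \<le> global_height (\<lambda>w. arch_const (2 * ?N) w * mat_norm w F * vec_norm w y ^ 2)"
    using y T0 F0 y0 N local by (intro global_height_mono adelic_mult adelic_principal adelic_mat_norm adelic_arch_const adelic_power adelic_vec_norm) auto
  also have "\<dots> = 2 * ?N * matrix_height F * vec_height y ^ 2"
    using F0 y0 N by (simp add: global_height_mult global_height_power global_height_arch_const adelic_mult adelic_arch_const adelic_power adelic_mat_norm adelic_vec_norm
        matrix_height_eq vec_height_def)
  finally show ?thesis .
qed

lemma isometry_matrix_nonzero:
  assumes "\<rho> \<in> isometries F UNIV" "bilin F x x \<noteq> 0" shows "matrix \<rho> \<noteq> (0 :: 'k::field ^ 'n ^ 'n)"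
proof
  assume "matrix \<rho> = 0"
  hence "\<rho> x = 0" using matrix_works[OF isometries_linear[OF assms(1)], of x] by simp
  hence "bilin F x x = 0" using isometries_bilin[OF assms(1), of x x] by simp
  thus False using assms(2) by simp
qed

text \<open>Were the norm below 1, the iterates of an anisotropic vector under the isometry would tend to 0,
  although the form is constant on them.\<close>
lemma isometry_mat_norm_ge_1:
  fixes F :: "'k::number_field ^ 'n ^ 'n"
  assumes \<rho>: "\<rho> \<in> isometries F UNIV" and x: "bilin F x x \<noteq> 0" and w: "w \<in> places"
  shows "mat_norm w (matrix \<rho>) \<ge> 1"
proof (rule ccontr)
  let ?m = "mat_norm w (matrix \<rho>)"
  assume "\<not> ?thesis"
  hence m: "?m < 1" by simp
  have m0: "0 \<le> ?m" by (rule place_norm_nonneg[OF w]) auto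
  have it: "vec_norm w ((\<rho> ^^ n) x) \<le> ?m ^ n * vec_norm w x" for n
  proof (induction n)
    case (Suc n)
    have "vec_norm w ((\<rho> ^^ Suc n) x) \<le> ?m * vec_norm w ((\<rho> ^^ n) x)"
      using vec_norm_mult[OF w, of "matrix \<rho>" "(\<rho> ^^ n) x"] matrix_works[OF isometries_linear[OF \<rho>]] by simp
    also have "\<dots> \<le> ?m * (?m ^ n * vec_norm w x)" by (intro mult_left_mono Suc m0)
    finally show ?case by (simp add: mult_ac)
  qed simp
  have bi: "bilin F ((\<rho> ^^ n) x) ((\<rho> ^^ n) x) = bilin F x x" for n
    by (induction n) (simp_all add: isometries_bilin[OF \<rho>])
  have le: "w (bilin F x x) \<le> mat_norm w F * (?m ^ n * vec_norm w x) * (?m ^ n * vec_norm w x)" for n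
  proof -
    have "w (bilin F x x) \<le> mat_norm w F * vec_norm w ((\<rho> ^^ n) x) * vec_norm w ((\<rho> ^^ n) x)"
      using bilin_le[OF w, of F "(\<rho> ^^ n) x" "(\<rho> ^^ n) x"] bi by simp
    also have "\<dots> \<le> mat_norm w F * (?m ^ n * vec_norm w x) * (?m ^ n * vec_norm w x)"
      using m0 by (intro mult_mono it) (auto intro!: mult_nonneg_nonneg place_norm_nonneg[OF w])
    finally show ?thesis .
  qed
  have "(\<lambda>n. mat_norm w F * (?m ^ n * vec_norm w x) * (?m ^ n * vec_norm w x)) \<longlonglongrightarrow> mat_norm w F * (0 * vec_norm w x) * (0 * vec_norm w x)"
    using m m0 by (intro tendsto_mult tendsto_const LIMSEQ_power_zero) auto
  hence "w (bilin F x x) \<le> mat_norm w F * (0 * vec_norm w x) * (0 * vec_norm w x)"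
    by (rule LIMSEQ_le_const) (use le in auto)
  thus False using av_pos[OF place_av[OF w] x] by simp
qed

text \<open>Since the matrix has norm at least 1 at every place, its norm times that of
  \<open>x\<close> bounds both \<open>\<rho> x\<close> and \<open>x\<close>, and the maximum of the
  two is not lost.\<close>

lemma vec_height_diff_isometry:
  fixes F :: "'k::number_field ^ 'n ^ 'n"
  assumes \<rho>: "\<rho> \<in> isometries F UNIV" and x: "bilin F x x \<noteq> 0" and y: "y = \<rho> x + x \<or> y = \<rho> x - x" "y \<noteq> 0"
  shows "vec_height y \<le> 2 * matrix_height (matrix \<rho>) * vec_height x"
proof -
  have A0: "matrix \<rho> \<noteq> 0" by (rule isometry_matrix_nonzero[OF \<rho> x])
  have x0: "x \<noteq> 0" using x by auto
  have local: "vec_norm w y \<le> arch_const 2 w * mat_norm w (matrix \<rho>) * vec_norm w x" if w: "w \<in> places" for w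
  proof -
    have "vec_norm w (\<rho> x) \<le> mat_norm w (matrix \<rho>) * vec_norm w x"
      using vec_norm_mult[OF w, of "matrix \<rho>" x] matrix_works[OF isometries_linear[OF \<rho>]] by simp
    moreover have "1 * vec_norm w x \<le> mat_norm w (matrix \<rho>) * vec_norm w x"
      by (intro mult_right_mono isometry_mat_norm_ge_1[OF \<rho> x w] place_norm_nonneg[OF w]) auto
    moreover have "vec_norm w y \<le> arch_const 2 w * max (vec_norm w (\<rho> x)) (vec_norm w x)"
      using y(1) vec_norm_add[OF w, of "\<rho> x" x] vec_norm_add[OF w, of "\<rho> x" "- x"] by (auto simp: vec_norm_uminus[OF w] simp del: vector_uminus_component)
    ultimately show ?thesis
      using mult_left_mono[of "max (vec_norm w (\<rho> x)) (vec_norm w x)" "mat_norm w (matrix \<rho>) * vec_norm w x" "arch_const 2 w"]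
      by (simp add: arch_const_nonneg mult.assoc)
  qed
  have "vec_height y \<le> global_height (\<lambda>w. arch_const 2 w * mat_norm w (matrix \<rho>) * vec_norm w x)"
    unfolding vec_height_def using A0 x0 y(2) local by (intro global_height_mono adelic_mult adelic_arch_const adelic_mat_norm adelic_vec_norm) auto
  also have "\<dots> = 2 * matrix_height (matrix \<rho>) * vec_height x"
    using A0 x0 by (simp add: global_height_mult global_height_arch_const adelic_mult adelic_arch_const adelic_mat_norm adelic_vec_norm matrix_height_eq vec_height_def)
  finally show ?thesis .
qed

lemma matrix_height_compose:
  fixes \<rho> \<tau> :: "'k::number_field ^ 'n \<Rightarrow> 'k ^ 'n"
  assumes "Vector_Spaces.linear (*s) (*s) \<rho>" "Vector_Spaces.linear (*s) (*s) \<tau>"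
    and nz: "matrix (\<tau> \<circ> \<rho>) \<noteq> 0" "matrix \<rho> \<noteq> 0" "matrix \<tau> \<noteq> 0"
  shows "matrix_height (matrix (\<tau> \<circ> \<rho>)) \<le> matrix_height (matrix \<tau>) * matrix_height (matrix \<rho>)"
proof -
  have "matrix (\<tau> \<circ> \<rho>) = matrix \<tau> ** matrix \<rho>" by (rule matrix_compose_gen[OF assms(1,2)])
  hence "global_height (\<lambda>w. mat_norm w (matrix (\<tau> \<circ> \<rho>))) \<le> global_height (\<lambda>w. mat_norm w (matrix \<tau>) * mat_norm w (matrix \<rho>))"
    using nz by (intro global_height_mono adelic_mult adelic_mat_norm) (auto intro: mat_norm_mult)
  thus ?thesis using nz by (simp add: matrix_height_eq global_height_mult adelic_mat_norm)
qed

section \<open>Minors of bases of subspaces\<close>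

text \<open>Minors with the rows given as a list, in any order and possibly repeated. Laplace
  expansion prepends or appends a row, which a set of rows cannot express.\<close>

definition row_det :: "('k::field ^ 'n) list \<Rightarrow> 'n list \<Rightarrow> 'k" where
  "row_det xs rs = Determinant.det (Matrix.mat (length xs) (length xs) (\<lambda>(i, j). (xs ! j) $ (rs ! i)))"

lemma minor_row_det: "minor xs I = row_det xs (sorted_list_of_set I)"
  by (simp add: minor_def row_det_def)

lemma row_det_not_distinct:
  assumes "length rs = length xs" "\<not> distinct rs" shows "row_det xs rs = 0"
proof -
  obtain i j where ij: "i < length rs" "j < length rs" "i \<noteq> j" "rs ! i = rs ! j"
    using assms(2) by (auto simp: distinct_conv_nth)
  show ?thesis unfolding row_det_def
    by (rule det_identical_rows[of _ "length xs" i j]) (use ij assms(1) in \<open>auto intro!: eq_vecI\<close>)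
qed

lemma row_det_distinct:
  assumes "length rs = length xs" "distinct rs"
  shows "row_det xs rs = minor xs (set rs) \<or> row_det xs rs = - minor xs (set rs)"
proof -
  let ?ss = "sorted_list_of_set (set rs)" and ?n = "length xs"
  have ls: "length ?ss = ?n" using assms by (simp add: distinct_card)
  have "mset rs = mset ?ss" using assms(2) by (simp add: set_eq_iff_mset_eq_distinct[symmetric])
  then obtain p where p: "p permutes {..<length ?ss}" "permute_list p ?ss = rs" by (rule mset_eq_permutation)
  have p': "p permutes {0..<?n}" using p(1) ls by (simp add: lessThan_atLeast0)
  let ?A = "Matrix.mat ?n ?n (\<lambda>(i, j). (xs ! j) $ (?ss ! i))"
  have "Matrix.mat ?n ?n (\<lambda>(i, j). (xs ! j) $ (rs ! i)) = Matrix.mat ?n ?n (\<lambda>(i, j). ?A $$ (p i, j))"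
  proof (rule eq_matI)
    fix i j assume "i < dim_row (Matrix.mat ?n ?n (\<lambda>(i, j). ?A $$ (p i, j)))" "j < dim_col (Matrix.mat ?n ?n (\<lambda>(i, j). ?A $$ (p i, j)))"
    hence ij: "i < ?n" "j < ?n" by auto
    have "rs ! i = ?ss ! p i" using permute_list_nth[OF p(1), of i] p(2) ij ls by simp
    moreover have "p i < ?n" using permutes_in_image[OF p', of i] ij by simp
    ultimately show "Matrix.mat ?n ?n (\<lambda>(i, j). (xs ! j) $ (rs ! i)) $$ (i, j) = Matrix.mat ?n ?n (\<lambda>(i, j). ?A $$ (p i, j)) $$ (i, j)"
      using ij by simp
  qed auto
  hence "row_det xs rs = signof p * minor xs (set rs)"
    unfolding minor_row_det row_det_def using det_permute_rows[OF _ p', of ?A] by simp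
  thus ?thesis by (auto simp: sign_def)
qed

lemma w_row_det:
  assumes w: "w \<in> places" and "length rs = length xs"
  shows "w (row_det xs rs) = (if distinct rs then w (minor xs (set rs)) else 0)"
  using row_det_distinct[OF assms(2)] row_det_not_distinct[OF assms(2)] av_uminus[OF place_av[OF w]] av_zero[OF place_av[OF w]]
  by (cases "distinct rs") auto

text \<open>The cofactors along a row do not depend on that row.\<close>
lemma laplace_row_update:
  assumes k: "k < n"
  shows "\<exists>C. (\<forall>f. Determinant.det (Matrix.mat n n (\<lambda>(i, j). if i = k then f j else g i j)) = (\<Sum>j<n. C j * (f j :: 'a::comm_ring_1)))
    \<and> (\<forall>j<n. C j = cofactor (Matrix.mat n n (\<lambda>(i, j). if i = k then 0 else g i j)) k j)"
proof -
  define C where "C j = cofactor (Matrix.mat n n (\<lambda>(i, j). if i = k then 0 else g i j)) k j" for j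
  have "Determinant.det (Matrix.mat n n (\<lambda>(i, j). if i = k then f j else g i j)) = (\<Sum>j<n. C j * f j)" for f
  proof -
    let ?A = "Matrix.mat n n (\<lambda>(i, j). if i = k then f j else g i j)"
    have "Determinant.det ?A = (\<Sum>j<n. ?A $$ (k, j) * cofactor ?A k j)"
      by (rule laplace_expansion_row) (use k in auto)
    also have "\<dots> = (\<Sum>j<n. C j * f j)"
    proof (rule sum.cong[OF refl])
      fix j assume j: "j \<in> {..<n}"
      have "mat_delete ?A k j = mat_delete (Matrix.mat n n (\<lambda>(i, j). if i = k then 0 else g i j)) k j"
        by (rule eq_matI) (auto simp: mat_delete_def)
      thus "?A $$ (k, j) * cofactor ?A k j = C j * f j" using j k by (simp add: C_def cofactor_def)
    qed
    finally show ?thesis .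
  qed
  thus ?thesis by (auto simp: C_def)
qed

lemma row_det_expand_last:
  assumes "length rs = l" "length xs = Suc l"
  shows "\<exists>C. (\<forall>r. row_det xs (rs @ [r]) = (\<Sum>j<Suc l. C j * (xs ! j) $ r)) \<and> C l = row_det (take l xs) rs"
proof -
  let ?g = "\<lambda>i j. (xs ! j) $ (rs ! i)"
  obtain C where C: "\<forall>f. Determinant.det (Matrix.mat (Suc l) (Suc l) (\<lambda>(i, j). if i = l then f j else ?g i j)) = (\<Sum>j<Suc l. C j * f j)"
    "\<forall>j<Suc l. C j = cofactor (Matrix.mat (Suc l) (Suc l) (\<lambda>(i, j). if i = l then 0 else ?g i j)) l j"
    using laplace_row_update[of l "Suc l" ?g] by auto
  have "row_det xs (rs @ [r]) = (\<Sum>j<Suc l. C j * (xs ! j) $ r)" for r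
  proof -
    have "Matrix.mat (Suc l) (Suc l) (\<lambda>(i, j). (xs ! j) $ ((rs @ [r]) ! i)) =
        Matrix.mat (Suc l) (Suc l) (\<lambda>(i, j). if i = l then (xs ! j) $ r else ?g i j)"
      by (rule eq_matI) (use assms in \<open>auto simp: nth_append less_Suc_eq\<close>)
    thus ?thesis unfolding row_det_def assms(2) using C(1) by simp
  qed
  moreover have "C l = row_det (take l xs) rs"
  proof -
    have "mat_delete (Matrix.mat (Suc l) (Suc l) (\<lambda>(i, j). if i = l then 0 else ?g i j)) l l
        = Matrix.mat l l (\<lambda>(i, j). (take l xs ! j) $ (rs ! i))"
      by (rule eq_matI) (auto simp: mat_delete_def)
    thus ?thesis using C(2) assms unfolding row_det_def by (simp add: cofactor_def min_def)
  qed
  ultimately show ?thesis by blast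
qed

lemma row_det_expand_first:
  assumes "length rs = length zs"
  shows "\<exists>C. (\<forall>r. row_det (x # zs) (r # rs) = C 0 * x $ r + (\<Sum>j<length zs. C (Suc j) * (zs ! j) $ r)) \<and> C 0 = row_det zs rs"
proof -
  let ?l = "length zs"
  let ?g = "\<lambda>i j. ((x # zs) ! j) $ (rs ! (i - 1))"
  obtain C where C: "\<forall>f. Determinant.det (Matrix.mat (Suc ?l) (Suc ?l) (\<lambda>(i, j). if i = 0 then f j else ?g i j)) = (\<Sum>j<Suc ?l. C j * f j)"
    "\<forall>j<Suc ?l. C j = cofactor (Matrix.mat (Suc ?l) (Suc ?l) (\<lambda>(i, j). if i = 0 then 0 else ?g i j)) 0 j"
    using laplace_row_update[of 0 "Suc ?l" ?g] by auto
  have "row_det (x # zs) (r # rs) = C 0 * x $ r + (\<Sum>j<?l. C (Suc j) * (zs ! j) $ r)" for r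
  proof -
    have "Matrix.mat (Suc ?l) (Suc ?l) (\<lambda>(i, j). ((x # zs) ! j) $ ((r # rs) ! i)) =
        Matrix.mat (Suc ?l) (Suc ?l) (\<lambda>(i, j). if i = 0 then ((x # zs) ! j) $ r else ?g i j)"
      by (rule eq_matI) (auto simp: nth_Cons')
    hence "row_det (x # zs) (r # rs) = (\<Sum>j<Suc ?l. C j * ((x # zs) ! j) $ r)"
      unfolding row_det_def using C(1) by simp
    thus ?thesis by (simp add: sum.lessThan_Suc_shift del: sum.lessThan_Suc)
  qed
  moreover have "C 0 = row_det zs rs"
  proof -
    have "mat_delete (Matrix.mat (Suc ?l) (Suc ?l) (\<lambda>(i, j). if i = 0 then 0 else ?g i j)) 0 0
        = Matrix.mat ?l ?l (\<lambda>(i, j). (zs ! j) $ (rs ! i))"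
      by (rule eq_matI) (auto simp: mat_delete_def)
    thus ?thesis using C(2) unfolding row_det_def by (simp add: cofactor_def)
  qed
  ultimately show ?thesis by blast
qed

lemma nth_inv_list: "distinct xs \<Longrightarrow> i < length xs \<Longrightarrow> the_inv_into {..<length xs} ((!) xs) (xs ! i) = i"
  by (rule the_inv_into_f_f) (auto simp: inj_on_def nth_eq_iff_index_eq)

lemma sum_list_index: "distinct xs \<Longrightarrow> (\<Sum>v\<in>set xs. f v) = (\<Sum>i<length xs. f (xs ! i))"
  using sum.reindex_bij_betw[OF bij_betw_nth[of xs "{..<length xs}" "set xs"], of f] by simp

lemma list_independent:
  assumes "distinct xs" "vec.independent (set xs)" "(\<Sum>j<length xs. c j *s xs ! j) = 0" "j < length xs"
  shows "c j = 0"
proof -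
  let ?u = "\<lambda>v. c (the_inv_into {..<length xs} ((!) xs) v)"
  have "(\<Sum>v\<in>set xs. ?u v *s v) = (\<Sum>j<length xs. c j *s xs ! j)"
    unfolding sum_list_index[OF assms(1)] by (rule sum.cong) (auto simp: nth_inv_list[OF assms(1)])
  hence "(\<Sum>v\<in>set xs. ?u v *s v) = 0" using assms(3) by simp
  hence "?u (xs ! j) = 0" using vec.independentD[OF assms(2), of "set xs" ?u "xs ! j"] assms(4) by simp
  thus ?thesis by (simp add: nth_inv_list[OF assms(1,4)])
qed

lemma list_span:
  assumes "distinct ys" "z \<in> vec.span (set ys)"
  shows "\<exists>c. z = (\<Sum>k<length ys. c k *s ys ! k)"
proof -
  obtain u where "z = (\<Sum>v\<in>set ys. u v *s v)" using assms(2) vec.span_finite[of "set ys"] by auto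
  hence "z = (\<Sum>k<length ys. u (ys ! k) *s ys ! k)" unfolding sum_list_index[OF assms(1)] .
  thus ?thesis by (rule exI[of _ "\<lambda>k. u (ys ! k)"])
qed

text \<open>If every further row gave determinant 0, the coefficients of the expansion along that
  row would form a linear relation whose last coefficient is the nonzero smaller minor.\<close>

lemma exists_nonzero_row_det:
  fixes xs :: "('k::field ^ 'n) list"
  assumes "distinct xs" "vec.independent (set xs)"
  shows "\<exists>rs. length rs = length xs \<and> row_det xs rs \<noteq> 0"
  using assms
proof (induction xs rule: rev_induct)
  case Nil
  have "row_det ([] :: ('k ^ 'n) list) [] = 1" unfolding row_det_def by (simp add: det_dim_zero)
  thus ?case by (intro exI[of _ "[]"]) simp
next
  case (snoc x xs)
  let ?l = "length xs"
  have "vec.independent (set xs)" using snoc.prems(2) by (rule vec.independent_mono) auto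
  then obtain rs where rs: "length rs = ?l" "row_det xs rs \<noteq> 0" using snoc by auto
  obtain C where C: "\<forall>r. row_det (xs @ [x]) (rs @ [r]) = (\<Sum>j<Suc ?l. C j * ((xs @ [x]) ! j) $ r)" "C ?l = row_det xs rs"
    using row_det_expand_last[of rs ?l "xs @ [x]"] rs by (auto simp del: sum.lessThan_Suc)
  show ?case
  proof (rule ccontr)
    assume "\<not> ?thesis"
    hence "row_det (xs @ [x]) (rs @ [r]) = 0" for r using rs(1) by auto
    hence "(\<Sum>j<Suc ?l. C j *s (xs @ [x]) ! j) = 0"
      using C(1) by (simp add: Finite_Cartesian_Product.vec_eq_iff del: sum.lessThan_Suc)
    hence "C ?l = 0" using list_independent[OF snoc.prems, of C ?l] by simp
    thus False using C(2) rs(2) by simp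
  qed
qed

lemma basis_length: assumes "subspace_basis U xs" shows "length xs = vec.dim U"
  using assms vec.dim_eq_card[of "set xs" U] distinct_card[of xs] unfolding subspace_basis_def
  by (metis vec.span_span)

lemma basis_exists_list: assumes "vec.subspace U" obtains xs where "subspace_basis U xs"
proof -
  obtain B where B: "B \<subseteq> U" "vec.independent B" "U \<subseteq> vec.span B" using vec.basis_exists[of U] by metis
  have "finite B" using vec.finiteI_independent[OF B(2)] .
  then obtain xs where "set xs = B" "distinct xs" using finite_distinct_list by blast
  moreover have "vec.span B = U" using B assms by (metis vec.span_minimal subset_antisym)
  ultimately show ?thesis using that B(2) unfolding subspace_basis_def by auto
qed

lemma basis_change:
  assumes xs: "subspace_basis U xs" and ys: "subspace_basis U ys"
  shows "\<exists>c. \<forall>I. minor xs I = c * minor ys I"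
proof -
  let ?n = "length ys"
  have len: "length xs = ?n" using basis_length[OF xs] basis_length[OF ys] by simp
  have "\<forall>j\<in>{..<?n}. \<exists>c. xs ! j = (\<Sum>k<?n. c k *s ys ! k)"
  proof
    fix j assume "j \<in> {..<?n}"
    hence "xs ! j \<in> vec.span (set ys)"
      using xs ys len vec.span_base[of "xs ! j" "set xs"] unfolding subspace_basis_def by auto
    thus "\<exists>c. xs ! j = (\<Sum>k<?n. c k *s ys ! k)" using ys unfolding subspace_basis_def by (intro list_span) auto
  qed
  from bchoice[OF this] obtain P where P: "\<forall>j\<in>{..<?n}. xs ! j = (\<Sum>k<?n. P j k *s ys ! k)" ..
  let ?P = "Matrix.mat ?n ?n (\<lambda>(k, j). P j k)"
  have "minor xs I = Determinant.det ?P * minor ys I" for I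
  proof -
    let ?Y = "Matrix.mat ?n ?n (\<lambda>(i, j). (ys ! j) $ (sorted_list_of_set I ! i))"
    have "Matrix.mat ?n ?n (\<lambda>(i, j). (xs ! j) $ (sorted_list_of_set I ! i)) = ?Y * ?P"
      by (rule eq_matI) (use P in \<open>auto simp: scalar_prod_def lessThan_atLeast0 mult.commute intro!: sum.cong\<close>)
    thus ?thesis unfolding minor_def len using det_mult[of ?Y ?n ?P] by (simp add: mult.commute)
  qed
  thus ?thesis by blast
qed

definition minors_norm :: "('k::number_field \<Rightarrow> real) \<Rightarrow> ('k ^ 'n::{finite,linorder}) list \<Rightarrow> real" where
  "minors_norm w xs = place_norm w {I. card I = length xs} (minor xs)"

lemma exists_nonzero_minor:
  assumes "subspace_basis U xs" shows "\<exists>I. card I = length xs \<and> minor xs I \<noteq> 0"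
proof -
  obtain rs where rs: "length rs = length xs" "row_det xs rs \<noteq> 0"
    using exists_nonzero_row_det assms unfolding subspace_basis_def by blast
  hence d: "distinct rs" using row_det_not_distinct by blast
  have "minor xs (set rs) \<noteq> 0" using row_det_distinct[OF rs(1) d] rs(2) by auto
  thus ?thesis using rs(1) distinct_card[OF d] by auto
qed

lemma adelic_minors_norm: assumes "subspace_basis U xs" shows "adelic (\<lambda>w. minors_norm w xs)"
proof -
  obtain I where "card I = length xs" "minor xs I \<noteq> 0" using exists_nonzero_minor[OF assms] by blast
  thus ?thesis unfolding minors_norm_def by (intro adelic_place_norm[of _ I]) auto
qed

text \<open>A change of basis multiplies all minors by one scalar, which the product formula
  removes. Any convenient basis can thus replace the chosen one.\<close>

lemma subspace_height_eq:
  assumes xs: "subspace_basis U xs" shows "subspace_height U = global_height (\<lambda>w. minors_norm w xs)"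
proof -
  define ys where "ys = (SOME xs. subspace_basis U xs)"
  have ys: "subspace_basis U ys" unfolding ys_def using xs by (rule someI)
  obtain c where c: "\<And>I. minor ys I = c * minor xs I" using basis_change[OF ys xs] by blast
  obtain I where I: "card I = length ys" "minor ys I \<noteq> 0" using exists_nonzero_minor[OF ys] by blast
  hence c0: "c \<noteq> 0" using c by auto
  have len: "length ys = length xs" using basis_length[OF xs] basis_length[OF ys] by simp
  have ne: "{I :: 'b set. card I = length xs} \<noteq> {}" using I len by auto
  have "subspace_height U = global_height (\<lambda>w. place_norm w {I. card I = length ys} (minor ys))"
    unfolding subspace_height_def Let_def ys_def[symmetric] by (rule height_eq[of _ I]) (use I in auto)
  also have "\<dots> = global_height (\<lambda>w. w c * minors_norm w xs)"
  proof (rule global_height_cong)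
    fix w :: "'a \<Rightarrow> real" assume w: "w \<in> places"
    have "minor ys = (\<lambda>I. c * minor xs I)" using c by auto
    thus "place_norm w {I. card I = length ys} (minor ys) = w c * minors_norm w xs"
      unfolding minors_norm_def len using place_norm_scale[OF w _ ne, of c "minor xs"] by simp
  qed
  also have "\<dots> = global_height (\<lambda>w. minors_norm w xs)"
    using c0 adelic_minors_norm[OF xs] by (simp add: global_height_mult adelic_principal global_height_principal)
  finally show ?thesis .
qed

lemma subspace_height_ge_1:
  assumes "vec.subspace U" shows "subspace_height (U :: ('k::number_field ^ 'n::{finite,linorder}) set) \<ge> 1"
proof -
  obtain xs where xs: "subspace_basis U xs" using basis_exists_list[OF assms] .
  obtain I where I: "card I = length xs" "minor xs I \<noteq> 0" using exists_nonzero_minor[OF xs] by blast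
  have "global_height (\<lambda>w. w (minor xs I)) \<le> global_height (\<lambda>w. minors_norm w xs)"
    using I adelic_minors_norm[OF xs] unfolding minors_norm_def by (intro global_height_mono adelic_principal place_norm_ge) auto
  thus ?thesis using global_height_principal[OF I(2)] subspace_height_eq[OF xs] by simp
qed

text \<open>For a basis \<open>xs\<close> of \<open>Z\<close> these vectors lie in \<open>Z\<close>, their coordinates are minors of \<open>xs\<close>, and they span
  \<open>Z\<close>; hence \<open>Z\<close> has a spanning set of vectors of height at most about that of \<open>Z\<close>.\<close>
definition minor_vec :: "('k::field ^ 'n) list \<Rightarrow> 'n list \<Rightarrow> 'k ^ 'n" where
  "minor_vec xs rs = (\<chi> r. row_det xs (rs @ [r]))"

lemma minor_vec_mem:
  assumes xs: "subspace_basis Z xs" and l: "length xs = Suc (length rs)"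
  shows "minor_vec xs rs \<in> Z"
proof -
  obtain C where C: "\<forall>r. row_det xs (rs @ [r]) = (\<Sum>j<length xs. C j * (xs ! j) $ r)"
    using row_det_expand_last[OF refl l] unfolding l by auto
  have "minor_vec xs rs = (\<Sum>j<length xs. C j *s xs ! j)"
    using C by (simp add: minor_vec_def Finite_Cartesian_Product.vec_eq_iff)
  also have "\<dots> \<in> vec.span (set xs)" by (intro vec.span_sum vec.span_scale vec.span_base) auto
  finally show ?thesis using xs unfolding subspace_basis_def by simp
qed

lemma minors_norm_ge_row_det:
  assumes w: "w \<in> places" and l: "length rs = length xs" and xs: "subspace_basis Z xs"
  shows "w (row_det xs rs) \<le> minors_norm w xs"
proof -
  obtain I where "card I = length xs" "minor xs I \<noteq> 0" using exists_nonzero_minor[OF xs] by blast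
  hence "0 \<le> minors_norm w xs" unfolding minors_norm_def by (intro place_norm_nonneg[OF w]) auto
  moreover have "distinct rs \<Longrightarrow> w (minor xs (set rs)) \<le> minors_norm w xs"
    unfolding minors_norm_def by (rule place_norm_ge[OF w]) (use l in \<open>auto simp: distinct_card\<close>)
  ultimately show ?thesis unfolding w_row_det[OF w l] by auto
qed

lemma vec_norm_minor_vec:
  fixes xs :: "('k::number_field ^ 'n::{finite,linorder}) list"
  assumes w: "w \<in> places" and xs: "subspace_basis Z xs" and l: "length xs = Suc (length rs)"
  shows "vec_norm w (minor_vec xs rs) \<le> arch_const (real CARD('n)) w * minors_norm w xs"
proof -
  obtain I where "card I = length xs" "minor xs I \<noteq> 0" using exists_nonzero_minor[OF xs] by blast
  hence p0: "0 \<le> minors_norm w xs" unfolding minors_norm_def by (intro place_norm_nonneg[OF w]) auto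
  have "vec_norm w (minor_vec xs rs) \<le> arch_const (real (card (UNIV :: 'n set))) w * minors_norm w xs"
    unfolding place_norm_def[of w UNIV]
    by (rule l2_or_max_le_card) (use p0 l in \<open>auto simp: minor_vec_def w_nonneg[OF w] intro!: minors_norm_ge_row_det[OF w _ xs]\<close>)
  thus ?thesis by simp
qed

text \<open>The \<open>i\<close>-th vector vanishes at the rows \<open>rs ! k\<close> with
  \<open>k \<noteq> i\<close> and not at \<open>rs ! i\<close>. Subtracting the combination that
  interpolates \<open>z\<close> at these rows leaves a vector of \<open>Z\<close> that vanishes on
  all of \<open>rs\<close>, hence 0, since the minor on \<open>rs\<close> is nonzero.\<close>

lemma minor_vec_span:
  fixes xs :: "('k::field ^ 'n::{finite,linorder}) list"
  assumes xs: "subspace_basis Z xs" and rs: "length rs = length xs" "row_det xs rs \<noteq> 0"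
  shows "Z \<subseteq> vec.span ((\<lambda>i. minor_vec xs (take i rs @ drop (Suc i) rs)) ` {..<length xs})"
proof
  fix z assume z: "z \<in> Z"
  let ?n = "length xs" and ?v = "\<lambda>i. minor_vec xs (take i rs @ drop (Suc i) rs)"
  have d: "distinct rs" using rs row_det_not_distinct by blast
  have v0: "?v i $ (rs ! k) = 0" if "i < ?n" "k < ?n" "i \<noteq> k" for i k
  proof -
    have "rs ! k \<in> set (take i rs @ drop (Suc i) rs)"
    proof (cases "k < i")
      case True
      hence "take i rs ! k = rs ! k" "k < length (take i rs)" using that rs(1) by auto
      thus ?thesis by (metis UnI1 nth_mem set_append)
    next
      case False
      hence "drop (Suc i) rs ! (k - Suc i) = rs ! k" "k - Suc i < length (drop (Suc i) rs)" using that rs(1) by auto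
      thus ?thesis by (metis UnI2 nth_mem set_append)
    qed
    hence "\<not> distinct ((take i rs @ drop (Suc i) rs) @ [rs ! k])" by auto
    thus ?thesis unfolding minor_vec_def using that rs(1) by (simp add: row_det_not_distinct)
  qed
  have vi: "?v i $ (rs ! i) \<noteq> 0" if i: "i < ?n" for i
  proof -
    let ?rs = "(take i rs @ drop (Suc i) rs) @ [rs ! i]"
    have "rs = take i rs @ rs ! i # drop (Suc i) rs" using i rs(1) by (simp add: id_take_nth_drop)
    hence "mset rs = mset (take i rs @ rs ! i # drop (Suc i) rs)" by (rule arg_cong)
    hence ms: "mset ?rs = mset rs" by simp
    have d': "distinct ?rs" using d ms by (metis mset_eq_imp_distinct_iff)
    have l: "length ?rs = ?n" using ms rs(1) by (metis mset_eq_length)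
    have "set ?rs = set rs" using ms by (rule mset_eq_setD)
    hence "row_det xs ?rs \<noteq> 0"
      using row_det_distinct[OF l d'] row_det_distinct[OF rs(1) d] rs(2) by auto
    thus ?thesis by (simp add: minor_vec_def)
  qed
  define z' where "z' = z - (\<Sum>i<?n. (z $ (rs ! i) / ?v i $ (rs ! i)) *s ?v i)"
  have n0: "i < ?n \<Longrightarrow> ?n = Suc (length (take i rs @ drop (Suc i) rs))" for i using rs(1) by auto
  have subZ: "vec.subspace Z" using xs unfolding subspace_basis_def by (metis vec.subspace_span)
  have "z' \<in> Z" unfolding z'_def
    by (intro vec.subspace_diff[OF subZ] z vec.subspace_sum[OF subZ] vec.subspace_scale[OF subZ] minor_vec_mem[OF xs] n0) auto
  hence "z' \<in> vec.span (set xs)" using xs unfolding subspace_basis_def by simp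
  then obtain a where a: "z' = (\<Sum>j<?n. a j *s xs ! j)" using list_span[of xs z'] xs unfolding subspace_basis_def by blast
  have z0: "z' $ (rs ! k) = 0" if k: "k < ?n" for k
  proof -
    have "(\<Sum>i<?n. (z $ (rs ! i) / ?v i $ (rs ! i)) * ?v i $ (rs ! k)) = (\<Sum>i<?n. if i = k then z $ (rs ! k) else 0)"
      by (rule sum.cong) (use v0 vi k in auto)
    thus ?thesis using k by (simp add: z'_def)
  qed
  let ?M = "Matrix.mat ?n ?n (\<lambda>(i, j). (xs ! j) $ (rs ! i))"
  have "?M *\<^sub>v Matrix.vec ?n a = 0\<^sub>v ?n"
  proof (rule eq_vecI)
    fix k assume "k < dim_vec (0\<^sub>v ?n :: 'k Matrix.vec)"
    hence k: "k < ?n" by simp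
    have "vec_index (?M *\<^sub>v Matrix.vec ?n a) k = (\<Sum>j<?n. (xs ! j) $ (rs ! k) * a j)"
      using k by (auto simp: scalar_prod_def lessThan_atLeast0 intro!: sum.cong)
    also have "\<dots> = z' $ (rs ! k)" unfolding a by (simp add: mult.commute)
    finally show "vec_index (?M *\<^sub>v Matrix.vec ?n a) k = vec_index (0\<^sub>v ?n) k" using z0 k by simp
  qed auto
  hence "Matrix.vec ?n a = 0\<^sub>v ?n"
    using det_0_iff_vec_prod_zero_field[of ?M ?n] rs(2) unfolding row_det_def by (metis mat_carrier vec_carrier)
  hence "a j = 0" if "j < ?n" for j using that by (metis index_vec index_zero_vec(1))
  hence "z' = 0" unfolding a by simp
  hence "z = (\<Sum>i<?n. (z $ (rs ! i) / ?v i $ (rs ! i)) *s ?v i)" unfolding z'_def by simp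
  also have "\<dots> \<in> vec.span (?v ` {..<?n})" by (intro vec.span_sum vec.span_scale vec.span_base) auto
  finally show "z \<in> vec.span (?v ` {..<?n})" .
qed

text \<open>If all the spanning vectors and their pairwise sums were isotropic, the form would vanish on \<open>Z\<close>.\<close>
lemma small_anisotropic:
  fixes F :: "'k::number_field ^ 'n::{finite,linorder} ^ 'n::{finite,linorder}"
  assumes sym: "transpose F = F" and Z: "vec.subspace Z" "vec.dim Z \<ge> 1" and reg: "regular F Z"
  shows "\<exists>x\<in>Z. bilin F x x \<noteq> 0 \<and> vec_height x \<le> 2 * real CARD('n) * subspace_height Z"
proof -
  obtain xs where xs: "subspace_basis Z xs" using basis_exists_list[OF Z(1)] .
  have xs1: "length xs \<ge> 1" using Z(2) basis_length[OF xs] by simp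
  obtain rs where rs: "length rs = length xs" "row_det xs rs \<noteq> 0"
    using exists_nonzero_row_det xs unfolding subspace_basis_def by blast
  define v where "v i = minor_vec xs (take i rs @ drop (Suc i) rs)" for i
  let ?n = "length xs"
  have len: "i < ?n \<Longrightarrow> ?n = Suc (length (take i rs @ drop (Suc i) rs))" for i using rs(1) by auto
  have vZ: "v i \<in> Z" if "i < ?n" for i unfolding v_def by (rule minor_vec_mem[OF xs len[OF that]])
  have vle: "vec_norm w (v i) \<le> arch_const (real CARD('n)) w * minors_norm w xs" if "w \<in> places" "i < ?n" for w i
    unfolding v_def by (rule vec_norm_minor_vec[OF that(1) xs len[OF that(2)]])
  have pn0: "0 \<le> minors_norm w xs" if "w \<in> places" for w using adelic_pos[OF adelic_minors_norm[OF xs] that] by simp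
  have H: "vec_height y \<le> 2 * real CARD('n) * subspace_height Z"
    if "y \<noteq> 0" "\<And>w. w \<in> places \<Longrightarrow> vec_norm w y \<le> arch_const (2 * real CARD('n)) w * minors_norm w xs" for y
  proof -
    have "vec_height y \<le> global_height (\<lambda>w. arch_const (2 * real CARD('n)) w * minors_norm w xs)"
      unfolding vec_height_def using that by (intro global_height_mono adelic_vec_norm adelic_mult adelic_arch_const adelic_minors_norm[OF xs]) auto
    also have "\<dots> = 2 * real CARD('n) * subspace_height Z"
      by (simp add: global_height_mult adelic_arch_const adelic_minors_norm[OF xs] global_height_arch_const subspace_height_eq[OF xs])
    finally show ?thesis .
  qed
  have le1: "vec_norm w (v i) \<le> arch_const (2 * real CARD('n)) w * minors_norm w xs" if "w \<in> places" "i < ?n" for w i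
    using vle[OF that] mult_right_mono[OF arch_const_mono[of "real CARD('n)" "2 * real CARD('n)" w] pn0[OF that(1)]] by simp
  have le2: "vec_norm w (v i + v j) \<le> arch_const (2 * real CARD('n)) w * minors_norm w xs" if "w \<in> places" "i < ?n" "j < ?n" for w i j
  proof -
    have "vec_norm w (v i + v j) \<le> arch_const 2 w * max (vec_norm w (v i)) (vec_norm w (v j))" by (rule vec_norm_add[OF that(1)])
    also have "\<dots> \<le> arch_const 2 w * (arch_const (real CARD('n)) w * minors_norm w xs)"
      using vle that by (intro mult_left_mono) (auto simp: arch_const_nonneg)
    finally show ?thesis by (simp add: arch_const_mult mult.assoc)
  qed
  show ?thesis
  proof (rule ccontr)
    assume no: "\<not> ?thesis"
    have iso: "bilin F y y = 0" if "y \<in> Z" "\<And>w. w \<in> places \<Longrightarrow> vec_norm w y \<le> arch_const (2 * real CARD('n)) w * minors_norm w xs" for y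
      using no that H[of y] by (cases "y = 0") auto
    have ii: "bilin F (v i) (v i) = 0" if "i < ?n" for i using iso[OF vZ[OF that]] le1 that by blast
    have ij: "bilin F (v i) (v j) = 0" if "i < ?n" "j < ?n" for i j
    proof -
      have "bilin F (v i + v j) (v i + v j) = 0"
        using iso[OF vec.subspace_add[OF Z(1) vZ[OF that(1)] vZ[OF that(2)]]] le2 that by blast
      hence "2 * bilin F (v i) (v j) = 0"
        using ii that bilin_sym[OF sym, of "v j" "v i"] by (simp add: bilin_add_left bilin_add_right)
      thus ?thesis by simp
    qed
    have sp: "Z \<subseteq> vec.span (v ` {..<?n})" using minor_vec_span[OF xs rs] unfolding v_def .
    have 1: "bilin F (v i) z = 0" if i: "i < ?n" and z: "z \<in> Z" for i z
    proof -
      have "vec.subspace {z. bilin F (v i) z = 0}"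
        by (rule vec.subspaceI) (auto simp: bilin_add_right bilin_scale_right)
      hence "vec.span (v ` {..<?n}) \<subseteq> {z. bilin F (v i) z = 0}" using ij i by (intro vec.span_minimal) auto
      thus ?thesis using sp z by blast
    qed
    have 2: "bilin F y z = 0" if "y \<in> Z" "z \<in> Z" for y z
    proof -
      have "vec.subspace {y. bilin F y z = 0}"
        by (rule vec.subspaceI) (auto simp: bilin_add_left bilin_scale_left)
      hence "vec.span (v ` {..<?n}) \<subseteq> {y. bilin F y z = 0}" using 1 that(2) by (intro vec.span_minimal) auto
      thus ?thesis using sp that(1) by blast
    qed
    hence "Z \<subseteq> {0}" using reg unfolding regular_def by auto
    hence "vec.dim Z = 0" using vec.dim_le_card[of Z "{}"] by simp
    thus False using Z(2) by linarith
  qed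
qed

section \<open>The hyperplane orthogonal to an anisotropic vector\<close>

context
  fixes F :: "'k::number_field ^ 'n::{finite,linorder} ^ 'n::{finite,linorder}"
    and Z :: "('k ^ 'n::{finite,linorder}) set" and x :: "'k ^ 'n::{finite,linorder}"
  assumes sym: "transpose F = F" and Z: "vec.subspace Z" and xZ: "x \<in> Z" and x: "bilin F x x \<noteq> 0"
begin

lemma perp_subspace: "vec.subspace {z\<in>Z. bilin F x z = 0}"
  using Z by (intro vec.subspaceI)
    (auto simp: bilin_add_right bilin_scale_right vec.subspace_0 vec.subspace_add vec.subspace_scale)

lemma perp_decompose: assumes "z \<in> Z" shows "z - (bilin F x z / bilin F x x) *s x \<in> {z\<in>Z. bilin F x z = 0}"
  using assms x Z xZ by (auto simp: bilin_diff_right bilin_scale_right intro!: vec.subspace_diff vec.subspace_scale)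

lemma perp_basis:
  assumes zs: "subspace_basis {z\<in>Z. bilin F x z = 0} zs" shows "subspace_basis Z (x # zs)"
proof -
  have sp: "vec.span (set zs) = {z\<in>Z. bilin F x z = 0}" using zs by (simp add: subspace_basis_def)
  hence nx: "x \<notin> vec.span (set zs)" using x by simp
  hence "x \<notin> set zs" using vec.span_base by blast
  moreover have "vec.independent (insert x (set zs))"
    using nx zs by (intro vec.independent_insertI) (auto simp: subspace_basis_def)
  moreover have "vec.span (insert x (set zs)) = Z"
  proof
    have "set zs \<subseteq> Z" using sp vec.span_superset[of "set zs"] by blast
    thus "vec.span (insert x (set zs)) \<subseteq> Z" using xZ Z by (intro vec.span_minimal) auto
    show "Z \<subseteq> vec.span (insert x (set zs))"
    proof
      fix z assume "z \<in> Z"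
      from perp_decompose[OF this] show "z \<in> vec.span (insert x (set zs))"
        unfolding vec.span_breakdown_eq sp by blast
    qed
  qed
  ultimately show ?thesis using zs by (simp add: subspace_basis_def)
qed

lemma perp_dim: "vec.dim Z = Suc (vec.dim {z\<in>Z. bilin F x z = 0})"
proof -
  obtain zs where zs: "subspace_basis {z\<in>Z. bilin F x z = 0} zs" using basis_exists_list[OF perp_subspace] .
  show ?thesis using basis_length[OF zs] basis_length[OF perp_basis[OF zs]] by simp
qed

lemma perp_regular: assumes reg: "regular F Z" shows "regular F {z\<in>Z. bilin F x z = 0}"
proof -
  have "y = 0" if y: "y \<in> Z" "bilin F x y = 0" and orth: "\<forall>z\<in>{z\<in>Z. bilin F x z = 0}. bilin F y z = 0" for y
  proof -
    have "bilin F y z = 0" if "z \<in> Z" for z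
    proof -
      have "bilin F y (z - (bilin F x z / bilin F x x) *s x) = 0" using orth perp_decompose[OF that] by blast
      thus ?thesis using y(2) bilin_sym[OF sym, of y x] by (simp add: bilin_diff_right bilin_scale_right)
    qed
    thus ?thesis using reg y(1) unfolding regular_def by blast
  qed
  moreover have "0 \<in> Z" using Z by (rule vec.subspace_0)
  ultimately show ?thesis unfolding regular_def by auto
qed

text \<open>Expanding the minors of \<open>x # zs\<close> along their first row and contracting with
  \<open>F *v x\<close> leaves \<open>bilin F x x\<close> times a minor of \<open>zs\<close>,
  because \<open>zs\<close> is orthogonal to \<open>x\<close>.\<close>

lemma perp_minors_norm:
  assumes w: "w \<in> places" and zs: "subspace_basis {z\<in>Z. bilin F x z = 0} zs"
  shows "w (bilin F x x) * minors_norm w zs \<le> arch_const (real CARD('n)) w * mat_norm w F * vec_norm w x * minors_norm w (x # zs)"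
proof -
  let ?l = "length zs" and ?a = "archimedean w"
  let ?S = "{J :: 'n set. card J = ?l}"
  define G where "G J r = (if r \<in> J then 0 else w (minor (x # zs) (insert r J)))" for J r
  have G0: "0 \<le> G J r" for J r by (simp add: G_def w_nonneg[OF w])
  have xzs: "subspace_basis Z (x # zs)" by (rule perp_basis[OF zs])
  have S: "finite ?S" "?S \<noteq> {}" using exists_nonzero_minor[OF zs] by auto
  have mF: "0 \<le> mat_norm w F * vec_norm w x" by (intro mult_nonneg_nonneg place_norm_nonneg[OF w]) auto
  have zs0: "bilin F (zs ! j) x = 0" if "j < ?l" for j
  proof -
    have "zs ! j \<in> vec.span (set zs)" using that by (intro vec.span_base) simp
    thus ?thesis using zs bilin_sym[OF sym, of "zs ! j" x] by (simp add: subspace_basis_def)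
  qed
  have J: "w (bilin F x x) * w (minor zs J) \<le> (mat_norm w F * vec_norm w x) * l2_or_max ?a UNIV (G J)" if "J \<in> ?S" for J
  proof -
    let ?rs = "sorted_list_of_set J"
    have l: "length ?rs = ?l" using that by simp
    obtain C where C: "\<And>r. row_det (x # zs) (r # ?rs) = C 0 * x $ r + (\<Sum>j<?l. C (Suc j) * (zs ! j) $ r)"
      "C 0 = row_det zs ?rs" using row_det_expand_first[OF l] by blast
    have "(\<Sum>r\<in>UNIV. (F *v x) $ r * row_det (x # zs) (r # ?rs))
        = C 0 * (\<Sum>r\<in>UNIV. x $ r * (F *v x) $ r) + (\<Sum>r\<in>UNIV. \<Sum>j<?l. C (Suc j) * ((zs ! j) $ r * (F *v x) $ r))"
      unfolding C(1) by (simp add: sum.distrib sum_distrib_left distrib_left mult_ac)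
    also have "(\<Sum>r\<in>UNIV. \<Sum>j<?l. C (Suc j) * ((zs ! j) $ r * (F *v x) $ r)) = (\<Sum>j<?l. C (Suc j) * bilin F (zs ! j) x)"
      unfolding bilin_dot sum_distrib_left by (rule sum.swap)
    also have "\<dots> = 0" using zs0 by simp
    finally have "(\<Sum>r\<in>UNIV. (F *v x) $ r * row_det (x # zs) (r # ?rs)) = bilin F x x * minor zs J"
      using C(2) by (simp add: bilin_dot minor_row_det)
    hence "w (bilin F x x * minor zs J) \<le> vec_norm w (F *v x) * place_norm w UNIV (\<lambda>r. row_det (x # zs) (r # ?rs))"
      using dot_le[OF w, of UNIV "\<lambda>r. (F *v x) $ r" "\<lambda>r. row_det (x # zs) (r # ?rs)"] by simp
    also have "(\<lambda>r. w (row_det (x # zs) (r # ?rs))) = G J"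
      unfolding G_def using l by (auto simp: w_row_det[OF w])
    hence "place_norm w UNIV (\<lambda>r. row_det (x # zs) (r # ?rs)) = l2_or_max ?a UNIV (G J)" by (simp add: place_norm_def)
    also have "vec_norm w (F *v x) * l2_or_max ?a UNIV (G J) \<le> (mat_norm w F * vec_norm w x) * l2_or_max ?a UNIV (G J)"
      by (intro mult_right_mono vec_norm_mult w l2_or_max_nonneg) (auto simp: G0)
    finally show ?thesis by (simp add: av_mult[OF place_av[OF w]])
  qed
  \<comment> \<open>For fixed \<open>r\<close> the sets \<open>insert r J\<close> with
    \<open>r \<notin> J\<close> are distinct, so every minor of \<open>x # zs\<close> is counted at
    most once. This is why the norm over \<open>J\<close> is taken first; the rows \<open>r\<close>
    then cost only the factor \<open>N\<close>.\<close>
  have inner: "l2_or_max ?a ?S (\<lambda>J. G J r) \<le> minors_norm w (x # zs)" for r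
  proof (cases ?a)
    case True
    have "(\<Sum>J\<in>?S. (G J r)\<^sup>2) = (\<Sum>J\<in>{J\<in>?S. r \<notin> J}. (w (minor (x # zs) (insert r J)))\<^sup>2)"
      by (rule sum.mono_neutral_cong_right) (auto simp: G_def)
    also have "\<dots> = (\<Sum>I\<in>insert r ` {J\<in>?S. r \<notin> J}. (w (minor (x # zs) I))\<^sup>2)"
      by (subst sum.reindex) (auto intro!: inj_onI dest: insert_ident[THEN iffD1, rotated 2])
    also have "\<dots> \<le> (\<Sum>I\<in>{I. card I = length (x # zs)}. (w (minor (x # zs) I))\<^sup>2)"
      by (rule sum_mono2) auto
    finally show ?thesis using True by (simp add: minors_norm_def place_norm_def l2_or_max_def L2_set_def)
  next
    case False
    have "G J r \<le> minors_norm w (x # zs)" if "J \<in> ?S" for J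
    proof (cases "r \<in> J")
      case True
      thus ?thesis using adelic_pos[OF adelic_minors_norm[OF xzs] w] by (simp add: G_def)
    next
      case False
      thus ?thesis using that unfolding G_def minors_norm_def by (auto intro!: place_norm_ge[OF w])
    qed
    thus ?thesis using False S by (auto simp: l2_or_max_def)
  qed
  have "w (bilin F x x) * minors_norm w zs = l2_or_max ?a ?S (\<lambda>J. w (bilin F x x) * w (minor zs J))"
    unfolding minors_norm_def place_norm_def by (rule l2_or_max_scale[symmetric]) (use S in \<open>auto simp: w_nonneg[OF w]\<close>)
  also have "\<dots> \<le> l2_or_max ?a ?S (\<lambda>J. (mat_norm w F * vec_norm w x) * l2_or_max ?a UNIV (G J))"
    using S J by (intro l2_or_max_mono) (auto simp: w_nonneg[OF w])
  also have "\<dots> = (mat_norm w F * vec_norm w x) * l2_or_max ?a ?S (\<lambda>J. l2_or_max ?a UNIV (\<lambda>r. G J r))"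
    using S mF by (rule l2_or_max_scale)
  also have "l2_or_max ?a ?S (\<lambda>J. l2_or_max ?a UNIV (\<lambda>r. G J r)) = l2_or_max ?a UNIV (\<lambda>r. l2_or_max ?a ?S (\<lambda>J. G J r))"
    using S by (intro l2_or_max_swap) (auto simp: G0)
  also have "(mat_norm w F * vec_norm w x) * \<dots> \<le> (mat_norm w F * vec_norm w x) * (arch_const (real (card (UNIV :: 'n set))) w * minors_norm w (x # zs))"
    using mF S inner adelic_pos[OF adelic_minors_norm[OF xzs] w] by (intro mult_left_mono l2_or_max_le_card l2_or_max_nonneg) (auto simp: G0)
  finally show ?thesis by (simp add: mult_ac)
qed

lemma perp_height:
  "subspace_height {z\<in>Z. bilin F x z = 0} \<le> real CARD('n) * matrix_height F * vec_height x * subspace_height Z"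
proof -
  obtain zs where zs: "subspace_basis {z\<in>Z. bilin F x z = 0} zs" using basis_exists_list[OF perp_subspace] .
  have xzs: "subspace_basis Z (x # zs)" by (rule perp_basis[OF zs])
  have nz: "F \<noteq> 0" "x \<noteq> 0" using x by (auto simp: bilin_def)
  have "subspace_height {z\<in>Z. bilin F x z = 0} = global_height (\<lambda>w. w (bilin F x x) * minors_norm w zs)"
    unfolding subspace_height_eq[OF zs] using x by (simp add: global_height_mult adelic_principal adelic_minors_norm[OF zs] global_height_principal)
  also have "\<dots> \<le> global_height (\<lambda>w. arch_const (real CARD('n)) w * mat_norm w F * vec_norm w x * minors_norm w (x # zs))"
    using x nz perp_minors_norm[OF _ zs]
    by (intro global_height_mono adelic_mult adelic_principal adelic_minors_norm[OF zs] adelic_minors_norm[OF xzs] adelic_arch_const adelic_mat_norm adelic_vec_norm) auto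
  also have "\<dots> = real CARD('n) * matrix_height F * vec_height x * subspace_height Z"
    using nz by (simp add: global_height_mult adelic_mult adelic_arch_const adelic_mat_norm adelic_vec_norm adelic_minors_norm[OF xzs] global_height_arch_const
        matrix_height_eq vec_height_def subspace_height_eq[OF xzs])
  finally show ?thesis .
qed

end

section \<open>Decomposition into reflections\<close>

definition log_height :: "('k::number_field ^ 'n \<Rightarrow> 'k ^ 'n) \<Rightarrow> real" where
  "log_height \<rho> = ln (matrix_height (matrix \<rho>))"

lemma vec_height_pos: "x \<noteq> 0 \<Longrightarrow> vec_height x > 0"
  unfolding vec_height_def by (intro global_height_pos adelic_vec_norm)

lemma foldr_refl_linear:
  "foldr (reflect F) ys (a + b) = foldr (reflect F) ys a + foldr (reflect F) ys b"
  "foldr (reflect F) ys (c *s a) = c *s foldr (reflect F) ys a"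
  by (induction ys) (simp_all add: reflect_add reflect_scale)

lemma foldr_refl_orth: "(\<And>y. y \<in> set ys \<Longrightarrow> bilin F y x = 0) \<Longrightarrow> foldr (reflect F) ys x = x"
  by (induction ys) (simp_all add: reflect_def)

lemma foldr_comp: "foldr (\<circ>) (map f ys) id z = foldr f ys z"
  by (induction ys) simp_all

lemma ln_times3: "a > 0 \<Longrightarrow> b > 0 \<Longrightarrow> c > (0 :: real) \<Longrightarrow> ln (a * b * c) = ln a + ln b + ln c"
  by (simp add: ln_mult)

text \<open>Logarithm of the bound on a space of dimension \<open>Suc m\<close>; a line needs a bound in terms of
  \<open>F\<close> and \<open>Z\<close> alone for the induction to close with base 5.\<close>
definition log_bound :: "nat \<Rightarrow> real \<Rightarrow> real \<Rightarrow> real \<Rightarrow> real \<Rightarrow> real" where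
  "log_bound m k f z r = (if m = 0 then 3 * k + f + 2 * z
     else 5 ^ m * (real (Suc m) ^ 2 / 2 * k + real (Suc m) / 3 * f + real (Suc m) / 2 * z + r))"

text \<open>This covers the reflections introduced by a step. The dimension is at least 2, and five
  times the coefficients for dimension 2 already suffices.\<close>

lemma log_bound_new:
  assumes "0 \<le> k" "0 \<le> f" "0 \<le> z" "0 \<le> r"
  shows "3 * k + f + 2 * z + 2 * r \<le> log_bound (Suc m) k f z r"
proof -
  define t where "t = real (Suc (Suc m))"
  have t: "2 \<le> t" by (simp add: t_def)
  have t2: "2 * 2 \<le> t * t" using t by (intro mult_mono) auto
  have "4 / 2 * k \<le> t\<^sup>2 / 2 * k" "2 / 3 * f \<le> t / 3 * f" "2 / 2 * z \<le> t / 2 * z"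
    using t t2 assms by (intro mult_right_mono; simp add: power2_eq_square)+
  hence 1: "2 * k + 2 / 3 * f + z + r \<le> t\<^sup>2 / 2 * k + t / 3 * f + t / 2 * z + r" by linarith
  have "3 * k + f + 2 * z + 2 * r \<le> 5 * (2 * k + 2 / 3 * f + z + r)" using assms by simp
  also have "\<dots> \<le> 5 ^ Suc m * (2 * k + 2 / 3 * f + z + r)"
    using assms by (intro mult_right_mono) auto
  also have "\<dots> \<le> 5 ^ Suc m * (t\<^sup>2 / 2 * k + t / 3 * f + t / 2 * z + r)"
    using 1 by (rule mult_left_mono) simp
  finally show ?thesis by (simp add: log_bound_def t_def)
qed

text \<open>This covers the reflections from the induction hypothesis; \<open>z'\<close> and
  \<open>r'\<close> belong to the hyperplane and to the isometry that fixes \<open>x\<close>. For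
  \<open>m = 0\<close> it reduces to \<open>7 k + 3 f + 4 z\<close> against
  \<open>5 (2 k + 2/3 f + z + r)\<close>.\<close>

lemma log_bound_step:
  assumes "0 \<le> k" "0 \<le> f" "0 \<le> z" "0 \<le> r"
    and z': "z' \<le> 2 * k + f + 2 * z" and r': "r' \<le> 6 * k + 2 * f + 4 * z + 3 * r"
  shows "log_bound m k f z' r' \<le> log_bound (Suc m) k f z r"
proof (cases m)
  case 0
  thus ?thesis using assms by (simp add: log_bound_def)
next
  case (Suc m')
  define t where "t = real (Suc m)"
  have t: "2 \<le> t" by (simp add: t_def Suc)
  have t2: "2 * 2 \<le> t * t" using t by (intro mult_mono) auto
  have "t / 2 * z' \<le> t / 2 * (2 * k + f + 2 * z)" using z' t by (intro mult_left_mono) auto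
  hence "t\<^sup>2 / 2 * k + t / 3 * f + t / 2 * z' + r'
      \<le> (t\<^sup>2 / 2 + t + 6) * k + (t / 3 + t / 2 + 2) * f + (t + 4) * z + 3 * r"
    using r' by (simp add: algebra_simps)
  also have "\<dots> \<le> (5 * ((t + 1)\<^sup>2 / 2)) * k + (5 * ((t + 1) / 3)) * f + (5 * ((t + 1) / 2)) * z + 5 * r"
    using assms t t2 by (intro add_mono mult_right_mono) (auto simp: power2_eq_square algebra_simps)
  also have "\<dots> = 5 * ((t + 1)\<^sup>2 / 2 * k + (t + 1) / 3 * f + (t + 1) / 2 * z + r)"
    by (simp add: algebra_simps)
  finally have "5 ^ m * (t\<^sup>2 / 2 * k + t / 3 * f + t / 2 * z' + r')
      \<le> 5 ^ m * (5 * ((t + 1)\<^sup>2 / 2 * k + (t + 1) / 3 * f + (t + 1) / 2 * z + r))"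
    by (rule mult_left_mono) simp
  moreover have e: "real (Suc (Suc m)) = t + 1" by (simp add: t_def)
  have "log_bound (Suc m) k f z r = 5 ^ m * (5 * ((t + 1)\<^sup>2 / 2 * k + (t + 1) / 3 * f + (t + 1) / 2 * z + r))"
    unfolding log_bound_def e by simp
  moreover have "log_bound m k f z' r' = 5 ^ m * (t\<^sup>2 / 2 * k + t / 3 * f + t / 2 * z' + r')"
    using Suc by (simp add: log_bound_def t_def)
  ultimately show ?thesis by simp
qed

context
  fixes F :: "'k::number_field ^ 'n::{finite,linorder} ^ 'n::{finite,linorder}"
    and lk :: real
  assumes sym: "transpose F = F" and N: "2 \<le> CARD('n)" and lk: "lk = ln (2 * real CARD('n) ^ 2)"
begin

private abbreviation (input) "lF \<equiv> ln (matrix_height F)"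

text \<open>With \<open>2 \<le> N\<close> the constants \<open>N\<close>, \<open>2 N\<close> and
  \<open>4 N\<close> are at most \<open>2 N^2\<close>, so each occurrence costs at most one
  \<open>lk\<close>.\<close>

lemma lk_bounds: "0 \<le> lk" "ln (real CARD('n)) \<le> lk" "ln (2 * real CARD('n)) \<le> lk" "ln (2 * (2 * real CARD('n))) \<le> lk"
proof -
  have n: "2 \<le> real CARD('n)" using N by simp
  have nn: "2 * real CARD('n) \<le> real CARD('n) * real CARD('n)" using n by (intro mult_right_mono) auto
  have c: "0 < a \<Longrightarrow> a \<le> 2 * (real CARD('n) * real CARD('n)) \<Longrightarrow> ln a \<le> lk" for a
    unfolding lk power2_eq_square by (rule ln_mono)
  show "0 \<le> lk" using c[of 1] n nn by simp
  show "ln (real CARD('n)) \<le> lk" "ln (2 * real CARD('n)) \<le> lk" "ln (2 * (2 * real CARD('n))) \<le> lk"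
    using n nn by (auto intro!: c)
qed

lemma lF_nonneg: assumes "bilin F x x \<noteq> 0" shows "0 \<le> lF" "matrix_height F > 0"
proof -
  have "F \<noteq> 0" using assms by (auto simp: bilin_def)
  thus "0 \<le> lF" "matrix_height F > 0" using matrix_height_ge_1[of F] by auto
qed

lemma log_height_nonneg:
  assumes "\<rho> \<in> isometries F UNIV" "bilin F x x \<noteq> 0" shows "0 \<le> log_height \<rho>" "matrix_height (matrix \<rho>) > 0"
  using matrix_height_ge_1[OF isometry_matrix_nonzero[OF assms]] by (auto simp: log_height_def)

lemma reflect_UNIV: "bilin F y y \<noteq> 0 \<Longrightarrow> reflect F y \<in> isometries F UNIV"
  by (rule reflect_isometries[OF sym]) auto

lemma log_height_compose:
  assumes "\<rho> \<in> isometries F UNIV" "\<tau> \<in> isometries F UNIV" and x: "bilin F x x \<noteq> 0"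
  shows "log_height (\<tau> \<circ> \<rho>) \<le> log_height \<tau> + log_height \<rho>"
proof -
  note nz = isometry_matrix_nonzero[OF _ x]
  have c: "\<tau> \<circ> \<rho> \<in> isometries F UNIV" using assms by (intro isometries_compose)
  have "log_height (\<tau> \<circ> \<rho>) \<le> ln (matrix_height (matrix \<tau>) * matrix_height (matrix \<rho>))"
    unfolding log_height_def using log_height_nonneg(2)[OF c x] assms c
    by (intro ln_mono matrix_height_compose isometries_linear nz) auto
  also have "\<dots> = log_height \<tau> + log_height \<rho>"
    unfolding log_height_def using log_height_nonneg(2)[OF assms(1) x] log_height_nonneg(2)[OF assms(2) x] by (simp add: ln_mult)
  finally show ?thesis .
qed

lemma log_height_refl: assumes y: "bilin F y y \<noteq> 0" shows "log_height (reflect F y) \<le> lk + lF + 2 * ln (vec_height y)"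
proof -
  have "y \<noteq> 0" using y by auto
  hence v: "vec_height y > 0" by (rule vec_height_pos)
  have "log_height (reflect F y) \<le> ln (2 * real CARD('n) * matrix_height F * vec_height y ^ 2)"
    unfolding log_height_def by (intro ln_mono height_refl sym y N log_height_nonneg(2)[OF reflect_UNIV[OF y] y])
  also have "\<dots> = ln (2 * real CARD('n)) + lF + ln (vec_height y ^ 2)"
    using v lF_nonneg[OF y] by (intro ln_times3) auto
  finally show ?thesis using lk_bounds(3) v by (simp add: ln_realpow)
qed

text \<open>The Cartan-Dieudonne step: of \<open>\<rho> x - x\<close> and \<open>\<rho> x + x\<close> at least one is anisotropic, because
  the values of the form on them add up to \<open>4 F(x)\<close>.\<close>
lemma cartan_step:
  assumes \<rho>: "\<rho> \<in> isometries F UNIV" "\<rho> ` Z \<subseteq> Z" and Z: "vec.subspace Z" "x \<in> Z" and x: "bilin F x x \<noteq> 0"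
    and vx: "vec_height x \<le> 2 * real CARD('n) * H" and H: "H \<ge> 1"
  shows "\<exists>ps \<rho>'. length ps \<le> 2 \<and>
    (\<forall>y\<in>set ps. y \<in> Z \<and> bilin F y y \<noteq> 0 \<and> log_height (reflect F y) \<le> 3 * lk + lF + 2 * ln H + 2 * log_height \<rho>) \<and>
    \<rho>' \<in> isometries F UNIV \<and> \<rho>' ` Z \<subseteq> Z \<and> \<rho>' x = x \<and>
    log_height \<rho>' \<le> 6 * lk + 2 * lF + 4 * ln H + 3 * log_height \<rho> \<and> (\<forall>z. \<rho> z = foldr (reflect F) ps (\<rho>' z))"
proof -
  note nn = lk_bounds(1) lF_nonneg[OF x] log_height_nonneg[OF \<rho>(1) x]
  have x0: "x \<noteq> 0" using x by auto
  have lH: "0 \<le> ln H" using H by simp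
  have "ln (vec_height x) \<le> ln (2 * real CARD('n) * H)" using vx vec_height_pos[OF x0] by (intro ln_mono) auto
  also have "\<dots> = ln (2 * real CARD('n)) + ln H" using H by (subst ln_mult) auto
  finally have lx: "ln (vec_height x) \<le> lk + ln H" using lk_bounds(3) by simp
  have hx: "log_height (reflect F x) \<le> 3 * lk + lF + 2 * ln H" using log_height_refl[OF x] lx by simp
  have hy: "log_height (reflect F y) \<le> 3 * lk + lF + 2 * ln H + 2 * log_height \<rho>"
    if y: "bilin F y y \<noteq> 0" "y = \<rho> x + x \<or> y = \<rho> x - x" for y
  proof -
    have y0: "y \<noteq> 0" using y(1) by auto
    have "vec_height y \<le> 2 * matrix_height (matrix \<rho>) * vec_height x"
      by (rule vec_height_diff_isometry[OF \<rho>(1) x y(2) y0])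
    also have "\<dots> \<le> 2 * matrix_height (matrix \<rho>) * (2 * real CARD('n) * H)"
      using vx nn by (intro mult_left_mono) auto
    finally have "vec_height y \<le> 2 * (2 * real CARD('n)) * H * matrix_height (matrix \<rho>)" by (simp add: mult_ac)
    hence "ln (vec_height y) \<le> ln (2 * (2 * real CARD('n)) * H * matrix_height (matrix \<rho>))"
      using vec_height_pos[OF y0] by (intro ln_mono) auto
    also have "\<dots> = ln (2 * (2 * real CARD('n))) + ln H + log_height \<rho>"
      unfolding log_height_def using H nn by (intro ln_times3) auto
    finally show ?thesis using log_height_refl[OF y(1)] lk_bounds(4) by linarith
  qed
  have \<rho>x: "\<rho> x \<in> Z" using \<rho>(2) Z(2) by blast
  have b: "bilin F (\<rho> x) (\<rho> x) = bilin F x x" by (rule isometries_bilin[OF \<rho>(1)])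
  note bs = bilin_add_left bilin_add_right bilin_diff_left bilin_diff_right b bilin_sym[OF sym, of x "\<rho> x"]
  show ?thesis
  proof (cases "bilin F (\<rho> x - x) (\<rho> x - x) = 0")
    case False
    let ?y = "\<rho> x - x"
    have hy': "log_height (reflect F ?y) \<le> 3 * lk + lF + 2 * ln H + 2 * log_height \<rho>" by (rule hy[OF False]) simp
    have yZ: "?y \<in> Z" using Z \<rho>x by (intro vec.subspace_diff)
    \<comment> \<open>Hence the reflection in \<open>?y\<close> subtracts exactly \<open>?y\<close>
      from \<open>\<rho> x\<close> and leaves \<open>x\<close>.\<close>
    have "2 * bilin F ?y (\<rho> x) = bilin F ?y ?y" by (simp add: bs)
    hence "(reflect F ?y \<circ> \<rho>) x = x" unfolding reflect_def using False by simp
    moreover have "reflect F ?y \<circ> \<rho> \<in> isometries F UNIV" by (intro isometries_compose \<rho> reflect_UNIV False)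
    moreover have "log_height (reflect F ?y \<circ> \<rho>) \<le> 6 * lk + 2 * lF + 4 * ln H + 3 * log_height \<rho>"
      using log_height_compose[OF \<rho>(1) reflect_UNIV[OF False] x] hy' nn lH by linarith
    moreover have "(reflect F ?y \<circ> \<rho>) ` Z \<subseteq> Z" using \<rho>(2) reflect_mem[OF sym Z(1) yZ] by auto
    moreover have "\<forall>z. \<rho> z = foldr (reflect F) [?y] ((reflect F ?y \<circ> \<rho>) z)" using reflect_invol[OF sym False] by simp
    moreover have "\<forall>y\<in>set [?y]. y \<in> Z \<and> bilin F y y \<noteq> 0 \<and> log_height (reflect F y) \<le> 3 * lk + lF + 2 * ln H + 2 * log_height \<rho>"
      unfolding list.set ball_simps using yZ False hy' by (intro conjI TrueI)
    moreover have "length [?y] \<le> 2" by simp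
    ultimately show ?thesis by (intro exI[of _ "[?y]"] exI[of _ "reflect F ?y \<circ> \<rho>"] conjI)
  next
    case True
    let ?y = "\<rho> x + x"
    have "bilin F (\<rho> x - x) (\<rho> x - x) + bilin F ?y ?y = 4 * bilin F x x" by (simp add: bs)
    hence y: "bilin F ?y ?y \<noteq> 0" using True x by simp
    have hy': "log_height (reflect F ?y) \<le> 3 * lk + lF + 2 * ln H + 2 * log_height \<rho>" by (rule hy[OF y]) simp
    have yZ: "?y \<in> Z" using Z \<rho>x by (intro vec.subspace_add)
    \<comment> \<open>Now the reflection in \<open>?y\<close> leaves \<open>- x\<close>, and a
      second reflection, in \<open>x\<close> itself, corrects the sign.\<close>
    have "2 * bilin F ?y (\<rho> x) = bilin F ?y ?y" by (simp add: bs)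
    hence "reflect F ?y (\<rho> x) = - x" unfolding reflect_def using y by simp
    hence "(reflect F x \<circ> (reflect F ?y \<circ> \<rho>)) x = x"
      using reflect_self[OF sym x] reflect_scale[of F x "- 1" x] by (simp add: vec.scale_minus_left)
    moreover have yi: "reflect F ?y \<circ> \<rho> \<in> isometries F UNIV" by (intro isometries_compose \<rho> reflect_UNIV y)
    moreover have "reflect F x \<circ> (reflect F ?y \<circ> \<rho>) \<in> isometries F UNIV" by (intro isometries_compose yi reflect_UNIV x)
    moreover have "log_height (reflect F x \<circ> (reflect F ?y \<circ> \<rho>)) \<le> 6 * lk + 2 * lF + 4 * ln H + 3 * log_height \<rho>"
      using log_height_compose[OF \<rho>(1) reflect_UNIV[OF y] x] log_height_compose[OF yi reflect_UNIV[OF x] x] hy' hx nn lH by linarith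
    moreover have "(reflect F x \<circ> (reflect F ?y \<circ> \<rho>)) ` Z \<subseteq> Z"
      using \<rho>(2) reflect_mem[OF sym Z(1) yZ] reflect_mem[OF sym Z] by auto
    moreover have "\<forall>z. \<rho> z = foldr (reflect F) [?y, x] ((reflect F x \<circ> (reflect F ?y \<circ> \<rho>)) z)"
      using reflect_invol[OF sym y] reflect_invol[OF sym x] by simp
    moreover have "log_height (reflect F x) \<le> 3 * lk + lF + 2 * ln H + 2 * log_height \<rho>" using hx nn by linarith
    hence "\<forall>y\<in>set [?y, x]. y \<in> Z \<and> bilin F y y \<noteq> 0 \<and> log_height (reflect F y) \<le> 3 * lk + lF + 2 * ln H + 2 * log_height \<rho>"
      unfolding list.set ball_simps using yZ y hy' Z(2) x by (intro conjI TrueI)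
    moreover have "length [?y, x] \<le> 2" by simp
    ultimately show ?thesis by (intro exI[of _ "[?y, x]"] exI[of _ "reflect F x \<circ> (reflect F ?y \<circ> \<rho>)"] conjI)
  qed
qed

text \<open>A step splits off \<open>x\<close> with at most two reflections and a line needs at most
  one, whence \<open>2 * m + 1\<close>. The list may be empty, which is the case where
  \<open>\<rho>\<close> is the identity on \<open>Z\<close>.\<close>

lemma cartan_dieudonne:
  assumes "vec.subspace Z" "vec.dim Z = Suc m" "regular F Z" "\<rho> \<in> isometries F UNIV" "\<rho> ` Z \<subseteq> Z"
  shows "\<exists>ys. length ys \<le> 2 * m + 1 \<and>
    (\<forall>y\<in>set ys. y \<in> Z \<and> bilin F y y \<noteq> 0 \<and> log_height (reflect F y) \<le> log_bound m lk lF (ln (subspace_height Z)) (log_height \<rho>)) \<and>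
    (\<forall>z\<in>Z. \<rho> z = foldr (reflect F) ys z)"
  using assms
proof (induction m arbitrary: Z \<rho>)
  case 0
  obtain x where x: "x \<in> Z" "bilin F x x \<noteq> 0" "vec_height x \<le> 2 * real CARD('n) * subspace_height Z"
    using small_anisotropic[OF sym 0(1) _ 0(3)] 0(2) by auto
  have "vec.dim {z\<in>Z. bilin F x z = 0} = 0" using perp_dim[OF sym 0(1) x(1,2)] 0(2) by simp
  hence perp0: "{z\<in>Z. bilin F x z = 0} \<subseteq> {0}" by simp
  have line: "\<exists>t. z = t *s x" if "z \<in> Z" for z
    using perp_decompose[OF sym 0(1) x(1,2) that] perp0 by (metis (no_types, lifting) eq_iff_diff_eq_0 singletonD subsetD)
  obtain t where t: "\<rho> x = t *s x" using line[of "\<rho> x"] 0(5) x(1) by blast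
  have "t * t * bilin F x x = 1 * bilin F x x"
    using isometries_bilin[OF 0(4), of x x] unfolding t by (simp add: bilin_scale_left bilin_scale_right)
  hence "t * t = 1" using x(2) by (metis mult_right_cancel)
  hence t1: "t = 1 \<or> t = - 1" by (simp add: square_eq_1_iff)
  have \<rho>s: "\<rho> (c *s z) = c *s \<rho> z" for c z using 0(4) unfolding isometries_def by blast
  have hx: "log_height (reflect F x) \<le> 3 * lk + lF + 2 * ln (subspace_height Z)"
  proof -
    have H: "subspace_height Z \<ge> 1" by (rule subspace_height_ge_1[OF 0(1)])
    have "x \<noteq> 0" using x(2) by auto
    hence "ln (vec_height x) \<le> ln (2 * real CARD('n) * subspace_height Z)" using x(3) by (intro ln_mono vec_height_pos)
    also have "\<dots> = ln (2 * real CARD('n)) + ln (subspace_height Z)" using H by (subst ln_mult) auto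
    finally show ?thesis using log_height_refl[OF x(2)] lk_bounds(3) by linarith
  qed
  show ?case
  proof (cases "t = 1")
    case True
    have "\<rho> z = z" if z: "z \<in> Z" for z
    proof -
      obtain s where "z = s *s x" using line[OF z] by blast
      thus ?thesis using t True \<rho>s by simp
    qed
    thus ?thesis by (intro exI[of _ "[]"]) simp
  next
    case False
    have "\<rho> z = reflect F x z" if z: "z \<in> Z" for z
    proof -
      obtain s where "z = s *s x" using line[OF z] by blast
      thus ?thesis using t t1 False \<rho>s reflect_self[OF sym x(2)] reflect_scale[of F x s x] by (simp add: vec.scale_minus_left)
    qed
    thus ?thesis using x hx by (intro exI[of _ "[x]"]) (simp add: log_bound_def)
  qed
next
  case (Suc m)
  let ?H = "subspace_height Z"
  obtain x where x: "x \<in> Z" "bilin F x x \<noteq> 0" "vec_height x \<le> 2 * real CARD('n) * ?H"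
    using small_anisotropic[OF sym Suc(2) _ Suc(4)] Suc(3) by auto
  have H: "?H \<ge> 1" by (rule subspace_height_ge_1[OF Suc(2)])
  obtain ps \<rho>' where ps: "length ps \<le> 2"
      "\<forall>y\<in>set ps. y \<in> Z \<and> bilin F y y \<noteq> 0 \<and> log_height (reflect F y) \<le> 3 * lk + lF + 2 * ln ?H + 2 * log_height \<rho>"
    and \<rho>': "\<rho>' \<in> isometries F UNIV" "\<rho>' ` Z \<subseteq> Z" "\<rho>' x = x"
      "log_height \<rho>' \<le> 6 * lk + 2 * lF + 4 * ln ?H + 3 * log_height \<rho>" "\<forall>z. \<rho> z = foldr (reflect F) ps (\<rho>' z)"
    using cartan_step[OF Suc(5,6,2) x H] by blast
  let ?Z = "{z\<in>Z. bilin F x z = 0}"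
  have inv: "\<rho>' ` ?Z \<subseteq> ?Z"
  proof (rule image_subsetI)
    fix z assume z: "z \<in> ?Z"
    hence "bilin F x (\<rho>' z) = 0" using isometries_bilin[OF \<rho>'(1), of x z] \<rho>'(3) by simp
    thus "\<rho>' z \<in> ?Z" using \<rho>'(2) z by auto
  qed
  note pr = sym Suc(2) x(1,2)
  have Z': "vec.subspace ?Z" "regular F ?Z" "vec.dim ?Z = Suc m"
    using perp_subspace[OF pr] perp_regular[OF pr Suc(4)] perp_dim[OF pr] Suc(3) by auto
  obtain ys where ys: "length ys \<le> 2 * m + 1"
      "\<forall>y\<in>set ys. y \<in> ?Z \<and> bilin F y y \<noteq> 0 \<and> log_height (reflect F y) \<le> log_bound m lk lF (ln (subspace_height ?Z)) (log_height \<rho>')"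
      "\<forall>z\<in>?Z. \<rho>' z = foldr (reflect F) ys z"
    using Suc.IH[OF Z'(1,3,2) \<rho>'(1) inv] by blast
  note nn = lk_bounds(1) lF_nonneg(1)[OF x(2)] _ log_height_nonneg(1)[OF Suc(5) x(2)]
  have lH: "0 \<le> ln ?H" using H by simp
  have "ln (subspace_height ?Z) \<le> 2 * lk + lF + 2 * ln ?H"
  proof -
    have x0: "x \<noteq> 0" using x(2) by auto
    have "subspace_height ?Z \<le> real CARD('n) * matrix_height F * vec_height x * ?H" by (rule perp_height[OF pr])
    also have "\<dots> \<le> real CARD('n) * matrix_height F * (2 * real CARD('n) * ?H) * ?H"
      using x(3) H lF_nonneg(2)[OF x(2)] by (intro mult_right_mono mult_left_mono) auto
    also have "\<dots> = (real CARD('n) * (2 * real CARD('n))) * matrix_height F * (?H * ?H)" by (simp only: mult_ac)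
    finally have "ln (subspace_height ?Z) \<le> ln ((real CARD('n) * (2 * real CARD('n))) * matrix_height F * (?H * ?H))"
      using subspace_height_ge_1[OF Z'(1)] by (intro ln_mono) auto
    also have "\<dots> = ln (real CARD('n) * (2 * real CARD('n))) + lF + ln (?H * ?H)"
      using H lF_nonneg(2)[OF x(2)] by (intro ln_times3) auto
    also have "\<dots> = ln (real CARD('n)) + ln (2 * real CARD('n)) + lF + (ln ?H + ln ?H)"
      using H by (subst ln_mult[of "?H" "?H"], simp, simp, subst ln_mult) auto
    finally show ?thesis using lk_bounds(2,3) by linarith
  qed
  from log_bound_step[OF nn(1,2) lH nn(4) this \<rho>'(4)]
  have le1: "log_bound m lk lF (ln (subspace_height ?Z)) (log_height \<rho>') \<le> log_bound (Suc m) lk lF (ln ?H) (log_height \<rho>)" .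
  have le2: "3 * lk + lF + 2 * ln ?H + 2 * log_height \<rho> \<le> log_bound (Suc m) lk lF (ln ?H) (log_height \<rho>)"
    by (rule log_bound_new[OF nn(1,2) lH nn(4)])
  have "\<rho> z = foldr (reflect F) (ps @ ys) z" if z: "z \<in> Z" for z
  proof -
    define a where "a = bilin F x z / bilin F x x"
    define z' where "z' = z - a *s x"
    have z': "z' \<in> ?Z" "z = z' + a *s x" using perp_decompose[OF pr z] by (simp_all add: z'_def a_def)
    \<comment> \<open>The vectors of \<open>ys\<close> are orthogonal to \<open>x\<close>, so their
      reflections fix \<open>x\<close>, as \<open>\<rho>'\<close> does; agreement on the hyperplane
      therefore extends to \<open>Z\<close>.\<close>
    have "foldr (reflect F) ys x = x" using ys(2) bilin_sym[OF sym, of x] by (intro foldr_refl_orth) simp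
    moreover have "\<rho>' z = \<rho>' z' + a *s \<rho>' x" unfolding z'(2) using \<rho>'(1) unfolding isometries_def by simp
    ultimately have "\<rho>' z = foldr (reflect F) ys z"
      using ys(3) z' \<rho>'(3) by (simp add: foldr_refl_linear)
    thus ?thesis using \<rho>'(5) by simp
  qed
  moreover have "\<forall>y\<in>set (ps @ ys). y \<in> Z \<and> bilin F y y \<noteq> 0 \<and> log_height (reflect F y) \<le> log_bound (Suc m) lk lF (ln ?H) (log_height \<rho>)"
    using ps(2) ys(2) le1 le2 by auto
  moreover have "length (ps @ ys) \<le> 2 * Suc m + 1" using ps(1) ys(1) by simp
  ultimately show ?case by blast
qed

text \<open>Gram-Schmidt along anisotropic vectors: the projection to the hyperplane orthogonal to
  \<open>x\<close> is corrected by the component along \<open>x\<close>. The form itself may be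
  degenerate on the whole space.\<close>

lemma orth_projection:
  assumes "vec.subspace Z" "regular F Z" shows "\<exists>z\<in>Z. \<forall>u\<in>Z. bilin F (v - z) u = 0"
  using assms
proof (induction "vec.dim Z" arbitrary: Z)
  case 0
  hence "Z \<subseteq> {0}" by simp
  thus ?case using vec.subspace_0[OF 0(2)] by (intro bexI[of _ 0]) auto
next
  case (Suc m)
  obtain x where x: "x \<in> Z" "bilin F x x \<noteq> 0"
    using small_anisotropic[OF sym Suc(3) _ Suc(4)] Suc(2) by auto
  note pr = sym Suc(3) x
  let ?Z = "{z\<in>Z. bilin F x z = 0}"
  obtain z where z: "z \<in> ?Z" "\<forall>u\<in>?Z. bilin F (v - z) u = 0"
    using Suc(1)[OF _ perp_subspace[OF pr] perp_regular[OF pr Suc(4)]] perp_dim[OF pr] Suc(2) by auto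
  define a where "a = bilin F x v / bilin F x x"
  have "bilin F (v - (z + a *s x)) u = 0" if u: "u \<in> Z" for u
  proof -
    let ?b = "bilin F x u / bilin F x x"
    have "bilin F (v - z) (u - ?b *s x) = 0" using z(2) perp_decompose[OF pr u] by blast
    hence "bilin F (v - z) u = ?b * bilin F (v - z) x" by (simp add: bilin_diff_right bilin_scale_right)
    also have "bilin F (v - z) x = bilin F x v"
      using z(1) bilin_sym[OF sym, of v x] bilin_sym[OF sym, of z x] by (simp add: bilin_diff_left)
    finally have "bilin F (v - z) u - a * bilin F x u = 0" using x(2) by (simp add: a_def)
    moreover have "v - (z + a *s x) = v - z - a *s x" by simp
    ultimately show ?thesis by (simp only: bilin_diff_left[of F "v - z"] bilin_scale_left)
  qed
  moreover have "z + a *s x \<in> Z" using z(1) x(1) Suc(3) by (auto intro!: vec.subspace_add vec.subspace_scale)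
  ultimately show ?case by blast
qed

section \<open>Extensions of isometries and the minimum of their heights\<close>

lemma id_isometries: "id \<in> isometries F W"
  by (simp add: isometries_def)

text \<open>The orthogonal projection \<open>\<pi>\<close> to \<open>Z\<close> is linear because
  regularity makes it unique. So \<open>\<sigma>\<close> extends by the identity on the complement,
  with inverse given by the inverse of \<open>\<sigma>\<close> on \<open>Z\<close>.\<close>

lemma extensions_nonempty:
  assumes Z: "vec.subspace Z" and reg: "regular F Z" and \<sigma>: "\<sigma> \<in> isometries F Z"
  shows "extensions F Z \<sigma> \<noteq> {}"
proof -
  obtain \<pi> where \<pi>: "\<And>v. \<pi> v \<in> Z" "\<And>v u. u \<in> Z \<Longrightarrow> bilin F (v - \<pi> v) u = 0"
    using orth_projection[OF Z reg] by metis
  have uniq: "\<pi> v = z" if "z \<in> Z" "\<And>u. u \<in> Z \<Longrightarrow> bilin F (v - z) u = 0" for v z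
  proof -
    have "bilin F (\<pi> v - z) u = 0" if u: "u \<in> Z" for u
      using \<pi>(2)[OF u, of v] \<open>\<And>u. u \<in> Z \<Longrightarrow> bilin F (v - z) u = 0\<close>[OF u] by (simp add: bilin_diff_left)
    moreover have "\<pi> v - z \<in> Z" using Z \<pi>(1) that(1) by (intro vec.subspace_diff)
    ultimately have "\<pi> v - z = 0" using reg unfolding regular_def by blast
    thus ?thesis by simp
  qed
  have \<pi>_add: "\<pi> (v + w) = \<pi> v + \<pi> w" for v w
  proof (rule uniq)
    show "\<pi> v + \<pi> w \<in> Z" by (intro vec.subspace_add Z \<pi>)
    fix u assume u: "u \<in> Z"
    show "bilin F (v + w - (\<pi> v + \<pi> w)) u = 0"
      using \<pi>(2)[OF u, of v] \<pi>(2)[OF u, of w] by (simp add: bilin_add_left bilin_diff_left)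
  qed
  have \<pi>_scale: "\<pi> (c *s v) = c *s \<pi> v" for c v
  proof (rule uniq)
    show "c *s \<pi> v \<in> Z" by (intro vec.subspace_scale Z \<pi>)
    fix u assume u: "u \<in> Z"
    show "bilin F (c *s v - c *s \<pi> v) u = 0"
      using \<pi>(2)[OF u, of v] by (simp add: bilin_scale_left bilin_diff_left)
  qed
  have \<pi>_id: "\<pi> z = z" if "z \<in> Z" for z using that by (intro uniq) auto
  have \<pi>_orth: "\<pi> y = 0" if "\<And>u. u \<in> Z \<Longrightarrow> bilin F y u = 0" for y
    using that vec.subspace_0[OF Z] by (intro uniq) auto
  have \<pi>_split: "\<pi> (z + (v - \<pi> v)) = z" if "z \<in> Z" for z v
    using \<pi>_add[of z "v - \<pi> v"] \<pi>_id[OF that] \<pi>_orth[of "v - \<pi> v"] \<pi>(2) by simp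
  have b: "bij_betw \<sigma> Z Z" and add: "\<And>x y. x \<in> Z \<Longrightarrow> y \<in> Z \<Longrightarrow> \<sigma> (x + y) = \<sigma> x + \<sigma> y"
    and sc: "\<And>c x. x \<in> Z \<Longrightarrow> \<sigma> (c *s x) = c *s \<sigma> x"
    and iso: "\<And>x y. x \<in> Z \<Longrightarrow> y \<in> Z \<Longrightarrow> bilin F (\<sigma> x) (\<sigma> y) = bilin F x y"
    using \<sigma> by (auto simp: isometries_def)
  have \<sigma>Z: "\<sigma> z \<in> Z" if "z \<in> Z" for z using b that by (auto simp: bij_betw_def)
  define g where "g = inv_into Z \<sigma>"
  have g: "g z \<in> Z" "\<sigma> (g z) = z" "g (\<sigma> z) = z" if "z \<in> Z" for z
    using b that unfolding g_def bij_betw_def by (auto intro: inv_into_into f_inv_into_f inv_into_f_f)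
  define \<rho> where "\<rho> v = \<sigma> (\<pi> v) + (v - \<pi> v)" for v
  define \<rho>' where "\<rho>' v = g (\<pi> v) + (v - \<pi> v)" for v
  have "\<rho>' (\<rho> v) = v" "\<rho> (\<rho>' v) = v" for v
    unfolding \<rho>_def \<rho>'_def \<pi>_split[OF \<sigma>Z[OF \<pi>(1)]] \<pi>_split[OF g(1)[OF \<pi>(1)]] using g \<pi>(1) by auto
  hence bij: "bij_betw \<rho> UNIV UNIV" by (intro bij_betw_byWitness[where f'=\<rho>']) auto
  have biso: "bilin F (\<rho> v) (\<rho> w) = bilin F v w" for v w
  proof -
    have dec: "bilin F (a + (v - \<pi> v)) (c + (w - \<pi> w)) = bilin F a c + bilin F (v - \<pi> v) (w - \<pi> w)"
      if "a \<in> Z" "c \<in> Z" for a c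
      using \<pi>(2)[OF that(2), of v] \<pi>(2)[OF that(1), of w] bilin_sym[OF sym, of a "w - \<pi> w"]
      by (simp add: bilin_add_left bilin_add_right)
    show ?thesis unfolding \<rho>_def using dec[OF \<sigma>Z[OF \<pi>(1)[of v]] \<sigma>Z[OF \<pi>(1)[of w]]] dec[OF \<pi>(1)[of v] \<pi>(1)[of w]] iso[OF \<pi>(1)[of v] \<pi>(1)[of w]] by simp
  qed
  have "\<rho> \<in> isometries F UNIV"
    unfolding isometries_def using bij biso
    by (auto simp: \<rho>_def \<pi>_add \<pi>_scale add sc \<pi>(1) vec.scale_right_distrib vec.scale_right_diff_distrib)
  moreover have "\<forall>z\<in>Z. \<rho> z = \<sigma> z" by (simp add: \<rho>_def \<pi>_id)
  moreover have "\<forall>y\<in>orth_complement F Z. \<rho> y = id y"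
    using sc[of 0 0] vec.subspace_0[OF Z] by (auto simp: orth_complement_def \<rho>_def \<pi>_orth)
  ultimately show ?thesis unfolding extensions_def using id_isometries by blast
qed

text \<open>\<open>LEAST\<close> on the reals has its meaning only when a minimum exists. The
  anisotropic \<open>x\<close> ensures that all matrices of extensions are nonzero, as the minimum
  over heights requires.\<close>

lemma isometry_height_attained:
  assumes Z: "vec.subspace Z" and reg: "regular F Z" and \<sigma>: "\<sigma> \<in> isometries F Z" and x: "bilin F x x \<noteq> 0"
  shows "\<exists>\<rho>\<in>extensions F Z \<sigma>. isometry_height F Z \<sigma> = matrix_height (matrix \<rho>) \<and>
    (\<forall>\<rho>'\<in>extensions F Z \<sigma>. isometry_height F Z \<sigma> \<le> matrix_height (matrix \<rho>'))"
proof -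
  have "\<exists>A\<in>matrix ` extensions F Z \<sigma>. \<forall>B\<in>matrix ` extensions F Z \<sigma>. matrix_height A \<le> matrix_height B"
    using extensions_nonempty[OF Z reg \<sigma>]
    by (intro matrix_height_min) (auto simp: extensions_def isometry_matrix_nonzero[OF _ x])
  then obtain \<rho> where \<rho>: "\<rho> \<in> extensions F Z \<sigma>"
      "\<forall>\<rho>'\<in>extensions F Z \<sigma>. matrix_height (matrix \<rho>) \<le> matrix_height (matrix \<rho>')" by auto
  hence "isometry_height F Z \<sigma> = matrix_height (matrix \<rho>)"
    unfolding isometry_height_def by (intro Least_equality) auto
  thus ?thesis using \<rho> by auto
qed

lemma reflect_extensions:
  assumes "bilin F y y \<noteq> 0" "y \<in> Z" shows "reflect F y \<in> extensions F Z (reflect F y)"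
proof -
  have "reflect F y v = id v" if "v \<in> orth_complement F Z" for v
    using that assms(2) bilin_sym[OF sym, of v y] by (simp add: orth_complement_def reflect_orth[OF sym])
  thus ?thesis unfolding extensions_def using reflect_UNIV[OF assms(1)] id_isometries by blast
qed

end

theorem theorem1p4:
  fixes F :: "'k::number_field ^ 'n::{finite,linorder} ^ 'n::{finite,linorder}"
    and Z :: "('k ^ 'n::{finite,linorder}) set"
    and \<sigma> :: "'k ^ 'n::{finite,linorder} \<Rightarrow> 'k ^ 'n::{finite,linorder}"
    and N L d :: nat
    and D :: real
  assumes "N = CARD('n)"
    and "d = degree_K TYPE('k)"
    and "D = real_of_rat (discriminant TYPE('k))"
    and "2 \<le> N"
    and "transpose F = F"
    and "vec.subspace Z"
    and "vec.dim Z = L"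
    and "1 \<le> L" and "L \<le> N"
    and "regular F Z"
    and "\<sigma> \<in> isometries F Z"
  shows "(\<forall>z\<in>Z. \<sigma> z = z) \<or>
    (\<exists>(l::nat) (\<tau> :: nat \<Rightarrow> 'k ^ 'n::{finite,linorder} \<Rightarrow> 'k ^ 'n::{finite,linorder}).
       1 \<le> l \<and> l \<le> 2 * L - 1 \<and>
       (\<forall>i\<in>{1..l}. \<tau> i \<in> reflections F Z) \<and>
       (\<forall>z\<in>Z. \<sigma> z = foldr (\<circ>) (map \<tau> [1..<l + 1]) id z) \<and>
       (\<forall>i\<in>{1..l}. isometry_height F Z (\<tau> i) \<le>
          ((2 * real N ^ 2 * \<bar>D\<bar> powr (1 / (2 * real d))) powr (real L ^ 2 / 2)
             * matrix_height F powr (real L / 3)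
             * subspace_height Z powr (real L / 2)
             * isometry_height F Z \<sigma>) ^ (5 ^ (L - 1))))"
proof -
  note sym = \<open>transpose F = F\<close> and Z = \<open>vec.subspace Z\<close> and reg = \<open>regular F Z\<close> and \<sigma> = \<open>\<sigma> \<in> isometries F Z\<close>
  define lk where "lk = ln (2 * real CARD('n) ^ 2)"
  have N2: "2 \<le> CARD('n)" using assms(1,4) by simp
  note ctx = sym N2 lk_def
  obtain m where m: "L = Suc m" using assms(8) by (cases L) auto
  have dimZ: "vec.dim Z = Suc m" using assms(7) m by simp
  obtain x where x: "bilin F x x \<noteq> 0"
    using small_anisotropic[OF sym Z _ reg] dimZ by auto
  obtain \<rho> where \<rho>: "\<rho> \<in> extensions F Z \<sigma>" "isometry_height F Z \<sigma> = matrix_height (matrix \<rho>)"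
    using isometry_height_attained[OF ctx Z reg \<sigma> x] by blast
  have \<rho>U: "\<rho> \<in> isometries F UNIV" and \<rho>\<sigma>: "\<And>z. z \<in> Z \<Longrightarrow> \<rho> z = \<sigma> z"
    using \<rho>(1) by (auto simp: extensions_def)
  have "\<sigma> ` Z = Z" using \<sigma> by (simp add: isometries_def bij_betw_def)
  hence \<rho>Z: "\<rho> ` Z \<subseteq> Z" using \<rho>\<sigma> by auto
  obtain ys where ys: "length ys \<le> 2 * m + 1"
      "\<And>y. y \<in> set ys \<Longrightarrow> y \<in> Z \<and> bilin F y y \<noteq> 0 \<and>
        log_height (reflect F y) \<le> log_bound m lk (ln (matrix_height F)) (ln (subspace_height Z)) (log_height \<rho>)"
      "\<And>z. z \<in> Z \<Longrightarrow> \<rho> z = foldr (reflect F) ys z"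
    using cartan_dieudonne[OF ctx Z dimZ reg \<rho>U \<rho>Z] by blast
  show ?thesis
  proof (cases "ys = []")
    case True
    thus ?thesis using ys(3) \<rho>\<sigma> by simp
  next
    case False
    define f z r q where "f = ln (matrix_height F)" and "z = ln (subspace_height Z)" and "r = log_height \<rho>"
      and "q = ln (2 * real N ^ 2 * \<bar>D\<bar> powr (1 / (2 * real d)))"
    let ?B = "(2 * real N ^ 2 * \<bar>D\<bar> powr (1 / (2 * real d))) powr (real L ^ 2 / 2)
             * matrix_height F powr (real L / 3)
             * subspace_height Z powr (real L / 2)
             * isometry_height F Z \<sigma>"
    have pos: "matrix_height F > 0" "subspace_height Z > 0" "isometry_height F Z \<sigma> > 0"
      using lF_nonneg(2)[OF ctx x] subspace_height_ge_1[OF Z] log_height_nonneg(2)[OF ctx \<rho>U x] \<rho>(2) by auto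
    have nn: "0 \<le> f" "0 \<le> z" "0 \<le> r"
      using lF_nonneg(1)[OF ctx x] subspace_height_ge_1[OF Z] log_height_nonneg(1)[OF ctx \<rho>U x]
      by (auto simp: f_def z_def r_def)
    have k0: "0 \<le> lk" by (rule lk_bounds(1)[OF ctx])
    have D: "1 \<le> \<bar>D\<bar>" unfolding assms(3) by (rule discriminant_ge_1)
    have N0: "real N > 0" using assms(4) by simp
    have "1 \<le> \<bar>D\<bar> powr (1 / (2 * real d))" using D by (intro ge_one_powr_ge_zero) auto
    hence "2 * real N ^ 2 * 1 \<le> 2 * real N ^ 2 * \<bar>D\<bar> powr (1 / (2 * real d))" by (intro mult_left_mono) auto
    \<comment> \<open>As \<open>1 \<le> \<bar>D\<bar>\<close>, the constant of the induction is at
      most the constant of the statement.\<close>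
    hence kq: "lk \<le> q" unfolding lk_def q_def using N0 assms(1) by (intro ln_mono) auto
    have lnB: "ln ?B = real L ^ 2 / 2 * q + real L / 3 * f + real L / 2 * z + r"
      using pos N0 D unfolding q_def f_def z_def r_def log_height_def \<rho>(2)[symmetric]
      by (subst ln_mult; (subst ln_mult; (subst ln_mult)?)?; simp add: ln_powr)
    have Bpos: "?B > 0" using pos N0 D by simp
    have bound: "isometry_height F Z (reflect F y) \<le> ?B ^ 5 ^ (L - 1)" if y: "y \<in> set ys" for y
    proof -
      have y': "y \<in> Z" "bilin F y y \<noteq> 0" "log_height (reflect F y) \<le> log_bound m lk f z r"
        using ys(2)[OF y] by (simp_all add: f_def z_def r_def)
      have rZ: "reflect F y \<in> isometries F Z" by (rule reflect_isometries[OF sym Z y'(1,2)])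
      obtain \<rho>' where \<rho>': "\<rho>' \<in> extensions F Z (reflect F y)" "isometry_height F Z (reflect F y) = matrix_height (matrix \<rho>')"
          "isometry_height F Z (reflect F y) \<le> matrix_height (matrix (reflect F y))"
        using isometry_height_attained[OF ctx Z reg rZ x] reflect_extensions[OF ctx y'(2,1)] by blast
      have hpos: "isometry_height F Z (reflect F y) > 0"
        unfolding \<rho>'(2) using \<rho>'(1) by (intro log_height_nonneg(2)[OF ctx _ x]) (simp add: extensions_def)
      have "ln (isometry_height F Z (reflect F y)) \<le> 5 ^ m * ln ?B"
      \<comment> \<open>On a line \<open>log_bound\<close> need not lie below the claimed bound. But
        \<open>ys\<close> then consists of \<open>y\<close> alone, so the reflection agrees with
        \<open>\<sigma>\<close> on \<open>Z\<close>; it has the same extensions and therefore the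
        same height.\<close>
      proof (cases "m = 0")
        case True
        then obtain y1 where "ys = [y1]" using ys(1) False by (cases ys) auto
        hence "ys = [y]" using y by simp
        hence "\<And>z. z \<in> Z \<Longrightarrow> reflect F y z = \<sigma> z" using ys(3) \<rho>\<sigma> by simp
        hence "extensions F Z (reflect F y) = extensions F Z \<sigma>" by (auto simp: extensions_def)
        hence "isometry_height F Z (reflect F y) = matrix_height (matrix \<rho>)" using \<rho>(2) by (simp add: isometry_height_def)
        hence "ln (isometry_height F Z (reflect F y)) = r" by (simp add: r_def log_height_def)
        also have "r \<le> ln ?B" unfolding lnB using nn k0 kq by simp
        finally show ?thesis using True by simp
      next
        case False
        have "ln (isometry_height F Z (reflect F y)) \<le> log_height (reflect F y)"
          unfolding log_height_def using hpos \<rho>'(3) by (intro ln_mono)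
        also note y'(3)
        also have "log_bound m lk f z r \<le> 5 ^ m * ln ?B"
          unfolding lnB unfolding log_bound_def m using False kq by (simp add: mult_left_mono)
        finally show ?thesis .
      qed
      also have "\<dots> = ln (?B ^ 5 ^ (L - 1))" using Bpos by (subst ln_realpow) (simp_all add: m)
      finally show ?thesis using hpos Bpos by (subst (asm) ln_le_cancel_iff) auto
    qed
    \<comment> \<open>The statement counts reflections from 1, the list from 0.\<close>
    define \<tau> where "\<tau> i = reflect F (ys ! (i - 1))" for i
    have mem: "ys ! (i - 1) \<in> set ys" if "i \<in> {1..length ys}" for i using that by (intro nth_mem) auto
    have map: "map \<tau> [1..<length ys + 1] = map (reflect F) ys"
      by (rule nth_equalityI) (auto simp: \<tau>_def simp del: upt_Suc)
    have "\<forall>i\<in>{1..length ys}. \<tau> i \<in> reflections F Z"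
      unfolding \<tau>_def using ys(2) mem by (blast intro: reflect_reflections[OF sym Z])
    moreover have "\<forall>z\<in>Z. \<sigma> z = foldr (\<circ>) (map \<tau> [1..<length ys + 1]) id z"
      unfolding map foldr_comp using ys(3) \<rho>\<sigma> by simp
    moreover have "\<forall>i\<in>{1..length ys}. isometry_height F Z (\<tau> i) \<le> ?B ^ 5 ^ (L - 1)"
      unfolding \<tau>_def using bound mem by blast
    moreover have "1 \<le> length ys" using False by (cases ys) auto
    moreover have "length ys \<le> 2 * L - 1" using ys(1) m by simp
    ultimately show ?thesis by blast
  qed
qed

end
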